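(* Let $S$ be a C*-bialgebra, let $A$ and $B$ be C*-algebras equipped with coactions of $S$, and let $0\le\alpha<1$. A conformally $S$-equivariant order-$\frac{1}{1-\alpha}$ cycle $(A,E_B,D)$, with conformal factor $\mu$, gives rise to an $S$-equivariant bounded Kasparov module $(A,E_B,F_D)$.
   Context: All C*-algebras are complex and trivially graded; $\otimes$ is the minimal (spatial) tensor product. $\operatorname{End}^*(E)$, $\operatorname{End}^0(E)$ are the adjointable and compact operators of a right Hilbert $B$-module $E$. An $A$-$B$-correspondence is a right Hilbert $B$-module $E$ with a $*$-homomorphism $A\to\operatorname{End}^*(E)$; elements of $A$ are identified with their images. For $D$ self-adjoint regular, $\langle D\rangle=(1+D^2)^{1/2}$, $F_D=D(1+D^2)^{-1/2}$. $\overline{\operatorname{span}}$ is the norm-closed linear span. Bounded Kasparov $A$-$B$-module: an $A$-$B$-correspondence $E$ and $F\in\operatorname{End}^*(E)$ with $(F^*-F)a,(1-F^2)a,[F,a]$ compact for all $a\in A$; even if $E$ is $\mathbb Z/2$-graded with $A$ acting evenly and $F$ odd, odd if $E$ is ungraded. $\operatorname{Lip}^*_\alpha(D)$: the $*$-algebra of $a\in\operatorname{End}^*(E)$ with $a\operatorname{dom}D\subseteq\operatorname{dom}D$ such that $[D,a]\langle D\rangle^{-\alpha}$ and $\langle D\rangle^{-\alpha}[D,a]$ extend to adjointable operators. An order-$\frac{1}{1-\alpha}$ cycle $(A,E_B,D)$ is an $A$-$B$-correspondence $E$ with a self-adjoint regular operator $D$ such that $(1+D^2)^{-1}a$ is compact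 for all $a\in A$ and $A$ is contained in the norm closure of $\operatorname{Lip}^*_\alpha(D)$; even if $E$ is $\mathbb Z/2$-graded, $A$ acts evenly and $D$ is odd, odd if $E$ is ungraded. C*-bialgebra: a C*-algebra $S$ with a coassociative nondegenerate $*$-homomorphism $\Delta:S\to M(S\otimes S)$ with $\Delta(S)(S\otimes1)$ and $(1\otimes S)\Delta(S)$ contained in $S\otimes S$. $M_S(B\otimes S)=\{m\in M(B\otimes S): m(1\otimes S)\cup(1\otimes S)m\subseteq B\otimes S\}$, and $M_S(E\otimes S)=\{m\in\operatorname{Hom}^*_{B\otimes S}(B\otimes S,E\otimes S): m(1\otimes S)\cup(1\otimes S)m\subseteq E\otimes S\}$. A coaction of $S$ on $B$ is a coassociative nondegenerate $*$-homomorphism $\delta_B:B\to M_S(B\otimes S)$. A coaction on a Hilbert $B$-module $E$ is a coassociative $\mathbb C$-linear map $\delta_E:E\to M_S(E\otimes S)$ with $\delta_E(\xi)\delta_B(b)=\delta_E(\xi b)$, $\langle\delta_E(\xi)|\delta_E(\eta)\rangle=\delta_B(\langle\xi|\eta\rangle_B)$ and $\delta_E(E)(B\otimes S)$ dense in $E\otimes S$. Let $E\otimes_{\delta_B}(B\otimes S)$ be the internal tensor product along $\delta_B$, and $T_\xi:B\otimes S\to E\otimes_{\delta_B}(B\otimes S)$, $x\mapsto\xi\otimes x$. The coaction is equivalently given by the admissible unitary $V_E\in\operatorname{Hom}^*_{B\otimes S}(E\otimes_{\delta_B}(B\otimes S),E\otimes S)$ determined by $V_ET_\xi=\delta_E(\xi)$.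 An $A$-$B$-correspondence $E$ is $S$-equivariant if it has a coaction $\delta_E$ with $\delta_A(a)\delta_E(\xi)=\delta_E(a\xi)$. Operators $D\otimes_{\delta_B}1$ act on $E\otimes_{\delta_B}(B\otimes S)$. A bounded Kasparov module $(A,E_B,F)$ is $S$-equivariant if $E$ is an $S$-equivariant $A$-$B$-correspondence and $(V_E(F\otimes_{\delta_B}1)V_E^*-F\otimes1)(a\otimes s)$ is compact for all $a\in A$, $s\in S$. Matched operators: a regular operator $T$ on the Hilbert $B\otimes S$-module $E\otimes S$ is $S$-matched if the set of $s\in S$ with $(E\otimes S)(1\otimes s)\subseteq\operatorname{dom}T$ is dense in $S$. $S$-matched operators form a $*$-algebra (operations followed by closure). $K_S$ denotes the Pedersen ideal (minimal dense two-sided ideal) of $S$. An order-$\frac1{1-\alpha}$ cycle $(A,E_B,D)$ is conformally $S$-equivariant if $E$ is an $S$-equivariant $A$-$B$-correspondence and there is an $S$-matched operator $\mu$ on $(E\otimes S)_{B\otimes S}$ (even if graded), the conformal factor, whose inverse is also $S$-matched, such that the following holds. For $a\in\operatorname{Lip}^*_\alpha(D)$ let $\mathscr S_a$ be the set of $s\in M(S)$ such that $\{(a\otimes s)\mu,(a\otimes s)\mu^{-1*}\}\operatorname{dom}(D\otimes1)(1\otimes K_S)\subseteq\operatorname{dom}(D\otimes1)\cap V_E\operatorname{dom}(D\otimes_{\delta_B}1)$ and the operators $\big(V_E(D\otimes_{\delta_B}1)V_E^*(a\otimes s)-(a\otimes s)\mu(D\otimes1)\mu^*\big)\mu^{-1*}\langle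 D\otimes1\rangle^{-\alpha}$, $V_E\langle D\otimes_{\delta_B}1\rangle^{-\alpha}V_E^*\big(V_E(D\otimes_{\delta_B}1)V_E^*(a\otimes s)-(a\otimes s)\mu(D\otimes1)\mu^*\big)$, $[D\otimes1,(a\otimes s)\mu]\langle D\otimes1\rangle^{-\alpha}$, $\langle D\otimes1\rangle^{-\alpha}[D\otimes1,(a\otimes s)\mu]$, $[D\otimes1,(a\otimes s)\mu^{-1*}]\langle D\otimes1\rangle^{-\alpha}$, $\langle D\otimes1\rangle^{-\alpha}[D\otimes1,(a\otimes s)\mu^{-1*}]$ extend to $S$-matched operators. Let $\mathscr Q$ be the set of $a\in\operatorname{Lip}^*_\alpha(D)$ with $S\subseteq\overline{\operatorname{span}}(S\mathscr S_a)\cap\overline{\operatorname{span}}(\mathscr S_aS)$. It is required that $A\subseteq\overline{\operatorname{span}}(A\mathscr Q)\cap\overline{\operatorname{span}}(\mathscr QA)$. Here $\mu^{-1*}=(\mu^{-1})^*$. *)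

theory Defs
  imports "HOL-Analysis.Analysis" "HOL-Computational_Algebra.Polynomial"
begin

section \<open>C*-algebras\<close>

class complex_vector = real_vector +
  fixes scaleC :: "complex \<Rightarrow> 'a \<Rightarrow> 'a"  (infixr "*\<^sub>C" 75)
  assumes scaleC_add_right: "c *\<^sub>C (x + y) = c *\<^sub>C x + c *\<^sub>C y"
    and scaleC_add_left: "(c + d) *\<^sub>C x = c *\<^sub>C x + d *\<^sub>C x"
    and scaleC_scaleC: "c *\<^sub>C (d *\<^sub>C x) = (c * d) *\<^sub>C x"
    and scaleR_scaleC: "r *\<^sub>R x = complex_of_real r *\<^sub>C x"

class complex_banach = complex_vector + banach +
  assumes norm_scaleC: "norm (c *\<^sub>C x) = cmod c * norm x"

text \<open>C*-algebras need not be unital.\<close>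

class cstar_algebra = complex_banach + real_normed_algebra +
  fixes star :: "'a \<Rightarrow> 'a"
  assumes mult_scaleC_left: "(c *\<^sub>C x) * y = c *\<^sub>C (x * y)"
    and mult_scaleC_right: "x * (c *\<^sub>C y) = c *\<^sub>C (x * y)"
    and star_star: "star (star x) = x"
    and star_add: "star (x + y) = star x + star y"
    and star_scaleC: "star (c *\<^sub>C x) = cnj c *\<^sub>C star x"
    and star_mult: "star (x * y) = star y * star x"
    and norm_star_mult: "norm (star x * x) = (norm x)\<^sup>2"

instantiation complex :: cstar_algebra
begin
definition "scaleC_complex = (\<lambda>c x :: complex. c * x)"
definition "star_complex = cnj"
instance
  by standard
    (auto simp: scaleC_complex_def star_complex_def algebra_simps norm_mult
       scaleR_conv_of_real power2_eq_square)
end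

definition clinear :: "('x::complex_vector \<Rightarrow> 'y::complex_vector) \<Rightarrow> bool" where
  "clinear f \<longleftrightarrow> (\<forall>x y. f (x + y) = f x + f y) \<and> (\<forall>c x. f (c *\<^sub>C x) = c *\<^sub>C f x)"

definition cbilinear ::
    "('x::complex_vector \<Rightarrow> 'y::complex_vector \<Rightarrow> 'z::complex_vector) \<Rightarrow> bool" where
  "cbilinear t \<longleftrightarrow> (\<forall>x. clinear (t x)) \<and> (\<forall>y. clinear (\<lambda>x. t x y))"

text \<open>
  The library's \<open>span\<close> is the real linear span.  It is only applied below to sets that
  are stable under complex scalars, where it coincides with the complex span.
\<close>

definition total_set :: "'x::complex_banach set \<Rightarrow> bool" where
  "total_set X \<longleftrightarrow> closure (span X) = UNIV"

definition pedersen_ideal :: "'s::cstar_algebra set" where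
  "pedersen_ideal = \<Inter>{I. 0 \<in> I \<and> (\<forall>x\<in>I. \<forall>y\<in>I. x + y \<in> I) \<and> (\<forall>c. \<forall>x\<in>I. c *\<^sub>C x \<in> I)
      \<and> (\<forall>x\<in>I. \<forall>s. s * x \<in> I \<and> x * s \<in> I) \<and> closure I = UNIV}"


section \<open>Hilbert modules and adjointable operators\<close>

text \<open>
  A right Hilbert \<open>B\<close>-module lives on a whole Banach space type \<open>'e\<close>; the record holds the
  right action and the \<open>B\<close>-valued inner product, which is linear in the second variable.
\<close>

record ('e, 'b) hmodule =
  act :: "'e \<Rightarrow> 'b \<Rightarrow> 'e"
  ip :: "'e \<Rightarrow> 'e \<Rightarrow> 'b"

definition hilbert_module :: "('e::complex_banach, 'b::cstar_algebra) hmodule \<Rightarrow> bool" where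
  "hilbert_module E \<longleftrightarrow>
     cbilinear (act E)
   \<and> (\<forall>x b c. act E x (b * c) = act E (act E x b) c)
   \<and> (\<forall>x. clinear (ip E x))
   \<and> (\<forall>x y. star (ip E x y) = ip E y x)
   \<and> (\<forall>x y b. ip E x (act E y b) = ip E x y * b)
   \<and> (\<forall>x. \<exists>b. ip E x x = star b * b)
   \<and> (\<forall>x. (norm x)\<^sup>2 = norm (ip E x x))"

definition self_module :: "('b::cstar_algebra, 'b) hmodule" where
  "self_module = \<lparr>act = (*), ip = (\<lambda>x y. star x * y)\<rparr>"

definition adjointable :: "('e, 'b) hmodule \<Rightarrow> ('f, 'b) hmodule \<Rightarrow> ('e \<Rightarrow> 'f) \<Rightarrow> bool" where
  "adjointable E F T \<longleftrightarrow> (\<exists>T'. \<forall>x y. ip F (T x) y = ip E x (T' y))"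

definition adj :: "('e, 'b) hmodule \<Rightarrow> ('f, 'b) hmodule \<Rightarrow> ('e \<Rightarrow> 'f) \<Rightarrow> ('f \<Rightarrow> 'e)" where
  "adj E F T = (THE T'. \<forall>x y. ip F (T x) y = ip E x (T' y))"

text \<open>
  The multiplier algebra \<open>M(S)\<close> is realised as \<open>End*(S)\<close>, with \<open>S\<close> embedded in it by left
  multiplications.
\<close>

abbreviation multiplier :: "('s::cstar_algebra \<Rightarrow> 's) \<Rightarrow> bool" where
  "multiplier m \<equiv> adjointable self_module self_module m"

abbreviation lmul :: "'s::cstar_algebra \<Rightarrow> 's \<Rightarrow> 's" where
  "lmul s \<equiv> (\<lambda>t. s * t)"

text \<open>Span and norm closure of sets of operators; the latter is taken in the operator norm, not
  in the product topology of the function type.\<close>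

definition op_span :: "('e \<Rightarrow> 'f::complex_vector) set \<Rightarrow> ('e \<Rightarrow> 'f) set" where
  "op_span X = {T. \<exists>(n::nat) c G. (\<forall>i<n. G i \<in> X) \<and> T = (\<lambda>x. \<Sum>i<n. c i *\<^sub>C G i x)}"

definition op_closure ::
    "('e::complex_banach \<Rightarrow> 'f::complex_banach) set \<Rightarrow> ('e \<Rightarrow> 'f) set" where
  "op_closure X = {T. bounded_linear T \<and> (\<forall>\<epsilon>>0. \<exists>G\<in>X. onorm (\<lambda>x. T x - G x) < \<epsilon>)}"

definition compact_ops :: "('e::complex_banach, 'b) hmodule \<Rightarrow> ('e \<Rightarrow> 'e) set" where
  "compact_ops E = op_closure (op_span {T. \<exists>\<xi> \<eta>. T = (\<lambda>\<zeta>. act E \<xi> (ip E \<eta> \<zeta>))})"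

definition representation ::
    "('e::complex_banach, 'b) hmodule \<Rightarrow> ('a::cstar_algebra \<Rightarrow> 'e \<Rightarrow> 'e) \<Rightarrow> bool" where
  "representation E \<pi> \<longleftrightarrow>
     (\<forall>x. clinear (\<lambda>a. \<pi> a x))
   \<and> (\<forall>a b. \<pi> (a * b) = \<pi> a \<circ> \<pi> b)
   \<and> (\<forall>a x y. ip E (\<pi> a x) y = ip E x (\<pi> (star a) y))"

definition nondegenerate :: "('a \<Rightarrow> 'e::complex_banach \<Rightarrow> 'e) \<Rightarrow> bool" where
  "nondegenerate \<pi> \<longleftrightarrow> total_set {\<pi> a x | a x. True}"


section \<open>Tensor products\<close>

text \<open>
  Tensor products are given by a space together with the map \<open>(x, y) \<mapsto> x \<otimes> y\<close> and are
  characterised up to canonical isomorphism.  Names such as \<open>tBS\<close>, \<open>tBSS\<close>, \<open>tES\<close>, \<open>tEBS\<close>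
  stand for the structure maps of \<open>B \<otimes> S\<close>, \<open>(B \<otimes> S) \<otimes> S\<close>, \<open>E \<otimes> S\<close> and of \<open>E \<otimes> (B \<otimes> S)\<close>
  along \<open>\<delta>\<^sub>B\<close>.
\<close>

definition cstar_norm_on :: "'c::cstar_algebra set \<Rightarrow> ('c \<Rightarrow> real) \<Rightarrow> bool" where
  "cstar_norm_on U \<nu> \<longleftrightarrow>
     (\<forall>x\<in>U. 0 \<le> \<nu> x \<and> (\<nu> x = 0 \<longleftrightarrow> x = 0))
   \<and> (\<forall>c. \<forall>x\<in>U. \<nu> (c *\<^sub>C x) = cmod c * \<nu> x)
   \<and> (\<forall>x\<in>U. \<forall>y\<in>U. \<nu> (x + y) \<le> \<nu> x + \<nu> y \<and> \<nu> (x * y) \<le> \<nu> x * \<nu> y)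
   \<and> (\<forall>x\<in>U. \<nu> (star x * x) = (\<nu> x)\<^sup>2)"

text \<open>
  The third-to-last condition says that the algebraic tensor product embeds, so that it may be
  identified with the span of the elementary tensors; the last two say that \<open>'c\<close> is its
  completion in the least C*-norm.
\<close>

definition min_tensor ::
    "('a::cstar_algebra \<Rightarrow> 'b::cstar_algebra \<Rightarrow> 'c::cstar_algebra) \<Rightarrow> bool" where
  "min_tensor t \<longleftrightarrow>
     cbilinear t
   \<and> (\<forall>a a' b b'. t a b * t a' b' = t (a * a') (b * b'))
   \<and> (\<forall>a b. star (t a b) = t (star a) (star b))
   \<and> (\<forall>(n::nat) a b. (\<forall>c. (\<Sum>i<n. c i *\<^sub>C b i) = 0 \<longrightarrow> (\<forall>i<n. c i = 0))
        \<and> (\<Sum>i<n. t (a i) (b i)) = 0 \<longrightarrow> (\<forall>i<n. a i = 0))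
   \<and> total_set {t a b | a b. True}
   \<and> (\<forall>\<nu>. cstar_norm_on (span {t a b | a b. True}) \<nu>
        \<longrightarrow> (\<forall>x\<in>span {t a b | a b. True}. norm x \<le> \<nu> x))"

definition exterior_tensor ::
    "('e::complex_banach, 'b::cstar_algebra) hmodule \<Rightarrow>
     ('b \<Rightarrow> 's::cstar_algebra \<Rightarrow> 'bs::cstar_algebra) \<Rightarrow>
     ('es::complex_banach, 'bs) hmodule \<Rightarrow> ('e \<Rightarrow> 's \<Rightarrow> 'es) \<Rightarrow> bool" where
  "exterior_tensor E tBS ES tES \<longleftrightarrow>
     hilbert_module ES \<and> cbilinear tES
   \<and> (\<forall>\<xi> \<eta> s u. ip ES (tES \<xi> s) (tES \<eta> u) = tBS (ip E \<xi> \<eta>) (star s * u))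
   \<and> (\<forall>\<xi> s b u. act ES (tES \<xi> s) (tBS b u) = tES (act E \<xi> b) (s * u))
   \<and> total_set {tES \<xi> s | \<xi> s. True}"

definition interior_tensor ::
    "('e::complex_banach, 'b::cstar_algebra) hmodule \<Rightarrow>
     ('f::complex_banach, 'c::cstar_algebra) hmodule \<Rightarrow> ('b \<Rightarrow> 'f \<Rightarrow> 'f) \<Rightarrow>
     ('g::complex_banach, 'c) hmodule \<Rightarrow> ('e \<Rightarrow> 'f \<Rightarrow> 'g) \<Rightarrow> bool" where
  "interior_tensor E F \<phi> G t \<longleftrightarrow>
     hilbert_module G \<and> cbilinear t
   \<and> (\<forall>\<xi> \<eta> x y. ip G (t \<xi> x) (t \<eta> y) = ip F x (\<phi> (ip E \<xi> \<eta>) y))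
   \<and> (\<forall>\<xi> x c. act G (t \<xi> x) c = t \<xi> (act F x c))
   \<and> (\<forall>\<xi> b x. t (act E \<xi> b) x = t \<xi> (\<phi> b x))
   \<and> total_set {t \<xi> x | \<xi> x. True}"

text \<open>\<open>X \<otimes> Y\<close> for adjointable \<open>X\<close> and \<open>Y\<close>, as an operator from \<open>M\<close> to \<open>N\<close>.\<close>

definition tensor_op ::
    "('m, 'c) hmodule \<Rightarrow> ('n, 'c) hmodule \<Rightarrow> ('x \<Rightarrow> 'y \<Rightarrow> 'm) \<Rightarrow> ('x' \<Rightarrow> 'y' \<Rightarrow> 'n) \<Rightarrow>
     ('x \<Rightarrow> 'x') \<Rightarrow> ('y \<Rightarrow> 'y') \<Rightarrow> ('m \<Rightarrow> 'n)" where
  "tensor_op M N t t' X Y =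
     (THE Z. adjointable M N Z \<and> (\<forall>x y. Z (t x y) = t' (X x) (Y y)))"

text \<open>Left multiplication by \<open>1 \<otimes> s\<close>.\<close>

definition one_tensor :: "('m, 'c) hmodule \<Rightarrow> ('x \<Rightarrow> 's::cstar_algebra \<Rightarrow> 'm) \<Rightarrow> 's \<Rightarrow> 'm \<Rightarrow> 'm" where
  "one_tensor M t s = tensor_op M M t t id (lmul s)"

text \<open>Right multiplication by \<open>1 \<otimes> s\<close>, which is not a module map.\<close>

definition rmul_one_tensor ::
    "('x \<Rightarrow> 's::cstar_algebra \<Rightarrow> 'm::complex_banach) \<Rightarrow> 's \<Rightarrow> 'm \<Rightarrow> 'm" where
  "rmul_one_tensor t s = (THE R. bounded_linear R \<and> (\<forall>\<xi> u. R (t \<xi> u) = t \<xi> (u * s)))"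

text \<open>
  Under \<open>(E \<otimes> S) \<otimes> S = E \<otimes> (S \<otimes> S)\<close>, the map \<open>(\<xi>, z) \<mapsto> \<xi> \<otimes> z\<close> for \<open>z\<close> in \<open>S \<otimes> S\<close>.
\<close>

definition reassoc ::
    "('e \<Rightarrow> 's \<Rightarrow> 'es) \<Rightarrow> ('s \<Rightarrow> 's \<Rightarrow> 'ss::complex_banach) \<Rightarrow>
     ('es \<Rightarrow> 's \<Rightarrow> 'ess::complex_banach) \<Rightarrow> 'e \<Rightarrow> 'ss \<Rightarrow> 'ess" where
  "reassoc tES tSS tESS =
     (THE r. \<forall>\<xi>. bounded_linear (r \<xi>) \<and> (\<forall>s u. r \<xi> (tSS s u) = tESS (tES \<xi> s) u))"

text \<open>The continuous linear extension of \<open>x \<otimes> y \<mapsto> f x y\<close> with values in \<open>Hom*(M, N)\<close>.\<close>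

definition tensor_lift ::
    "('x \<Rightarrow> 'y \<Rightarrow> 'z::complex_banach) \<Rightarrow> ('m, 'c) hmodule \<Rightarrow> ('n::complex_banach, 'c) hmodule \<Rightarrow>
     ('x \<Rightarrow> 'y \<Rightarrow> 'm \<Rightarrow> 'n) \<Rightarrow> 'z \<Rightarrow> 'm \<Rightarrow> 'n" where
  "tensor_lift t M N f =
     (THE \<Phi>. (\<forall>z. adjointable M N (\<Phi> z)) \<and> (\<forall>v. bounded_linear (\<lambda>z. \<Phi> z v))
        \<and> (\<forall>x y. \<Phi> (t x y) = f x y))"

text \<open>
  Extension to multipliers: \<open>\<Phi>\<^sub>B\<close> maps an algebra \<open>B'\<close> nondegenerately to \<open>End*(M)\<close>, \<open>\<Phi>\<^sub>E\<close>
  maps a Hilbert \<open>B'\<close>-module \<open>E'\<close> to \<open>Hom*(M, N)\<close> compatibly, and \<open>m\<close> is in \<open>Hom*(B', E')\<close>.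
\<close>

definition mult_ext ::
    "('m, 'c) hmodule \<Rightarrow> ('n, 'c) hmodule \<Rightarrow> ('z \<Rightarrow> 'm \<Rightarrow> 'm) \<Rightarrow> ('w \<Rightarrow> 'm \<Rightarrow> 'n) \<Rightarrow>
     ('z \<Rightarrow> 'w) \<Rightarrow> ('m \<Rightarrow> 'n)" where
  "mult_ext M N \<Phi>\<^sub>B \<Phi>\<^sub>E m = (THE n. adjointable M N n \<and> (\<forall>x v. n (\<Phi>\<^sub>B x v) = \<Phi>\<^sub>E (m x) v))"


section \<open>Bialgebras and coactions\<close>

text \<open>\<open>M\<^sub>S(E \<otimes> S)\<close>; for \<open>E = B\<close>, i.e. \<open>ES = self_module\<close> and \<open>tES = tBS\<close>, this is
  \<open>M\<^sub>S(B \<otimes> S)\<close>.\<close>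

definition S_multiplier ::
    "('b \<Rightarrow> 's::cstar_algebra \<Rightarrow> 'bs::cstar_algebra) \<Rightarrow>
     ('es, 'bs) hmodule \<Rightarrow> ('e \<Rightarrow> 's \<Rightarrow> 'es) \<Rightarrow> ('bs \<Rightarrow> 'es) \<Rightarrow> bool" where
  "S_multiplier tBS ES tES m \<longleftrightarrow>
     adjointable self_module ES m
   \<and> (\<forall>s. \<exists>\<zeta>. m \<circ> one_tensor self_module tBS s = act ES \<zeta>)
   \<and> (\<forall>s. \<exists>\<zeta>. one_tensor ES tES s \<circ> m = act ES \<zeta>)"

text \<open>\<open>(\<delta>\<^sub>E \<otimes> id) \<delta>\<^sub>E = (id \<otimes> \<Delta>) \<delta>\<^sub>E\<close> in \<open>Hom*(B \<otimes> S \<otimes> S, E \<otimes> S \<otimes> S)\<close>.\<close>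

definition coassociative ::
    "('s::cstar_algebra \<Rightarrow> 's \<Rightarrow> 'ss::cstar_algebra) \<Rightarrow> ('s \<Rightarrow> 'ss \<Rightarrow> 'ss) \<Rightarrow>
     ('b::cstar_algebra \<Rightarrow> 's \<Rightarrow> 'bs::cstar_algebra) \<Rightarrow> ('bs \<Rightarrow> 's \<Rightarrow> 'bss::cstar_algebra) \<Rightarrow>
     ('b \<Rightarrow> 'bs \<Rightarrow> 'bs) \<Rightarrow>
     ('e, 'b) hmodule \<Rightarrow> ('e \<Rightarrow> 's \<Rightarrow> 'es::complex_banach) \<Rightarrow>
     ('ess::complex_banach, 'bss) hmodule \<Rightarrow> ('es \<Rightarrow> 's \<Rightarrow> 'ess) \<Rightarrow>
     ('e \<Rightarrow> 'bs \<Rightarrow> 'es) \<Rightarrow> bool" where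
  "coassociative tSS \<Delta> tBS tBSS \<delta>\<^sub>B E tES ESS tESS \<delta>\<^sub>E \<longleftrightarrow>
    (let rB = reassoc tBS tSS tBSS;
         rE = reassoc tES tSS tESS;
         \<delta>id\<^sub>B = tensor_lift tBS self_module self_module
                  (\<lambda>b s. tensor_op self_module self_module tBSS tBSS (\<delta>\<^sub>B b) (lmul s));
         \<delta>id\<^sub>E = tensor_lift tES self_module ESS
                  (\<lambda>\<xi> s. tensor_op self_module ESS tBSS tESS (\<delta>\<^sub>E \<xi>) (lmul s));
         id\<Delta>\<^sub>B = tensor_lift tBS self_module self_module
                  (\<lambda>b s. tensor_op self_module self_module rB rB (lmul b) (\<Delta> s));
         id\<Delta>\<^sub>E = tensor_lift tES self_module ESS
                  (\<lambda>\<xi> s. tensor_op self_module ESS rB rE (act E \<xi>) (\<Delta> s))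
     in \<forall>\<xi>. mult_ext self_module ESS \<delta>id\<^sub>B \<delta>id\<^sub>E (\<delta>\<^sub>E \<xi>)
           = mult_ext self_module ESS id\<Delta>\<^sub>B id\<Delta>\<^sub>E (\<delta>\<^sub>E \<xi>))"

definition cstar_bialgebra ::
    "('s::cstar_algebra \<Rightarrow> 's \<Rightarrow> 'ss::cstar_algebra) \<Rightarrow> ('ss \<Rightarrow> 's \<Rightarrow> 'sss::cstar_algebra) \<Rightarrow>
     ('s \<Rightarrow> 'ss \<Rightarrow> 'ss) \<Rightarrow> bool" where
  "cstar_bialgebra tSS tSSS \<Delta> \<longleftrightarrow>
     representation self_module \<Delta> \<and> nondegenerate \<Delta>
   \<and> coassociative tSS \<Delta> tSS tSSS \<Delta> self_module tSS self_module tSSS \<Delta>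
   \<and> (\<forall>s u. \<exists>z. \<Delta> s \<circ> tensor_op self_module self_module tSS tSS (lmul u) id = lmul z)
   \<and> (\<forall>s u. \<exists>z. one_tensor self_module tSS u \<circ> \<Delta> s = lmul z)"

definition algebra_coaction ::
    "('s::cstar_algebra \<Rightarrow> 's \<Rightarrow> 'ss::cstar_algebra) \<Rightarrow> ('s \<Rightarrow> 'ss \<Rightarrow> 'ss) \<Rightarrow>
     ('b::cstar_algebra \<Rightarrow> 's \<Rightarrow> 'bs::cstar_algebra) \<Rightarrow> ('bs \<Rightarrow> 's \<Rightarrow> 'bss::cstar_algebra) \<Rightarrow>
     ('b \<Rightarrow> 'bs \<Rightarrow> 'bs) \<Rightarrow> bool" where
  "algebra_coaction tSS \<Delta> tBS tBSS \<delta>\<^sub>B \<longleftrightarrow>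
     representation self_module \<delta>\<^sub>B \<and> nondegenerate \<delta>\<^sub>B
   \<and> (\<forall>b. S_multiplier tBS self_module tBS (\<delta>\<^sub>B b))
   \<and> coassociative tSS \<Delta> tBS tBSS \<delta>\<^sub>B self_module tBS self_module tBSS \<delta>\<^sub>B"

definition module_coaction ::
    "('s::cstar_algebra \<Rightarrow> 's \<Rightarrow> 'ss::cstar_algebra) \<Rightarrow> ('s \<Rightarrow> 'ss \<Rightarrow> 'ss) \<Rightarrow>
     ('b::cstar_algebra \<Rightarrow> 's \<Rightarrow> 'bs::cstar_algebra) \<Rightarrow> ('bs \<Rightarrow> 's \<Rightarrow> 'bss::cstar_algebra) \<Rightarrow>
     ('b \<Rightarrow> 'bs \<Rightarrow> 'bs) \<Rightarrow>
     ('e::complex_banach, 'b) hmodule \<Rightarrow>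
     ('es::complex_banach, 'bs) hmodule \<Rightarrow> ('e \<Rightarrow> 's \<Rightarrow> 'es) \<Rightarrow>
     ('ess::complex_banach, 'bss) hmodule \<Rightarrow> ('es \<Rightarrow> 's \<Rightarrow> 'ess) \<Rightarrow>
     ('e \<Rightarrow> 'bs \<Rightarrow> 'es) \<Rightarrow> bool" where
  "module_coaction tSS \<Delta> tBS tBSS \<delta>\<^sub>B E ES tES ESS tESS \<delta>\<^sub>E \<longleftrightarrow>
     (\<forall>\<xi>. S_multiplier tBS ES tES (\<delta>\<^sub>E \<xi>))
   \<and> (\<forall>x. clinear (\<lambda>\<xi>. \<delta>\<^sub>E \<xi> x))
   \<and> coassociative tSS \<Delta> tBS tBSS \<delta>\<^sub>B E tES ESS tESS \<delta>\<^sub>E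
   \<and> (\<forall>\<xi> b. \<delta>\<^sub>E \<xi> \<circ> \<delta>\<^sub>B b = \<delta>\<^sub>E (act E \<xi> b))
   \<and> (\<forall>\<xi> \<eta>. adj self_module ES (\<delta>\<^sub>E \<xi>) \<circ> \<delta>\<^sub>E \<eta> = \<delta>\<^sub>B (ip E \<xi> \<eta>))
   \<and> total_set {\<delta>\<^sub>E \<xi> x | \<xi> x. True}"

definition admissible_unitary ::
    "('g, 'bs) hmodule \<Rightarrow> ('e \<Rightarrow> 'bs \<Rightarrow> 'g) \<Rightarrow> ('es, 'bs) hmodule \<Rightarrow> ('e \<Rightarrow> 'bs \<Rightarrow> 'es) \<Rightarrow> 'g \<Rightarrow> 'es" where
  "admissible_unitary EBS tEBS ES \<delta>\<^sub>E =
     (THE V. adjointable EBS ES V \<and> adj EBS ES V \<circ> V = id \<and> V \<circ> adj EBS ES V = id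
        \<and> (\<forall>\<xi>. V \<circ> tEBS \<xi> = \<delta>\<^sub>E \<xi>))"

text \<open>
  The action of \<open>m\<close> in \<open>M\<^sub>S(A \<otimes> S)\<close> on \<open>E \<otimes> S\<close>.  As \<open>A\<close> may act degenerately on \<open>E\<close>, it is
  determined by requiring that \<open>m (1 \<otimes> s)\<close>, which is in \<open>A \<otimes> S\<close>, acts through \<open>\<pi> \<otimes> id\<close>.
\<close>

definition S_multiplier_action ::
    "('a \<Rightarrow> 's::cstar_algebra \<Rightarrow> 'as::cstar_algebra) \<Rightarrow>
     ('es::complex_banach, 'bs) hmodule \<Rightarrow> ('e \<Rightarrow> 's \<Rightarrow> 'es) \<Rightarrow> ('a \<Rightarrow> 'e \<Rightarrow> 'e) \<Rightarrow>
     ('as \<Rightarrow> 'as) \<Rightarrow> 'es \<Rightarrow> 'es" where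
  "S_multiplier_action tAS ES tES \<pi> m =
     (let \<pi>id = tensor_lift tAS ES ES (\<lambda>a s. tensor_op ES ES tES tES (\<pi> a) (lmul s))
      in THE T. adjointable ES ES T
           \<and> (\<forall>s c. m \<circ> one_tensor self_module tAS s = lmul c \<longrightarrow>
                T \<circ> one_tensor ES tES s = \<pi>id c))"

definition equivariant_correspondence ::
    "('s::cstar_algebra \<Rightarrow> 's \<Rightarrow> 'ss::cstar_algebra) \<Rightarrow> ('s \<Rightarrow> 'ss \<Rightarrow> 'ss) \<Rightarrow>
     ('a::cstar_algebra \<Rightarrow> 's \<Rightarrow> 'as::cstar_algebra) \<Rightarrow> ('a \<Rightarrow> 'as \<Rightarrow> 'as) \<Rightarrow>
     ('b::cstar_algebra \<Rightarrow> 's \<Rightarrow> 'bs::cstar_algebra) \<Rightarrow> ('bs \<Rightarrow> 's \<Rightarrow> 'bss::cstar_algebra) \<Rightarrow>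
     ('b \<Rightarrow> 'bs \<Rightarrow> 'bs) \<Rightarrow>
     ('e::complex_banach, 'b) hmodule \<Rightarrow>
     ('es::complex_banach, 'bs) hmodule \<Rightarrow> ('e \<Rightarrow> 's \<Rightarrow> 'es) \<Rightarrow>
     ('ess::complex_banach, 'bss) hmodule \<Rightarrow> ('es \<Rightarrow> 's \<Rightarrow> 'ess) \<Rightarrow>
     ('a \<Rightarrow> 'e \<Rightarrow> 'e) \<Rightarrow> ('e \<Rightarrow> 'bs \<Rightarrow> 'es) \<Rightarrow> bool" where
  "equivariant_correspondence tSS \<Delta> tAS \<delta>\<^sub>A tBS tBSS \<delta>\<^sub>B E ES tES ESS tESS \<pi> \<delta>\<^sub>E \<longleftrightarrow>
     hilbert_module E \<and> representation E \<pi>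
   \<and> module_coaction tSS \<Delta> tBS tBSS \<delta>\<^sub>B E ES tES ESS tESS \<delta>\<^sub>E
   \<and> (\<forall>a \<xi>. S_multiplier_action tAS ES tES \<pi> (\<delta>\<^sub>A a) \<circ> \<delta>\<^sub>E \<xi> = \<delta>\<^sub>E (\<pi> a \<xi>))"


section \<open>Unbounded operators\<close>

text \<open>
  Unbounded operators are represented by their graphs; sums and compositions carry their maximal
  domains, \<open>Domain T\<close> is the domain and \<open>T\<inverse>\<close> (the converse relation) is the inverse.
  Inclusion of graphs is extension of operators.
\<close>

type_synonym 'e op_graph = "('e \<times> 'e) set"

definition gr :: "('e \<Rightarrow> 'e) \<Rightarrow> 'e op_graph" where
  "gr f = {(x, f x) | x. True}"

definition op_apply :: "'e op_graph \<Rightarrow> 'e \<Rightarrow> 'e" where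
  "op_apply T x = (THE y. (x, y) \<in> T)"

abbreviation op_comp :: "'e op_graph \<Rightarrow> 'e op_graph \<Rightarrow> 'e op_graph"  (infixr "\<odot>" 75) where
  "S \<odot> T \<equiv> T O S"

definition op_add :: "'e::plus op_graph \<Rightarrow> 'e op_graph \<Rightarrow> 'e op_graph"  (infixl "\<oplus>" 65) where
  "S \<oplus> T = {(x, y + z) | x y z. (x, y) \<in> S \<and> (x, z) \<in> T}"

definition op_diff :: "'e::minus op_graph \<Rightarrow> 'e op_graph \<Rightarrow> 'e op_graph"  (infixl "\<ominus>" 65) where
  "S \<ominus> T = {(x, y - z) | x y z. (x, y) \<in> S \<and> (x, z) \<in> T}"

definition commutator :: "'e::minus op_graph \<Rightarrow> 'e op_graph \<Rightarrow> 'e op_graph" where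
  "commutator S T = S \<odot> T \<ominus> T \<odot> S"

definition op_adjoint :: "('e, 'b) hmodule \<Rightarrow> 'e op_graph \<Rightarrow> 'e op_graph" where
  "op_adjoint E T = {(y, z). \<forall>(x, w)\<in>T. ip E w y = ip E x z}"

definition regular :: "('e::complex_banach, 'b) hmodule \<Rightarrow> 'e op_graph \<Rightarrow> bool" where
  "regular E T \<longleftrightarrow>
     single_valued T \<and> (0, 0) \<in> T
   \<and> (\<forall>x y x' y'. (x, y) \<in> T \<and> (x', y') \<in> T \<longrightarrow> (x + x', y + y') \<in> T)
   \<and> (\<forall>c x y. (x, y) \<in> T \<longrightarrow> (c *\<^sub>C x, c *\<^sub>C y) \<in> T)
   \<and> (\<forall>b x y. (x, y) \<in> T \<longrightarrow> (act E x b, act E y b) \<in> T)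
   \<and> closed T
   \<and> closure (Domain T) = UNIV
   \<and> closure (Domain (op_adjoint E T)) = UNIV
   \<and> closure (Range (Id \<oplus> op_adjoint E T \<odot> T)) = UNIV"

definition selfadjoint_regular :: "('e::complex_banach, 'b) hmodule \<Rightarrow> 'e op_graph \<Rightarrow> bool" where
  "selfadjoint_regular E D \<longleftrightarrow> regular E D \<and> op_adjoint E D = D"

text \<open>
  The continuous functional calculus \<open>f(R)\<close> of a positive bounded operator \<open>R\<close>, whose spectrum
  is contained in \<open>[0, \<parallel>R\<parallel>]\<close>, by polynomial approximation.
\<close>

definition poly_op :: "real poly \<Rightarrow> ('e::complex_banach \<Rightarrow> 'e) \<Rightarrow> 'e \<Rightarrow> 'e" where
  "poly_op p R x = (\<Sum>i\<le>degree p. coeff p i *\<^sub>R (R ^^ i) x)"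

definition fun_calc :: "(real \<Rightarrow> real) \<Rightarrow> ('e::complex_banach \<Rightarrow> 'e) \<Rightarrow> 'e \<Rightarrow> 'e" where
  "fun_calc f R = (THE T. bounded_linear T \<and>
     (\<forall>\<epsilon>>0. \<exists>p. (\<forall>x\<in>{0..onorm R}. \<bar>poly p x - f x\<bar> < \<epsilon>)
        \<and> onorm (\<lambda>v. poly_op p R v - T v) < \<epsilon>))"

text \<open>\<open>(1 + D\<^sup>2)\<^sup>-\<^sup>1\<close>\<close>

definition resolvent_sq :: "'e::complex_banach op_graph \<Rightarrow> 'e \<Rightarrow> 'e" where
  "resolvent_sq D = op_apply ((Id \<oplus> D \<odot> D)\<inverse>)"

text \<open>
  \<open>\<langle>D\<rangle>\<^sup>-\<^sup>\<beta> = ((1 + D\<^sup>2)\<^sup>-\<^sup>1)\<close> to the power \<open>\<beta>/2\<close>, for \<open>\<beta> \<ge> 0\<close>.  The case \<open>\<beta> = 0\<close> is separate because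
  \<open>0 powr 0 = 0\<close>.
\<close>

definition bracket_neg :: "real \<Rightarrow> 'e::complex_banach op_graph \<Rightarrow> 'e \<Rightarrow> 'e" where
  "bracket_neg \<beta> D =
     (if \<beta> = 0 then id else fun_calc (\<lambda>x. x powr (\<beta> / 2)) (resolvent_sq D))"

definition bounded_transform :: "'e::complex_banach op_graph \<Rightarrow> 'e \<Rightarrow> 'e" where
  "bounded_transform D = op_apply D \<circ> bracket_neg 1 D"

text \<open>\<open>D \<otimes> 1\<close>, as the closure of its restriction to the algebraic tensor product; \<open>t\<close> is the
  structure map of an exterior or interior tensor product.\<close>

definition unb_tensor_one ::
    "('e \<Rightarrow> 'f \<Rightarrow> 'g::complex_banach) \<Rightarrow> 'e op_graph \<Rightarrow> 'g op_graph" where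
  "unb_tensor_one t D = closure (span {(t \<xi> x, t \<eta> x) | \<xi> \<eta> x. (\<xi>, \<eta>) \<in> D})"

definition op_conj :: "('g \<Rightarrow> 'h) \<Rightarrow> 'g op_graph \<Rightarrow> 'h op_graph" where
  "op_conj V T = {(V x, V y) | x y. (x, y) \<in> T}"

definition extends_adjointable :: "('e, 'b) hmodule \<Rightarrow> 'e op_graph \<Rightarrow> bool" where
  "extends_adjointable E X \<longleftrightarrow> (\<exists>T. adjointable E E T \<and> X \<subseteq> gr T)"

definition matched ::
    "('es::complex_banach, 'bs) hmodule \<Rightarrow> ('e \<Rightarrow> 's::cstar_algebra \<Rightarrow> 'es) \<Rightarrow> 'es op_graph \<Rightarrow> bool" where
  "matched ES tES T \<longleftrightarrow>
     regular ES T \<and> closure {s. range (rmul_one_tensor tES s) \<subseteq> Domain T} = UNIV"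

definition extends_matched ::
    "('es::complex_banach, 'bs) hmodule \<Rightarrow> ('e \<Rightarrow> 's::cstar_algebra \<Rightarrow> 'es) \<Rightarrow> 'es op_graph \<Rightarrow> bool" where
  "extends_matched ES tES X \<longleftrightarrow> (\<exists>T. matched ES tES T \<and> X \<subseteq> T)"


section \<open>Cycles and Kasparov modules\<close>

text \<open>
  The parity is recorded by an optional grading operator: \<open>None\<close> for an ungraded (odd) module,
  \<open>Some \<gamma>\<close> for a graded (even) one, whose homogeneous parts are the \<open>\<plusminus>1\<close> eigenspaces of \<open>\<gamma>\<close>.
\<close>

definition grading_operator :: "('e, 'b) hmodule \<Rightarrow> ('e \<Rightarrow> 'e) \<Rightarrow> bool" where
  "grading_operator E \<gamma> \<longleftrightarrow> \<gamma> \<circ> \<gamma> = id \<and> (\<forall>x y. ip E (\<gamma> x) y = ip E x (\<gamma> y))"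

definition odd_operator :: "('e::uminus \<Rightarrow> 'e) \<Rightarrow> 'e op_graph \<Rightarrow> bool" where
  "odd_operator \<gamma> D \<longleftrightarrow> (\<forall>(x, y)\<in>D. (\<gamma> x, - \<gamma> y) \<in> D)"

definition even_operator :: "('e \<Rightarrow> 'e) \<Rightarrow> 'e op_graph \<Rightarrow> bool" where
  "even_operator \<gamma> D \<longleftrightarrow> (\<forall>(x, y)\<in>D. (\<gamma> x, \<gamma> y) \<in> D)"

definition parity_compatible ::
    "('e::uminus, 'b) hmodule \<Rightarrow> ('e \<Rightarrow> 'e) option \<Rightarrow> ('a \<Rightarrow> 'e \<Rightarrow> 'e) \<Rightarrow> 'e op_graph \<Rightarrow> bool" where
  "parity_compatible E g \<pi> D \<longleftrightarrow>
     (case g of None \<Rightarrow> True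
      | Some \<gamma> \<Rightarrow> grading_operator E \<gamma> \<and> (\<forall>a. even_operator \<gamma> (gr (\<pi> a))) \<and> odd_operator \<gamma> D)"

definition Lip_star ::
    "real \<Rightarrow> ('e::complex_banach, 'b) hmodule \<Rightarrow> 'e op_graph \<Rightarrow> ('e \<Rightarrow> 'e) set" where
  "Lip_star \<alpha> E D = {a. adjointable E E a \<and> a ` Domain D \<subseteq> Domain D
     \<and> extends_adjointable E (commutator D (gr a) \<odot> gr (bracket_neg \<alpha> D))
     \<and> extends_adjointable E (gr (bracket_neg \<alpha> D) \<odot> commutator D (gr a))}"

text \<open>An order-\<open>1/(1-\<alpha>)\<close> cycle.\<close>

definition order_cycle ::
    "real \<Rightarrow> ('e::complex_banach, 'b::cstar_algebra) hmodule \<Rightarrow> ('e \<Rightarrow> 'e) option \<Rightarrow>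
     ('a::cstar_algebra \<Rightarrow> 'e \<Rightarrow> 'e) \<Rightarrow> 'e op_graph \<Rightarrow> bool" where
  "order_cycle \<alpha> E g \<pi> D \<longleftrightarrow>
     hilbert_module E \<and> representation E \<pi>
   \<and> selfadjoint_regular E D
   \<and> (\<forall>a. resolvent_sq D \<circ> \<pi> a \<in> compact_ops E)
   \<and> range \<pi> \<subseteq> op_closure (Lip_star \<alpha> E D)
   \<and> parity_compatible E g \<pi> D"

definition kasparov_module ::
    "('e::complex_banach, 'b::cstar_algebra) hmodule \<Rightarrow> ('e \<Rightarrow> 'e) option \<Rightarrow>
     ('a::cstar_algebra \<Rightarrow> 'e \<Rightarrow> 'e) \<Rightarrow> ('e \<Rightarrow> 'e) \<Rightarrow> bool" where
  "kasparov_module E g \<pi> F \<longleftrightarrow>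
     hilbert_module E \<and> representation E \<pi>
   \<and> adjointable E E F
   \<and> (\<forall>a. (\<lambda>x. adj E E F (\<pi> a x) - F (\<pi> a x)) \<in> compact_ops E
        \<and> (\<lambda>x. \<pi> a x - F (F (\<pi> a x))) \<in> compact_ops E
        \<and> (\<lambda>x. F (\<pi> a x) - \<pi> a (F x)) \<in> compact_ops E)
   \<and> parity_compatible E g \<pi> (gr F)"

definition equivariant_kasparov_module ::
    "('s::cstar_algebra \<Rightarrow> 's \<Rightarrow> 'ss::cstar_algebra) \<Rightarrow> ('s \<Rightarrow> 'ss \<Rightarrow> 'ss) \<Rightarrow>
     ('a::cstar_algebra \<Rightarrow> 's \<Rightarrow> 'as::cstar_algebra) \<Rightarrow> ('a \<Rightarrow> 'as \<Rightarrow> 'as) \<Rightarrow>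
     ('b::cstar_algebra \<Rightarrow> 's \<Rightarrow> 'bs::cstar_algebra) \<Rightarrow> ('bs \<Rightarrow> 's \<Rightarrow> 'bss::cstar_algebra) \<Rightarrow>
     ('b \<Rightarrow> 'bs \<Rightarrow> 'bs) \<Rightarrow>
     ('e::complex_banach, 'b) hmodule \<Rightarrow>
     ('es::complex_banach, 'bs) hmodule \<Rightarrow> ('e \<Rightarrow> 's \<Rightarrow> 'es) \<Rightarrow>
     ('ess::complex_banach, 'bss) hmodule \<Rightarrow> ('es \<Rightarrow> 's \<Rightarrow> 'ess) \<Rightarrow>
     ('g::complex_banach, 'bs) hmodule \<Rightarrow> ('e \<Rightarrow> 'bs \<Rightarrow> 'g) \<Rightarrow>
     ('e \<Rightarrow> 'e) option \<Rightarrow> ('a \<Rightarrow> 'e \<Rightarrow> 'e) \<Rightarrow> ('e \<Rightarrow> 'bs \<Rightarrow> 'es) \<Rightarrow> ('e \<Rightarrow> 'e) \<Rightarrow> bool" where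
  "equivariant_kasparov_module tSS \<Delta> tAS \<delta>\<^sub>A tBS tBSS \<delta>\<^sub>B E ES tES ESS tESS EBS tEBS g \<pi> \<delta>\<^sub>E F \<longleftrightarrow>
     kasparov_module E g \<pi> F
   \<and> equivariant_correspondence tSS \<Delta> tAS \<delta>\<^sub>A tBS tBSS \<delta>\<^sub>B E ES tES ESS tESS \<pi> \<delta>\<^sub>E
   \<and> (let V = admissible_unitary EBS tEBS ES \<delta>\<^sub>E;
          F\<^sub>\<delta> = tensor_op EBS EBS tEBS tEBS F id;
          F\<^sub>1 = tensor_op ES ES tES tES F id
      in \<forall>a s. (let as = tensor_op ES ES tES tES (\<pi> a) (lmul s)
           in (\<lambda>\<zeta>. V (F\<^sub>\<delta> (adj EBS ES V (as \<zeta>))) - F\<^sub>1 (as \<zeta>)) \<in> compact_ops ES))"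

text \<open>
  The set \<open>\<S>\<^sub>a\<close>.  In the domain condition, \<open>dom(D \<otimes> 1)(1 \<otimes> K\<^sub>S)\<close> lies in the domain of every
  matched operator, because the \<open>s\<close> with \<open>(E \<otimes> S)(1 \<otimes> s)\<close> contained in such a domain form a
  dense two-sided ideal.
\<close>

definition conformal_multipliers ::
    "real \<Rightarrow>
     ('es::complex_banach, 'bs) hmodule \<Rightarrow> ('e::complex_banach \<Rightarrow> 's::cstar_algebra \<Rightarrow> 'es) \<Rightarrow>
     ('g::complex_banach, 'bs) hmodule \<Rightarrow> ('e \<Rightarrow> 'bs \<Rightarrow> 'g) \<Rightarrow>
     ('e \<Rightarrow> 'bs \<Rightarrow> 'es) \<Rightarrow> 'e op_graph \<Rightarrow> 'es op_graph \<Rightarrow> ('e \<Rightarrow> 'e) \<Rightarrow> ('s \<Rightarrow> 's) set" where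
  "conformal_multipliers \<alpha> ES tES EBS tEBS \<delta>\<^sub>E D \<mu> a = {s. multiplier s \<and>
    (let V = admissible_unitary EBS tEBS ES \<delta>\<^sub>E;
         D\<^sub>1 = unb_tensor_one tES D;
         D\<^sub>\<delta> = unb_tensor_one tEBS D;
         VDV = op_conj V D\<^sub>\<delta>;
         \<mu>s = op_adjoint ES \<mu>;
         \<mu>is = op_adjoint ES (\<mu>\<inverse>);
         as = gr (tensor_op ES ES tES tES a s);
         W = {rmul_one_tensor tES k x | k x. x \<in> Domain D\<^sub>1 \<and> k \<in> pedersen_ideal};
         L = gr (bracket_neg \<alpha> D\<^sub>1);
         L\<^sub>\<delta> = op_conj V (gr (bracket_neg \<alpha> D\<^sub>\<delta>));
         X = VDV \<odot> as \<ominus> as \<odot> \<mu> \<odot> D\<^sub>1 \<odot> \<mu>s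
     in (as \<odot> \<mu>) `` W \<union> (as \<odot> \<mu>is) `` W \<subseteq> Domain D\<^sub>1 \<inter> V ` Domain D\<^sub>\<delta>
      \<and> extends_matched ES tES (X \<odot> \<mu>is \<odot> L)
      \<and> extends_matched ES tES (L\<^sub>\<delta> \<odot> X)
      \<and> extends_matched ES tES (commutator D\<^sub>1 (as \<odot> \<mu>) \<odot> L)
      \<and> extends_matched ES tES (L \<odot> commutator D\<^sub>1 (as \<odot> \<mu>))
      \<and> extends_matched ES tES (commutator D\<^sub>1 (as \<odot> \<mu>is) \<odot> L)
      \<and> extends_matched ES tES (L \<odot> commutator D\<^sub>1 (as \<odot> \<mu>is)))}"

definition conformally_equivariant_cycle ::
    "real \<Rightarrow>
     ('s::cstar_algebra \<Rightarrow> 's \<Rightarrow> 'ss::cstar_algebra) \<Rightarrow> ('s \<Rightarrow> 'ss \<Rightarrow> 'ss) \<Rightarrow>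
     ('a::cstar_algebra \<Rightarrow> 's \<Rightarrow> 'as::cstar_algebra) \<Rightarrow> ('a \<Rightarrow> 'as \<Rightarrow> 'as) \<Rightarrow>
     ('b::cstar_algebra \<Rightarrow> 's \<Rightarrow> 'bs::cstar_algebra) \<Rightarrow> ('bs \<Rightarrow> 's \<Rightarrow> 'bss::cstar_algebra) \<Rightarrow>
     ('b \<Rightarrow> 'bs \<Rightarrow> 'bs) \<Rightarrow>
     ('e::complex_banach, 'b) hmodule \<Rightarrow>
     ('es::complex_banach, 'bs) hmodule \<Rightarrow> ('e \<Rightarrow> 's \<Rightarrow> 'es) \<Rightarrow>
     ('ess::complex_banach, 'bss) hmodule \<Rightarrow> ('es \<Rightarrow> 's \<Rightarrow> 'ess) \<Rightarrow>
     ('g::complex_banach, 'bs) hmodule \<Rightarrow> ('e \<Rightarrow> 'bs \<Rightarrow> 'g) \<Rightarrow>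
     ('e \<Rightarrow> 'e) option \<Rightarrow> ('a \<Rightarrow> 'e \<Rightarrow> 'e) \<Rightarrow> ('e \<Rightarrow> 'bs \<Rightarrow> 'es) \<Rightarrow>
     'e op_graph \<Rightarrow> 'es op_graph \<Rightarrow> bool" where
  "conformally_equivariant_cycle \<alpha> tSS \<Delta> tAS \<delta>\<^sub>A tBS tBSS \<delta>\<^sub>B E ES tES ESS tESS EBS tEBS g \<pi> \<delta>\<^sub>E D \<mu> \<longleftrightarrow>
     order_cycle \<alpha> E g \<pi> D
   \<and> equivariant_correspondence tSS \<Delta> tAS \<delta>\<^sub>A tBS tBSS \<delta>\<^sub>B E ES tES ESS tESS \<pi> \<delta>\<^sub>E
   \<and> matched ES tES \<mu> \<and> matched ES tES (\<mu>\<inverse>)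
   \<and> (case g of None \<Rightarrow> True | Some \<gamma> \<Rightarrow> even_operator (tensor_op ES ES tES tES \<gamma> id) \<mu>)
   \<and> (let \<S> = conformal_multipliers \<alpha> ES tES EBS tEBS \<delta>\<^sub>E D \<mu>;
          \<Q> = {a \<in> Lip_star \<alpha> E D. \<forall>s.
                 lmul s \<in> op_closure (op_span {lmul u \<circ> m | u m. m \<in> \<S> a})
               \<and> lmul s \<in> op_closure (op_span {m \<circ> lmul u | u m. m \<in> \<S> a})}
      in range \<pi> \<subseteq> op_closure (op_span {\<pi> a \<circ> q | a q. q \<in> \<Q>})
                 \<inter> op_closure (op_span {q \<circ> \<pi> a | a q. q \<in> \<Q>}))"

end

theory Submission
  imports Defs "HOL-Complex_Analysis.Complex_Analysis"
begin

text \<open>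
  Throughout, \<open>D\<close> is handled through its bounded picture: with \<open>R = (1 + D\<^sup>2)\<^sup>-\<^sup>1\<close> and the bounded
  transform \<open>F\<close> the graph of \<open>D\<close> is the set of all \<open>(R\<^sup>1\<^sup>/\<^sup>2 u, F u)\<close> (\<open>selfadjoint_btrans\<close>).  Write
  \<open>D\<^sub>1 = D \<otimes> 1\<close> and \<open>D\<^sub>2 = V (D \<otimes> 1) V\<^sup>*\<close> for the two operators on \<open>E \<otimes> S\<close>, and \<open>F\<^sub>1\<close>, \<open>F\<^sub>2\<close> for their
  bounded transforms.  It is to be shown that \<open>(F\<^sub>2 - F\<^sub>1) (\<pi>(a) \<otimes> s)\<close> is compact.

  \<^emph>\<open>Scales.\<close>  For \<open>r = 2\<^sup>j\<close> let \<open>Y = (1 + D\<^sup>2 / r\<^sup>2)\<^sup>-\<^sup>1\<close> and \<open>Z = (D / r) Y\<close>; the projection onto the graph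
  of \<open>D / r\<close> has the entries \<open>Y\<close>, \<open>Z\<close>, \<open>Z\<close>, \<open>1 - Y\<close>.  All relations hold up to errors that decay
  geometrically in \<open>j\<close>, and such an error may be ignored: if \<open>T Z\<close> decays, then \<open>T (1 - Y)\<close>
  is a telescoping sum of decaying terms (\<open>nul_telescope\<close>), while \<open>Y\<close> is a multiple of \<open>R\<close>.  So \<open>T c\<close> is
  compact whenever \<open>R c\<close> is compact (\<open>nul_compact\<close>), which is how compactness of resolvents enters.

  \<^emph>\<open>Comparison of the transforms.\<close>  For \<open>x = a \<otimes> s\<close> the conformal conditions say that \<open>D\<^sub>2 x \<mu>\<^sup>-\<^sup>1\<^sup>*\<close>
  and \<open>x \<mu> D\<^sub>1\<close> differ by an operator of order \<open>\<alpha> < 1\<close>, and that \<open>x \<mu>\<close> and \<open>x \<mu>\<^sup>-\<^sup>1\<^sup>*\<close> commute with \<open>D\<^sub>1\<close> up to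
  such operators.  Terms of order \<open>\<alpha>\<close> decay at the scales \<open>r\<close>.  It follows that
  \<open>N = X Y\<^sub>1 X\<^sup>* + X' (1 - Y\<^sub>1) X'\<^sup>*\<close> with \<open>X = x \<mu>\<^sup>-\<^sup>1\<^sup>*\<close> and \<open>X' = x \<mu>\<close> satisfies \<open>Z\<^sub>2 N \<simeq> q Z\<^sub>1\<close> with
  \<open>q = x x\<^sup>*\<close>: the two factors \<open>\<mu>\<close> and \<open>\<mu>\<^sup>-\<^sup>1\<close> cancel in \<open>X X'\<^sup>*\<close>, and the conformal factor disappears.
  Squaring removes the signs of \<open>D\<^sub>1\<close> and \<open>D\<^sub>2\<close>, and uniqueness of positive square roots up to decay
  (\<open>eqv_sqrt\<close>) yields \<open>W\<^sub>2 N \<simeq> q W\<^sub>1\<close> for the absolute values \<open>W\<close> of \<open>Z\<close>.  As \<open>F Z = W\<close>, this means that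
  \<open>(F\<^sub>2 - F\<^sub>1) q Z\<^sub>1\<close> decays (\<open>nul_intertwiner\<close>).  The same method applied to a single operator shows that
  \<open>F\<close> commutes with \<open>A\<close> up to compact operators, so that \<open>(A, E, F)\<close> is a bounded Kasparov module
  (\<open>order_cycle_kasparov\<close>).

  \<^emph>\<open>Localisation.\<close>  The factor \<open>\<mu>\<close> and the extensions in the conformal conditions are unbounded, but
  matched: their domains contain \<open>(E \<otimes> S) (1 \<otimes> k)\<close> for \<open>k\<close> in the Pedersen ideal.  If \<open>k\<close> has a unit
  \<open>k'\<close> in that ideal, then a matched operator agrees with a bounded one on the submodule
  generated by \<open>1 \<otimes> k\<close> (\<open>matched_local\<close>).  This submodule is invariant under all adjointable operators,
  so the comparison above can be carried out on it.  Elements \<open>\<pi>(b) \<otimes> k u\<close> map into it, and local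
  units \<open>k\<close> approximate every \<open>u\<close>.

  \<^emph>\<open>Conclusion.\<close>  This gives compactness of \<open>(F\<^sub>2 - F\<^sub>1) x x\<^sup>* (\<pi>(b) \<otimes> u)\<close>, by polarisation that of
  \<open>(F\<^sub>2 - F\<^sub>1) x y\<^sup>* (\<pi>(b) \<otimes> u)\<close> (\<open>good_compact\<close>, \<open>compact_products\<close>), and the two density conditions turn
  such products into \<open>\<pi>(a) \<otimes> s\<close> (\<open>compact_difference\<close>).

  The operator theory underneath rests on one estimate: for a self-adjoint contraction \<open>T\<close> the norm of
  \<open>p(T)\<close> is at most the supremum of \<open>p\<close> on \<open>[-1, 1]\<close> (\<open>norm_poly_op_le\<close>), which follows from
  Cauchy's inequality for a polynomial in the unitary \<open>T + i (1 - T\<^sup>2)\<^sup>1\<^sup>/\<^sup>2\<close>.  It provides the functional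
  calculus (\<open>fun_calc_eq_fc\<close>), positivity of \<open>X\<^sup>*X\<close> (\<open>spos_adjoint_square\<close>) and, through it, the
  Cauchy--Schwarz inequality on Hilbert modules (\<open>csmod\<close>).
\<close>

section \<open>Complex Banach spaces and Hilbert modules\<close>

lemma scaleC_zero_right [simp]: "c *\<^sub>C (0::'a::complex_vector) = 0"
  using scaleC_add_right[of c "0::'a" 0] by simp

lemma scaleC_zero_left [simp]: "0 *\<^sub>C (x::'a::complex_vector) = 0"
  using scaleC_add_left[of 0 0 x] by simp

lemma scaleC_one [simp]: "1 *\<^sub>C (x::'a::complex_vector) = x"
  using scaleR_scaleC[of 1 x] by simp

lemma scaleC_minus_right [simp]: "c *\<^sub>C (- x) = - (c *\<^sub>C (x::'a::complex_vector))"
  using scaleC_add_right[of c x "- x"] by (simp add: eq_neg_iff_add_eq_0 add.commute)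

lemma scaleC_minus_left [simp]: "(- c) *\<^sub>C x = - (c *\<^sub>C (x::'a::complex_vector))"
  using scaleC_add_left[of c "- c" x] by (simp add: eq_neg_iff_add_eq_0 add.commute)

lemma scaleC_diff_right: "c *\<^sub>C (x - y) = c *\<^sub>C x - c *\<^sub>C (y::'a::complex_vector)"
  using scaleC_add_right[of c x "- y"] by simp

lemma scaleC_sum_right: "c *\<^sub>C (\<Sum>i\<in>I. f i) = (\<Sum>i\<in>I. c *\<^sub>C (f i ::'a::complex_vector))"
  by (induction I rule: infinite_finite_induct) (auto simp: scaleC_add_right)

lemma scaleR_scaleC_commute: "r *\<^sub>R (c *\<^sub>C x) = c *\<^sub>C (r *\<^sub>R (x::'a::complex_vector))"
  by (simp add: scaleR_scaleC scaleC_scaleC mult.commute)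

lemma clinear_add: "clinear f \<Longrightarrow> f (x + y) = f x + f y"
  and clinear_scaleC: "clinear f \<Longrightarrow> f (c *\<^sub>C x) = c *\<^sub>C f x"
  by (auto simp: clinear_def)

lemma clinear_scaleR: "clinear f \<Longrightarrow> f (r *\<^sub>R x) = r *\<^sub>R f x"
  by (simp add: scaleR_scaleC clinear_scaleC)

lemma clinear_linear: "clinear f \<Longrightarrow> linear f"
  by (auto intro!: linearI simp: clinear_add clinear_scaleR)

lemma clinear_zero: "clinear f \<Longrightarrow> f 0 = 0"
  by (rule linear_0) (rule clinear_linear)

lemma clinear_minus: "clinear f \<Longrightarrow> f (- x) = - f x"
  by (rule linear_neg) (rule clinear_linear)

lemma clinear_diff: "clinear f \<Longrightarrow> f (x - y) = f x - f y"
  by (rule linear_diff) (rule clinear_linear)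

lemma clinear_sum: "clinear f \<Longrightarrow> f (\<Sum>i\<in>I. g i) = (\<Sum>i\<in>I. f (g i))"
  by (rule linear_sum) (rule clinear_linear)

lemma star_zero [simp]: "star (0::'a::cstar_algebra) = 0"
  using star_add[of "0::'a" 0] by simp

lemma star_minus: "star (- x) = - star (x::'a::cstar_algebra)"
  using star_add[of x "- x"] by (simp add: eq_neg_iff_add_eq_0 add.commute)

lemma star_diff: "star (x - y) = star x - star (y::'a::cstar_algebra)"
  using star_add[of x "- y"] by (simp add: star_minus)

lemma star_scaleR: "star (r *\<^sub>R x) = r *\<^sub>R star (x::'a::cstar_algebra)"
  by (simp add: scaleR_scaleC star_scaleC)

lemma norm_star [simp]: "norm (star x) = norm (x::'a::cstar_algebra)"
proof -
  have *: "norm y \<le> norm (star y)" for y :: 'a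
  proof (cases "y = 0")
    case False
    have "(norm y)\<^sup>2 \<le> norm (star y) * norm y"
      by (metis norm_mult_ineq norm_star_mult)
    then show ?thesis
      using False by (simp add: power2_eq_square)
  qed simp
  from *[of x] *[of "star x"] show ?thesis
    by (simp add: star_star)
qed

lemma star_mult_self_zero: "star x * x = 0 \<Longrightarrow> x = (0::'a::cstar_algebra)"
  using norm_star_mult[of x] by simp

lemma bounded_linear_star: "bounded_linear (star :: 'a::cstar_algebra \<Rightarrow> 'a)"
  by (intro bounded_linear_intro[where K=1]) (auto simp: star_add star_scaleR)

text \<open>
  If the open sets on which some \<open>f i\<close> exceeds \<open>n\<close> were dense for all \<open>n\<close>, then by Baire's theorem
  a point common to all of them would contradict pointwise boundedness.  So on some ball all \<open>f i\<close>
  are at most \<open>n\<close>, and linearity carries this bound to the unit ball.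
\<close>

lemma uniform_boundedness:
  fixes f :: "'i \<Rightarrow> 'a::banach \<Rightarrow> 'b::real_normed_vector"
  assumes lin: "\<And>i. i \<in> I \<Longrightarrow> bounded_linear (f i)"
    and ptw: "\<And>x. \<exists>C. \<forall>i\<in>I. norm (f i x) \<le> C"
  shows "\<exists>C\<ge>0. \<forall>i\<in>I. \<forall>x. norm (f i x) \<le> C * norm x"
proof -
  define G where "G n = {x. \<exists>i\<in>I. norm (f i x) > real n}" for n :: nat
  have op: "open (G n)" for n
  proof -
    have "G n = (\<Union>i\<in>I. {x. norm (f i x) > real n})"
      by (auto simp: G_def)
    moreover have "open {x. norm (f i x) > real n}" if "i \<in> I" for i
      by (intro open_Collect_less continuous_intros linear_continuous_on lin that)
    ultimately show ?thesis by auto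
  qed
  have "\<exists>n. closure (G n) \<noteq> UNIV"
  proof (rule ccontr)
    assume "\<not> ?thesis"
    then have "closure (\<Inter>(range G)) = UNIV"
      using Met_TC.metric_Baire_category[where ?'a='a, of "range G"] op
      by (auto simp: mcomplete_iff_complete complete_UNIV)
    then obtain x where "x \<in> \<Inter>(range G)"
      by (metis UNIV_not_empty closure_empty ex_in_conv)
    then have x: "x \<in> G n" for n by auto
    obtain C where C: "\<forall>i\<in>I. norm (f i x) \<le> C" using ptw by blast
    obtain n where "C \<le> real n" using real_arch_simple by blast
    with x[of n] C show False by (force simp: G_def)
  qed
  then obtain n a where "a \<notin> closure (G n)" by blast
  then obtain e where e: "e > 0" "\<And>y. dist y a < e \<Longrightarrow> y \<notin> G n"
    by (metis closure_approachable)
  have bd: "norm (f i y) \<le> real n" if "i \<in> I" "dist y a < e" for i y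
    using e(2)[OF that(2)] that(1) by (force simp: G_def)
  have "norm (f i x) \<le> (4 * real n / e) * norm x" if i: "i \<in> I" for i x
  proof (cases "x = 0")
    case True
    then show ?thesis using lin[OF i] by (simp add: bounded_linear.linear linear_0)
  next
    case False
    interpret bounded_linear "f i" by (rule lin[OF i])
    define r where "r = e / (2 * norm x)"
    have r: "r > 0" using False e by (simp add: r_def)
    have "norm (f i (a + r *\<^sub>R x)) \<le> real n"
      using e False by (intro bd i) (simp add: dist_norm r_def)
    moreover have "norm (f i a) \<le> real n" using e by (intro bd i) simp
    moreover have "f i (a + r *\<^sub>R x) = f i a + r *\<^sub>R f i x" by (simp add: add scaleR)
    ultimately have "norm (r *\<^sub>R f i x) \<le> 2 * real n"
      by (metis add_diff_cancel_left' mult_2 norm_triangle_le_diff add_mono)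
    then have "r * norm (f i x) \<le> 2 * real n" using r by simp
    then show ?thesis using False e by (simp add: r_def field_simps)
  qed
  then show ?thesis using e by (intro exI[of _ "4 * real n / e"]) auto
qed

locale hmod =
  fixes E :: "('e::complex_banach, 'b::cstar_algebra) hmodule"
  assumes hilbert: "hilbert_module E"
begin

lemma clinear_act_left: "clinear (\<lambda>x. act E x b)"
  and clinear_act_right: "clinear (act E x)"
  and clinear_ip: "clinear (ip E x)"
  and star_ip: "star (ip E x y) = ip E y x"
  and ip_act_right: "ip E x (act E y b) = ip E x y * b"
  and ip_self_square: "\<exists>b. ip E x x = star b * b"
  and norm_ip_self: "norm (ip E x x) = (norm x)\<^sup>2"
  using hilbert unfolding hilbert_module_def cbilinear_def by auto

lemma ip_act_left: "ip E (act E x b) y = star b * ip E x y"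
  by (metis ip_act_right star_ip star_mult)

lemma ip_add_right: "ip E x (y + z) = ip E x y + ip E x z"
  and ip_diff_right: "ip E x (y - z) = ip E x y - ip E x z"
  and ip_minus_right: "ip E x (- y) = - ip E x y"
  and ip_zero_right [simp]: "ip E x 0 = 0"
  and ip_scaleC_right: "ip E x (c *\<^sub>C y) = c *\<^sub>C ip E x y"
  and ip_scaleR_right: "ip E x (r *\<^sub>R y) = r *\<^sub>R ip E x y"
  using clinear_ip[of x]
  by (auto simp: clinear_add clinear_diff clinear_minus clinear_zero clinear_scaleC
      clinear_scaleR clinear_sum)

lemma ip_add_left: "ip E (x + y) z = ip E x z + ip E y z"
  by (metis ip_add_right star_ip star_add)

lemma ip_diff_left: "ip E (x - y) z = ip E x z - ip E y z"
  by (metis ip_diff_right star_ip star_diff)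

lemma ip_minus_left: "ip E (- x) z = - ip E x z"
  by (metis ip_minus_right star_ip star_minus)

lemma ip_zero_left [simp]: "ip E 0 z = 0"
  by (metis ip_zero_right star_ip star_zero)

lemma ip_scaleC_left: "ip E (c *\<^sub>C x) z = cnj c *\<^sub>C ip E x z"
  by (metis ip_scaleC_right star_ip star_scaleC)

lemma ip_scaleR_left: "ip E (r *\<^sub>R x) z = r *\<^sub>R ip E x z"
  by (simp add: scaleR_scaleC ip_scaleC_left)

lemma ip_self_eq_zero: "ip E x x = 0 \<Longrightarrow> x = 0"
  using norm_ip_self[of x] by simp

lemma ip_ext: "(\<And>x. ip E x y = ip E x z) \<Longrightarrow> y = z"
  using ip_self_eq_zero[of "y - z"] by (simp add: ip_diff_right)

lemma ip_ext_left: "(\<And>x. ip E y x = ip E z x) \<Longrightarrow> y = z"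
  by (rule ip_ext) (metis star_ip)

lemma act_add_left: "act E (x + y) b = act E x b + act E y b"
  and act_diff_left: "act E (x - y) b = act E x b - act E y b"
  and act_zero_left [simp]: "act E 0 b = 0"
  and act_scaleR_left: "act E (r *\<^sub>R x) b = r *\<^sub>R act E x b"
  using clinear_act_left[of b]
  by - (auto dest: clinear_add[where x=x and y=y] clinear_diff[where x=x and y=y] clinear_zero
     clinear_scaleR[where x=x and r=r])

lemma act_add_right: "act E x (b + c) = act E x b + act E x c"
  and act_zero_right [simp]: "act E x 0 = 0"
  and act_scaleR_right: "act E x (r *\<^sub>R b) = r *\<^sub>R act E x b"
  using clinear_act_right[of x]
  by (auto simp: clinear_add clinear_diff clinear_zero clinear_scaleC clinear_scaleR)

lemma norm_act: "norm (act E x b) \<le> norm x * norm b"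
proof -
  have "(norm (act E x b))\<^sup>2 = norm (star b * ip E x x * b)"
    by (simp add: norm_ip_self[symmetric] ip_act_left ip_act_right mult.assoc)
  also have "\<dots> \<le> norm (star b) * norm (ip E x x) * norm b"
    by (meson mult_right_mono norm_ge_zero norm_mult_ineq order_trans)
  also have "\<dots> = (norm x * norm b)\<^sup>2"
    by (simp add: norm_ip_self power2_eq_square)
  finally show ?thesis
    by (rule power2_le_imp_le) simp
qed

lemma bounded_linear_act_left: "bounded_linear (\<lambda>x. act E x b)"
  by (intro bounded_linear_intro[where K="norm b"])
    (auto simp: act_add_left act_scaleR_left norm_act)

lemma bounded_linear_act_right: "bounded_linear (act E x)"
  by (intro bounded_linear_intro[where K="norm x"])
    (use norm_act in \<open>auto simp: act_add_right act_scaleR_right mult.commute\<close>)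

text \<open>
  If \<open>\<langle>u | v\<rangle>\<close> is self-adjoint, then \<open>u + iv\<close> and \<open>u - iv\<close> have the same norm, and \<open>u\<close> is their
  mean.  So the square \<open>\<langle>u | u\<rangle>\<close> is dominated in norm by \<open>\<langle>u | u\<rangle> + \<langle>v | v\<rangle>\<close>, by an argument
  that does not appeal to the order of the C*-algebra.
\<close>

lemma ip_self_pm:
  assumes "ip E u v = ip E v u"
  shows "ip E (u + \<i> *\<^sub>C v) (u + \<i> *\<^sub>C v) = ip E u u + ip E v v"
    and "ip E (u - \<i> *\<^sub>C v) (u - \<i> *\<^sub>C v) = ip E u u + ip E v v"
  using assms by (auto simp: ip_add_left ip_add_right ip_diff_left ip_diff_right ip_scaleC_left
      ip_scaleC_right scaleC_scaleC scaleC_add_right scaleC_diff_right)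

lemma norm_le_commuting_squares:
  assumes "ip E u v = ip E v u"
  shows "(norm u)\<^sup>2 \<le> norm (ip E u u + ip E v v)"
proof -
  let ?s = "sqrt (norm (ip E u u + ip E v v))"
  have n: "norm (u + \<i> *\<^sub>C v) = ?s" "norm (u - \<i> *\<^sub>C v) = ?s"
    using ip_self_pm[OF assms] norm_ip_self by (metis norm_ge_zero real_sqrt_abs abs_norm_cancel)+
  have "2 *\<^sub>R u = (u + \<i> *\<^sub>C v) + (u - \<i> *\<^sub>C v)"
    by (simp add: scaleR_2)
  then have "norm (2 *\<^sub>R u) \<le> ?s + ?s"
    by (metis n norm_triangle_ineq)
  then have "norm u \<le> ?s" by simp
  then show ?thesis
    by (metis norm_ge_zero power_mono real_sqrt_pow2)
qed

end

lemma hmod_self_module: "hmod (self_module :: ('b::cstar_algebra, 'b) hmodule)"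
  unfolding hmod_def hilbert_module_def self_module_def cbilinear_def clinear_def
  by (auto simp: mult_scaleC_left mult_scaleC_right algebra_simps star_mult star_star
      norm_star_mult)

lemma self_module_simps [simp]:
  "act self_module x b = x * b" "ip self_module x y = star x * y"
  by (simp_all add: self_module_def)


section \<open>Adjointable operators\<close>

lemma adjointableI: "(\<And>x y. ip F (T x) y = ip E x (T' y)) \<Longrightarrow> adjointable E F T"
  by (auto simp: adjointable_def)

lemma (in hmod) adj_eqI:
  assumes "\<And>x y. ip F (T x) y = ip E x (T' y)"
  shows "adj E F T = T'"
  unfolding adj_def
proof (rule the_equality)
  show "\<forall>x y. ip F (T x) y = ip E x (T' y)" using assms by simp
  fix S assume "\<forall>x y. ip F (T x) y = ip E x (S y)"
  then show "S = T'" using assms by (intro ext ip_ext) metis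
qed

lemma (in hmod) ip_adj:
  assumes "adjointable E F T"
  shows "ip F (T x) y = ip E x (adj E F T y)"
proof -
  obtain T' where T': "\<And>x y. ip F (T x) y = ip E x (T' y)"
    using assms by (auto simp: adjointable_def)
  then have "adj E F T = T'" by (rule adj_eqI)
  then show ?thesis using T' by simp
qed

lemma ip_adj_left:
  assumes "hmod E" "hmod F" "adjointable E F T"
  shows "ip E (adj E F T y) x = ip F y (T x)"
  by (metis assms hmod.ip_adj hmod.star_ip)

lemma adjointable_adj:
  assumes "hmod E" "hmod F" "adjointable E F T"
  shows "adjointable F E (adj E F T)"
  by (rule adjointableI) (rule ip_adj_left[OF assms])

lemma adj_adj:
  assumes "hmod E" "hmod F" "adjointable E F T"
  shows "adj F E (adj E F T) = T"
  by (rule hmod.adj_eqI[OF assms(2)]) (rule ip_adj_left[OF assms])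

lemma clinear_adjointable:
  assumes "hmod E" "hmod F" "adjointable E F T"
  shows "clinear T"
proof -
  interpret E: hmod E by fact
  interpret F: hmod F by fact
  note a = E.ip_adj[OF assms(3)]
  show ?thesis
    unfolding clinear_def
    by (intro conjI allI; rule F.ip_ext_left)
      (simp_all add: a F.ip_add_left E.ip_add_left F.ip_scaleC_left E.ip_scaleC_left)
qed

lemma adjointable_compose:
  assumes "hmod E" "hmod F" "adjointable E F T" "adjointable F G S"
  shows "adjointable E G (S \<circ> T)" "adj E G (S \<circ> T) = adj E F T \<circ> adj F G S"
proof -
  have *: "ip G ((S \<circ> T) x) y = ip E x ((adj E F T \<circ> adj F G S) y)" for x y
    by (simp add: hmod.ip_adj[OF assms(1,3)] hmod.ip_adj[OF assms(2,4)])
  show "adjointable E G (S \<circ> T)" by (rule adjointableI) (rule *)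
  show "adj E G (S \<circ> T) = adj E F T \<circ> adj F G S" by (rule hmod.adj_eqI[OF assms(1) *])
qed

lemma (in hmod) adjointable_act:
  assumes F: "hmod F" and T: "adjointable E F T"
  shows "T (act E x b) = act F (T x) b"
proof -
  interpret F: hmod F by fact
  show ?thesis
    by (rule F.ip_ext_left) (simp add: ip_adj[OF T] F.ip_act_left ip_act_left)
qed

text \<open>The operators on one module, as a *-algebra.\<close>

context hmod
begin

abbreviation adm :: "('e \<Rightarrow> 'e) \<Rightarrow> bool" where "adm \<equiv> adjointable E E"
abbreviation ad :: "('e \<Rightarrow> 'e) \<Rightarrow> 'e \<Rightarrow> 'e" where "ad \<equiv> adj E E"

lemma adm_clinear: "adm T \<Longrightarrow> clinear T"
  by (rule clinear_adjointable[OF hmod_axioms hmod_axioms])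

lemma adm_ad: "adm T \<Longrightarrow> adm (ad T)" "adm T \<Longrightarrow> ad (ad T) = T"
  by (simp_all add: adjointable_adj adj_adj hmod_axioms)

lemma ip_ad: "adm T \<Longrightarrow> ip E (T x) y = ip E x (ad T y)"
  by (rule ip_adj)

lemma ip_ad_left: "adm T \<Longrightarrow> ip E (ad T x) y = ip E x (T y)"
  by (rule ip_adj_left) (simp_all add: hmod_axioms)

lemma adm_comp: "adm S \<Longrightarrow> adm T \<Longrightarrow> adm (\<lambda>x. S (T x))"
  and ad_comp: "adm S \<Longrightarrow> adm T \<Longrightarrow> ad (\<lambda>x. S (T x)) = (\<lambda>x. ad T (ad S x))"
  using adjointable_compose[OF hmod_axioms hmod_axioms, of T E S] by (simp_all add: o_def)

lemma adm_id: "adm (\<lambda>x. x)" and ad_id: "ad (\<lambda>x. x) = (\<lambda>x. x)"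
  by (rule adjointableI adj_eqI; simp)+

lemma adm_zero: "adm (\<lambda>x. 0)" and ad_zero: "ad (\<lambda>x. 0) = (\<lambda>x. 0)"
  by (rule adjointableI[where T'="\<lambda>x. 0"] adj_eqI; simp)+

lemma adm_add: assumes "adm S" "adm T"
  shows "adm (\<lambda>x. S x + T x)" "ad (\<lambda>x. S x + T x) = (\<lambda>x. ad S x + ad T x)"
  by (rule adjointableI[where T'="\<lambda>x. ad S x + ad T x"] adj_eqI;
      simp add: ip_ad assms ip_add_left ip_add_right)+

lemma adm_diff: assumes "adm S" "adm T"
  shows "adm (\<lambda>x. S x - T x)" "ad (\<lambda>x. S x - T x) = (\<lambda>x. ad S x - ad T x)"
  by (rule adjointableI[where T'="\<lambda>x. ad S x - ad T x"] adj_eqI;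
      simp add: ip_ad assms ip_diff_left ip_diff_right)+

lemma adm_minus: assumes "adm S"
  shows "adm (\<lambda>x. - S x)" "ad (\<lambda>x. - S x) = (\<lambda>x. - ad S x)"
  by (rule adjointableI[where T'="\<lambda>x. - ad S x"] adj_eqI;
      simp add: ip_ad assms ip_minus_left ip_minus_right)+

lemma adm_scaleC: assumes "adm S"
  shows "adm (\<lambda>x. c *\<^sub>C S x)" "ad (\<lambda>x. c *\<^sub>C S x) = (\<lambda>x. cnj c *\<^sub>C ad S x)"
  by (rule adjointableI[where T'="\<lambda>x. cnj c *\<^sub>C ad S x"] adj_eqI;
      simp add: ip_ad assms ip_scaleC_left ip_scaleC_right)+

lemma adm_scaleR: assumes "adm S"
  shows "adm (\<lambda>x. r *\<^sub>R S x)" "ad (\<lambda>x. r *\<^sub>R S x) = (\<lambda>x. r *\<^sub>R ad S x)"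
  by (rule adjointableI[where T'="\<lambda>x. r *\<^sub>R ad S x"] adj_eqI;
      simp add: ip_ad assms ip_scaleR_left ip_scaleR_right)+

lemma adm_act: "adm T \<Longrightarrow> T (act E x b) = act E (T x) b"
  by (rule adjointable_act[OF hmod_axioms])

definition sa :: "('e \<Rightarrow> 'e) \<Rightarrow> bool" where
  "sa T \<longleftrightarrow> (\<forall>x y. ip E (T x) y = ip E x (T y))"

lemma sa_adm: "sa T \<Longrightarrow> adm T" and sa_ad: "sa T \<Longrightarrow> ad T = T"
  by (auto simp: sa_def intro: adjointableI adj_eqI)

lemma saI: "adm T \<Longrightarrow> ad T = T \<Longrightarrow> sa T"
  by (simp add: sa_def ip_ad)

lemma sa_clinear: "sa T \<Longrightarrow> clinear T"
  by (simp add: adm_clinear sa_adm)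

lemma sa_linear: "sa T \<Longrightarrow> linear T"
  by (simp add: clinear_linear sa_clinear)

lemma sa_ip: "sa T \<Longrightarrow> ip E (T x) y = ip E x (T y)"
  by (simp add: sa_def)

lemma sa_id: "sa (\<lambda>x. x)" and sa_zero: "sa (\<lambda>x. 0)"
  by (simp_all add: sa_def)

lemma sa_add: "sa S \<Longrightarrow> sa T \<Longrightarrow> sa (\<lambda>x. S x + T x)"
  and sa_diff: "sa S \<Longrightarrow> sa T \<Longrightarrow> sa (\<lambda>x. S x - T x)"
  and sa_scaleR: "sa S \<Longrightarrow> sa (\<lambda>x. r *\<^sub>R S x)"
  by (simp_all add: sa_def ip_add_left ip_add_right ip_diff_left ip_diff_right ip_minus_left
      ip_minus_right ip_scaleR_left ip_scaleR_right)

lemma sa_comp_commute: "sa S \<Longrightarrow> sa T \<Longrightarrow> (\<And>x. S (T x) = T (S x)) \<Longrightarrow> sa (\<lambda>x. S (T x))"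
  by (simp add: sa_def)

lemma sa_sandwich: "adm X \<Longrightarrow> sa T \<Longrightarrow> sa (\<lambda>x. X (T (ad X x)))"
  by (simp add: sa_def ip_ad ip_ad_left)

lemma sa_square: "adm X \<Longrightarrow> sa (\<lambda>x. ad X (X x))"
  by (simp add: sa_def ip_ad ip_ad_left)

end

text \<open>
  Modules whose inner product satisfies the Cauchy--Schwarz inequality.  For \<open>B\<close> over itself this
  is immediate, and it is what the spectral theory needs; for all Hilbert modules it follows once
  the squares \<open>b\<^sup>*b\<close> are known to be positive.
\<close>

locale csmod = hmod +
  assumes cauchy_schwarz: "norm (ip E x y) \<le> norm x * norm y"

lemma csmod_self_module: "csmod (self_module :: ('b::cstar_algebra, 'b) hmodule)"
proof -
  interpret hmod "self_module :: ('b, 'b) hmodule" by (rule hmod_self_module)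
  show ?thesis
    by standard (metis norm_mult_ineq norm_star self_module_simps(2))
qed

context csmod
begin

lemma bounded_linear_ip_right: "bounded_linear (ip E x)"
  by (rule bounded_linear_intro[where K="norm x"])
    (auto simp: ip_add_right ip_scaleR_right mult.commute intro: order_trans[OF cauchy_schwarz])

lemma bounded_linear_ip_left: "bounded_linear (\<lambda>x. ip E x y)"
  by (rule bounded_linear_intro[where K="norm y"])
    (auto simp: ip_add_left ip_scaleR_left intro: order_trans[OF cauchy_schwarz])

lemma norm_le_ip:
  assumes "\<And>y. norm (ip E y x) \<le> c * norm y" "0 \<le> c"
  shows "norm x \<le> c"
proof (cases "x = 0")
  case False
  have "norm x * norm x \<le> c * norm x"
    using assms(1)[of x] by (simp add: norm_ip_self power2_eq_square)
  then show ?thesis using False by simp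
qed (simp add: assms)

text \<open>
  An operator with an adjoint is bounded: the functionals \<open>\<langle>T x | \<cdot>\<rangle>\<close> with \<open>\<parallel>x\<parallel> \<le> 1\<close> are
  bounded at \<open>y\<close> by \<open>\<parallel>T\<^sup>* y\<parallel>\<close>, hence uniformly.
\<close>

lemma adm_bounded:
  assumes "adm T"
  shows "bounded_linear T"
proof -
  have "\<exists>C\<ge>0. \<forall>x\<in>{x. norm x \<le> 1}. \<forall>y. norm (ip E (T x) y) \<le> C * norm y"
  proof (rule uniform_boundedness)
    show "bounded_linear (ip E (T x))" for x by (rule bounded_linear_ip_right)
    show "\<exists>C. \<forall>x\<in>{x. norm x \<le> 1}. norm (ip E (T x) y) \<le> C" for y
    proof (intro exI ballI)
      fix x :: 'a assume "x \<in> {x. norm x \<le> 1}"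
      then show "norm (ip E (T x) y) \<le> norm (ad T y)"
        using order_trans[OF cauchy_schwarz[of x "ad T y"]] mult_right_mono[of "norm x" 1 "norm (ad T y)"]
        by (simp add: ip_ad assms)
    qed
  qed
  then obtain C where C: "C \<ge> 0" "\<And>x y. norm x \<le> 1 \<Longrightarrow> norm (ip E (T x) y) \<le> C * norm y"
    by blast
  have lin: "linear T" by (rule clinear_linear[OF adm_clinear[OF assms]])
  have le: "norm (T x) \<le> C" if "norm x \<le> 1" for x
    by (rule norm_le_ip) (use C that star_ip norm_star in metis)+
  have "norm (T x) \<le> norm x * C" for x
  proof (cases "x = 0")
    case False
    have "norm (T ((1 / norm x) *\<^sub>R x)) \<le> C" using False by (intro le) simp
    then show ?thesis using False by (simp add: linear_scale[OF lin] field_simps)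
  qed (simp add: linear_0[OF lin])
  then show ?thesis
    using lin by (intro bounded_linear_intro[where K=C]) (auto simp: linear_add linear_scale)
qed

lemma sa_bounded: "sa T \<Longrightarrow> bounded_linear T"
  by (simp add: adm_bounded sa_adm)

lemma norm_square_le: "adm T \<Longrightarrow> (norm (T x))\<^sup>2 \<le> norm x * norm (ad T (T x))"
  by (metis cauchy_schwarz ip_ad norm_ip_self)

end

section \<open>Polynomials in an operator\<close>

lemma poly_op_eq_sum:
  assumes "degree p \<le> n"
  shows "poly_op p R x = (\<Sum>i\<le>n. coeff p i *\<^sub>R (R ^^ i) x)"
  unfolding poly_op_def
  by (rule sum.mono_neutral_left) (use assms in \<open>auto simp: coeff_eq_0\<close>)

lemma poly_op_0 [simp]: "poly_op 0 R x = 0"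
  by (simp add: poly_op_def)

lemma poly_op_pCons:
  assumes "linear R"
  shows "poly_op (pCons c p) R x = c *\<^sub>R x + R (poly_op p R x)"
proof -
  have "poly_op (pCons c p) R x = (\<Sum>i\<le>Suc (degree p). coeff (pCons c p) i *\<^sub>R (R ^^ i) x)"
    by (rule poly_op_eq_sum) (rule degree_pCons_le)
  also have "\<dots> = c *\<^sub>R x + (\<Sum>i\<le>degree p. coeff p i *\<^sub>R R ((R ^^ i) x))"
    unfolding sum.atMost_Suc_shift by simp
  also have "\<dots> = c *\<^sub>R x + R (poly_op p R x)"
    unfolding poly_op_def using assms by (simp add: linear_sum linear_scale)
  finally show ?thesis .
qed

lemma poly_op_add: "poly_op (p + q) R x = poly_op p R x + poly_op q R x"
proof -
  let ?n = "max (degree p) (degree q)"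
  show ?thesis
    using poly_op_eq_sum[of "p + q" ?n R x] poly_op_eq_sum[of p ?n R x] poly_op_eq_sum[of q ?n R x]
    by (simp add: degree_add_le sum.distrib scaleR_add_left)
qed

lemma poly_op_smult: "poly_op (smult c p) R x = c *\<^sub>R poly_op p R x"
  using poly_op_eq_sum[of "smult c p" "degree p"]
  by (simp add: poly_op_def degree_smult_le scaleR_sum_right)

lemma poly_op_minus: "poly_op (- p) R x = - poly_op p R x"
  using poly_op_smult[of "- 1" p R x] by simp

lemma poly_op_diff: "poly_op (p - q) R x = poly_op p R x - poly_op q R x"
  using poly_op_add[of p "- q"] by (simp add: poly_op_minus)

lemma poly_op_linear:
  assumes "linear R"
  shows "linear (poly_op p R)"
proof (induction p)
  case 0
  then show ?case by (auto intro: linearI)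
next
  case (pCons c p)
  then show ?case
    using assms by (auto intro!: linearI simp: poly_op_pCons linear_add linear_scale algebra_simps)
qed

lemma poly_op_commute:
  assumes "linear R" "linear B" "\<And>x. B (R x) = R (B x)"
  shows "B (poly_op p R x) = poly_op p R (B x)"
  by (induction p) (use assms in \<open>auto simp: poly_op_pCons linear_add linear_scale linear_0\<close>)

lemma poly_op_mult:
  assumes "linear R"
  shows "poly_op (p * q) R x = poly_op p R (poly_op q R x)"
proof (induction p)
  case (pCons c p)
  have "poly_op (pCons c p * q) R x = c *\<^sub>R poly_op q R x + poly_op (pCons 0 (p * q)) R x"
    by (simp add: poly_op_add poly_op_smult)
  then show ?case using assms pCons by (simp add: poly_op_pCons)
qed simp

lemma poly_op_1 [simp]: "poly_op 1 R x = x"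
  by (simp add: poly_op_def)

lemma poly_op_X: "linear R \<Longrightarrow> poly_op [:0, 1:] R x = R x"
  by (simp add: poly_op_pCons linear_0)

lemma poly_op_const: "poly_op [:c:] R x = c *\<^sub>R x"
  by (simp add: poly_op_def)

lemma poly_op_pcompose:
  assumes "linear R"
  shows "poly_op (pcompose p q) R x = poly_op p (poly_op q R) x"
proof -
  note l = poly_op_linear[OF assms, of q]
  show ?thesis
    by (induction p)
      (use assms l in \<open>auto simp: pcompose_pCons poly_op_add poly_op_mult poly_op_pCons linear_0\<close>)
qed

lemma poly_op_power:
  assumes "linear R"
  shows "poly_op (p ^ n) R = (poly_op p R) ^^ n"
  by (induction n) (use assms in \<open>auto simp: poly_op_mult fun_eq_iff\<close>)

lemma funpow_contraction:
  fixes A :: "'a::real_normed_vector \<Rightarrow> 'a"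
  assumes "\<And>x. norm (A x) \<le> norm x"
  shows "norm ((A ^^ n) x) \<le> norm x"
proof (induction n)
  case (Suc n)
  then show ?case using assms[of "(A ^^ n) x"] by simp
qed simp

text \<open>
  For nonnegative coefficients the triangle inequality suffices, so that this bound holds for every
  contraction.
\<close>

lemma norm_poly_op_nonneg:
  assumes A: "\<And>x. norm (A x) \<le> norm x" and p: "\<And>i. 0 \<le> coeff p i"
  shows "norm (poly_op p A x) \<le> poly p 1 * norm x"
proof -
  have "norm (poly_op p A x) \<le> (\<Sum>i\<le>degree p. coeff p i * norm x)"
    unfolding poly_op_def
    by (rule sum_norm_le) (use p funpow_contraction[of A, OF A] in \<open>auto intro: mult_left_mono\<close>)
  then show ?thesis by (simp add: poly_altdef sum_distrib_right)
qed


section \<open>The binomial series of the square root\<close>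

text \<open>
  The central binomial numbers \<open>d\<^sub>n = binom(2n, n) / 4\<^sup>n\<close>.  They are the partial sums at \<open>x = 1\<close> of
  the binomial series of \<open>sqrt (1 - x)\<close>.
\<close>

primrec sqd :: "nat \<Rightarrow> real" where
  "sqd 0 = 1"
| "sqd (Suc n) = sqd n * (2 * real n + 1) / (2 * real n + 2)"

text \<open>
  The coefficients of the binomial series of \<open>sqrt (1 - x)\<close>.  Written as differences of the
  decreasing numbers \<open>d\<^sub>n\<close>, they are visibly nonpositive except for the first one.
\<close>

definition sqa :: "nat \<Rightarrow> real" where
  "sqa n = (if n = 0 then 1 else sqd n - sqd (n - 1))"

definition sqpoly :: "nat \<Rightarrow> real poly" where
  "sqpoly N = (\<Sum>n\<le>N. monom (sqa n) n)"

lemma sqd_pos: "0 < sqd n"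
  by (induction n) auto

lemma sqd_Suc_le: "sqd (Suc n) \<le> sqd n"
  using sqd_pos[of n] by (simp add: divide_le_eq mult_left_mono)

lemma sqd_antimono: "m \<le> n \<Longrightarrow> sqd n \<le> sqd m"
  by (rule lift_Suc_antimono_le[of sqd]) (simp_all add: sqd_Suc_le del: sqd.simps)

lemma sqd_le_1: "sqd n \<le> 1"
  using sqd_antimono[of 0 n] by simp

lemma sqd_square_le: "(sqd n)\<^sup>2 * (2 * real n + 1) \<le> 1"
proof (induction n)
  case (Suc n)
  have "(sqd (Suc n))\<^sup>2 * (2 * real (Suc n) + 1)
      = ((sqd n)\<^sup>2 * (2 * real n + 1)) * ((2 * real n + 1) * (2 * real n + 3) / (2 * real n + 2)\<^sup>2)"
    by (simp add: power2_eq_square field_simps)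
  also have "\<dots> \<le> 1 * 1"
  proof (rule mult_mono[OF Suc])
    have "(2 * real n + 1) * (2 * real n + 3) \<le> (2 * real n + 2)\<^sup>2"
      by (simp add: power2_eq_square algebra_simps)
    then show "(2 * real n + 1) * (2 * real n + 3) / (2 * real n + 2)\<^sup>2 \<le> 1"
      by (simp add: divide_le_eq_1_pos)
  qed auto
  finally show ?case by simp
qed simp

lemma sqd_le: "sqd n \<le> 1 / sqrt (2 * real n + 1)"
proof -
  have "(sqd n)\<^sup>2 \<le> 1 / (2 * real n + 1)"
    using sqd_square_le[of n] by (simp add: field_simps)
  then have "sqrt ((sqd n)\<^sup>2) \<le> sqrt (1 / (2 * real n + 1))" by (rule real_sqrt_le_mono)
  then show ?thesis using sqd_pos[of n] by (simp add: real_sqrt_divide)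
qed

lemma sqd_tendsto_0: "sqd \<longlonglongrightarrow> 0"
proof (rule tendsto_sandwich[of "\<lambda>_. 0"])
  show "(\<lambda>n. 1 / sqrt (2 * real n + 1)) \<longlonglongrightarrow> 0" by real_asymp
qed (use sqd_le sqd_pos[THEN less_imp_le] in auto)

lemma sqa_nonpos: "n \<noteq> 0 \<Longrightarrow> sqa n \<le> 0"
  using sqd_Suc_le[of "n - 1"] by (simp add: sqa_def del: sqd.simps)

lemma sum_sqa: "(\<Sum>n\<le>N. sqa n) = sqd N"
  by (induction N) (auto simp: sqa_def simp del: sqd.simps(2))

lemma sqa_gbinomial: "sqa n = (- 1) ^ n * ((1/2) gchoose n)"
proof (cases n)
  case (Suc m)
  have 1: "sqa (Suc m) = - sqd m / (2 * real m + 2)"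
    by (simp add: sqa_def field_simps)
  have 2: "(- 1) ^ Suc m * ((1/2) gchoose Suc m) = - sqd m / (2 * real m + 2)"
  proof (induction m)
    case (Suc m)
    have *: "((1/2::real) gchoose Suc (Suc m)) = ((1/2) gchoose Suc m) * (1/2 - real (Suc m)) / real (Suc (Suc m))"
      using gbinomial_mult_1[of "1/2::real" "Suc m"] by (simp add: field_simps)
    have "(- 1) ^ Suc (Suc m) * ((1/2) gchoose Suc (Suc m))
        = ((- 1) ^ Suc m * ((1/2) gchoose Suc m)) * (real (Suc m) - 1/2) / real (Suc (Suc m))"
    proof -
      have "(- 1) * s * (g * (1/2 - a) / b) = s * g * (a - 1/2) / b" for s g a b :: real
        by (simp add: algebra_simps diff_divide_distrib)
      from this[of "(- 1) ^ Suc m"] show ?thesis unfolding * by (simp only: power_Suc)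
    qed
    also have "\<dots> = - sqd (Suc m) / (2 * real (Suc m) + 2)"
      unfolding Suc by (simp add: field_simps)
    finally show ?case .
  qed (simp add: field_simps)
  show ?thesis using 1 2 Suc by simp
qed (simp add: sqa_def)

text \<open>The square of the series is \<open>1 - x\<close>.\<close>

lemma sqa_convolution:
  "(\<Sum>i\<le>n. sqa i * sqa (n - i)) = (if n = 0 then 1 else if n = 1 then - 1 else 0)"
proof -
  have "(\<Sum>i\<le>n. sqa i * sqa (n - i)) = (\<Sum>i\<le>n. (- 1) ^ n * (((1/2) gchoose i) * ((1/2) gchoose (n - i))))"
  proof (rule sum.cong)
    fix i assume "i \<in> {..n}"
    then have "(- 1 :: real) ^ i * (- 1) ^ (n - i) = (- 1) ^ n"
      by (simp add: power_add[symmetric])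
    then show "sqa i * sqa (n - i) = (- 1) ^ n * (((1/2) gchoose i) * ((1/2) gchoose (n - i)))"
      unfolding sqa_gbinomial by (metis mult.assoc mult.left_commute)
  qed simp
  also have "\<dots> = (- 1) ^ n * ((1::real) gchoose n)"
    using gbinomial_Vandermonde[of "1/2::real" "1/2" n]
    by (simp only: sum_distrib_left[symmetric] atMost_atLeast0) simp
  also have "(1::real) gchoose n = of_nat (1 choose n)"
    using binomial_gbinomial[of 1 n, where ?'a=real] by simp
  finally show ?thesis
  proof (cases "n \<le> 1")
    case True
    then have "n = 0 \<or> n = 1" by auto
    then show ?thesis using \<open>(\<Sum>i\<le>n. sqa i * sqa (n - i)) = _\<close> by auto
  qed (simp add: binomial_eq_0)
qed

lemma coeff_sqpoly: "coeff (sqpoly N) n = (if n \<le> N then sqa n else 0)"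
  by (simp add: sqpoly_def coeff_sum coeff_monom)

lemma poly_sqpoly_1: "poly (sqpoly N) 1 = sqd N"
  by (simp add: sqpoly_def poly_sum poly_monom sum_sqa)

text \<open>
  All the coefficients of \<open>(sqpoly N)\<^sup>2\<close> beyond those of \<open>1 - x\<close> are products of two nonpositive
  numbers.  So the error is controlled by its value at \<open>1\<close>, which is \<open>d\<^sub>N\<^sup>2\<close>.
\<close>

lemma coeff_sqpoly_square:
  assumes "1 \<le> N"
  shows "0 \<le> coeff (sqpoly N * sqpoly N - [:1, - 1:]) n"
proof (cases "n \<le> N")
  case True
  have "coeff (sqpoly N * sqpoly N) n = (\<Sum>i\<le>n. sqa i * sqa (n - i))"
    unfolding coeff_mult using True by (intro sum.cong) (auto simp: coeff_sqpoly)
  then show ?thesis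
    by (auto simp: sqa_convolution coeff_pCons split: nat.splits)
next
  case False
  then have "coeff [:1, - 1::real:] n = 0"
    using assms by (intro coeff_eq_0) simp
  moreover have "0 \<le> coeff (sqpoly N * sqpoly N) n"
    unfolding coeff_mult
  proof (rule sum_nonneg)
    fix i assume "i \<in> {..n}"
    show "0 \<le> coeff (sqpoly N) i * coeff (sqpoly N) (n - i)"
    proof (cases "i \<le> N \<and> n - i \<le> N")
      case True
      then have "sqa i \<le> 0" "sqa (n - i) \<le> 0" using False by (auto intro: sqa_nonpos)
      then show ?thesis using True by (simp add: coeff_sqpoly mult_nonpos_nonpos)
    qed (auto simp: coeff_sqpoly)
  qed
  ultimately show ?thesis by (simp only: coeff_diff)
qed

lemma poly_nonneg_coeff_bounds:
  fixes p :: "real poly"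
  assumes "\<And>i. 0 \<le> coeff p i" "0 \<le> x" "x \<le> 1"
  shows "0 \<le> poly p x" "poly p x \<le> poly p 1"
  using assms
  by (auto simp: poly_altdef intro!: sum_nonneg sum_mono mult_left_le power_le_one)

text \<open>
  The partial sum \<open>s\<close> is at least \<open>d\<^sub>N\<close> on \<open>[0, 1]\<close>.  Dividing the error \<open>d\<^sub>N\<^sup>2\<close> of \<open>s\<^sup>2\<close> by the sum of
  \<open>s\<close> and the root therefore leaves an error of at most \<open>d\<^sub>N\<close>.
\<close>

lemma sqpoly_bounds:
  assumes "1 \<le> N" "0 \<le> x" "x \<le> 1"
  shows "sqrt (1 - x) \<le> poly (sqpoly N) x" "poly (sqpoly N) x \<le> 1"
    "poly (sqpoly N) x - sqrt (1 - x) \<le> sqd N"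
proof -
  let ?s = "poly (sqpoly N) x"
  let ?p = "1 - sqpoly N"
  have c: "0 \<le> coeff ?p i" for i
    using sqa_nonpos[of i] by (auto simp: coeff_sqpoly sqa_def[of 0])
  have "0 \<le> poly ?p x" "poly ?p x \<le> poly ?p 1"
    by (rule poly_nonneg_coeff_bounds[OF c assms(2,3)])+
  then have sN: "sqd N \<le> ?s" and s1: "?s \<le> 1"
    by (auto simp: poly_sqpoly_1)
  show "?s \<le> 1" by (rule s1)
  let ?e = "sqpoly N * sqpoly N - [:1, - 1:]"
  have "0 \<le> poly ?e x" "poly ?e x \<le> poly ?e 1"
    by (rule poly_nonneg_coeff_bounds[OF coeff_sqpoly_square[OF assms(1)] assms(2,3)])+
  then have e: "1 - x \<le> ?s * ?s" "?s * ?s - (1 - x) \<le> sqd N * sqd N"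
    by (auto simp: poly_sqpoly_1)
  have s0: "0 < ?s" using sN sqd_pos[of N] by linarith
  show *: "sqrt (1 - x) \<le> ?s"
    using e(1) s0 by (intro real_le_lsqrt) (auto simp: power2_eq_square)
  have "(?s - sqrt (1 - x)) * sqd N \<le> (?s - sqrt (1 - x)) * (?s + sqrt (1 - x))"
    using sN * assms real_sqrt_ge_zero[of "1 - x"] by (intro mult_left_mono) linarith+
  also have "\<dots> = ?s * ?s - (1 - x)"
    using assms by (simp add: algebra_simps)
  also have "\<dots> \<le> sqd N * sqd N" by (rule e)
  finally show "?s - sqrt (1 - x) \<le> sqd N"
    using sqd_pos[of N] by simp
qed

text \<open>\<open>csq A\<close> is \<open>sqrt (1 - A)\<close>, for a self-adjoint contraction \<open>A\<close>.\<close>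

definition csq :: "('e::complex_banach \<Rightarrow> 'e) \<Rightarrow> 'e \<Rightarrow> 'e" where
  "csq A x = lim (\<lambda>N. poly_op (sqpoly N) A x)"

lemma norm_sqpoly_diff:
  assumes A: "\<And>x. norm (A x) \<le> norm x" and "K \<le> N"
  shows "norm (poly_op (sqpoly K) A x - poly_op (sqpoly N) A x) \<le> (sqd K - sqd N) * norm x"
proof -
  have "0 \<le> coeff (sqpoly K - sqpoly N) i" for i
    using assms(2) sqa_nonpos[of i] by (auto simp: coeff_sqpoly)
  from norm_poly_op_nonneg[of A, OF A this, of x] show ?thesis
    by (simp add: poly_sqpoly_1 poly_op_diff)
qed

lemma csq_LIMSEQ:
  assumes A: "\<And>x. norm (A x) \<le> norm (x::'e::complex_banach)"
  shows "(\<lambda>N. poly_op (sqpoly N) A x) \<longlonglongrightarrow> csq A x"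
    and "norm (poly_op (sqpoly N) A x - csq A x) \<le> sqd N * norm x"
proof -
  let ?s = "\<lambda>N. poly_op (sqpoly N) A x"
  have d: "norm (?s K - ?s N) \<le> sqd K * norm x" if "K \<le> N" for K N
  proof -
    have "0 \<le> sqd N * norm x" using sqd_pos[of N] by simp
    then show ?thesis
      using norm_sqpoly_diff[of A, OF A that, of x] unfolding left_diff_distrib by linarith
  qed
  have z: "(\<lambda>N. sqd N * norm x) \<longlonglongrightarrow> 0"
    using tendsto_mult_right[OF sqd_tendsto_0, of "norm x"] by simp
  have "Cauchy ?s"
  proof (rule CauchyI')
    fix e :: real assume "0 < e"
    then obtain M where M: "\<And>m. M \<le> m \<Longrightarrow> sqd m * norm x < e"
      using order_tendstoD(2)[OF z] by (auto simp: eventually_sequentially)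
    show "\<exists>M. \<forall>m\<ge>M. \<forall>n>m. dist (?s m) (?s n) < e"
    proof (intro exI[of _ M] allI impI)
      fix m n assume "M \<le> m" "m < n"
      then show "dist (?s m) (?s n) < e" using d[of m n] M[of m] by (simp add: dist_norm)
    qed
  qed
  then show l: "?s \<longlonglongrightarrow> csq A x"
    unfolding csq_def by (simp add: Cauchy_convergent convergent_LIMSEQ_iff[symmetric])
  have "(\<lambda>n. norm (?s N - ?s n)) \<longlonglongrightarrow> norm (?s N - csq A x)"
    by (intro tendsto_intros l)
  then show "norm (?s N - csq A x) \<le> sqd N * norm x"
    by (rule LIMSEQ_le_const2) (use d in auto)
qed

context csmod
begin

lemma sa_poly_op: "sa A \<Longrightarrow> sa (poly_op p A)"
proof (induction p)
  case 0
  then show ?case by (simp add: sa_def)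
next
  case (pCons c p)
  have A: "sa A" and p: "sa (poly_op p A)" using pCons by auto
  have c: "\<And>x. A (poly_op p A x) = poly_op p A (A x)"
    by (rule poly_op_commute) (simp_all add: sa_linear A)
  have "sa (\<lambda>x. c *\<^sub>R x + A (poly_op p A x))"
    by (rule sa_add[OF sa_scaleR[OF sa_id] sa_comp_commute[OF A p c]])
  moreover have "poly_op (pCons c p) A = (\<lambda>x. c *\<^sub>R x + A (poly_op p A x))"
    by (rule ext) (simp add: poly_op_pCons sa_linear pCons.prems)
  ultimately show ?case by simp
qed

lemma sa_lim:
  assumes "\<And>n. sa (S n)" "\<And>x. (\<lambda>n. S n x) \<longlonglongrightarrow> T x"
  shows "sa T"
  unfolding sa_def
proof (intro allI)
  fix x y
  have "(\<lambda>n. ip E (S n x) y) \<longlonglongrightarrow> ip E (T x) y"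
    by (rule bounded_linear.tendsto[OF bounded_linear_ip_left assms(2)])
  moreover have "(\<lambda>n. ip E x (S n y)) \<longlonglongrightarrow> ip E x (T y)"
    by (rule bounded_linear.tendsto[OF bounded_linear_ip_right assms(2)])
  moreover have "ip E (S n x) y = ip E x (S n y)" for n
    using assms(1) by (rule sa_ip)
  ultimately show "ip E (T x) y = ip E x (T y)"
    using LIMSEQ_unique by simp
qed

lemma sa_csq:
  assumes "sa A" "\<And>x. norm (A x) \<le> norm x"
  shows "sa (csq A)"
  by (rule sa_lim[OF sa_poly_op[OF assms(1)] csq_LIMSEQ(1)[of A, OF assms(2)]])

lemma csq_commute:
  assumes A: "sa A" "\<And>x. norm (A x) \<le> norm x"
    and B: "bounded_linear B" "\<And>x. B (A x) = A (B x)"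
  shows "B (csq A x) = csq A (B x)"
proof -
  note l = csq_LIMSEQ(1)[of A, OF A(2)]
  have "B (poly_op (sqpoly N) A x) = poly_op (sqpoly N) A (B x)" for N
    by (rule poly_op_commute[OF sa_linear[OF A(1)] bounded_linear.linear[OF B(1)] B(2)])
  then have "(\<lambda>N. B (poly_op (sqpoly N) A x)) \<longlonglongrightarrow> csq A (B x)"
    using l[of "B x"] by simp
  moreover have "(\<lambda>N. B (poly_op (sqpoly N) A x)) \<longlonglongrightarrow> B (csq A x)"
    by (rule bounded_linear.tendsto[OF B(1) l])
  ultimately show ?thesis using LIMSEQ_unique by blast
qed

text \<open>The series of \<open>1 - sqrt (1 - x)\<close> has nonnegative coefficients with sum \<open>1\<close>.\<close>

lemma norm_diff_csq:
  assumes A: "\<And>x. norm (A x) \<le> norm x"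
  shows "norm (x - csq A x) \<le> norm x"
proof -
  have "norm (x - poly_op (sqpoly N) A x) \<le> norm x" for N
  proof -
    have "0 \<le> coeff (1 - sqpoly N) i" for i
      using sqa_nonpos[of i] by (auto simp: coeff_sqpoly sqa_def[of 0])
    from norm_poly_op_nonneg[of A, OF A this, of x]
    have "norm (x - poly_op (sqpoly N) A x) \<le> (1 - sqd N) * norm x"
      by (simp add: poly_sqpoly_1 poly_op_diff)
    also have "\<dots> \<le> 1 * norm x" using sqd_pos[of N] by (intro mult_right_mono) auto
    finally show ?thesis by simp
  qed
  moreover have "(\<lambda>N. norm (x - poly_op (sqpoly N) A x)) \<longlonglongrightarrow> norm (x - csq A x)"
    by (intro tendsto_intros csq_LIMSEQ(1)[of A, OF A])
  ultimately show ?thesis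
    by (intro LIMSEQ_le_const2) auto
qed

lemma csq_csq:
  assumes A: "sa A" "\<And>x. norm (A x) \<le> norm x"
  shows "csq A (csq A x) = x - A x"
proof -
  note l = csq_LIMSEQ[of A, OF A(2)]
  note lA = sa_linear[OF A(1)]
  note sa = sa_csq[of A, OF A]
  let ?s = "\<lambda>N. poly_op (sqpoly N) A"
  have "(\<lambda>N. ?s N (?s N x)) \<longlonglongrightarrow> csq A (csq A x)"
  proof (rule LIM_zero_cancel, rule Lim_null_comparison)
    let ?b = "\<lambda>N. sqd N * (norm x * 3) + norm (csq A (?s N x) - csq A (csq A x))"
    show "eventually (\<lambda>N. norm (?s N (?s N x) - csq A (csq A x)) \<le> ?b N) sequentially"
    proof (rule always_eventually, rule allI)
      fix N
      have "norm (?s N x) \<le> norm (csq A x) + sqd N * norm x"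
        using l(2)[of N x] norm_triangle_sub[of "?s N x" "csq A x"] by linarith
      have "norm (csq A x) \<le> norm x * 2"
        using norm_diff_csq[of A x, OF A(2)] norm_triangle_sub[of "csq A x" x]
        by (simp add: norm_minus_commute)
      moreover have "sqd N * norm x \<le> 1 * norm x" by (intro mult_right_mono sqd_le_1) simp
      ultimately have "norm (?s N x) \<le> norm x * 3"
        using \<open>norm (?s N x) \<le> norm (csq A x) + sqd N * norm x\<close> by simp
      then have "norm (?s N (?s N x) - csq A (?s N x)) \<le> sqd N * (norm x * 3)"
        using l(2)[of N "?s N x"] mult_left_mono[of "norm (?s N x)" "norm x * 3" "sqd N"] sqd_pos[of N]
        by linarith
      then show "norm (?s N (?s N x) - csq A (csq A x)) \<le> ?b N"
        using norm_triangle_ineq[of "?s N (?s N x) - csq A (?s N x)" "csq A (?s N x) - csq A (csq A x)"]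
        by simp
    qed
    have "(\<lambda>N. csq A (?s N x)) \<longlonglongrightarrow> csq A (csq A x)"
      by (rule bounded_linear.tendsto[OF sa_bounded[OF sa] l(1)])
    then have "?b \<longlonglongrightarrow> 0 * (norm x * 3) + norm (csq A (csq A x) - csq A (csq A x))"
      by (intro tendsto_intros sqd_tendsto_0)
    then show "?b \<longlonglongrightarrow> 0" by simp
  qed
  moreover have "(\<lambda>N. ?s N (?s N x)) \<longlonglongrightarrow> x - A x"
  proof (rule LIM_zero_cancel, rule Lim_null_comparison)
    let ?b = "\<lambda>N. sqd N * sqd N * norm x"
    show "eventually (\<lambda>N. norm (?s N (?s N x) - (x - A x)) \<le> ?b N) sequentially"
      unfolding eventually_sequentially
    proof (intro exI[of _ 1] allI impI)
      fix N :: nat assume N: "1 \<le> N"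
      from norm_poly_op_nonneg[of A, OF A(2) coeff_sqpoly_square[OF N], of x]
      show "norm (?s N (?s N x) - (x - A x)) \<le> ?b N"
        by (simp add: poly_op_diff poly_op_mult[OF lA] poly_op_pCons[OF lA] poly_sqpoly_1 linear_0[OF lA]
            linear_neg[OF lA])
    qed
    have "?b \<longlonglongrightarrow> 0 * 0 * norm x" by (intro tendsto_intros sqd_tendsto_0)
    then show "?b \<longlonglongrightarrow> 0" by simp
  qed
  ultimately show ?thesis using LIMSEQ_unique by blast
qed

end

section \<open>The spectral bound for self-adjoint contractions\<close>

definition cpoly_op :: "complex poly \<Rightarrow> ('e::complex_banach \<Rightarrow> 'e) \<Rightarrow> 'e \<Rightarrow> 'e" where
  "cpoly_op p U x = (\<Sum>i\<le>degree p. coeff p i *\<^sub>C (U ^^ i) x)"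

lemma cpoly_op_eq_sum:
  assumes "degree p \<le> n"
  shows "cpoly_op p U x = (\<Sum>i\<le>n. coeff p i *\<^sub>C (U ^^ i) x)"
  unfolding cpoly_op_def
  by (rule sum.mono_neutral_left) (use assms in \<open>auto simp: coeff_eq_0\<close>)

lemma cpoly_op_pCons:
  assumes "clinear U"
  shows "cpoly_op (pCons c p) U x = c *\<^sub>C x + U (cpoly_op p U x)"
proof -
  have "cpoly_op (pCons c p) U x = (\<Sum>i\<le>Suc (degree p). coeff (pCons c p) i *\<^sub>C (U ^^ i) x)"
    by (rule cpoly_op_eq_sum) (rule degree_pCons_le)
  also have "\<dots> = c *\<^sub>C x + (\<Sum>i\<le>degree p. coeff p i *\<^sub>C U ((U ^^ i) x))"
    unfolding sum.atMost_Suc_shift by simp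
  also have "\<dots> = c *\<^sub>C x + U (cpoly_op p U x)"
    unfolding cpoly_op_def using assms by (simp add: clinear_sum clinear_scaleC)
  finally show ?thesis .
qed

lemma cpoly_op_add: "cpoly_op (p + q) U x = cpoly_op p U x + cpoly_op q U x"
proof -
  let ?n = "max (degree p) (degree q)"
  show ?thesis
    using cpoly_op_eq_sum[of "p + q" ?n U x] cpoly_op_eq_sum[of p ?n U x] cpoly_op_eq_sum[of q ?n U x]
    by (simp add: degree_add_le sum.distrib scaleC_add_left)
qed

lemma cpoly_op_smult: "cpoly_op (smult c p) U x = c *\<^sub>C cpoly_op p U x"
  using cpoly_op_eq_sum[of "smult c p" "degree p"]
  by (simp add: cpoly_op_def degree_smult_le scaleC_sum_right scaleC_scaleC)

lemma cpoly_op_monom: "cpoly_op (monom c n) U x = c *\<^sub>C (U ^^ n) x"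
proof -
  have "cpoly_op (monom c n) U x = (\<Sum>i\<le>n. coeff (monom c n) i *\<^sub>C (U ^^ i) x)"
    by (rule cpoly_op_eq_sum) (rule degree_monom_le)
  also have "\<dots> = (\<Sum>i\<le>n. if i = n then c *\<^sub>C (U ^^ n) x else 0)"
    by (rule sum.cong) (auto simp: coeff_monom)
  finally show ?thesis by simp
qed

text \<open>Cauchy's inequality for the coefficients of a polynomial on the unit circle.\<close>

lemma norm_coeff_le:
  fixes P :: "complex poly"
  assumes "\<And>t. norm (poly P (cis t)) \<le> s"
  shows "norm (coeff P n) \<le> s"
proof -
  have d: "(deriv ^^ n) (poly P) = poly ((pderiv ^^ n) P)"
  proof (induction n)
    case (Suc n)
    show ?case
      unfolding funpow.simps o_def Suc
      by (rule ext) (rule DERIV_imp_deriv, rule poly_DERIV)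
  qed simp
  have "norm ((deriv ^^ n) (poly P) 0) \<le> fact n * s / 1 ^ n"
  proof (rule Cauchy_inequality)
    fix x :: complex assume "norm (0 - x) = 1"
    then have "x = cis (Arg x)" by (metis norm_minus_cancel diff_0 cis_Arg_unique cis_Arg
        complex_norm_eq_1_exp norm_zero zero_neq_one sgn_eq div_by_1 of_real_1)
    then show "norm (poly P x) \<le> s" using assms by metis
  qed (auto intro: holomorphic_intros continuous_intros)
  moreover have "(deriv ^^ n) (poly P) 0 = fact n * coeff P n"
    unfolding d by (simp add: poly_0_coeff_0 coeff_higher_pderiv pochhammer_fact)
  ultimately show ?thesis by (simp add: norm_mult)
qed

context csmod
begin

text \<open>
  For a self-adjoint contraction \<open>T\<close>, the operator \<open>U = T + i sqrt (1 - T\<^sup>2)\<close> is unitary with real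
  part \<open>T\<close>.  If \<open>p\<close> has degree at most \<open>d\<close>, then \<open>z\<^sup>d p ((z + 1/z) / 2)\<close> is a polynomial of degree
  at most \<open>2 d\<close>.  Its coefficients are bounded by the supremum of \<open>p\<close>, so the norm of \<open>p(T)\<close>
  exceeds the supremum at most by the factor \<open>2 d + 1\<close>.
\<close>

lemma norm_poly_op_le_degree:
  assumes T: "sa T" "\<And>u. norm (T u) \<le> norm u"
    and p: "\<And>x. \<bar>x\<bar> \<le> 1 \<Longrightarrow> \<bar>poly p x\<bar> \<le> s"
  shows "norm (poly_op p T u) \<le> (2 * real (degree p) + 1) * s * norm u"
proof -
  define A where "A = (\<lambda>x. T (T x))"
  define S where "S = csq A"
  define U where "U = (\<lambda>x. T x + \<i> *\<^sub>C S x)"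
  have lT: "clinear T" by (rule sa_clinear[OF T(1)])
  have A: "sa A" "\<And>x. norm (A x) \<le> norm x"
    using sa_comp_commute[OF T(1) T(1)] order_trans[OF T(2) T(2)] by (auto simp: A_def)
  have S: "sa S" unfolding S_def by (rule sa_csq[OF A])
  have lS: "clinear S" by (rule sa_clinear[OF S])
  have TS: "T (S x) = S (T x)" for x
    unfolding S_def by (rule csq_commute[OF A sa_bounded[OF T(1)]]) (simp add: A_def)
  have SS: "S (S x) = x - T (T x)" for x
    unfolding S_def by (subst csq_csq[OF A]) (simp_all add: A_def)
  have lU: "clinear U"
    unfolding U_def clinear_def
    by (simp add: clinear_add[OF lT] clinear_add[OF lS] clinear_scaleC[OF lT] clinear_scaleC[OF lS]
        scaleC_add_right scaleC_scaleC mult.commute)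
  have iso: "norm (U x) = norm x" for x
  proof -
    have "ip E (T x) (S x) = ip E (S x) (T x)"
      by (simp add: sa_ip[OF T(1)] sa_ip[OF S] TS)
    from ip_self_pm(1)[OF this] have "ip E (U x) (U x) = ip E x x"
      by (simp add: U_def sa_ip[OF T(1)] sa_ip[OF S] SS ip_diff_right)
    then show ?thesis by (metis norm_ip_self norm_ge_zero power2_eq_imp_eq)
  qed
  have isoU: "norm ((U ^^ n) x) = norm x" for n x
    by (induction n) (auto simp: iso)
  \<comment> \<open>This is \<open>T = (U + U\<^sup>-\<^sup>1) / 2\<close>, multiplied by \<open>U\<close>.\<close>
  have UT: "U (T x) = (1/2) *\<^sub>C (x + U (U x))" for x
  proof -
    have two: "2 *\<^sub>C y = y + y" for y :: 'a
      using scaleC_add_left[of 1 1 y] by simp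
    have two': "(2 * c) *\<^sub>C y = c *\<^sub>C y + c *\<^sub>C y" for c and y :: 'a
      by (simp only: mult_2 scaleC_add_left)
    have "x + U (U x) = 2 *\<^sub>C U (T x)"
      by (simp add: U_def clinear_add[OF lT] clinear_add[OF lS] clinear_scaleC[OF lT]
          clinear_scaleC[OF lS] scaleC_add_right scaleC_scaleC SS TS scaleC_diff_right
          two two')
    then show ?thesis by (simp add: scaleC_scaleC)
  qed
  have "\<exists>P. degree P \<le> 2 * d \<and> (\<forall>t. poly P (cis t) = cis t ^ d * complex_of_real (poly p (cos t)))
      \<and> (\<forall>u. cpoly_op P U u = (U ^^ d) (poly_op p T u))" if "degree p \<le> d" for d p
    using that
  proof (induction d arbitrary: p)
    case 0
    then obtain c where p: "p = [:c:]" by (metis degree_eq_zeroE le_zero_eq)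
    then show ?case
      by (intro exI[of _ "[:complex_of_real c:]"])
        (auto simp: cpoly_op_def poly_op_const scaleR_scaleC)
  next
    case (Suc d)
    obtain c q where p: "p = pCons c q" by (cases p)
    with Suc.prems have "degree q \<le> d" by (cases "q = 0") auto
    from Suc.IH[OF this] obtain Q where Q: "degree Q \<le> 2 * d"
      "\<And>t. poly Q (cis t) = cis t ^ d * complex_of_real (poly q (cos t))"
      "\<And>u. cpoly_op Q U u = (U ^^ d) (poly_op q T u)" by blast
    define P where "P = monom (complex_of_real c) (Suc d) + smult (1/2) (Q + pCons 0 (pCons 0 Q))"
    have "degree (pCons 0 (pCons 0 Q)) \<le> 2 * Suc d"
      using Q(1) by (auto simp: degree_pCons_eq_if)
    then have "degree P \<le> 2 * Suc d"
      unfolding P_def using Q(1) degree_monom_le[of "complex_of_real c" "Suc d"]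
      by (intro degree_add_le order_trans[OF degree_smult_le]) auto
    moreover have "poly P (cis t) = cis t ^ Suc d * complex_of_real (poly p (cos t))" for t
    proof -
      have c2: "1 + cis t * cis t = 2 * cis t * complex_of_real (cos t)"
        using sin_cos_squared_add[of t]
        by (auto simp: complex_eq_iff power2_eq_square algebra_simps)
      have "poly P (cis t) = cis t ^ Suc d * complex_of_real c
          + (1 + cis t * cis t) / 2 * poly Q (cis t)"
        by (simp add: P_def poly_monom algebra_simps)
      also have "\<dots> = cis t ^ Suc d * complex_of_real (poly p (cos t))"
        unfolding c2 Q(2) p by (simp add: algebra_simps)
      finally show ?thesis .
    qed
    moreover have "cpoly_op P U u = (U ^^ Suc d) (poly_op p T u)" for u
    proof -
      let ?w = "poly_op q T u"
      have fU: "clinear (U ^^ n)" for n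
        by (induction n) (use lU in \<open>auto simp: clinear_def\<close>)
      have "cpoly_op P U u = complex_of_real c *\<^sub>C (U ^^ Suc d) u
          + (1/2) *\<^sub>C ((U ^^ d) ?w + U (U ((U ^^ d) ?w)))"
        by (simp add: P_def cpoly_op_add cpoly_op_smult cpoly_op_monom cpoly_op_pCons[OF lU] Q(3)
            clinear_zero[OF lU])
      also have "(U ^^ d) ?w + U (U ((U ^^ d) ?w)) = (U ^^ d) (?w + U (U ?w))"
        by (simp add: clinear_add[OF fU] funpow_swap1)
      also have "(1/2) *\<^sub>C \<dots> = (U ^^ d) (U (T ?w))"
        by (simp add: UT clinear_scaleC[OF fU])
      also have "complex_of_real c *\<^sub>C (U ^^ Suc d) u + (U ^^ d) (U (T ?w)) = (U ^^ Suc d) (poly_op p T u)"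
        unfolding p poly_op_pCons[OF sa_linear[OF T(1)]]
        by (simp add: clinear_add[OF fU] funpow_swap1 clinear_scaleR[OF fU] scaleR_scaleC
            clinear_scaleC[OF fU] clinear_add[OF lU] clinear_scaleC[OF lU])
      finally show ?thesis .
    qed
    ultimately show ?case by blast
  qed
  from this[OF order_refl, of p] obtain P where P: "degree P \<le> 2 * degree p"
    "\<And>t. poly P (cis t) = cis t ^ degree p * complex_of_real (poly p (cos t))"
    "\<And>u. cpoly_op P U u = (U ^^ degree p) (poly_op p T u)" by blast
  have cf: "norm (coeff P i) \<le> s" for i
    by (rule norm_coeff_le) (simp add: P(2) norm_mult norm_power p)
  have "norm (poly_op p T u) = norm (cpoly_op P U u)"
    by (simp add: P(3) isoU)
  also have "\<dots> \<le> (\<Sum>i\<le>2 * degree p. s * norm u)"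
    unfolding cpoly_op_eq_sum[OF P(1)]
    by (rule sum_norm_le) (simp add: norm_scaleC isoU mult_right_mono cf)
  finally show ?thesis by (simp add: algebra_simps)
qed

text \<open>Repeated use of \<open>\<parallel>Y u\<parallel>\<^sup>2 \<le> \<parallel>u\<parallel> \<parallel>Y\<^sup>2 u\<parallel>\<close>, for \<open>Y = X, X\<^sup>2, X\<^sup>4, \<dots>\<close>.\<close>

lemma norm_power_le_funpow:
  assumes X: "sa X"
  shows "sa (X ^^ (2 ^ m))"
    and "norm (X u) ^ (2 ^ m) \<le> norm u ^ (2 ^ m - 1) * norm ((X ^^ (2 ^ m)) u)"
proof (induction m)
  case 0
  show "sa (X ^^ (2 ^ 0))" using X by simp
  show "norm (X u) ^ 2 ^ 0 \<le> norm u ^ (2 ^ 0 - 1) * norm ((X ^^ (2 ^ 0)) u)" by simp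
next
  case (Suc m)
  let ?N = "2 ^ m :: nat" and ?Y = "X ^^ (2 ^ m)"
  have eq: "X ^^ (2 ^ Suc m) = (\<lambda>u. ?Y (?Y u))"
    by (simp add: funpow_add fun_eq_iff mult_2)
  show "sa (X ^^ (2 ^ Suc m))"
    unfolding eq by (rule sa_comp_commute[OF Suc(1) Suc(1)]) simp
  have "norm (X u) ^ (2 ^ Suc m) = (norm (X u) ^ ?N)\<^sup>2"
    by (simp add: power_mult[symmetric] mult.commute)
  also have "\<dots> \<le> (norm u ^ (?N - 1) * norm (?Y u))\<^sup>2"
    by (intro power_mono Suc(2)) simp
  also have "\<dots> = norm u ^ (2 * (?N - 1)) * (norm (?Y u))\<^sup>2"
    by (simp add: power_mult_distrib power_mult[symmetric] mult.commute)
  also have "\<dots> \<le> norm u ^ (2 * (?N - 1)) * (norm u * norm (?Y (?Y u)))"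
    using norm_square_le[OF sa_adm[OF Suc(1)], of u]
    by (intro mult_left_mono) (simp_all add: sa_ad[OF Suc(1)])
  also have "\<dots> = norm u ^ (2 ^ Suc m - 1) * norm (?Y (?Y u))"
  proof -
    have "(2::nat) ^ Suc m - 1 = Suc (2 * (?N - 1))"
      using one_le_power[of "2::nat" m] unfolding power_Suc by arith
    then show ?thesis by (simp add: mult.assoc)
  qed
  finally show "norm (X u) ^ (2 ^ Suc m) \<le> norm u ^ (2 ^ Suc m - 1) * norm ((X ^^ (2 ^ Suc m)) u)"
    unfolding eq .
qed

text \<open>
  For the powers \<open>p\<^sup>N\<close> with \<open>N = 2\<^sup>m\<close>, the bound \<open>norm_poly_op_le_degree\<close> loses a factor linear in \<open>N\<close>,
  which disappears after taking the \<open>N\<close>-th root.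
\<close>

theorem norm_poly_op_le:
  assumes T: "sa T" "\<And>u. norm (T u) \<le> norm u"
    and p: "\<And>x. \<bar>x\<bar> \<le> 1 \<Longrightarrow> \<bar>poly p x\<bar> \<le> s"
  shows "norm (poly_op p T u) \<le> s * norm u"
proof (rule ccontr)
  assume neg: "\<not> norm (poly_op p T u) \<le> s * norm u"
  let ?X = "poly_op p T" and ?d = "real (degree p)"
  have X: "sa ?X" by (rule sa_poly_op[OF T(1)])
  have s0: "0 \<le> s" using p[of 0] by simp
  have u: "norm u > 0" using neg linear_0[OF sa_linear[OF X]] by (cases "u = 0") auto
  have main: "norm (?X u) ^ (2^m) \<le> norm u ^ (2^m) * ((2 * (2^m * ?d) + 1) * s ^ (2^m))" for m
  proof -
    let ?N = "2 ^ m :: nat"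
    have "norm ((?X ^^ ?N) u) \<le> (2 * real (degree (p ^ ?N)) + 1) * s ^ ?N * norm u"
      unfolding poly_op_power[OF sa_linear[OF T(1)], symmetric]
      by (rule norm_poly_op_le_degree[OF T]) (auto simp: power_abs intro!: power_mono p)
    also have "\<dots> \<le> (2 * (2^m * ?d) + 1) * s ^ ?N * norm u"
    proof -
      have "real (degree (p ^ ?N)) \<le> real (?N * degree p)"
        using degree_power_le[of p ?N] by (simp only: of_nat_le_iff mult.commute)
      then show ?thesis
        using s0 by (intro mult_right_mono add_mono mult_left_mono) auto
    qed
    finally have "norm (?X u) ^ ?N \<le> norm u ^ (?N - 1) * ((2 * (2^m * ?d) + 1) * s ^ ?N * norm u)"
      using norm_power_le_funpow(2)[OF X, of u m]
      by (meson mult_left_mono norm_ge_zero order_trans zero_le_power)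
    also have "\<dots> = norm u ^ Suc (?N - 1) * ((2 * (2^m * ?d) + 1) * s ^ ?N)"
      by (simp only: power_Suc mult_ac)
    finally show ?thesis by simp
  qed
  have s: "s > 0"
  proof (rule ccontr)
    assume "\<not> s > 0"
    then have "s = 0" using s0 by simp
    then show False using main[of 0] neg by simp
  qed
  define \<rho> where "\<rho> = norm (?X u) / (s * norm u)"
  have \<rho>: "\<rho> > 1" using neg s u by (simp add: \<rho>_def less_divide_eq)
  have le: "\<rho> ^ (2^m) \<le> 2 * (2^m * ?d) + 1" for m
  proof -
    have "norm (?X u) ^ (2^m) = \<rho> ^ (2^m) * (s ^ (2^m) * norm u ^ (2^m))"
    proof -
      have "norm (?X u) = \<rho> * (s * norm u)" using s u by (simp add: \<rho>_def)
      then show ?thesis by (simp only: power_mult_distrib)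
    qed
    with main[of m] have "\<rho> ^ (2^m) * (s ^ (2^m) * norm u ^ (2^m))
        \<le> (2 * (2^m * ?d) + 1) * (s ^ (2^m) * norm u ^ (2^m))"
      by (simp add: mult_ac)
    then show ?thesis using s u by simp
  qed
  have "(\<lambda>n. (2 * (real n * ?d) + 1) / \<rho> ^ n) \<longlonglongrightarrow> 0"
  proof -
    have "norm (1 / \<rho>) < 1" using \<rho> by simp
    then have "(\<lambda>n. 2 * ?d * (real n * (1 / \<rho>) ^ n) + (1 / \<rho>) ^ n) \<longlonglongrightarrow> 2 * ?d * 0 + 0"
      by (intro tendsto_add tendsto_mult_left powser_times_n_limit_0 LIMSEQ_power_zero)
    moreover have "(2 * (real n * ?d) + 1) / \<rho> ^ n = 2 * ?d * (real n * (1 / \<rho>) ^ n) + (1 / \<rho>) ^ n" for n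
      by (simp only: power_one_over add_divide_distrib mult.assoc times_divide_eq_right mult_1_right)
        (simp add: mult_ac)
    ultimately show ?thesis by (simp only: mult_zero_right add_0_right)
  qed
  then have "\<forall>\<^sub>F n in sequentially. (2 * (real n * ?d) + 1) / \<rho> ^ n < 1"
    by (rule order_tendstoD) simp
  then obtain K where K: "\<And>n. n \<ge> K \<Longrightarrow> (2 * (real n * ?d) + 1) / \<rho> ^ n < 1"
    by (auto simp: eventually_sequentially)
  have "K \<le> 2 ^ K" by (rule less_imp_le) (rule less_exp)
  from K[OF this] have "2 * (2^K * ?d) + 1 < \<rho> ^ (2^K)"
    using \<rho> by (simp add: divide_less_eq)
  with le[of K] show False by simp
qed

end

section \<open>Positivity and the Cauchy--Schwarz inequality\<close>

context csmod
begin

lemma norm_le_of_square: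
  assumes "(norm (T u))\<^sup>2 \<le> norm u * norm v" "norm v \<le> c * norm u" "0 \<le> c"
  shows "norm (T u) \<le> sqrt c * norm u"
proof (rule power2_le_imp_le)
  have "norm u * norm v \<le> norm u * (c * norm u)"
    using assms by (intro mult_left_mono) auto
  also have "\<dots> = (sqrt c * norm u)\<^sup>2"
    using assms(3) by (simp add: power_mult_distrib) (simp add: power2_eq_square)
  finally show "(norm (T u))\<^sup>2 \<le> (sqrt c * norm u)\<^sup>2"
    using assms(1) by linarith
qed (use assms in auto)

lemma norm_ad_le:
  assumes "adm T" "\<And>u. norm (T u) \<le> c * norm u" "0 \<le> c"
  shows "norm (ad T u) \<le> c * norm u"
proof (cases "ad T u = 0")
  case False
  have "(norm (ad T u))\<^sup>2 \<le> norm u * (c * norm (ad T u))"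
    using norm_square_le[OF adm_ad(1)[OF assms(1)], of u] assms(2)[of "ad T u"]
    by (simp add: adm_ad(2)[OF assms(1)]) (meson mult_left_mono norm_ge_zero order_trans)
  then show ?thesis using False by (simp add: power2_eq_square mult_ac)
qed (use assms in simp)

lemma adm_bound:
  assumes "adm T"
  obtains c where "0 < c" "\<And>u. norm (T u) \<le> c * norm u"
  using bounded_linear.pos_bounded[OF adm_bounded[OF assms]] by (auto simp: mult.commute)

text \<open>
  Positivity of a self-adjoint operator, expressed by norms: \<open>0 \<le> A \<le> 2 t\<close> holds if and only if
  \<open>t - A\<close> has norm at most \<open>t\<close>.  In this form it is obviously inherited by sums.
\<close>

definition spos :: "('a \<Rightarrow> 'a) \<Rightarrow> bool" where
  "spos A \<longleftrightarrow> sa A \<and> (\<exists>t\<ge>0. \<forall>u. norm (t *\<^sub>R u - A u) \<le> t * norm u)"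

lemma sposI: "sa A \<Longrightarrow> 0 \<le> t \<Longrightarrow> (\<And>u. norm (t *\<^sub>R u - A u) \<le> t * norm u) \<Longrightarrow> spos A"
  by (auto simp: spos_def)

lemma spos_sa: "spos A \<Longrightarrow> sa A"
  by (simp add: spos_def)

lemma spos_add:
  assumes "spos A" "spos B"
  shows "spos (\<lambda>u. A u + B u)"
proof -
  obtain s t where st: "0 \<le> s" "\<And>u. norm (s *\<^sub>R u - A u) \<le> s * norm u"
    "0 \<le> t" "\<And>u. norm (t *\<^sub>R u - B u) \<le> t * norm u"
    using assms by (auto simp: spos_def)
  show ?thesis
  proof (rule sposI)
    show "sa (\<lambda>u. A u + B u)" using assms by (simp add: sa_add spos_sa)
    show "norm ((s + t) *\<^sub>R u - (A u + B u)) \<le> (s + t) * norm u" for u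
      using norm_triangle_ineq[of "s *\<^sub>R u - A u" "t *\<^sub>R u - B u"] st(2,4)[of u]
      by (simp add: algebra_simps)
  qed (use st in auto)
qed

lemma spos_scaleR:
  assumes "spos A" "0 \<le> c"
  shows "spos (\<lambda>u. c *\<^sub>R A u)"
proof -
  obtain s where s: "0 \<le> s" "\<And>u. norm (s *\<^sub>R u - A u) \<le> s * norm u"
    using assms by (auto simp: spos_def)
  show ?thesis
  proof (rule sposI)
    show "sa (\<lambda>u. c *\<^sub>R A u)" using assms by (simp add: sa_scaleR spos_sa)
    have "(c * s) *\<^sub>R u - c *\<^sub>R A u = c *\<^sub>R (s *\<^sub>R u - A u)" for u
      by (simp add: algebra_simps)
    then show "norm ((c * s) *\<^sub>R u - c *\<^sub>R A u) \<le> c * s * norm u" for u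
      using mult_left_mono[OF s(2) assms(2)] assms(2) by (simp add: mult.assoc)
  qed (use s assms in auto)
qed

lemma norm_diff_square_le:
  assumes V: "sa V" "\<And>u. norm (V u) \<le> c * norm u" "0 \<le> c"
  shows "norm (c\<^sup>2 *\<^sub>R u - V (V u)) \<le> c\<^sup>2 * norm u"
proof (cases "c = 0")
  case True
  then have "V u = 0" for u using V(2)[of u] by simp
  then show ?thesis using True by simp
next
  case False
  define T where "T = (\<lambda>u. (1 / c) *\<^sub>R V u)"
  have T: "sa T" unfolding T_def by (rule sa_scaleR[OF V(1)])
  have "norm (T u) \<le> norm u" for u
    using V(2)[of u] V(3) False by (simp add: T_def field_simps)
  moreover have "\<bar>poly [:1, 0, -1:] x\<bar> \<le> 1" if "\<bar>x\<bar> \<le> 1" for x :: real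
    using abs_square_le_1[of x] that by (simp add: power2_eq_square abs_le_iff)
  ultimately have "norm (poly_op [:1, 0, -1:] T u) \<le> 1 * norm u"
    by (rule norm_poly_op_le[OF T])
  then have "norm (u - T (T u)) \<le> norm u"
    by (simp add: poly_op_pCons sa_linear[OF T] linear_0[OF sa_linear[OF T]]
        linear_neg[OF sa_linear[OF T]])
  moreover have "c\<^sup>2 *\<^sub>R u - V (V u) = c\<^sup>2 *\<^sub>R (u - T (T u))"
    using False by (simp add: T_def linear_scale[OF sa_linear[OF V(1)]] algebra_simps power2_eq_square)
  ultimately show ?thesis by (simp add: mult_left_mono)
qed

lemma spos_square:
  assumes "sa V"
  shows "spos (\<lambda>u. V (V u))"
proof -
  obtain c where c: "0 < c" "\<And>u. norm (V u) \<le> c * norm u"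
    using adm_bound[OF sa_adm[OF assms]] by metis
  show ?thesis
    by (rule sposI[OF _ zero_le_power2 norm_diff_square_le[OF assms c(2)]])
      (use c in \<open>auto intro: sa_comp_commute assms\<close>)
qed

text \<open>
  The root is \<open>t\<^sup>1\<^sup>/\<^sup>2\<close> times the binomial series of \<open>sqrt (1 - A')\<close>, where \<open>A = t (1 - A')\<close> and
  \<open>A'\<close> is a contraction.
\<close>

lemma spos_sqrt:
  assumes "spos A"
  obtains V where "sa V" "\<And>u. V (V u) = A u"
    "\<And>B u. bounded_linear B \<Longrightarrow> (\<And>u. B (A u) = A (B u)) \<Longrightarrow> B (V u) = V (B u)"
proof -
  obtain s where s: "0 \<le> s" "\<And>u. norm (s *\<^sub>R u - A u) \<le> s * norm u"
    using assms by (auto simp: spos_def)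
  \<comment> \<open>The number \<open>s\<close> may be \<open>0\<close>, and \<open>t\<close> is divided by.\<close>
  define t where "t = s + 1"
  have t: "t > 0" using s by (simp add: t_def)
  have le: "norm (t *\<^sub>R u - A u) \<le> t * norm u" for u
    using norm_triangle_ineq[of "s *\<^sub>R u - A u" u] s(2)[of u]
    by (simp add: t_def algebra_simps)
  define A' where "A' = (\<lambda>u. u - (1 / t) *\<^sub>R A u)"
  have A: "sa A" by (rule spos_sa[OF assms])
  have A': "sa A'" unfolding A'_def by (rule sa_diff[OF sa_id sa_scaleR[OF A]])
  have A'le: "norm (A' u) \<le> norm u" for u
  proof -
    have "A' u = (1 / t) *\<^sub>R (t *\<^sub>R u - A u)" using t by (simp add: A'_def scaleR_diff_right)
    then show ?thesis using le[of u] t by (simp add: divide_le_eq mult.commute)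
  qed
  define V where "V = (\<lambda>u. sqrt t *\<^sub>R csq A' u)"
  have S: "sa (csq A')" by (rule sa_csq[OF A' A'le])
  show thesis
  proof
    show "sa V" unfolding V_def by (rule sa_scaleR[OF S])
    show "V (V u) = A u" for u
      using t by (simp add: V_def linear_scale[OF sa_linear[OF S]] csq_csq[OF A' A'le]) (simp add: A'_def)
    show "B (V u) = V (B u)" if B: "bounded_linear B" "\<And>u. B (A u) = A (B u)" for B u
    proof -
      interpret bounded_linear B by fact
      have "B (A' u) = A' (B u)" for u by (simp add: A'_def diff scaleR B(2))
      then show ?thesis
        unfolding V_def by (simp add: scaleR csq_commute[OF A' A'le B(1)])
    qed
  qed
qed

text \<open>
  The operator \<open>T - A\<close> is positive, and its root \<open>S\<close> commutes with the root \<open>V\<close> of \<open>A\<close>.  Hence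
  \<open>\<langle>V u | S u\<rangle>\<close> is self-adjoint, and \<open>\<langle>V u | V u\<rangle> + \<langle>S u | S u\<rangle> = T \<langle>u | u\<rangle>\<close> bounds \<open>V\<close> by \<open>T\<^sup>1\<^sup>/\<^sup>2\<close>.
\<close>

lemma spos_norm_mono:
  assumes A: "spos A" and B: "spos B"
    and T: "0 \<le> T" "\<And>u. norm (A u + B u) \<le> T * norm u"
  shows "norm (A u) \<le> T * norm u"
proof -
  define C where "C = (\<lambda>u. T *\<^sub>R u - A u)"
  have sA: "sa A" by (rule spos_sa[OF A])
  have sC: "sa C" unfolding C_def by (rule sa_diff[OF sa_scaleR[OF sa_id] sA])
  obtain t where t: "0 \<le> t" "\<And>u. norm (t *\<^sub>R u - B u) \<le> t * norm u"
    using B by (auto simp: spos_def)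
  have "spos C"
  proof (rule sposI[OF sC])
    \<comment> \<open>The vector on the left is \<open>t u + A u\<close>, the sum of \<open>A u + B u\<close> and \<open>t u - B u\<close>.\<close>
    show "norm ((T + t) *\<^sub>R u - C u) \<le> (T + t) * norm u" for u
      using norm_triangle_ineq[of "A u + B u" "t *\<^sub>R u - B u"] T(2)[of u] t(2)[of u]
      by (simp add: C_def algebra_simps)
  qed (use T t in auto)
  then obtain S where S: "sa S" "\<And>u. S (S u) = C u"
    "\<And>B u. bounded_linear B \<Longrightarrow> (\<And>u. B (C u) = C (B u)) \<Longrightarrow> B (S u) = S (B u)"
    by (rule spos_sqrt) blast
  obtain V where V: "sa V" "\<And>u. V (V u) = A u"
    "\<And>B u. bounded_linear B \<Longrightarrow> (\<And>u. B (A u) = A (B u)) \<Longrightarrow> B (V u) = V (B u)"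
    using A by (rule spos_sqrt) blast
  have VA: "V (A u) = A (V u)" for u by (simp flip: V(2))
  have "V (C u) = C (V u)" for u
    by (simp add: C_def linear_diff[OF sa_linear[OF V(1)]] linear_scale[OF sa_linear[OF V(1)]] VA)
  then have VS: "V (S u) = S (V u)" for u by (rule S(3)[OF sa_bounded[OF V(1)]])
  have "norm (V u) \<le> sqrt T * norm u" for u
  proof (rule power2_le_imp_le)
    have "ip E (V u) (S u) = ip E (S u) (V u)"
      by (simp add: sa_ip[OF V(1)] sa_ip[OF S(1)] VS)
    from norm_le_commuting_squares[OF this]
    have "(norm (V u))\<^sup>2 \<le> norm (ip E u (A u) + ip E u (C u))"
      by (simp add: sa_ip[OF V(1)] sa_ip[OF S(1)] V(2) S(2))
    also have "ip E u (A u) + ip E u (C u) = T *\<^sub>R ip E u u"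
      by (simp add: C_def ip_diff_right ip_scaleR_right)
    finally show "(norm (V u))\<^sup>2 \<le> (sqrt T * norm u)\<^sup>2"
      using T(1) by (simp add: norm_ip_self power_mult_distrib)
  qed (use T in auto)
  then have "norm (V (V u)) \<le> sqrt T * (sqrt T * norm u)"
    using T(1) by (meson mult_left_mono order_trans real_sqrt_ge_zero)
  then show ?thesis using T(1) by (simp add: V(2) mult.assoc[symmetric])
qed

text \<open>
  The heart of the proof that \<open>X\<^sup>*X\<close> is positive.  Suppose \<open>C\<^sup>*C = - K\<close> with \<open>K\<close> positive.  Then
  \<open>P = CC\<^sup>*\<close> is positive as well, because \<open>C\<^sup>*C + CC\<^sup>*\<close> is twice the sum of the squares of the real and
  the imaginary part of \<open>C\<close>.  With \<open>\<tau> = \<parallel>C\<parallel>\<^sup>2\<close> the operator \<open>Y = (\<tau> - P) C = C (\<tau> + K)\<close> has norm at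
  most \<open>\<tau> \<parallel>C\<parallel>\<close>, so that \<open>- Y\<^sup>*Y = K (\<tau> + K)\<^sup>2\<close> has norm at most \<open>\<tau>\<^sup>3\<close>.  It dominates \<open>2 \<tau> K\<^sup>2\<close>, of
  norm \<open>2 \<tau>\<^sup>3\<close>, and \<open>\<tau>\<close> must vanish.
\<close>

lemma negative_square_zero:
  assumes C: "adm C" and K: "spos K" and CC: "\<And>u. ad C (C u) = - K u"
  shows "K u = 0"
proof -
  let ?D = "ad C"
  define \<gamma> where "\<gamma> = onorm C"
  define \<tau> where "\<tau> = \<gamma>\<^sup>2"
  have D: "adm ?D" "ad ?D = C" using adm_ad[OF C] by auto
  have bC: "bounded_linear C" by (rule adm_bounded[OF C])
  have \<gamma>: "0 \<le> \<gamma>" "norm (C u) \<le> \<gamma> * norm u" for u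
    using onorm_pos_le[OF bC] onorm[OF bC] by (auto simp: \<gamma>_def)
  have \<gamma>': "norm (?D u) \<le> \<gamma> * norm u" for u by (rule norm_ad_le[OF C \<gamma>(2,1)])
  have lC: "clinear C" and lD: "clinear ?D" using C D adm_clinear by auto
  define U where "U = (\<lambda>u. (1/2) *\<^sub>R (C u + ?D u))"
  define W where "W = (\<lambda>u. (\<i> / 2) *\<^sub>C (C u - ?D u))"
  have sU: "sa U" unfolding sa_def U_def
    by (simp add: ip_scaleR_left ip_scaleR_right ip_add_left ip_add_right ip_ad C D add.commute)
  have sW: "sa W" unfolding sa_def W_def
    by (simp add: ip_scaleC_left ip_scaleC_right ip_diff_left ip_diff_right ip_ad C D
        scaleC_diff_right)
  define P where "P = (\<lambda>u. C (?D u))"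
  have P: "P u = 2 *\<^sub>R U (U u) + 2 *\<^sub>R W (W u) + K u" for u
  proof -
    have "4 *\<^sub>R U (U u) = C (C u) + C (?D u) + ?D (C u) + ?D (?D u)"
      by (simp add: U_def clinear_scaleR[OF lC] clinear_scaleR[OF lD] clinear_add[OF lC]
          clinear_add[OF lD] scaleR_add_right add_ac)
    moreover have "4 *\<^sub>R W (W u) = - (C (C u)) + C (?D u) + ?D (C u) - ?D (?D u)"
      by (simp add: W_def clinear_scaleC[OF lC] clinear_scaleC[OF lD] clinear_diff[OF lC]
          clinear_diff[OF lD] scaleC_diff_right scaleC_scaleC scaleR_scaleC)
    ultimately have "4 *\<^sub>R U (U u) + 4 *\<^sub>R W (W u) = 2 *\<^sub>R (C (?D u) + ?D (C u))"
      by (simp add: scaleR_2)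
    then have "2 *\<^sub>R (2 *\<^sub>R U (U u) + 2 *\<^sub>R W (W u)) = 2 *\<^sub>R (C (?D u) + ?D (C u))"
      by (simp add: scaleR_add_right)
    then have "2 *\<^sub>R U (U u) + 2 *\<^sub>R W (W u) = C (?D u) + ?D (C u)"
      by (rule real_vector.scale_left_imp_eq[rotated]) simp
    then show ?thesis by (simp add: P_def CC)
  qed
  have sP: "spos P"
    using spos_add[OF spos_add[OF spos_scaleR[OF spos_square[OF sU], of 2]
          spos_scaleR[OF spos_square[OF sW], of 2]] K]
    by (simp add: P[abs_def])
  have Ple: "norm (P u) \<le> \<tau> * norm u" for u
    using order_trans[OF \<gamma>(2) mult_left_mono[OF \<gamma>'[of u] \<gamma>(1)]]
    by (simp add: P_def \<tau>_def power2_eq_square mult.assoc)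
  obtain V where V: "sa V" "\<And>u. V (V u) = P u" using spos_sqrt[OF sP] by metis
  have "norm (V u) \<le> \<gamma> * norm u" for u
  proof -
    have "norm (V u) \<le> sqrt \<tau> * norm u"
      using norm_square_le[OF sa_adm[OF V(1)], of u]
      by (intro norm_le_of_square[of V u "P u"]) (simp_all add: sa_ad[OF V(1)] V(2) Ple[unfolded \<tau>_def] \<tau>_def)
    then show ?thesis using \<gamma>(1) by (simp add: \<tau>_def)
  qed
  from norm_diff_square_le[OF V(1) this \<gamma>(1)]
  have tP: "norm (\<tau> *\<^sub>R u - P u) \<le> \<tau> * norm u" for u
    by (simp add: V(2) \<tau>_def)
  have sK: "sa K" by (rule spos_sa[OF K])
  have lK: "linear K" by (rule sa_linear[OF sK])
  define T where "T = (\<lambda>u. \<tau> *\<^sub>R u + K u)"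
  have sT: "sa T" unfolding T_def by (rule sa_add[OF sa_scaleR[OF sa_id] sK])
  define Y where "Y = (\<lambda>u. C (T u))"
  have adY: "adm Y" "ad Y = (\<lambda>u. T (?D u))"
    unfolding Y_def using adm_comp[OF C sa_adm[OF sT]] ad_comp[OF C sa_adm[OF sT]]
    by (simp_all add: sa_ad[OF sT])
  have "Y u = \<tau> *\<^sub>R C u - P (C u)" for u
    by (simp add: Y_def T_def P_def CC clinear_add[OF lC] clinear_scaleR[OF lC] clinear_minus[OF lC])
  then have Yle: "norm (Y u) \<le> \<tau> * \<gamma> * norm u" for u
    using order_trans[OF tP[of "C u"] mult_left_mono[OF \<gamma>(2)[of u], of \<tau>]]
    by (simp add: \<tau>_def mult.assoc)
  have YY: "ad Y (Y u) = - (2 * \<tau>) *\<^sub>R K (K u) - (\<tau>\<^sup>2 *\<^sub>R K u + K (K (K u)))" for u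
  proof -
    have "ad Y (Y u) = - T (K (T u))"
      by (simp add: adY(2)) (simp add: Y_def CC linear_neg[OF sa_linear[OF sT]])
    moreover have "(2 * \<tau>) *\<^sub>R K (K u) = \<tau> *\<^sub>R K (K u) + \<tau> *\<^sub>R K (K u)"
      by (simp only: mult_2 scaleR_add_left)
    ultimately show ?thesis
      by (simp add: T_def linear_add[OF lK] linear_scale[OF lK] power2_eq_square scaleR_add_right)
  qed
  have "norm ((2 * \<tau>) *\<^sub>R K (K u)) \<le> \<tau> ^ 3 * norm u" for u
  proof (rule spos_norm_mono[where B="\<lambda>u. \<tau>\<^sup>2 *\<^sub>R K u + K (K (K u))"])
    show "spos (\<lambda>u. (2 * \<tau>) *\<^sub>R K (K u))"
      by (rule spos_scaleR[OF spos_square[OF sK]]) (simp add: \<tau>_def)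
    obtain L where L: "sa L" "\<And>u. L (L u) = K u"
      "\<And>B u. bounded_linear B \<Longrightarrow> (\<And>u. B (K u) = K (B u)) \<Longrightarrow> B (L u) = L (B u)"
      using spos_sqrt[OF K] by metis
    have LK: "K (L u) = L (K u)" for u by (simp flip: L(2))
    have "sa (\<lambda>u. L (K u))" by (rule sa_comp_commute[OF L(1) sK]) (simp add: LK)
    from spos_square[OF this] have "spos (\<lambda>u. K (K (K u)))" by (simp add: LK L(2))
    then show "spos (\<lambda>u. \<tau>\<^sup>2 *\<^sub>R K u + K (K (K u)))"
      by (rule spos_add[OF spos_scaleR[OF K zero_le_power2]])
    show "norm ((2 * \<tau>) *\<^sub>R K (K u) + (\<tau>\<^sup>2 *\<^sub>R K u + K (K (K u)))) \<le> \<tau> ^ 3 * norm u" for u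
    proof -
      have "0 \<le> \<tau> * \<gamma>" using \<gamma>(1) by (simp add: \<tau>_def)
      from norm_ad_le[OF adY(1) Yle this, of "Y u"] mult_left_mono[OF Yle[of u] this]
      have "norm (ad Y (Y u)) \<le> \<tau> * \<gamma> * (\<tau> * \<gamma> * norm u)" by linarith
      also have "\<dots> = \<tau> ^ 3 * norm u" by (simp add: \<tau>_def power2_eq_square power3_eq_cube)
      also have "ad Y (Y u) = - ((2 * \<tau>) *\<^sub>R K (K u) + (\<tau>\<^sup>2 *\<^sub>R K u + K (K (K u))))"
        by (simp add: YY)
      finally show ?thesis by (simp only: norm_minus_cancel)
    qed
  qed (simp add: \<tau>_def)
  then have KK: "2 * \<tau> * norm (K (K u)) \<le> 2 * \<tau> * (\<tau>\<^sup>2 / 2 * norm u)" for u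
    by (simp add: \<tau>_def power3_eq_cube power2_eq_square mult_ac)
  have "\<tau> = 0"
  proof (rule ccontr)
    assume "\<tau> \<noteq> 0"
    then have t0: "\<tau> > 0" by (simp add: \<tau>_def)
    then have "norm (K (K u)) \<le> \<tau>\<^sup>2 / 2 * norm u" for u
      using KK[of u] by (simp only: mult_le_cancel_left_pos)
    then have "norm (K u) \<le> sqrt (\<tau>\<^sup>2 / 2) * norm u" for u
      using norm_square_le[OF sa_adm[OF sK], of u]
      by (intro norm_le_of_square[of K u "K (K u)"]) (simp_all add: sa_ad[OF sK])
    then have *: "norm (C u) \<le> sqrt (sqrt (\<tau>\<^sup>2 / 2)) * norm u" for u
      using norm_square_le[OF C, of u]
      by (intro norm_le_of_square[of C u "K u"]) (simp_all add: CC)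
    have "\<gamma> \<le> sqrt (sqrt (\<tau>\<^sup>2 / 2))"
      unfolding \<gamma>_def by (rule onorm_bound[OF _ *]) simp
    then have "\<gamma>\<^sup>2 \<le> (sqrt (sqrt (\<tau>\<^sup>2 / 2)))\<^sup>2" by (rule power_mono) (rule \<gamma>)
    then have "\<tau> \<le> sqrt (\<tau>\<^sup>2 / 2)" by (simp add: \<tau>_def)
    then have "\<tau>\<^sup>2 \<le> (sqrt (\<tau>\<^sup>2 / 2))\<^sup>2" by (rule power_mono) (use t0 in simp)
    then show False using t0 by simp
  qed
  then have "C u = 0" for u using \<gamma>(2)[of u] by (simp add: \<tau>_def)
  then have "ad C (C u) = 0" by (simp add: clinear_zero[OF lD])
  then show ?thesis using CC[of u] by simp
qed

text \<open>
  The negative part \<open>N\<close> of \<open>H = X\<^sup>*X\<close> satisfies \<open>H N = - N\<^sup>2\<close>.  Hence \<open>C = X N\<close> has the negative square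
  \<open>C\<^sup>*C = - N\<^sup>3\<close>, and \<open>N\<close> vanishes by \<open>negative_square_zero\<close>.  The absolute value of \<open>H\<close>, from which
  \<open>N\<close> is formed, is \<open>sqrt (1 - (1 - H\<^sup>2))\<close> after scaling \<open>H\<close> to a contraction.
\<close>

theorem spos_adjoint_square:
  assumes X: "adm X"
  shows "spos (\<lambda>u. ad X (X u))"
proof -
  define H0 where "H0 = (\<lambda>u. ad X (X u))"
  have s0: "sa H0" unfolding H0_def by (rule sa_square[OF X])
  obtain \<kappa> where \<kappa>: "0 < \<kappa>" "\<And>u. norm (H0 u) \<le> \<kappa> * norm u"
    using adm_bound[OF sa_adm[OF s0]] by metis
  define H where "H = (\<lambda>u. (1 / \<kappa>) *\<^sub>R H0 u)"
  have H: "sa H" unfolding H_def by (rule sa_scaleR[OF s0])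
  have Hle: "norm (H u) \<le> norm u" for u
    using \<kappa>(2)[of u] \<kappa>(1) by (simp add: H_def field_simps)
  note lH = sa_linear[OF H]
  define A where "A = (\<lambda>u. u - H (H u))"
  have A: "sa A" unfolding A_def by (rule sa_diff[OF sa_id sa_comp_commute[OF H H]]) simp
  have Ale: "norm (A u) \<le> norm u" for u
    using norm_diff_square_le[of H 1 u] H Hle by (simp add: A_def)
  have Apoly: "poly_op [:1, 0, -1:] H = A"
    by (rule ext) (simp add: A_def poly_op_pCons[OF lH] linear_0[OF lH] linear_neg[OF lH])
  define S where "S = csq A"
  have S: "sa S" unfolding S_def by (rule sa_csq[OF A Ale])
  note lS = sa_linear[OF S]
  have SS: "S (S u) = H (H u)" for u
    unfolding S_def by (subst csq_csq[OF A Ale]) (simp add: A_def)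
  have HS: "H (S u) = S (H u)" for u
    unfolding S_def by (rule csq_commute[OF A Ale sa_bounded[OF H]]) (simp add: A_def linear_diff[OF lH])
  define N where "N = (\<lambda>u. (1/2) *\<^sub>R (S u - H u))"
  have sN: "sa N" unfolding N_def by (rule sa_scaleR[OF sa_diff[OF S H]])
  note lN = sa_linear[OF sN]
  have pN: "spos N"
  proof (rule sposI[OF sN, of 1])
    fix u
    let ?r = "\<lambda>n. 1 - smult (1/2) (pcompose (sqpoly n) [:1, 0, -1:] - [:0, 1:])"
    have rn: "poly_op (?r n) H u = u - (1/2) *\<^sub>R (poly_op (sqpoly n) A u - H u)" for n
      by (simp add: poly_op_diff poly_op_smult poly_op_pcompose[OF lH] Apoly poly_op_X[OF lH])
    have "norm (poly_op (?r n) H u) \<le> 1 * norm u" if "1 \<le> n" for n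
    proof (rule norm_poly_op_le[OF H Hle])
      fix x :: real assume x: "\<bar>x\<bar> \<le> 1"
      have y: "0 \<le> 1 - x * x" "1 - x * x \<le> 1"
        using abs_square_le_1[of x] x by (auto simp: power2_eq_square)
      have "sqrt (x * x) \<le> poly (sqpoly n) (1 - x * x)" "poly (sqpoly n) (1 - x * x) \<le> 1"
        using sqpoly_bounds(1,2)[OF that y] by simp_all
      then show "\<bar>poly (?r n) x\<bar> \<le> 1"
        using x by (simp add: poly_pcompose abs_le_iff)
    qed
    moreover have "(\<lambda>n. norm (poly_op (?r n) H u)) \<longlonglongrightarrow> norm (u - N u)"
      unfolding rn N_def S_def by (intro tendsto_intros csq_LIMSEQ(1)[of A, OF Ale])
    ultimately show "norm (1 *\<^sub>R u - N u) \<le> 1 * norm u"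
      by (intro LIMSEQ_le_const2) auto
  qed simp
  have HN: "H (N u) = - N (N u)" for u
  proof -
    have "4 *\<^sub>R N (N u) = 2 *\<^sub>R (H (H u) - H (S u))"
      by (simp add: N_def linear_scale[OF lS] linear_scale[OF lH] linear_diff[OF lS]
          linear_diff[OF lH] SS HS scaleR_diff_right scaleR_2)
    then have "2 *\<^sub>R (2 *\<^sub>R N (N u)) = 2 *\<^sub>R (H (H u) - H (S u))" by simp
    then have "2 *\<^sub>R N (N u) = H (H u) - H (S u)"
      by (rule real_vector.scale_left_imp_eq[rotated]) simp
    then have "2 *\<^sub>R (- N (N u)) = 2 *\<^sub>R H (N u)"
      by (simp add: N_def linear_scale[OF lH] linear_diff[OF lH])
    then show ?thesis by (metis real_vector.scale_left_imp_eq zero_neq_numeral)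
  qed
  have NNN: "N (N (N u)) = 0" for u
  proof -
    define C where "C = (\<lambda>u. X (N u))"
    have C: "adm C" "ad C = (\<lambda>u. N (ad X u))"
      unfolding C_def using adm_comp[OF X sa_adm[OF sN]] ad_comp[OF X sa_adm[OF sN]]
      by (simp_all add: sa_ad[OF sN])
    obtain L where L: "sa L" "\<And>u. L (L u) = N u" using spos_sqrt[OF pN] by metis
    have LN: "N (L u) = L (N u)" for u by (simp flip: L(2))
    have "sa (\<lambda>u. L (N u))" by (rule sa_comp_commute[OF L(1) sN]) (simp add: LN)
    from spos_scaleR[OF spos_square[OF this], of \<kappa>] \<kappa>(1)
    have p: "spos (\<lambda>u. \<kappa> *\<^sub>R N (N (N u)))" by (simp add: LN L(2))
    have "ad C (C u) = - (\<kappa> *\<^sub>R N (N (N u)))" for u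
    proof -
      have "ad C (C u) = N (H0 (N u))" unfolding C(2) by (simp add: C_def H0_def)
      also have "H0 (N u) = \<kappa> *\<^sub>R H (N u)" using \<kappa>(1) by (simp add: H_def)
      finally show ?thesis by (simp add: HN linear_scale[OF lN] linear_neg[OF lN])
    qed
    from negative_square_zero[OF C(1) p this, of u] show ?thesis using \<kappa>(1) by simp
  qed
  have N0: "N u = 0" for u
  proof -
    have "N (N u) = 0" for u
      using norm_square_le[OF sa_adm[OF sN], of "N u"] by (simp add: sa_ad[OF sN] NNN)
    then show ?thesis
      using norm_square_le[OF sa_adm[OF sN], of u] by (simp add: sa_ad[OF sN])
  qed
  then have "H u = S u" for u by (simp add: N_def)
  then have "spos H"
    using norm_diff_csq[of A, OF Ale] by (intro sposI[OF H, of 1]) (simp_all add: S_def)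
  from spos_scaleR[OF this, of \<kappa>] \<kappa>(1) show ?thesis by (simp add: H_def H0_def)
qed

end

definition cpos :: "'b::cstar_algebra \<Rightarrow> bool" where
  "cpos h \<longleftrightarrow> csmod.spos self_module (lmul h)"

lemma cpos_add: "cpos h \<Longrightarrow> cpos k \<Longrightarrow> cpos (h + k)"
  unfolding cpos_def distrib_right by (rule csmod.spos_add[OF csmod_self_module])

lemma lmul_adjoint:
  "adjointable self_module self_module (lmul (x::'b::cstar_algebra))"
  "adj self_module self_module (lmul x) = lmul (star x)"
proof -
  have *: "ip self_module (x * u) v = ip self_module u (star x * v)" for u v
    by (simp add: star_mult mult.assoc)
  show "adjointable self_module self_module (lmul x)" by (rule adjointableI) (rule *)
  show "adj self_module self_module (lmul x) = lmul (star x)"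
    by (rule hmod.adj_eqI[OF hmod_self_module]) (rule *)
qed

lemma cpos_star_mult: "cpos (star x * x)"
  using csmod.spos_adjoint_square[OF csmod_self_module lmul_adjoint(1), of x]
  by (simp add: cpos_def lmul_adjoint(2) mult.assoc)

lemma cpos_norm_mono:
  assumes "cpos h" "cpos k"
  shows "norm h \<le> norm (h + k)"
proof -
  have "norm (h * u) \<le> norm (h + k) * norm u" for u
    using assms
    by (intro csmod.spos_norm_mono[OF csmod_self_module, where A="lmul h" and B="lmul k"])
      (auto simp: cpos_def distrib_right[symmetric] norm_mult_ineq)
  from this[of "star h"] have "norm h * norm h \<le> norm (h + k) * norm h"
    using norm_star_mult[of "star h"] by (simp add: star_star power2_eq_square)
  then show ?thesis by (cases "h = 0") auto
qed

text \<open>\<open>v = (1 - a\<^sup>*a)\<^sup>1\<^sup>/\<^sup>2 b\<close>.  In the absence of a unit the root is that of an operator on the algebra.\<close>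

lemma contraction_complement_square:
  fixes a b :: "'b::cstar_algebra"
  assumes "norm a \<le> 1"
  shows "\<exists>v. star b * b - star (a * b) * (a * b) = star v * v"
proof -
  interpret csmod "self_module :: ('b, 'b) hmodule" by (rule csmod_self_module)
  let ?A = "\<lambda>u. star a * (a * u)"
  have sA: "sa ?A"
    by (simp add: sa_def star_mult star_star mult.assoc)
  have "norm (star a * (a * u)) \<le> norm u" for u
  proof -
    have "norm (star a * (a * u)) \<le> norm (star a) * (norm a * norm u)"
      by (meson mult_left_mono norm_ge_zero norm_mult_ineq order_trans)
    also have "\<dots> \<le> 1 * (1 * norm u)"
      using assms by (intro mult_mono) auto
    finally show ?thesis by simp
  qed
  then have csq: "sa (csq ?A)" "csq ?A (csq ?A b) = b - ?A b"
    using sA by (auto intro!: sa_csq csq_csq)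
  have "star (csq ?A b) * csq ?A b = star b * csq ?A (csq ?A b)"
    using sa_ip[OF csq(1), of b "csq ?A b"] by simp
  also have "\<dots> = star b * b - star (a * b) * (a * b)"
    unfolding csq(2) by (simp add: right_diff_distrib star_mult mult.assoc)
  finally show ?thesis by metis
qed

context hmod
begin

lemma cpos_ip: "cpos (ip E x x)"
  using ip_self_square[of x] cpos_star_mult by metis

lemma norm_ip_self_mono: "norm x \<le> sqrt (norm (ip E x x + ip E y y))"
  using cpos_norm_mono[OF cpos_ip[of x] cpos_ip[of y]]
  by (simp add: norm_ip_self real_le_rsqrt)

text \<open>
  With \<open>b = \<langle>x | y\<rangle>\<close> and \<open>\<parallel>x\<parallel> \<le> 1\<close>, the square of \<open>y\<close> is the square of \<open>y - x b\<close> plus \<open>b\<^sup>*b\<close> plus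
  \<open>b\<^sup>*(1 - \<langle>x | x\<rangle>) b\<close>, and all three are positive.
\<close>

lemma csmod: "csmod E"
proof
  have le1: "norm (ip E x y) \<le> norm y" if x: "norm x \<le> 1" for x y
  proof -
    obtain a where a: "ip E x x = star a * a" using ip_self_square by blast
    have "(norm a)\<^sup>2 = (norm x)\<^sup>2" using norm_star_mult[of a] norm_ip_self[of x] a by simp
    then have a1: "norm a \<le> 1" using x by (metis norm_ge_zero power2_eq_imp_eq)
    let ?b = "ip E x y"
    define z where "z = y - act E x ?b"
    obtain v where v: "star ?b * ?b - star (a * ?b) * (a * ?b) = star v * v"
      using contraction_complement_square[OF a1] by blast
    have "ip E z z = ip E y y - star ?b * ?b - star ?b * ?b + star ?b * (ip E x x * ?b)"
      by (simp add: z_def ip_diff_left ip_diff_right ip_act_left ip_act_right star_ip mult.assoc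
          left_diff_distrib right_diff_distrib)
    then have "ip E y y = star ?b * ?b + (star v * v + ip E z z)"
      unfolding v[symmetric] a by (simp add: star_mult mult.assoc)
    then have "norm (star ?b * ?b) \<le> norm (ip E y y)"
      by (simp add: cpos_norm_mono cpos_add cpos_star_mult cpos_ip)
    then show ?thesis
      unfolding norm_star_mult norm_ip_self by (rule power2_le_imp_le) simp
  qed
  show "norm (ip E x y) \<le> norm x * norm y" for x y
  proof (cases "x = 0")
    case False
    have "norm (ip E ((1 / norm x) *\<^sub>R x) y) \<le> norm y" using False by (intro le1) simp
    then show ?thesis using False by (simp add: ip_scaleR_left field_simps)
  qed simp
qed

end

sublocale hmod \<subseteq> csmod
  by (rule csmod)

section \<open>Continuous functional calculus of a positive contraction\<close>

abbreviation cont01 :: "(real \<Rightarrow> real) \<Rightarrow> bool" where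
  "cont01 f \<equiv> continuous_on {0..1} f"

lemma weierstrass_poly:
  assumes "cont01 f" "0 < e"
  shows "\<exists>p. \<forall>x\<in>{0..1}. \<bar>poly p x - f x\<bar> < e"
proof -
  obtain g where g: "real_polynomial_function g" "\<And>x. x \<in> {0..1} \<Longrightarrow> \<bar>f x - g x\<bar> < e"
    using Stone_Weierstrass_real_polynomial_function[OF compact_Icc assms] by blast
  then obtain a n where gx: "g = (\<lambda>x. \<Sum>i\<le>n. a i * x ^ i)"
    using real_polynomial_function_iff_sum by blast
  have "poly (\<Sum>i\<le>n. monom (a i) i) x = g x" for x
    by (simp add: gx poly_sum poly_monom)
  then show ?thesis using g(2) by (intro exI[of _ "\<Sum>i\<le>n. monom (a i) i"]) (simp add: abs_minus_commute)
qed

lemma cont01_cong: "cont01 g \<Longrightarrow> (\<And>x. 0 \<le> x \<Longrightarrow> x \<le> 1 \<Longrightarrow> f x = g x) \<Longrightarrow> cont01 f"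
  using continuous_on_cong[of "{0..1}" "{0..1}" f g] by auto

definition approx_poly :: "(real \<Rightarrow> real) \<Rightarrow> nat \<Rightarrow> real poly" where
  "approx_poly f n = (SOME p. \<forall>x\<in>{0..1}. \<bar>poly p x - f x\<bar> < 1 / real (Suc n))"

lemma approx_poly:
  assumes "cont01 f" "x \<in> {0..1}"
  shows "\<bar>poly (approx_poly f n) x - f x\<bar> < 1 / real (Suc n)"
  using someI_ex[OF weierstrass_poly[OF assms(1), of "1 / real (Suc n)"]] assms(2)
  by (simp add: approx_poly_def)

text \<open>
  The functional calculus for operators \<open>0 \<le> A \<le> 1\<close> and continuous functions on the fixed interval
  \<open>[0, 1]\<close>, by an explicit sequence of polynomials.  It agrees with \<open>fun_calc\<close> by \<open>fun_calc_eq_fc\<close>.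
\<close>

definition fc :: "(real \<Rightarrow> real) \<Rightarrow> ('e::complex_banach \<Rightarrow> 'e) \<Rightarrow> 'e \<Rightarrow> 'e" where
  "fc f A u = lim (\<lambda>n. poly_op (approx_poly f n) A u)"

context hmod
begin

text \<open>\<open>0 \<le> A \<le> 1\<close>, again in terms of norms.\<close>

definition pcontr :: "('e \<Rightarrow> 'e) \<Rightarrow> bool" where
  "pcontr A \<longleftrightarrow> sa A \<and> (\<forall>u. norm (2 *\<^sub>R A u - u) \<le> norm u)"

lemma pcontr_sa: "pcontr A \<Longrightarrow> sa A"
  by (simp add: pcontr_def)

lemma pcontr_linear: "pcontr A \<Longrightarrow> linear A"
  by (simp add: sa_linear pcontr_sa)

lemma norm_poly_op_pcontr:
  assumes A: "pcontr A" and p: "\<And>x. 0 \<le> x \<Longrightarrow> x \<le> 1 \<Longrightarrow> \<bar>poly p x\<bar> \<le> s"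
  shows "norm (poly_op p A u) \<le> s * norm u"
proof -
  define T where "T = (\<lambda>u. 2 *\<^sub>R A u - u)"
  have T: "sa T" unfolding T_def by (rule sa_diff[OF sa_scaleR[OF pcontr_sa[OF A]] sa_id])
  have Tle: "norm (T u) \<le> norm u" for u using A by (simp add: pcontr_def T_def)
  have "poly_op [:1/2, 1/2:] T = A"
    by (rule ext) (simp add: poly_op_pCons[OF sa_linear[OF T]] linear_0[OF sa_linear[OF T]]
        linear_scale[OF sa_linear[OF T]], simp add: T_def scaleR_diff_right)
  then have "poly_op p A u = poly_op (pcompose p [:1/2, 1/2:]) T u"
    by (simp add: poly_op_pcompose[OF sa_linear[OF T]])
  also have "norm \<dots> \<le> s * norm u"
    by (rule norm_poly_op_le[OF T Tle]) (auto simp: poly_pcompose intro!: p)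
  finally show ?thesis .
qed

lemma pcontr_norm_le: "pcontr A \<Longrightarrow> norm (A u) \<le> norm u"
  using norm_poly_op_pcontr[of A "[:0, 1:]" 1 u] by (simp add: poly_op_X pcontr_linear)

lemma pcontrI:
  assumes A: "spos A" and le: "\<And>u. norm (A u) \<le> norm u"
  shows "pcontr A"
  unfolding pcontr_def
proof (intro conjI allI)
  show "sa A" by (rule spos_sa[OF A])
  fix u
  obtain V where V: "sa V" "\<And>u. V (V u) = A u" using spos_sqrt[OF A] by metis
  have Vle: "norm (V u) \<le> norm u" for u
    using norm_le_of_square[of V u "A u" 1] norm_square_le[OF sa_adm[OF V(1)], of u] le
    by (simp add: sa_ad[OF V(1)] V(2))
  note lV = sa_linear[OF V(1)]
  have "norm (poly_op [:-1, 0, 2:] V u) \<le> 1 * norm u"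
  proof (rule norm_poly_op_le[OF V(1) Vle])
    fix x :: real assume "\<bar>x\<bar> \<le> 1"
    then show "\<bar>poly [:-1, 0, 2:] x\<bar> \<le> 1"
      using abs_square_le_1[of x] by (simp add: power2_eq_square abs_le_iff mult_ac)
  qed
  then show "norm (2 *\<^sub>R A u - u) \<le> norm u"
    by (simp add: poly_op_pCons[OF lV] linear_0[OF lV] linear_scale[OF lV] V(2))
qed

lemma spos_pcontr: "pcontr A \<Longrightarrow> spos A"
proof (rule sposI[of A "1/2"])
  fix u assume A: "pcontr A"
  have "(1/2) *\<^sub>R u - A u = (- 1/2) *\<^sub>R (2 *\<^sub>R A u - u)" by (simp add: scaleR_diff_right)
  then show "norm ((1/2) *\<^sub>R u - A u) \<le> 1/2 * norm u" using A by (simp add: pcontr_def)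
qed (auto simp: pcontr_sa)

lemma pcontr_adjoint_square:
  assumes "adm X" "\<And>u. norm (X u) \<le> norm u"
  shows "pcontr (\<lambda>u. X (ad X u))"
proof (rule pcontrI)
  show "spos (\<lambda>u. X (ad X u))"
    using spos_adjoint_square[OF adm_ad(1)[OF assms(1)]] by (simp add: adm_ad(2)[OF assms(1)])
  show "norm (X (ad X u)) \<le> norm u" for u
    using order_trans[OF assms(2) norm_ad_le[OF assms(1), of 1]] assms(2) by simp
qed

text \<open>
  The spectrum of \<open>A\<close> is contained in \<open>[0, \<parallel>A\<parallel>]\<close>.  The sharp interval matters for the uniqueness of
  the functional calculus, because a function is only approximated there.
\<close>

lemma norm_poly_op_onorm:
  assumes A: "pcontr A" and p: "\<And>x. 0 \<le> x \<Longrightarrow> x \<le> onorm A \<Longrightarrow> \<bar>poly p x\<bar> \<le> s"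
  shows "norm (poly_op p A u) \<le> s * norm u"
proof (cases "onorm A = 0")
  case True
  then have "A = (\<lambda>u. 0)" using onorm_eq_0[OF sa_bounded[OF pcontr_sa[OF A]]] by auto
  then have "poly_op p A u = poly p 0 *\<^sub>R u"
    using poly_op_pCons[OF pcontr_linear[OF A]] by (cases p) simp
  then show ?thesis using p[of 0] True by (simp add: mult_right_mono)
next
  case False
  let ?r = "onorm A"
  have bA: "bounded_linear A" by (rule sa_bounded[OF pcontr_sa[OF A]])
  have r: "0 < ?r" using False onorm_pos_le[OF bA] by simp
  define B where "B = (\<lambda>u. (1 / ?r) *\<^sub>R A u)"
  have B: "pcontr B"
  proof (rule pcontrI)
    show "spos B" unfolding B_def using r by (intro spos_scaleR spos_pcontr A) simp
    show "norm (B u) \<le> norm u" for u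
      using onorm[OF bA, of u] r by (simp add: B_def divide_le_eq mult.commute)
  qed
  have "poly_op [:0, ?r:] B = A"
    using r by (intro ext) (simp add: poly_op_pCons[OF pcontr_linear[OF B]]
        linear_0[OF pcontr_linear[OF B]] linear_scale[OF pcontr_linear[OF B]], simp add: B_def)
  then have "poly_op p A u = poly_op (pcompose p [:0, ?r:]) B u"
    by (simp add: poly_op_pcompose[OF pcontr_linear[OF B]])
  also have "norm \<dots> \<le> s * norm u"
    by (rule norm_poly_op_pcontr[OF B])
      (use r in \<open>auto simp: poly_pcompose mult_left_le intro!: p\<close>)
  finally show ?thesis .
qed

lemma fc_approx:
  assumes A: "pcontr A" and f: "cont01 f"
    and p: "\<And>x. 0 \<le> x \<Longrightarrow> x \<le> 1 \<Longrightarrow> \<bar>poly p x - f x\<bar> \<le> s"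
  shows "norm (poly_op p A u - fc f A u) \<le> s * norm u"
    and "(\<lambda>n. poly_op (approx_poly f n) A u) \<longlonglongrightarrow> fc f A u"
proof -
  let ?p = "approx_poly f"
  have inv: "(\<lambda>n. 1 / real (Suc n)) \<longlonglongrightarrow> 0" by real_asymp
  have d: "norm (poly_op (?p m) A u - poly_op (?p n) A u) \<le> 2 / real (Suc m) * norm u" if "m \<le> n" for m n
  proof -
    have "norm (poly_op (?p m - ?p n) A u) \<le> 2 / real (Suc m) * norm u"
    proof (rule norm_poly_op_pcontr[OF A])
      fix x :: real assume "0 \<le> x" "x \<le> 1"
      then have "\<bar>poly (?p m) x - f x\<bar> < 1 / real (Suc m)" "\<bar>poly (?p n) x - f x\<bar> < 1 / real (Suc n)"
        using approx_poly[OF f, of x m] approx_poly[OF f, of x n] by auto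
      moreover have "1 / real (Suc n) \<le> 1 / real (Suc m)" using that by (simp add: frac_le)
      moreover have "2 / real (Suc m) = 1 / real (Suc m) + 1 / real (Suc m)" by (simp add: add_divide_distrib[symmetric])
      ultimately show "\<bar>poly (?p m - ?p n) x\<bar> \<le> 2 / real (Suc m)"
        unfolding poly_diff by linarith
    qed
    then show ?thesis by (simp add: poly_op_diff)
  qed
  have "Cauchy (\<lambda>n. poly_op (?p n) A u)"
  proof (rule CauchyI')
    fix e :: real assume "0 < e"
    have "(\<lambda>n. 2 * (1 / real (Suc n)) * norm u) \<longlonglongrightarrow> 2 * 0 * norm u"
      by (intro tendsto_intros inv)
    then have "\<forall>\<^sub>F n in sequentially. 2 * (1 / real (Suc n)) * norm u < e"
      using \<open>0 < e\<close> by (intro order_tendstoD(2)) auto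
    then obtain M where M: "\<And>m. M \<le> m \<Longrightarrow> 2 * (1 / real (Suc m)) * norm u < e"
      by (auto simp: eventually_sequentially)
    show "\<exists>M. \<forall>m\<ge>M. \<forall>n>m. dist (poly_op (?p m) A u) (poly_op (?p n) A u) < e"
    proof (intro exI[of _ M] allI impI)
      fix m n assume "M \<le> m" "m < n"
      then show "dist (poly_op (?p m) A u) (poly_op (?p n) A u) < e"
        using d[of m n] M[of m] by (simp add: dist_norm)
    qed
  qed
  then show l: "(\<lambda>n. poly_op (?p n) A u) \<longlonglongrightarrow> fc f A u"
    unfolding fc_def by (simp add: Cauchy_convergent convergent_LIMSEQ_iff[symmetric])
  have "norm (poly_op p A u - poly_op (?p n) A u) \<le> (s + 1 / real (Suc n)) * norm u" for n
  proof -
    have "norm (poly_op (p - ?p n) A u) \<le> (s + 1 / real (Suc n)) * norm u"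
    proof (rule norm_poly_op_pcontr[OF A])
      fix x :: real assume x: "0 \<le> x" "x \<le> 1"
      then have "\<bar>poly (?p n) x - f x\<bar> < 1 / real (Suc n)" using approx_poly[OF f, of x n] by auto
      with p[OF x] show "\<bar>poly (p - ?p n) x\<bar> \<le> s + 1 / real (Suc n)"
        unfolding poly_diff by linarith
    qed
    then show ?thesis by (simp add: poly_op_diff)
  qed
  moreover have "(\<lambda>n. norm (poly_op p A u - poly_op (?p n) A u)) \<longlonglongrightarrow> norm (poly_op p A u - fc f A u)"
    by (intro tendsto_intros l)
  moreover have "(\<lambda>n. (s + 1 / real (Suc n)) * norm u) \<longlonglongrightarrow> (s + 0) * norm u"
    by (intro tendsto_intros inv)
  ultimately show "norm (poly_op p A u - fc f A u) \<le> s * norm u"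
    using LIMSEQ_le by fastforce
qed

lemma fc_LIMSEQ: "pcontr A \<Longrightarrow> cont01 f \<Longrightarrow> (\<lambda>n. poly_op (approx_poly f n) A u) \<longlonglongrightarrow> fc f A u"
  using fc_approx(2)[of A f "approx_poly f 0" 1] approx_poly[of f _ 0]
  by (simp add: less_imp_le)

lemma fc_eqI:
  assumes A: "pcontr A" and f: "cont01 f"
    and "\<And>e. 0 < e \<Longrightarrow> \<exists>p. (\<forall>x\<in>{0..1}. \<bar>poly p x - f x\<bar> \<le> e) \<and> norm (poly_op p A u - v) \<le> c * e"
  shows "fc f A u = v"
proof -
  have "norm (fc f A u - v) \<le> 0 + e" if e: "0 < e" for e
  proof -
    define d where "d = e / (norm u + \<bar>c\<bar> + 1)"
    have d: "0 < d" using e by (simp add: d_def add_nonneg_pos)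
    obtain p where p: "\<And>x. 0 \<le> x \<Longrightarrow> x \<le> 1 \<Longrightarrow> \<bar>poly p x - f x\<bar> \<le> d" "norm (poly_op p A u - v) \<le> c * d"
      using assms(3)[OF d] that by (metis atLeastAtMost_iff)
    have "norm (fc f A u - v) \<le> norm (poly_op p A u - fc f A u) + norm (poly_op p A u - v)"
      by (metis add_diff_cancel_right' diff_add_cancel norm_minus_commute norm_triangle_ineq add_diff_eq
          add.commute)
    also have "\<dots> \<le> d * norm u + c * d" using fc_approx(1)[OF A f p(1)] p(2) by (simp add: add_mono)
    also have "\<dots> \<le> d * (norm u + \<bar>c\<bar> + 1)"
    proof -
      have "c * d \<le> \<bar>c\<bar> * d" using d by (intro mult_right_mono) auto
      moreover have "d * (norm u + \<bar>c\<bar> + 1) = d * norm u + \<bar>c\<bar> * d + d" by (simp add: algebra_simps)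
      ultimately show ?thesis using d by linarith
    qed
    also have "\<dots> = e" using add_nonneg_pos[of "norm u + \<bar>c\<bar>" 1] by (simp add: d_def)
    finally show ?thesis by simp
  qed
  then have "norm (fc f A u - v) \<le> 0" by (rule field_le_epsilon)
  then show ?thesis by simp
qed

lemma fc_poly:
  assumes A: "pcontr A" and f: "\<And>x. x \<in> {0..1} \<Longrightarrow> f x = poly p x"
  shows "fc f A u = poly_op p A u"
proof (rule fc_eqI[OF A, where c=0])
  show "cont01 f"
    by (rule cont01_cong[OF continuous_on_poly[OF continuous_on_id, of "{0..1}" p]]) (simp add: f)
qed (use f in \<open>auto intro!: exI[of _ p]\<close>)

lemma fc_one: "pcontr A \<Longrightarrow> fc (\<lambda>x. 1) A u = u"
  using fc_poly[of A "\<lambda>x. 1" 1] by simp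

lemma fc_const: "pcontr A \<Longrightarrow> fc (\<lambda>x. c) A u = c *\<^sub>R u"
  using fc_poly[of A "\<lambda>x. c" "[:c:]"] by (simp add: poly_op_const)

lemma fc_id: "pcontr A \<Longrightarrow> fc (\<lambda>x. x) A u = A u"
  using fc_poly[of A "\<lambda>x. x" "[:0, 1:]"] by (simp add: poly_op_X pcontr_linear)

lemma fc_cong: "pcontr A \<Longrightarrow> cont01 g \<Longrightarrow> (\<And>x. 0 \<le> x \<Longrightarrow> x \<le> 1 \<Longrightarrow> f x = g x) \<Longrightarrow> fc f A u = fc g A u"
proof -
  assume A: "pcontr A" and g: "cont01 g" and eq: "\<And>x. 0 \<le> x \<Longrightarrow> x \<le> 1 \<Longrightarrow> f x = g x"
  have f: "cont01 f" by (rule cont01_cong[OF g eq])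
  show ?thesis
  proof (rule fc_eqI[OF A f])
    fix e :: real assume "0 < e"
    then obtain p where p: "\<And>x. x \<in> {0..1} \<Longrightarrow> \<bar>poly p x - g x\<bar> \<le> e"
      using weierstrass_poly[OF g] by (meson less_imp_le)
    then show "\<exists>p. (\<forall>x\<in>{0..1}. \<bar>poly p x - f x\<bar> \<le> e) \<and> norm (poly_op p A u - fc g A u) \<le> norm u * e"
      using fc_approx(1)[OF A g, of p e u] eq by (intro exI[of _ p]) (auto simp: mult.commute)
  qed
qed

lemma norm_fc_le:
  assumes A: "pcontr A" and f: "cont01 f" and le: "\<And>x. 0 \<le> x \<Longrightarrow> x \<le> 1 \<Longrightarrow> \<bar>f x\<bar> \<le> s"
  shows "norm (fc f A u) \<le> s * norm u"
proof (rule LIMSEQ_le)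
  show "(\<lambda>n. norm (poly_op (approx_poly f n) A u)) \<longlonglongrightarrow> norm (fc f A u)"
    by (intro tendsto_norm fc_LIMSEQ A f)
  have "(\<lambda>n. (s + 1 / real (Suc n)) * norm u) \<longlonglongrightarrow> (s + 0) * norm u"
  proof (intro tendsto_intros)
    show "(\<lambda>n. 1 / real (Suc n)) \<longlonglongrightarrow> 0" by real_asymp
  qed
  then show "(\<lambda>n. (s + 1 / real (Suc n)) * norm u) \<longlonglongrightarrow> s * norm u" by simp
  show "\<exists>N. \<forall>n\<ge>N. norm (poly_op (approx_poly f n) A u) \<le> (s + 1 / real (Suc n)) * norm u"
  proof (intro exI allI impI norm_poly_op_pcontr[OF A])
    fix n and x :: real assume x: "0 \<le> x" "x \<le> 1"
    then have "\<bar>poly (approx_poly f n) x - f x\<bar> < 1 / real (Suc n)" using approx_poly[OF f, of x n] by auto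
    with le[OF x] show "\<bar>poly (approx_poly f n) x\<bar> \<le> s + 1 / real (Suc n)" by linarith
  qed
qed

lemma sa_fc: "pcontr A \<Longrightarrow> cont01 f \<Longrightarrow> sa (fc f A)"
  by (rule sa_lim[OF sa_poly_op[OF pcontr_sa] fc_LIMSEQ])

lemma adm_fc: "pcontr A \<Longrightarrow> cont01 f \<Longrightarrow> adm (fc f A)"
  by (simp add: sa_fc sa_adm)

lemma fc_commute:
  assumes A: "pcontr A" and f: "cont01 f"
    and B: "bounded_linear B" "\<And>u. B (A u) = A (B u)"
  shows "B (fc f A u) = fc f A (B u)"
proof -
  have "B (poly_op (approx_poly f n) A u) = poly_op (approx_poly f n) A (B u)" for n
    by (rule poly_op_commute[OF pcontr_linear[OF A] bounded_linear.linear[OF B(1)] B(2)])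
  then have "(\<lambda>n. B (poly_op (approx_poly f n) A u)) \<longlonglongrightarrow> fc f A (B u)"
    using fc_LIMSEQ[OF A f, of "B u"] by simp
  moreover have "(\<lambda>n. B (poly_op (approx_poly f n) A u)) \<longlonglongrightarrow> B (fc f A u)"
    by (rule bounded_linear.tendsto[OF B(1) fc_LIMSEQ[OF A f]])
  ultimately show ?thesis using LIMSEQ_unique by blast
qed

lemma fc_add:
  assumes A: "pcontr A" and f: "cont01 f" and g: "cont01 g"
  shows "fc (\<lambda>x. f x + g x) A u = fc f A u + fc g A u"
proof (rule fc_eqI[OF A continuous_on_add[OF f g]])
  fix e :: real assume "0 < e"
  then have "0 < e / 2" by simp
  then obtain p q where pq: "\<And>x. x \<in> {0..1} \<Longrightarrow> \<bar>poly p x - f x\<bar> \<le> e / 2"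
    "\<And>x. x \<in> {0..1} \<Longrightarrow> \<bar>poly q x - g x\<bar> \<le> e / 2"
    using weierstrass_poly[OF f] weierstrass_poly[OF g] by (meson less_imp_le)
  have "norm (poly_op p A u - fc f A u) \<le> e / 2 * norm u" "norm (poly_op q A u - fc g A u) \<le> e / 2 * norm u"
    by (rule fc_approx(1)[OF A f] fc_approx(1)[OF A g]; use pq in force)+
  then have "norm (poly_op (p + q) A u - (fc f A u + fc g A u)) \<le> norm u * e"
    using norm_triangle_ineq[of "poly_op p A u - fc f A u" "poly_op q A u - fc g A u"]
    by (simp add: poly_op_add algebra_simps)
  moreover have "\<bar>poly (p + q) x - (f x + g x)\<bar> \<le> e" if "x \<in> {0..1}" for x
    using pq[OF that] unfolding poly_add by linarith
  ultimately show "\<exists>p. (\<forall>x\<in>{0..1}. \<bar>poly p x - (f x + g x)\<bar> \<le> e)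
      \<and> norm (poly_op p A u - (fc f A u + fc g A u)) \<le> norm u * e" by blast
qed

lemma fc_mult:
  assumes A: "pcontr A" and f: "cont01 f" and g: "cont01 g"
  shows "fc (\<lambda>x. f x * g x) A u = fc f A (fc g A u)"
proof -
  obtain K where K: "\<And>x. x \<in> {0..1} \<Longrightarrow> \<bar>f x\<bar> \<le> K" "\<And>x. x \<in> {0..1} \<Longrightarrow> \<bar>g x\<bar> \<le> K"
  proof -
    have "bounded (f ` {0..1})" "bounded (g ` {0..1})"
      using compact_continuous_image[OF f] compact_continuous_image[OF g] compact_imp_bounded by auto
    then obtain K1 K2 where "\<And>x. x \<in> {0..1} \<Longrightarrow> \<bar>f x\<bar> \<le> K1" "\<And>x. x \<in> {0..1} \<Longrightarrow> \<bar>g x\<bar> \<le> K2"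
      unfolding bounded_iff by (metis imageI real_norm_def)
    then show thesis by (intro that[of "max K1 K2"]) (auto simp: le_max_iff_disj)
  qed
  have K0: "0 \<le> K" using K(1)[of 0] by simp
  have fg: "cont01 (\<lambda>x. f x * g x)" by (intro continuous_intros f g)
  have bf: "bounded_linear (fc f A)" by (rule sa_bounded[OF sa_fc[OF A f]])
  let ?c = "K * norm u + (K + 1) * norm u"
  show ?thesis
  proof (rule fc_eqI[OF A fg])
    fix e :: real assume e: "0 < e"
    define d where "d = min 1 (e / (2 * K + 1))"
    have d: "0 < d" "d \<le> 1" "d * (2 * K + 1) \<le> e"
    proof -
      have "d \<le> e / (2 * K + 1)" by (simp add: d_def)
      then show "d * (2 * K + 1) \<le> e" using K0 by (simp add: pos_le_divide_eq)
    qed (use e K0 in \<open>auto simp: d_def\<close>)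
    obtain p q where pq: "\<And>x. x \<in> {0..1} \<Longrightarrow> \<bar>poly p x - f x\<bar> \<le> d"
      "\<And>x. x \<in> {0..1} \<Longrightarrow> \<bar>poly q x - g x\<bar> \<le> d"
      using weierstrass_poly[OF f d(1)] weierstrass_poly[OF g d(1)] by (meson less_imp_le)
    have le: "\<bar>poly (p * q) x - f x * g x\<bar> \<le> e" if x: "x \<in> {0..1}" for x
    proof -
      have "poly (p * q) x - f x * g x = (poly p x - f x) * (poly q x - g x)
          + (poly p x - f x) * g x + f x * (poly q x - g x)" by (simp add: algebra_simps)
      also have "\<bar>\<dots>\<bar> \<le> d * d + d * K + K * d"
        by (intro order_trans[OF abs_triangle_ineq] add_mono)
          (auto simp: abs_mult K0 intro!: mult_mono pq[OF x] K[OF x] d(1)[THEN less_imp_le])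
      also have "\<dots> \<le> d * 1 + d * K + K * d" using d K0 by (intro add_mono mult_left_mono) auto
      also have "\<dots> \<le> e" using d(3) by (simp add: algebra_simps)
      finally show ?thesis .
    qed
    have "norm (poly_op p A (poly_op q A u) - fc f A (fc g A u)) \<le> ?c * d"
    proof -
      have "norm (poly_op q A u) \<le> (K + 1) * norm u"
      proof (rule norm_poly_op_pcontr[OF A])
        fix x :: real assume "0 \<le> x" "x \<le> 1"
        then have "\<bar>poly q x - g x\<bar> \<le> d" "\<bar>g x\<bar> \<le> K" using pq K by auto
        then show "\<bar>poly q x\<bar> \<le> K + 1" using d by linarith
      qed
      moreover have "norm (poly_op p A (poly_op q A u) - fc f A (poly_op q A u)) \<le> d * norm (poly_op q A u)"
        using pq by (intro fc_approx(1)[OF A f]) auto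
      ultimately have 1: "norm (poly_op p A (poly_op q A u) - fc f A (poly_op q A u)) \<le> d * ((K + 1) * norm u)"
        using d(1) by (meson mult_left_mono order_trans less_imp_le)
      have "norm (poly_op q A u - fc g A u) \<le> d * norm u"
        using pq by (intro fc_approx(1)[OF A g]) auto
      then have "K * norm (poly_op q A u - fc g A u) \<le> K * (d * norm u)"
        using K0 by (rule mult_left_mono)
      moreover have "norm (fc f A (poly_op q A u - fc g A u)) \<le> K * norm (poly_op q A u - fc g A u)"
        using K by (intro norm_fc_le[OF A f]) auto
      ultimately have 2: "norm (fc f A (poly_op q A u) - fc f A (fc g A u)) \<le> K * (d * norm u)"
        by (simp add: linear_diff[OF bounded_linear.linear[OF bf]])
      from norm_triangle_ineq[of "poly_op p A (poly_op q A u) - fc f A (poly_op q A u)"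
          "fc f A (poly_op q A u) - fc f A (fc g A u)"] 1 2
      show ?thesis by (simp add: algebra_simps)
    qed
    also have "?c * d \<le> ?c * e"
    proof (rule mult_left_mono)
      have "d * 1 \<le> d * (2 * K + 1)" using d K0 by (intro mult_left_mono) auto
      then show "d \<le> e" using d(3) by linarith
    qed (use K0 in auto)
    finally show "\<exists>p. (\<forall>x\<in>{0..1}. \<bar>poly p x - f x * g x\<bar> \<le> e)
        \<and> norm (poly_op p A u - fc f A (fc g A u)) \<le> ?c * e"
      using le by (intro exI[of _ "p * q"]) (simp add: poly_op_mult[OF pcontr_linear[OF A]])
  qed
qed

lemma fc_scaleR: "pcontr A \<Longrightarrow> cont01 f \<Longrightarrow> fc (\<lambda>x. c * f x) A u = c *\<^sub>R fc f A u"
  using fc_mult[of A "\<lambda>x. c" f u] by (simp add: fc_const continuous_on_const)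

lemma fc_diff:
  assumes "pcontr A" "cont01 f" "cont01 g"
  shows "fc (\<lambda>x. f x - g x) A u = fc f A u - fc g A u"
  using fc_add[OF assms(1,2), of "\<lambda>x. - 1 * g x" u] fc_scaleR[OF assms(1,3), of "- 1" u] assms(3)
  by (simp add: continuous_on_minus)

lemma fc_swap: "pcontr A \<Longrightarrow> cont01 f \<Longrightarrow> cont01 g \<Longrightarrow> fc f A (fc g A u) = fc g A (fc f A u)"
  by (simp add: fc_mult[symmetric] mult.commute)

text \<open>With \<open>h = sqrt (g\<^sup>2 - f\<^sup>2)\<close> the square of \<open>g(A) u\<close> is the sum of those of \<open>f(A) u\<close> and \<open>h(A) u\<close>.\<close>

lemma norm_fc_mono:
  assumes A: "pcontr A" and f: "cont01 f" and g: "cont01 g"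
    and le: "\<And>x. 0 \<le> x \<Longrightarrow> x \<le> 1 \<Longrightarrow> \<bar>f x\<bar> \<le> \<bar>g x\<bar>"
  shows "norm (fc f A u) \<le> norm (fc g A u)"
proof -
  define h where "h = (\<lambda>x. sqrt ((g x)\<^sup>2 - (f x)\<^sup>2))"
  have h: "cont01 h" unfolding h_def by (intro continuous_intros f g)
  have hh: "h x * h x = g x * g x - f x * f x" if "0 \<le> x" "x \<le> 1" for x
    using le[OF that] by (simp add: h_def abs_le_square_iff power2_eq_square)
  have sq: "ip E (fc k A u) (fc k A u) = ip E u (fc (\<lambda>x. k x * k x) A u)" if "cont01 k" for k
    by (simp add: fc_mult[OF A that that] sa_ip[OF sa_fc[OF A that]])
  have "fc (\<lambda>x. f x * f x) A u + fc (\<lambda>x. h x * h x) A u = fc (\<lambda>x. g x * g x) A u"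
  proof -
    have "fc (\<lambda>x. f x * f x) A u + fc (\<lambda>x. h x * h x) A u = fc (\<lambda>x. f x * f x + h x * h x) A u"
      by (rule fc_add[OF A, symmetric]) (intro continuous_intros f h)+
    also have "\<dots> = fc (\<lambda>x. g x * g x) A u"
      by (rule fc_cong[OF A]) (auto simp: hh intro!: continuous_intros g)
    finally show ?thesis .
  qed
  then have "ip E (fc f A u) (fc f A u) + ip E (fc h A u) (fc h A u) = ip E (fc g A u) (fc g A u)"
    by (simp add: sq f g h ip_add_right[symmetric])
  then show ?thesis
    using norm_ip_self_mono[of "fc f A u" "fc h A u"] by (simp add: norm_ip_self)
qed

lemma pcontr_fc:
  assumes A: "pcontr A" and f: "cont01 f" and le: "\<And>x. 0 \<le> x \<Longrightarrow> x \<le> 1 \<Longrightarrow> 0 \<le> f x \<and> f x \<le> 1"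
  shows "pcontr (fc f A)"
  unfolding pcontr_def
proof (intro conjI allI sa_fc A f)
  fix u
  have "fc (\<lambda>x. 2 * f x - 1) A u = 2 *\<^sub>R fc f A u - u"
    using fc_diff[OF A continuous_on_mult[OF continuous_on_const f] continuous_on_const, of 2 1 u]
    by (simp add: fc_scaleR A f fc_one)
  moreover have "norm (fc (\<lambda>x. 2 * f x - 1) A u) \<le> 1 * norm u"
    by (rule norm_fc_le[OF A]) (use le in \<open>auto simp: abs_le_iff intro!: continuous_intros f\<close>)
  ultimately show "norm (2 *\<^sub>R fc f A u - u) \<le> norm u" by simp
qed

lemma onorm_pcontr_le_1: "pcontr A \<Longrightarrow> onorm A \<le> 1"
  by (rule onorm_bound) (simp_all add: pcontr_norm_le)

text \<open>
  In \<open>fun_calc\<close> the polynomials approximate \<open>f\<close> only on \<open>[0, \<parallel>A\<parallel>]\<close>; by \<open>norm_poly_op_onorm\<close> this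
  determines the operator.
\<close>

theorem fun_calc_eq_fc:
  assumes A: "pcontr A" and f: "cont01 f"
  shows "fun_calc f A = fc f A"
  unfolding fun_calc_def
proof (rule the_equality)
  have bp: "bounded_linear (poly_op p A)" for p
    by (rule sa_bounded[OF sa_poly_op[OF pcontr_sa[OF A]]])
  have bf: "bounded_linear (fc f A)" by (rule sa_bounded[OF sa_fc[OF A f]])
  have ex: "\<exists>p. (\<forall>x\<in>{0..onorm A}. \<bar>poly p x - f x\<bar> < e) \<and> onorm (\<lambda>v. poly_op p A v - fc f A v) < e"
    if "0 < e" for e
  proof -
    have e: "0 < e / 2" using that by simp
    obtain p where p: "\<And>x. x \<in> {0..1} \<Longrightarrow> \<bar>poly p x - f x\<bar> < e / 2"
      using weierstrass_poly[OF f e] by blast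
    have "onorm (\<lambda>v. poly_op p A v - fc f A v) \<le> e / 2"
    proof (rule onorm_bound)
      show "norm (poly_op p A v - fc f A v) \<le> e / 2 * norm v" for v
        by (rule fc_approx(1)[OF A f]) (use p in \<open>force intro: less_imp_le\<close>)
    qed (use e in simp)
    moreover have "\<bar>poly p x - f x\<bar> < e" if "x \<in> {0..onorm A}" for x
      using p[of x] that onorm_pcontr_le_1[OF A] e by fastforce
    ultimately show ?thesis using that by (intro exI[of _ p]) auto
  qed
  then show "bounded_linear (fc f A) \<and> (\<forall>\<epsilon>>0. \<exists>p. (\<forall>x\<in>{0..onorm A}. \<bar>poly p x - f x\<bar> < \<epsilon>)
      \<and> onorm (\<lambda>v. poly_op p A v - fc f A v) < \<epsilon>)" using bf by blast
  fix T assume T: "bounded_linear T \<and> (\<forall>\<epsilon>>0. \<exists>p. (\<forall>x\<in>{0..onorm A}. \<bar>poly p x - f x\<bar> < \<epsilon>)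
      \<and> onorm (\<lambda>v. poly_op p A v - T v) < \<epsilon>)"
  show "T = fc f A"
  proof
    fix u
    have "norm (T u - fc f A u) \<le> 0 + e" if "0 < e" for e
    proof -
      define d where "d = e / (4 * (norm u + 1))"
      have d: "0 < d" using that by (simp add: d_def add_nonneg_pos)
      obtain p where p: "\<And>x. x \<in> {0..onorm A} \<Longrightarrow> \<bar>poly p x - f x\<bar> < d" "onorm (\<lambda>v. poly_op p A v - T v) < d"
        using T d by blast
      obtain q where q: "\<And>x. x \<in> {0..onorm A} \<Longrightarrow> \<bar>poly q x - f x\<bar> < d" "onorm (\<lambda>v. poly_op q A v - fc f A v) < d"
        using ex[OF d] by blast
      have "norm (poly_op (p - q) A u) \<le> (2 * d) * norm u"
      proof (rule norm_poly_op_onorm[OF A])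
        fix x assume "0 \<le> x" "x \<le> onorm A"
        then show "\<bar>poly (p - q) x\<bar> \<le> 2 * d" using p(1)[of x] q(1)[of x] by simp
      qed
      moreover have "norm (poly_op p A u - T u) \<le> d * norm u"
        using order_trans[OF onorm[OF bounded_linear_sub[OF bp[of p], of T], of u]] T p(2)
        by (simp add: mult_right_mono)
      moreover have "norm (poly_op q A u - fc f A u) \<le> d * norm u"
        using order_trans[OF onorm[OF bounded_linear_sub[OF bp[of q] bf], of u]] q(2)
        by (simp add: mult_right_mono)
      moreover have "norm (T u - fc f A u)
          = norm (- (poly_op p A u - T u) + poly_op (p - q) A u + (poly_op q A u - fc f A u))"
        by (simp add: poly_op_diff)
      ultimately have "norm (T u - fc f A u) \<le> d * norm u + (2 * d) * norm u + d * norm u"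
        using norm_triangle_ineq[of "- (poly_op p A u - T u) + poly_op (p - q) A u" "poly_op q A u - fc f A u"]
          norm_triangle_ineq[of "- (poly_op p A u - T u)" "poly_op (p - q) A u"]
        unfolding norm_minus_cancel by linarith
      also have "\<dots> \<le> d * (4 * (norm u + 1))" using d by (simp add: algebra_simps)
      also have "\<dots> = e" using add_nonneg_pos[of "norm u" 1] by (simp add: d_def)
      finally show ?thesis by simp
    qed
    then have "norm (T u - fc f A u) \<le> 0" by (rule field_le_epsilon)
    then show "T u = fc f A u" by simp
  qed
qed

end

section \<open>Regular operators and the bounded transform\<close>

lemma subspace_closure:
  fixes S :: "'a::real_normed_vector set"
  assumes "subspace S"
  shows "subspace (closure S)"
proof (rule subspaceI)
  show "0 \<in> closure S" using closure_subset subspace_0[OF assms] by blast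
  fix x y and c :: real
  assume "x \<in> closure S"
  then obtain a where a: "\<And>n::nat. a n \<in> S" "a \<longlonglongrightarrow> x" unfolding closure_sequential by blast
  have "(\<lambda>n. c *\<^sub>R a n) \<longlonglongrightarrow> c *\<^sub>R x" by (intro tendsto_intros a)
  moreover have "c *\<^sub>R a n \<in> S" for n by (rule subspace_scale[OF assms a(1)])
  ultimately show "c *\<^sub>R x \<in> closure S" unfolding closure_sequential by meson
  assume "y \<in> closure S"
  then obtain b where b: "\<And>n::nat. b n \<in> S" "b \<longlonglongrightarrow> y" unfolding closure_sequential by blast
  have "(\<lambda>n. a n + b n) \<longlonglongrightarrow> x + y" by (intro tendsto_intros a b)
  moreover have "a n + b n \<in> S" for n by (rule subspace_add[OF assms a(1) b(1)])
  ultimately show "x + y \<in> closure S" unfolding closure_sequential by meson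
qed

text \<open>The graph of the extension is the closure of the span of \<open>S\<close>, on which the bound persists.\<close>

lemma dense_extension:
  fixes S :: "('m::banach \<times> 'n::banach) set"
  assumes bound: "\<And>u v. (u, v) \<in> span S \<Longrightarrow> norm v \<le> C * norm u"
    and dense: "closure (span (fst ` S)) = UNIV"
  shows "\<exists>R. bounded_linear R \<and> (\<forall>(u, v)\<in>S. R u = v) \<and> (\<forall>u. norm (R u) \<le> C * norm u)"
proof -
  let ?\<Gamma> = "closure (span S)"
  have sub: "subspace ?\<Gamma>" by (rule subspace_closure[OF subspace_span])
  have bd: "norm v \<le> C * norm u" if "(u, v) \<in> ?\<Gamma>" for u v
  proof -
    obtain p where p: "\<And>n::nat. p n \<in> span S" "p \<longlonglongrightarrow> (u, v)"
      using \<open>(u, v) \<in> ?\<Gamma>\<close> unfolding closure_sequential by blast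
    have "norm (snd (p n)) \<le> C * norm (fst (p n))" for n using bound[of "fst (p n)" "snd (p n)"] p(1) by simp
    moreover have "(\<lambda>n. norm (snd (p n))) \<longlonglongrightarrow> norm v" "(\<lambda>n. C * norm (fst (p n))) \<longlonglongrightarrow> C * norm u"
      using tendsto_fst[OF p(2)] tendsto_snd[OF p(2)] by (auto intro!: tendsto_intros)
    ultimately show ?thesis using LIMSEQ_le by blast
  qed
  have ex: "\<exists>v. (u, v) \<in> ?\<Gamma>" for u
  proof -
    have "u \<in> closure (span (fst ` S))" using dense by simp
    then obtain a where a: "\<And>n::nat. a n \<in> span (fst ` S)" "a \<longlonglongrightarrow> u"
      unfolding closure_sequential by blast
    have "span (fst ` S) = fst ` span S"
      by (rule linear_span_image[symmetric, OF bounded_linear.linear[OF bounded_linear_fst], symmetric])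
    then have "\<forall>n. \<exists>b. (a n, b) \<in> span S" using a(1) by force
    then obtain b where b: "\<And>n. (a n, b n) \<in> span S" by metis
    have "norm (b m - b n) \<le> norm (C *\<^sub>R a m - C *\<^sub>R a n)" for m n
    proof -
      have "(a m, b m) - (a n, b n) \<in> span S" by (intro span_diff b)
      then have 1: "norm (b m - b n) \<le> C * norm (a m - a n)" using bound by simp
      then show ?thesis by (simp add: scaleR_diff_right[symmetric])
        (metis abs_ge_self mult_right_mono norm_ge_zero order_trans)
    qed
    moreover have "Cauchy (\<lambda>n. C *\<^sub>R a n)" by (rule LIMSEQ_imp_Cauchy[OF tendsto_scaleR[OF tendsto_const a(2)]])
    ultimately have "Cauchy b" unfolding Cauchy_def dist_norm by (meson le_less_trans)
    then obtain v where "b \<longlonglongrightarrow> v" by (meson Cauchy_convergent convergentD)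
    then have "(\<lambda>n. (a n, b n)) \<longlonglongrightarrow> (u, v)" by (intro tendsto_Pair a)
    then show ?thesis unfolding closure_sequential
      by (intro exI[of _ v] exI[of _ "\<lambda>n. (a n, b n)"] conjI allI b)
  qed
  then obtain R where R: "\<And>u. (u, R u) \<in> ?\<Gamma>" by metis
  have uniq: "R u = v" if "(u, v) \<in> ?\<Gamma>" for u v
  proof -
    have "(u, R u) - (u, v) \<in> ?\<Gamma>" by (intro subspace_diff[OF sub] R that)
    then show ?thesis using bd[of 0 "R u - v"] by simp
  qed
  have "bounded_linear R"
  proof (rule bounded_linear_intro[where K=C])
    show "R (x + y) = R x + R y" for x y
      using subspace_add[OF sub R[of x] R[of y]] by (intro uniq) simp
    show "R (r *\<^sub>R x) = r *\<^sub>R R x" for r x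
      using subspace_scale[OF sub R[of x], of r] by (intro uniq) simp
    show "norm (R x) \<le> norm x * C" for x using bd[OF R[of x]] by (simp add: mult.commute)
  qed
  moreover have "R u = v" if "(u, v) \<in> S" for u v
    by (rule uniq) (use that span_base closure_subset in blast)
  ultimately show ?thesis using bd[OF R] by blast
qed

lemma total_ext:
  fixes f g :: "'m::complex_banach \<Rightarrow> 'n::real_normed_vector"
  assumes "bounded_linear f" "bounded_linear g" "total_set X" "\<And>x. x \<in> X \<Longrightarrow> f x = g x"
  shows "f u = g u"
proof -
  have "u \<in> closure (span X)" using assms(3) by (simp add: total_set_def)
  then obtain a where a: "\<And>n::nat. a n \<in> span X" "a \<longlonglongrightarrow> u" unfolding closure_sequential by blast
  have "f x = g x" if "x \<in> span X" for x
    by (rule linear_eq_on[OF assms(1,2)[THEN bounded_linear.linear] that assms(4)])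
  moreover have "(\<lambda>n. f (a n)) \<longlonglongrightarrow> f u" "(\<lambda>n. g (a n)) \<longlonglongrightarrow> g u"
    by (intro bounded_linear.tendsto[OF assms(1)] bounded_linear.tendsto[OF assms(2)] a)+
  ultimately show ?thesis using a(1) LIMSEQ_unique by simp
qed

lemma ip_total_ext:
  assumes "hmod E" "hmod F" "bounded_linear S" "bounded_linear T" "total_set X" "total_set Y"
    and "\<And>x y. x \<in> X \<Longrightarrow> y \<in> Y \<Longrightarrow> ip F (S x) y = ip E x (T y)"
  shows "ip F (S u) v = ip E u (T v)"
proof -
  interpret E: hmod E by fact
  interpret F: hmod F by fact
  have "ip F (S u) y = ip E u (T y)" if "y \<in> Y" for y
    by (rule total_ext[OF bounded_linear_compose[OF F.bounded_linear_ip_left assms(3)] E.bounded_linear_ip_left assms(5)])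
      (rule assms(7)[OF _ that])
  then show ?thesis
    using total_ext[where f="ip F (S u)" and g="\<lambda>y. ip E u (T y)" and X=Y and u=v,
        OF F.bounded_linear_ip_right bounded_linear_compose[OF E.bounded_linear_ip_right assms(4)] assms(6)]
    by blast
qed

lemma op_addI: "(x, y) \<in> S \<Longrightarrow> (x, z) \<in> T \<Longrightarrow> (x, y + z) \<in> S \<oplus> T"
  by (auto simp: op_add_def)

lemma op_diffI: "(x, y) \<in> S \<Longrightarrow> (x, z) \<in> T \<Longrightarrow> (x, y - z) \<in> S \<ominus> T"
  by (auto simp: op_diff_def)

lemma gr_iff: "(x, y) \<in> gr f \<longleftrightarrow> y = f x"
  by (auto simp: gr_def)

lemma regularD:
  assumes "regular E T"
  shows "single_valued T" "(0, 0) \<in> T"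
    "(x, y) \<in> T \<Longrightarrow> (x', y') \<in> T \<Longrightarrow> (x + x', y + y') \<in> T"
    "(x, y) \<in> T \<Longrightarrow> (c *\<^sub>C x, c *\<^sub>C y) \<in> T"
    "(x, y) \<in> T \<Longrightarrow> (act E x b, act E y b) \<in> T"
    "closed T" "closure (Domain T) = UNIV" "closure (Domain (op_adjoint E T)) = UNIV"
    "closure (Range (Id \<oplus> op_adjoint E T \<odot> T)) = UNIV"
  using assms unfolding regular_def by blast+

lemma regular_diff:
  assumes "regular E T" "(x, y) \<in> T" "(x', y') \<in> T"
  shows "(x - x', y - y') \<in> T"
proof -
  have "(x + (- 1) *\<^sub>C x', y + (- 1) *\<^sub>C y') \<in> T"
    by (intro regularD(3,4)[OF assms(1)] assms)
  then show ?thesis by simp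
qed

lemma op_adjointI: "(\<And>x w. (x, w) \<in> T \<Longrightarrow> ip E w y = ip E x z) \<Longrightarrow> (y, z) \<in> op_adjoint E T"
  by (auto simp: op_adjoint_def)

lemma op_adjointD: "(y, z) \<in> op_adjoint E T \<Longrightarrow> (x, w) \<in> T \<Longrightarrow> ip E w y = ip E x z"
  by (auto simp: op_adjoint_def)

context hmod
begin

lemma op_adjoint_diff:
  "(y, z) \<in> op_adjoint E T \<Longrightarrow> (y', z') \<in> op_adjoint E T \<Longrightarrow> (y - y', z - z') \<in> op_adjoint E T"
  by (rule op_adjointI) (simp add: ip_diff_right op_adjointD)

lemma op_adjoint_closed:
  assumes "\<And>n. (y n, z n) \<in> op_adjoint E T" "y \<longlonglongrightarrow> y'" "z \<longlonglongrightarrow> z'"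
  shows "(y', z') \<in> op_adjoint E T"
proof (rule op_adjointI)
  fix x w assume "(x, w) \<in> T"
  then have "ip E w (y n) = ip E x (z n)" for n by (rule op_adjointD[OF assms(1)])
  moreover have "(\<lambda>n. ip E w (y n)) \<longlonglongrightarrow> ip E w y'" "(\<lambda>n. ip E x (z n)) \<longlonglongrightarrow> ip E x z'"
    by (auto intro: bounded_linear.tendsto[OF bounded_linear_ip_right] assms)
  ultimately show "ip E w y' = ip E x z'" using LIMSEQ_unique by simp
qed

lemma Cauchy_dominated:
  fixes f :: "nat \<Rightarrow> 'x::real_normed_vector" and g :: "nat \<Rightarrow> 'y::real_normed_vector"
  assumes "Cauchy g" "\<And>m n. norm (f m - f n) \<le> norm (g m - g n)"
  shows "Cauchy f"
  using assms unfolding Cauchy_def dist_norm by (meson le_less_trans)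

text \<open>
  The resolvent \<open>(1 + T\<^sup>*T)\<^sup>-\<^sup>1\<close> of a regular operator.  For \<open>w = u + T\<^sup>*T u\<close> the inner product
  \<open>\<langle>u | w\<rangle>\<close> is the sum of the squares of \<open>u\<close> and \<open>T u\<close>, so both are dominated by \<open>w\<close>, and the
  dense range of \<open>1 + T\<^sup>*T\<close> is closed.
\<close>

lemma regular_graph_bounds:
  assumes "(u, v) \<in> T" "(v, w - u) \<in> op_adjoint E T"
  shows "norm u \<le> norm w" "norm v \<le> norm w"
proof -
  have uw: "ip E u w = ip E u u + ip E v v"
    using op_adjointD[OF assms(2,1)] by (simp add: ip_diff_right)
  have "(norm u)\<^sup>2 \<le> norm (ip E u u + ip E v v)"
    using power_mono[OF norm_ip_self_mono[of u v], of 2] by simp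
  also have "\<dots> \<le> norm u * norm w" unfolding uw[symmetric] by (rule cauchy_schwarz)
  finally show u: "norm u \<le> norm w"
    by (cases "u = 0") (auto simp: power2_eq_square)
  have "(norm v)\<^sup>2 \<le> norm (ip E u u + ip E v v)"
    using power_mono[OF norm_ip_self_mono[of v u], of 2] by (simp add: add.commute)
  also have "\<dots> \<le> norm u * norm w" unfolding uw[symmetric] by (rule cauchy_schwarz)
  also have "\<dots> \<le> (norm w)\<^sup>2" using u by (simp add: power2_eq_square mult_right_mono)
  finally show "norm v \<le> norm w" by (rule power2_le_imp_le) simp
qed

lemma regular_resolvent:
  assumes reg: "regular E T"
  obtains Q H where "pcontr Q" "adm H" "\<And>w. (Q w, H w) \<in> T"
    "\<And>w. (H w, w - Q w) \<in> op_adjoint E T"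
    "\<And>u v w. (u, v) \<in> T \<Longrightarrow> (v, w - u) \<in> op_adjoint E T \<Longrightarrow> Q w = u"
proof -
  let ?P = "\<lambda>w u v. (u, v) \<in> T \<and> (v, w - u) \<in> op_adjoint E T"
  have diff: "?P (w - w') (u - u') (v - v')" if "?P w u v" "?P w' u' v'" for w u v w' u' v'
    using regular_diff[OF reg, of u v u' v'] op_adjoint_diff[of v "w - u" T v' "w' - u'"] that
    by (simp add: algebra_simps)
  have "\<exists>u v. ?P w u v" for w
  proof -
    have "w \<in> closure (Range (Id \<oplus> op_adjoint E T \<odot> T))" using regularD(9)[OF reg] by simp
    then obtain wn where wn: "\<And>n::nat. wn n \<in> Range (Id \<oplus> op_adjoint E T \<odot> T)" "wn \<longlonglongrightarrow> w"
      unfolding closure_sequential by blast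
    have "\<exists>u v. ?P (wn n) u v" for n
      using wn(1)[of n] by (fastforce simp: op_add_def relcomp_unfold)
    then obtain un vn where P: "\<And>n. ?P (wn n) (un n) (vn n)" by metis
    have cw: "Cauchy wn" using wn(2) by (rule LIMSEQ_imp_Cauchy)
    have d: "?P (wn m - wn n) (un m - un n) (vn m - vn n)" for m n by (rule diff[OF P P])
    have "norm (un m - un n) \<le> norm (wn m - wn n)" "norm (vn m - vn n) \<le> norm (wn m - wn n)" for m n
      using regular_graph_bounds[of "un m - un n" "vn m - vn n" T "wn m - wn n"] d by blast+
    then have "Cauchy un" "Cauchy vn" using Cauchy_dominated[OF cw] by blast+
    then obtain u v where uv: "un \<longlonglongrightarrow> u" "vn \<longlonglongrightarrow> v"
      by (meson Cauchy_convergent convergentD)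
    have "(\<lambda>n. (un n, vn n)) \<longlonglongrightarrow> (u, v)" by (intro tendsto_Pair uv)
    then have "(u, v) \<in> T"
      using closed_sequentially[OF regularD(6)[OF reg], of "\<lambda>n. (un n, vn n)"] P by blast
    moreover have "(v, w - u) \<in> op_adjoint E T"
      by (rule op_adjoint_closed[of vn "\<lambda>n. wn n - un n"]) (use P in \<open>auto intro!: tendsto_diff uv wn(2)\<close>)
    ultimately show ?thesis by blast
  qed
  then obtain Q H where QH: "\<And>w. ?P w (Q w) (H w)" by metis
  have uniq: "Q w = u \<and> H w = v" if "?P w u v" for w u v
    using regular_graph_bounds[of "Q w - u" "H w - v" T "w - w"] diff[OF QH[of w] that] by simp
  have bd: "norm (Q w) \<le> norm w" "norm (H w) \<le> norm w" for w
    using regular_graph_bounds[of "Q w" "H w" T w] QH by auto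
  have ipQ: "ip E (Q w) w' = ip E (Q w) (Q w') + ip E (H w) (H w')" for w w'
    using op_adjointD[of "H w'" "w' - Q w'" E T "Q w" "H w"] QH[of w] QH[of w'] by (simp add: ip_diff_right)
  have sQ: "sa Q"
    unfolding sa_def
  proof (intro allI)
    fix w w'
    have "ip E w (Q w') = star (ip E (Q w') w)" by (simp add: star_ip)
    also have "\<dots> = ip E (Q w) w'"
      by (simp only: ipQ[of w' w] ipQ[of w w'] star_add star_ip)
    finally show "ip E (Q w) w' = ip E w (Q w')" by simp
  qed
  have pQ: "pcontr Q"
    unfolding pcontr_def
  proof (intro conjI allI sQ)
    fix w
    let ?u = "Q w" and ?v = "H w" and ?z = "w - Q w"
    have uz: "ip E ?u ?z = ip E ?v ?v" using op_adjointD[of ?v ?z E T ?u ?v] QH[of w] by simp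
    then have zu: "ip E ?z ?u = ip E ?v ?v" by (metis star_ip)
    \<comment> \<open>As \<open>\<langle>u | z\<rangle> = \<langle>v | v\<rangle>\<close>, the square of \<open>u + z\<close> exceeds that of \<open>u - z\<close> by the square of \<open>2 v\<close>.\<close>
    have "w = ?u + ?z" by simp
    then have "ip E w w = ip E (?u + ?z) (?u + ?z)" by metis
    also have "\<dots> = ip E (?u - ?z) (?u - ?z) + ip E (2 *\<^sub>R ?v) (2 *\<^sub>R ?v)"
      unfolding ip_add_left ip_add_right[of _ ?u ?z] ip_diff_left[of ?u ?z] ip_diff_right[of _ ?u ?z] uz zu
      by (simp only: scaleR_2) (simp add: ip_add_left ip_add_right algebra_simps)
    finally have "norm (?u - ?z) \<le> norm w"
      using norm_ip_self_mono[of "?u - ?z" "2 *\<^sub>R ?v"] norm_ip_self[of w] by simp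
    moreover have "2 *\<^sub>R Q w - w = ?u - ?z" by (simp add: scaleR_2)
    ultimately show "norm (2 *\<^sub>R Q w - w) \<le> norm w" by (simp only:)
  qed
  have lQ: "bounded_linear Q" by (rule sa_bounded[OF sQ])
  \<comment> \<open>The adjoint of \<open>H = T Q\<close> is the continuous extension of \<open>Q T\<^sup>*\<close> from the dense domain of \<open>T\<^sup>*\<close>.\<close>
  have adj: "\<exists>s. \<forall>w. ip E (H w) y = ip E w s" for y
  proof -
    have "y \<in> closure (Domain (op_adjoint E T))" using regularD(8)[OF reg] by simp
    then obtain yn where yn: "\<And>n::nat. yn n \<in> Domain (op_adjoint E T)" "yn \<longlonglongrightarrow> y"
      unfolding closure_sequential by blast
    then obtain zn where zn: "\<And>n. (yn n, zn n) \<in> op_adjoint E T" by (meson DomainE)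
    have ipn: "ip E (H w) y' = ip E w (Q z')" if "(y', z') \<in> op_adjoint E T" for w y' z'
      using op_adjointD[OF that, of "Q w" "H w"] QH[of w] by (simp add: sa_ip[OF sQ])
    have "norm (Q (zn m) - Q (zn n)) \<le> norm (yn m - yn n)" for m n
    proof -
      let ?y = "yn m - yn n" and ?z = "zn m - zn n"
      have "(norm (Q ?z))\<^sup>2 = norm (ip E (H (Q ?z)) ?y)"
        unfolding ipn[OF op_adjoint_diff[OF zn[of m] zn[of n]]] norm_ip_self[symmetric] sa_ip[OF sQ, symmetric] ..
      also have "\<dots> \<le> norm (Q ?z) * norm ?y"
        by (rule order_trans[OF cauchy_schwarz mult_right_mono[OF bd(2)]]) simp
      finally have "norm (Q ?z) \<le> norm ?y"
        by (cases "Q ?z = 0") (auto simp: power2_eq_square)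
      then show ?thesis by (simp add: linear_diff[OF bounded_linear.linear[OF lQ]])
    qed
    with LIMSEQ_imp_Cauchy[OF yn(2)] have "Cauchy (\<lambda>n. Q (zn n))" by (rule Cauchy_dominated)
    then obtain s where s: "(\<lambda>n. Q (zn n)) \<longlonglongrightarrow> s" by (meson Cauchy_convergent convergentD)
    have "ip E (H w) y = ip E w s" for w
    proof -
      have "(\<lambda>n. ip E (H w) (yn n)) \<longlonglongrightarrow> ip E (H w) y" "(\<lambda>n. ip E w (Q (zn n))) \<longlonglongrightarrow> ip E w s"
        by (auto intro: bounded_linear.tendsto[OF bounded_linear_ip_right] yn s)
      then show ?thesis using LIMSEQ_unique by (simp add: ipn[OF zn])
    qed
    then show ?thesis by blast
  qed
  then obtain H' where "\<And>w y. ip E (H w) y = ip E w (H' y)" by metis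
  then have aH: "adm H" by (rule adjointableI)
  show thesis
  proof (rule that[OF pQ aH])
    show "(Q w, H w) \<in> T" "(H w, w - Q w) \<in> op_adjoint E T" for w using QH[of w] by simp_all
    show "Q w = u" if "(u, v) \<in> T" "(v, w - u) \<in> op_adjoint E T" for u v w
      using uniq[of u v w] that by simp
  qed
qed

text \<open>
  The relations between \<open>R = (1 + D\<^sup>2)\<^sup>-\<^sup>1\<close> and the bounded transform \<open>F\<close> of a self-adjoint regular
  operator \<open>D\<close>; the operator itself is recovered as \<open>bgraph R F\<close>.
\<close>

definition tp :: "('e \<Rightarrow> 'e) \<Rightarrow> ('e \<Rightarrow> 'e) \<Rightarrow> bool" where
  "tp R F \<longleftrightarrow> pcontr R \<and> sa F \<and> (\<forall>u. F (F u) = u - R u) \<and> (\<forall>u. F (R u) = R (F u))"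

definition bgraph :: "('e \<Rightarrow> 'e) \<Rightarrow> ('e \<Rightarrow> 'e) \<Rightarrow> 'e op_graph" where
  "bgraph R F = {(fc sqrt R u, F u) | u. True}"

lemma cont01_sqrt: "cont01 sqrt"
  by (intro continuous_intros)

lemma fc_sqrt_sqrt: "pcontr R \<Longrightarrow> fc sqrt R (fc sqrt R u) = R u"
  using fc_mult[OF _ cont01_sqrt cont01_sqrt, of R u] fc_cong[of R "\<lambda>x. x" "\<lambda>x. sqrt x * sqrt x" u]
  by (simp add: fc_id continuous_on_id)

lemma fc_graph:
  assumes reg: "regular E D" and R: "pcontr R" and f: "cont01 f"
    and RD: "\<And>x y. (x, y) \<in> D \<Longrightarrow> (R x, R y) \<in> D" and xy: "(x, y) \<in> D"
  shows "(fc f R x, fc f R y) \<in> D"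
proof -
  have scale: "(c *\<^sub>R a, c *\<^sub>R b) \<in> D" if "(a, b) \<in> D" for a b c
    using regularD(4)[OF reg that] by (simp add: scaleR_scaleC)
  have poly: "(poly_op p R x, poly_op p R y) \<in> D" for p
    by (induction p)
      (auto simp: poly_op_pCons[OF pcontr_linear[OF R]] intro: regularD(2,3)[OF reg] scale xy RD)
  have "(\<lambda>n. (poly_op (approx_poly f n) R x, poly_op (approx_poly f n) R y)) \<longlonglongrightarrow> (fc f R x, fc f R y)"
    by (intro tendsto_Pair fc_LIMSEQ R f)
  then show ?thesis by (rule closed_sequentially[OF regularD(6)[OF reg] poly])
qed

text \<open>
  For \<open>(x, y)\<close> in the graph of \<open>D\<close> the vector \<open>R\<^sup>1\<^sup>/\<^sup>2 y\<close> is at most as long as \<open>x\<close>.  So \<open>x \<mapsto> R\<^sup>1\<^sup>/\<^sup>2 y\<close>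
  extends to a bounded operator \<open>F\<close>, and all identities need only be verified on the domain of \<open>D\<close>.
\<close>

lemma selfadjoint_btrans:
  assumes "selfadjoint_regular E D"
  shows "\<exists>R F. tp R F \<and> D = bgraph R F"
proof -
  have reg: "regular E D" and sD: "op_adjoint E D = D"
    using assms by (auto simp: selfadjoint_regular_def)
  obtain R H where R: "pcontr R" and H: "adm H" and RH: "\<And>w. (R w, H w) \<in> D"
    and HD: "\<And>w. (H w, w - R w) \<in> D"
    and uniq: "\<And>u v w. (u, v) \<in> D \<Longrightarrow> (v, w - u) \<in> D \<Longrightarrow> R w = u"
    by (rule regular_resolvent[OF reg, unfolded sD]) (rule that)
  have sym: "ip E y x' = ip E x y'" if "(x, y) \<in> D" "(x', y') \<in> D" for x y x' y'
    using op_adjointD[of x' y' E D x y] that by (simp add: sD)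
  have sR: "sa R" by (rule pcontr_sa[OF R])
  have RyHx: "R y = H x" if "(x, y) \<in> D" for x y
    by (rule uniq[OF HD[of x]]) (rule regular_diff[OF reg that RH])
  have RD: "(R x, R y) \<in> D" if "(x, y) \<in> D" for x y
    using RH[of x] by (simp add: RyHx[OF that])
  have split: "x = R x + H y" if xy: "(x, y) \<in> D" for x y
  proof -
    have "(R y, x - R x) \<in> D" using HD[of x] RyHx[OF xy] by simp
    then have "x - R x = H y" using RH[of y] regularD(1)[OF reg] by (metis single_valuedD)
    then show ?thesis by (simp add: algebra_simps)
  qed
  let ?G = "fc sqrt R"
  have G: "sa ?G" by (rule sa_fc[OF R cont01_sqrt])
  have GG: "?G (?G u) = R u" for u by (rule fc_sqrt_sqrt[OF R])
  have GD: "(?G x, ?G y) \<in> D" if "(x, y) \<in> D" for x y by (rule fc_graph[OF reg R cont01_sqrt RD that])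
  have lG: "linear ?G" and bG: "bounded_linear ?G" and bR: "bounded_linear R" and bH: "bounded_linear H"
    by (rule sa_linear[OF G] sa_bounded[OF G] sa_bounded[OF sR] adm_bounded[OF H])+
  let ?S = "{(x, ?G y) | x y. (x, y) \<in> D}"
  have subD: "subspace D"
    using regularD(2,3)[OF reg] regularD(4)[OF reg, of _ _ "complex_of_real _"]
    by (auto simp: subspace_def zero_prod_def scaleR_scaleC)
  have dom: "fst ` ?S = Domain D" by force
  have tot: "total_set (Domain D)"
    using regularD(7)[OF reg] closure_mono[OF span_superset[of "Domain D"]] by (auto simp: total_set_def)
  have "\<exists>F. bounded_linear F \<and> (\<forall>(x, z)\<in>?S. F x = z) \<and> (\<forall>u. norm (F u) \<le> 1 * norm u)"
  proof (rule dense_extension)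
    have "?S = (\<lambda>p. (fst p, ?G (snd p))) ` D" by force
    moreover have "linear (\<lambda>p. (fst p, ?G (snd p)))"
      by (rule linearI) (auto simp: linear_add[OF lG] linear_scale[OF lG])
    ultimately have "subspace ?S" by (metis linear_subspace_image subD)
    then have S: "span ?S = ?S" by (simp add: span_eq_iff)
    fix x z assume "(x, z) \<in> span ?S"
    then obtain y where xy: "(x, y) \<in> D" and z: "z = ?G y" unfolding S by auto
    have "ip E z z = ip E y (H x)" by (simp add: z sa_ip[OF G] GG RyHx[OF xy])
    also have "\<dots> = ip E x (x - R x)" by (rule sym[OF xy HD])
    finally have "(norm z)\<^sup>2 \<le> norm x * norm (x - R x)" by (metis cauchy_schwarz norm_ip_self)
    also have "norm (x - R x) \<le> 1 * norm x"
      using norm_poly_op_pcontr[OF R, of "[:1, -1:]" 1 x]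
      by (simp add: poly_op_pCons[OF sa_linear[OF sR]] linear_0[OF sa_linear[OF sR]] linear_neg[OF sa_linear[OF sR]])
    finally have "(norm z)\<^sup>2 \<le> (norm x)\<^sup>2" by (simp add: power2_eq_square mult_left_mono)
    then have "norm z \<le> norm x" by (rule power2_le_imp_le) simp
    then show "norm z \<le> 1 * norm x" by simp
  qed (use tot in \<open>simp only: dom total_set_def\<close>)
  then obtain F where bF: "bounded_linear F" and FS: "\<forall>(x, z)\<in>?S. F x = z" by blast
  from FS have F: "F x = ?G y" if "(x, y) \<in> D" for x y using that by auto
  note lF = bounded_linear.linear[OF bF]
  have eqI: "S u = T u" if "bounded_linear S" "bounded_linear T" "\<And>x y. (x, y) \<in> D \<Longrightarrow> S x = T x" for S T :: "'e \<Rightarrow> 'e" and u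
    by (rule total_ext[OF that(1,2) tot]) (use that(3) in auto)
  have sF: "sa F"
    unfolding sa_def
  proof (intro allI)
    show "ip E (F u) v = ip E u (F v)" for u v
      by (rule ip_total_ext[OF hmod_axioms hmod_axioms bF bF tot tot])
        (auto simp: F sa_ip[OF G] sym[OF _ GD])
  qed
  have FG: "F (?G u) = H u" for u
    by (rule eqI[OF bounded_linear_compose[OF bF bG] bH]) (simp add: F[OF GD] GG RyHx)
  have FR: "F (R u) = R (F u)" for u
  proof (rule eqI[OF bounded_linear_compose[OF bF bR] bounded_linear_compose[OF bR bF]])
    show "F (R x) = R (F x)" if "(x, y) \<in> D" for x y by (simp add: F[OF RD[OF that]] F[OF that] fc_commute[OF R cont01_sqrt bR refl])
  qed
  have GF: "?G (F u) = F (?G u)" for u by (rule fc_commute[OF R cont01_sqrt bF FR, symmetric])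
  have FF: "F (F u) = u - R u" for u
  proof (rule eqI[OF bounded_linear_compose[OF bF bF] bounded_linear_sub[OF bounded_linear_ident bR]])
    show "F (F x) = x - R x" if "(x, y) \<in> D" for x y
      using split[OF that] by (simp add: F[OF that] FG algebra_simps)
  qed
  have "D = {(?G u, F u) | u. True}"
  proof (intro equalityI subrelI)
    fix x y assume xy: "(x, y) \<in> D"
    have "x = ?G (F y + ?G x)" using split[OF xy] by (simp add: linear_add[OF lG] GG GF FG add.commute)
    moreover have "y = F (F y + ?G x)" using RyHx[OF xy] by (simp add: linear_add[OF lF] FF FG)
    ultimately show "(x, y) \<in> {(?G u, F u) | u. True}" by blast
  next
    fix x y assume "(x, y) \<in> {(?G u, F u) | u. True}"
    then obtain u where u: "x = ?G u" "y = F u" by blast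
    have "u \<in> closure (Domain D)" using regularD(7)[OF reg] by simp
    then obtain a where a: "\<And>n::nat. a n \<in> Domain D" "a \<longlonglongrightarrow> u" unfolding closure_sequential by blast
    have "(?G (a n), F (a n)) \<in> D" for n using a(1)[of n] GD F by fastforce
    moreover have "(\<lambda>n. (?G (a n), F (a n))) \<longlonglongrightarrow> (?G u, F u)"
      by (intro tendsto_Pair bounded_linear.tendsto[OF bG] bounded_linear.tendsto[OF bF] a)
    ultimately show "(x, y) \<in> D" unfolding u by (rule closed_sequentially[OF regularD(6)[OF reg]])
  qed
  moreover have "tp R F" unfolding tp_def using R sF FF FR by simp
  ultimately show ?thesis unfolding bgraph_def by blast
qed

end

section \<open>Sequences of operators modulo geometrically decaying ones\<close>

text \<open>
  The estimates below hold at the scales \<open>2\<^sup>j\<close> with errors that decay geometrically in \<open>j\<close>.  They are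
  organised as computations in the algebra of bounded sequences of adjointable operators modulo
  the sequences that decay geometrically on a fixed invariant submodule \<open>M\<close>.
\<close>

type_synonym 'e opseq = "nat \<Rightarrow> 'e \<Rightarrow> 'e"

definition opmul :: "'e opseq \<Rightarrow> 'e opseq \<Rightarrow> 'e opseq"  (infixl "\<star>" 70) where
  "S \<star> T = (\<lambda>j u. S j (T j u))"

definition opadd :: "'e::plus opseq \<Rightarrow> 'e opseq \<Rightarrow> 'e opseq"  (infixl "\<boxplus>" 65) where
  "S \<boxplus> T = (\<lambda>j u. S j u + T j u)"

definition opsub :: "'e::minus opseq \<Rightarrow> 'e opseq \<Rightarrow> 'e opseq"  (infixl "\<boxminus>" 65) where
  "S \<boxminus> T = (\<lambda>j u. S j u - T j u)"

abbreviation cst :: "('e \<Rightarrow> 'e) \<Rightarrow> 'e opseq" where "cst A \<equiv> (\<lambda>j. A)"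
abbreviation one :: "'e opseq" where "one \<equiv> (\<lambda>j u. u)"

lemma opmul_assoc: "S \<star> T \<star> U = S \<star> (T \<star> U)"
  by (simp add: opmul_def)

lemma opmul_one [simp]: "one \<star> T = T" "T \<star> one = T"
  by (simp_all add: opmul_def)

lemma opsub_mul: "(S \<boxminus> T) \<star> U = S \<star> U \<boxminus> T \<star> U"
  by (simp add: opmul_def opadd_def opsub_def)

text \<open>
  The typical \<open>M\<close> is the closed span of \<open>E J\<close> for an ideal \<open>J\<close> of the coefficient algebra; as
  adjointable operators are module maps, they leave it invariant.
\<close>

locale isub = hmod E for E :: "('e::complex_banach, 'b::cstar_algebra) hmodule" +
  fixes M :: "'e set"
  assumes M_subspace: "subspace M"
    and M_closed: "closed M"
    and M_inv: "\<And>T u. adm T \<Longrightarrow> u \<in> M \<Longrightarrow> T u \<in> M"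
begin

definition bnd :: "'e opseq \<Rightarrow> bool" where
  "bnd T \<longleftrightarrow> (\<forall>j. adm (T j)) \<and> (\<exists>C\<ge>0. \<forall>j u. norm (T j u) \<le> C * norm u)"

definition nul :: "'e opseq \<Rightarrow> bool" where
  "nul T \<longleftrightarrow> (\<exists>C \<theta>. 0 \<le> C \<and> 0 < \<theta> \<and> \<theta> < 1 \<and> (\<forall>j. \<forall>u\<in>M. norm (T j u) \<le> C * \<theta> ^ j * norm u))"

definition eqv :: "'e opseq \<Rightarrow> 'e opseq \<Rightarrow> bool"  (infix "\<simeq>" 50) where
  "S \<simeq> T \<longleftrightarrow> nul (S \<boxminus> T)"

lemma bnd_adm: "bnd T \<Longrightarrow> adm (T j)"
  by (simp add: bnd_def)

lemma bnd_linear: "bnd T \<Longrightarrow> linear (T j)"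
  by (simp add: bnd_adm adm_clinear clinear_linear)

lemma bnd_cst: "adm A \<Longrightarrow> bnd (cst A)"
  unfolding bnd_def using adm_bound[of A] by (metis less_imp_le)

lemma bnd_one: "bnd one"
  by (rule bnd_cst[OF adm_id])

lemma bndI: "(\<And>j. adm (T j)) \<Longrightarrow> (\<And>j u. norm (T j u) \<le> C * norm u) \<Longrightarrow> bnd T"
proof -
  assume a: "\<And>j. adm (T j)" "\<And>j u. norm (T j u) \<le> C * norm u"
  have "norm (T j u) \<le> \<bar>C\<bar> * norm u" for j u
    by (rule order_trans[OF a(2)]) (simp add: mult_right_mono)
  then show "bnd T" unfolding bnd_def using a(1) abs_ge_zero by blast
qed

lemma bndE:
  assumes "bnd T"
  obtains C where "0 < C" "\<And>j u. norm (T j u) \<le> C * norm u"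
proof -
  obtain C where C: "0 \<le> C" "\<And>j u. norm (T j u) \<le> C * norm u" using assms by (auto simp: bnd_def)
  have "norm (T j u) \<le> (C + 1) * norm u" for j u
    by (rule order_trans[OF C(2)]) (simp add: mult_right_mono)
  then show thesis using C(1) by (intro that[of "C + 1"]) auto
qed

lemma bnd_mul:
  assumes "bnd S" "bnd T"
  shows "bnd (S \<star> T)"
proof -
  obtain C where C: "0 < C" "\<And>j u. norm (S j u) \<le> C * norm u" using bndE[OF assms(1)] by metis
  obtain D where D: "0 < D" "\<And>j u. norm (T j u) \<le> D * norm u" using bndE[OF assms(2)] by metis
  show ?thesis
  proof (rule bndI)
    show "adm ((S \<star> T) j)" for j unfolding opmul_def by (rule adm_comp[OF bnd_adm bnd_adm]) fact+
    show "norm ((S \<star> T) j u) \<le> C * D * norm u" for j u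
      using order_trans[OF C(2) mult_left_mono[OF D(2) less_imp_le[OF C(1)]]]
      by (simp add: opmul_def mult.assoc)
  qed
qed

lemma bnd_add:
  assumes "bnd S" "bnd T"
  shows "bnd (S \<boxplus> T)"
proof -
  obtain C where C: "0 < C" "\<And>j u. norm (S j u) \<le> C * norm u" using bndE[OF assms(1)] by metis
  obtain D where D: "0 < D" "\<And>j u. norm (T j u) \<le> D * norm u" using bndE[OF assms(2)] by metis
  show ?thesis
  proof (rule bndI)
    show "adm ((S \<boxplus> T) j)" for j unfolding opadd_def by (rule adm_add[OF bnd_adm bnd_adm]) fact+
    show "norm ((S \<boxplus> T) j u) \<le> (C + D) * norm u" for j u
      using norm_triangle_mono[OF C(2) D(2)] by (simp add: opadd_def distrib_right)
  qed
qed

lemma bnd_sub: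
  assumes "bnd S" "bnd T"
  shows "bnd (S \<boxminus> T)"
proof -
  obtain C where C: "0 < C" "\<And>j u. norm (S j u) \<le> C * norm u" using bndE[OF assms(1)] by metis
  obtain D where D: "0 < D" "\<And>j u. norm (T j u) \<le> D * norm u" using bndE[OF assms(2)] by metis
  show ?thesis
  proof (rule bndI)
    show "adm ((S \<boxminus> T) j)" for j unfolding opsub_def by (rule adm_diff[OF bnd_adm bnd_adm]) fact+
    show "norm ((S \<boxminus> T) j u) \<le> (C + D) * norm u" for j u
      using order_trans[OF norm_triangle_ineq4 add_mono[OF C(2) D(2)]]
      by (simp add: opsub_def distrib_right)
  qed
qed

lemma bnd_M: "bnd T \<Longrightarrow> u \<in> M \<Longrightarrow> T j u \<in> M"
  by (rule M_inv[OF bnd_adm])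

lemma nulI: "0 \<le> C \<Longrightarrow> 0 < \<theta> \<Longrightarrow> \<theta> < 1 \<Longrightarrow> (\<And>j u. u \<in> M \<Longrightarrow> norm (T j u) \<le> C * \<theta> ^ j * norm u) \<Longrightarrow> nul T"
  unfolding nul_def by blast

lemma nulE:
  assumes "nul T"
  obtains C \<theta> where "0 \<le> C" "0 < \<theta>" "\<theta> < 1" "\<And>j u. u \<in> M \<Longrightarrow> norm (T j u) \<le> C * \<theta> ^ j * norm u"
  using assms unfolding nul_def by blast

lemma nul_cong: "nul T \<Longrightarrow> (\<And>j u. u \<in> M \<Longrightarrow> S j u = T j u) \<Longrightarrow> nul S"
  unfolding nul_def by metis

lemma nul_zero: "nul (\<lambda>j u. 0)"
  by (rule nulI[of 0 "1/2"]) auto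

lemma nul_add:
  assumes "nul S" "nul T"
  shows "nul (S \<boxplus> T)"
proof -
  obtain C \<theta> where C: "0 \<le> C" "0 < \<theta>" "\<theta> < 1" "\<And>j u. u \<in> M \<Longrightarrow> norm (S j u) \<le> C * \<theta> ^ j * norm u"
    using nulE[OF assms(1)] by metis
  obtain D \<eta> where D: "0 \<le> D" "0 < \<eta>" "\<eta> < 1" "\<And>j u. u \<in> M \<Longrightarrow> norm (T j u) \<le> D * \<eta> ^ j * norm u"
    using nulE[OF assms(2)] by metis
  let ?m = "max \<theta> \<eta>"
  show ?thesis
  proof (rule nulI[of "C + D" ?m])
    fix j u assume u: "u \<in> M"
    have "C * \<theta> ^ j \<le> C * ?m ^ j" "D * \<eta> ^ j \<le> D * ?m ^ j"
      using C D by (auto intro!: mult_left_mono power_mono)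
    then have "norm (S j u) \<le> C * ?m ^ j * norm u" "norm (T j u) \<le> D * ?m ^ j * norm u"
      using C(4)[OF u] D(4)[OF u] by (meson mult_right_mono norm_ge_zero order_trans)+
    from norm_triangle_mono[OF this] show "norm ((S \<boxplus> T) j u) \<le> (C + D) * ?m ^ j * norm u"
      by (simp add: opadd_def distrib_right)
  qed (use C D in auto)
qed

lemma nul_minus: "nul T \<Longrightarrow> nul (\<lambda>j u. - T j u)"
  unfolding nul_def by simp

lemma nul_mul_left:
  assumes "bnd A" "nul T"
  shows "nul (A \<star> T)"
proof -
  obtain D where D: "0 < D" "\<And>j u. norm (A j u) \<le> D * norm u" using bndE[OF assms(1)] by metis
  obtain C \<theta> where C: "0 \<le> C" "0 < \<theta>" "\<theta> < 1" "\<And>j u. u \<in> M \<Longrightarrow> norm (T j u) \<le> C * \<theta> ^ j * norm u"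
    using nulE[OF assms(2)] by metis
  show ?thesis
  proof (rule nulI[of "D * C" \<theta>])
    fix j u assume "u \<in> M"
    from order_trans[OF D(2) mult_left_mono[OF C(4)[OF this] less_imp_le[OF D(1)]]]
    show "norm ((A \<star> T) j u) \<le> D * C * \<theta> ^ j * norm u" by (simp add: opmul_def mult.assoc)
  qed (use C D in auto)
qed

lemma nul_mul_right:
  assumes "bnd A" "nul T"
  shows "nul (T \<star> A)"
proof -
  obtain D where D: "0 < D" "\<And>j u. norm (A j u) \<le> D * norm u" using bndE[OF assms(1)] by metis
  obtain C \<theta> where C: "0 \<le> C" "0 < \<theta>" "\<theta> < 1" "\<And>j u. u \<in> M \<Longrightarrow> norm (T j u) \<le> C * \<theta> ^ j * norm u"
    using nulE[OF assms(2)] by metis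
  show ?thesis
  proof (rule nulI[of "D * C" \<theta>])
    fix j u assume "u \<in> M"
    have "0 \<le> C * \<theta> ^ j" using C by simp
    from order_trans[OF C(4)[OF bnd_M[OF assms(1) \<open>u \<in> M\<close>]] mult_left_mono[OF D(2) this]]
    show "norm ((T \<star> A) j u) \<le> D * C * \<theta> ^ j * norm u" by (simp add: opmul_def mult_ac)
  qed (use C D in auto)
qed

text \<open>Only vectors of \<open>M\<close> are tested, but by invariance the usual argument takes place inside \<open>M\<close>.\<close>

lemma norm_ad_le_M:
  assumes "adm T" "\<And>u. u \<in> M \<Longrightarrow> norm (T u) \<le> c * norm u" "0 \<le> c" "u \<in> M"
  shows "norm (ad T u) \<le> c * norm u"
proof (cases "ad T u = 0")
  case False
  have "ad T u \<in> M" by (rule M_inv[OF adm_ad(1)[OF assms(1)] assms(4)])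
  then have "norm u * norm (T (ad T u)) \<le> norm u * (c * norm (ad T u))"
    by (intro mult_left_mono assms(2)) auto
  then have "(norm (ad T u))\<^sup>2 \<le> norm u * (c * norm (ad T u))"
    using norm_square_le[OF adm_ad(1)[OF assms(1)], of u] by (simp add: adm_ad(2)[OF assms(1)])
  then show ?thesis using False by (simp add: power2_eq_square mult_ac)
qed (use assms in simp)

lemma nul_ad:
  assumes "\<And>j. adm (T j)" "nul T"
  shows "nul (\<lambda>j. ad (T j))"
proof -
  obtain C \<theta> where C: "0 \<le> C" "0 < \<theta>" "\<theta> < 1" "\<And>j u. u \<in> M \<Longrightarrow> norm (T j u) \<le> C * \<theta> ^ j * norm u"
    using nulE[OF assms(2)] by metis
  show ?thesis
    by (rule nulI[of C \<theta>]) (use C in \<open>auto intro!: norm_ad_le_M assms(1)\<close>)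
qed

lemma eqv_M: "(\<And>j u. u \<in> M \<Longrightarrow> S j u = T j u) \<Longrightarrow> S \<simeq> T"
  unfolding eqv_def by (rule nul_cong[OF nul_zero]) (simp add: opsub_def)

lemma eqv_refl: "T \<simeq> T"
  by (rule eqv_M) simp

lemma eqv_sym: "S \<simeq> T \<Longrightarrow> T \<simeq> S"
  unfolding eqv_def
  by (rule nul_cong[OF nul_minus[of "S \<boxminus> T"]]) (auto simp: opsub_def)

lemma eqv_trans [trans]: "S \<simeq> T \<Longrightarrow> T \<simeq> U \<Longrightarrow> S \<simeq> U"
  unfolding eqv_def
  by (rule nul_cong[OF nul_add[of "S \<boxminus> T" "T \<boxminus> U"]]) (auto simp: opsub_def opadd_def)

lemma eqv_add: "S \<simeq> S' \<Longrightarrow> T \<simeq> T' \<Longrightarrow> S \<boxplus> T \<simeq> S' \<boxplus> T'"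
  unfolding eqv_def
  by (rule nul_cong[OF nul_add[of "S \<boxminus> S'" "T \<boxminus> T'"]]) (auto simp: opsub_def opadd_def)

lemma eqv_sub: "S \<simeq> S' \<Longrightarrow> T \<simeq> T' \<Longrightarrow> S \<boxminus> T \<simeq> S' \<boxminus> T'"
  unfolding eqv_def
  by (rule nul_cong[OF nul_add[OF _ nul_minus, of "S \<boxminus> S'" "T \<boxminus> T'"]])
    (auto simp: opsub_def opadd_def)

lemma eqv_left: "bnd A \<Longrightarrow> S \<simeq> T \<Longrightarrow> A \<star> S \<simeq> A \<star> T"
  unfolding eqv_def
  by (rule nul_cong[OF nul_mul_left[of A "S \<boxminus> T"]])
    (auto simp: opsub_def opmul_def linear_diff[OF bnd_linear])

lemma eqv_right: "bnd A \<Longrightarrow> S \<simeq> T \<Longrightarrow> S \<star> A \<simeq> T \<star> A"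
  unfolding eqv_def
  by (rule nul_cong[OF nul_mul_right[of A "S \<boxminus> T"]]) (auto simp: opsub_def opmul_def)

lemma eqv_ad:
  assumes "bnd S" "bnd T" "S \<simeq> T"
  shows "(\<lambda>j. ad (S j)) \<simeq> (\<lambda>j. ad (T j))"
proof -
  have "nul (\<lambda>j. ad ((S \<boxminus> T) j))"
    by (rule nul_ad[OF bnd_adm[OF bnd_sub[OF assms(1,2)]] assms(3)[unfolded eqv_def]])
  then show ?thesis
    unfolding eqv_def
    by (rule nul_cong) (simp add: opsub_def adm_diff(2)[OF bnd_adm[OF assms(1)] bnd_adm[OF assms(2)]])
qed

lemma eqv_cancel: "S \<boxminus> U \<simeq> T \<boxminus> U \<Longrightarrow> S \<simeq> T"
  unfolding eqv_def by (erule nul_cong) (simp add: opsub_def)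

lemma eqv_cancel': "S \<boxminus> U \<simeq> T \<boxminus> V \<Longrightarrow> U \<simeq> V \<Longrightarrow> S \<simeq> T"
  by (rule eqv_cancel[of S U T]) (rule eqv_trans, assumption, rule eqv_sub[OF eqv_refl eqv_sym])

lemma mul_sub: "bnd A \<Longrightarrow> A \<star> (S \<boxminus> T) = A \<star> S \<boxminus> A \<star> T"
  by (simp add: opmul_def opsub_def linear_diff[OF bnd_linear])

lemma mul_add: "bnd A \<Longrightarrow> A \<star> (S \<boxplus> T) = A \<star> S \<boxplus> A \<star> T"
  by (simp add: opmul_def opadd_def linear_add[OF bnd_linear])

text \<open>
  Square roots of positive operators may be extracted up to geometric decay.  The partial sum
  \<open>s\<^sub>N\<close> of the binomial series approximates \<open>a = sqrt (1 - (1 - a\<^sup>2))\<close> up to \<open>N\<^sup>-\<^sup>1\<^sup>/\<^sup>2\<close>, and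
  \<open>s\<^sub>N (1 - a\<^sup>2) c - c s\<^sub>N (1 - b\<^sup>2)\<close> is at most \<open>N\<close> times as large as \<open>a\<^sup>2 c - c b\<^sup>2\<close>.
\<close>

lemma norm_funpow_intertwine:
  assumes A: "linear A" "\<And>u. norm (A u) \<le> norm u" and B: "adm B" "\<And>u. norm (B u) \<le> norm u"
    and c: "linear c" and e: "\<And>u. u \<in> M \<Longrightarrow> norm (A (c u) - c (B u)) \<le> e * norm u" "0 \<le> e" and u: "u \<in> M"
  shows "norm ((A ^^ n) (c u) - c ((B ^^ n) u)) \<le> real n * e * norm u"
proof (induction n)
  case (Suc n)
  have Bn: "(B ^^ n) u \<in> M" by (induction n) (auto intro: M_inv[OF B(1)] u)
  have "(A ^^ Suc n) (c u) - c ((B ^^ Suc n) u)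
      = A ((A ^^ n) (c u) - c ((B ^^ n) u)) + (A (c ((B ^^ n) u)) - c (B ((B ^^ n) u)))"
    by (simp add: linear_diff[OF A(1)])
  also have "norm \<dots> \<le> real n * e * norm u + e * norm u"
  proof (rule norm_triangle_mono)
    show "norm (A ((A ^^ n) (c u) - c ((B ^^ n) u))) \<le> real n * e * norm u"
      by (rule order_trans[OF A(2) Suc])
    show "norm (A (c ((B ^^ n) u)) - c (B ((B ^^ n) u))) \<le> e * norm u"
      by (rule order_trans[OF e(1)[OF Bn]])
        (intro mult_left_mono funpow_contraction[of B, OF B(2)] e(2))
  qed
  finally show ?case by (simp add: algebra_simps)
qed simp

lemma norm_sqpoly_intertwine:
  assumes A: "linear A" "\<And>u. norm (A u) \<le> norm u" and B: "adm B" "\<And>u. norm (B u) \<le> norm u"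
    and c: "linear c" and e: "\<And>u. u \<in> M \<Longrightarrow> norm (A (c u) - c (B u)) \<le> e * norm u" "0 \<le> e" and u: "u \<in> M"
  shows "norm (poly_op (sqpoly N) A (c u) - c (poly_op (sqpoly N) B u)) \<le> real N * e * norm u"
proof -
  have deg: "degree (sqpoly N) \<le> N"
    by (rule degree_le) (simp add: coeff_sqpoly)
  have "poly_op (sqpoly N) A (c u) - c (poly_op (sqpoly N) B u)
      = (\<Sum>n\<le>N. sqa n *\<^sub>R ((A ^^ n) (c u) - c ((B ^^ n) u)))"
    unfolding poly_op_eq_sum[OF deg]
    by (simp add: coeff_sqpoly linear_sum[OF c] linear_scale[OF c] scaleR_diff_right sum_subtractf)
  also have "norm \<dots> \<le> (\<Sum>n\<le>N. (if n = 0 then 0 else - sqa n) * (real N * e * norm u))"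
  proof (rule sum_norm_le)
    fix n assume n: "n \<in> {..N}"
    show "norm (sqa n *\<^sub>R ((A ^^ n) (c u) - c ((B ^^ n) u)))
        \<le> (if n = 0 then 0 else - sqa n) * (real N * e * norm u)"
    proof (cases "n = 0")
      case False
      have "norm ((A ^^ n) (c u) - c ((B ^^ n) u)) \<le> real n * e * norm u"
        by (rule norm_funpow_intertwine[OF A B c e u])
      also have "\<dots> \<le> real N * e * norm u"
        using n e(2) by (intro mult_right_mono) auto
      finally show ?thesis
        using False sqa_nonpos[of n] by (simp add: mult_left_mono_neg)
    qed simp
  qed
  also have "\<dots> = (\<Sum>n\<le>N. if n = 0 then 0 else - sqa n) * (real N * e * norm u)"
    by (simp add: sum_distrib_right)
  also have "\<dots> \<le> 1 * (real N * e * norm u)"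
  proof (rule mult_right_mono)
    have "(\<Sum>n\<le>N. if n = 0 then 0 else - sqa n) = (\<Sum>n\<le>N. (if n = 0 then 1 else 0) - sqa n)"
      by (rule sum.cong) (auto simp: sqa_def)
    also have "\<dots> = 1 - sqd N" by (simp add: sum_subtractf sum_sqa)
    finally show "(\<Sum>n\<le>N. if n = 0 then 0 else - sqa n) \<le> 1" using sqd_pos[of N] by simp
  qed (use e in auto)
  finally show ?thesis by simp
qed

lemma norm_sqrt_intertwine:
  assumes a: "pcontr a" and b: "pcontr b" and c: "linear c" "\<And>u. norm (c u) \<le> \<kappa> * norm u"
    and e: "\<And>u. u \<in> M \<Longrightarrow> norm (a (a (c u)) - c (b (b u))) \<le> e * norm u" "0 \<le> e" and u: "u \<in> M"
    and N: "1 \<le> N"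
  shows "norm (a (c u) - c (b u)) \<le> (2 * \<kappa> * sqd N + real N * e) * norm u"
proof -
  have root: "norm (poly_op (sqpoly N) (\<lambda>u. u - a (a u)) v - a v) \<le> sqd N * norm v"
    and lin: "sa (\<lambda>u. u - a (a u))" "norm (v - a (a v)) \<le> norm v" if a: "pcontr a" for a v
  proof -
    note la = pcontr_linear[OF a]
    have eq: "poly_op [:1, 0, -1:] a = (\<lambda>u. u - a (a u))"
      by (rule ext) (simp add: poly_op_pCons[OF la] linear_0[OF la] linear_neg[OF la])
    show "sa (\<lambda>u. u - a (a u))" unfolding eq[symmetric] by (rule sa_poly_op[OF pcontr_sa[OF a]])
    have sq: "0 \<le> 1 - x * x" "1 - x * x \<le> 1" if "0 \<le> x" "x \<le> 1" for x :: real
      using that mult_le_one[of x x] by auto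
    have "norm (poly_op [:1, 0, -1:] a v) \<le> 1 * norm v"
      by (rule norm_poly_op_pcontr[OF a]) (use sq in \<open>auto simp: abs_le_iff\<close>)
    then show "norm (v - a (a v)) \<le> norm v" by (simp add: eq)
    have "norm (poly_op (pcompose (sqpoly N) [:1, 0, -1:] - [:0, 1:]) a v) \<le> sqd N * norm v"
    proof (rule norm_poly_op_pcontr[OF a])
      fix x :: real assume x: "0 \<le> x" "x \<le> 1"
      have "sqrt (1 - (1 - x * x)) = x" using x by simp
      then show "\<bar>poly (pcompose (sqpoly N) [:1, 0, -1:] - [:0, 1:]) x\<bar> \<le> sqd N"
        using sqpoly_bounds(1,3)[OF N sq[OF x]] by (simp add: poly_pcompose abs_le_iff)
    qed
    then show "norm (poly_op (sqpoly N) (\<lambda>u. u - a (a u)) v - a v) \<le> sqd N * norm v"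
      by (simp add: poly_op_diff poly_op_pcompose[OF la] eq poly_op_X[OF la])
  qed
  let ?A = "\<lambda>u. u - a (a u)" and ?B = "\<lambda>u. u - b (b u)"
  have 1: "norm (poly_op (sqpoly N) ?A (c u) - c (poly_op (sqpoly N) ?B u)) \<le> real N * e * norm u"
  proof (rule norm_sqpoly_intertwine[OF sa_linear[OF lin(1)[OF a]] lin(2)[OF a] sa_adm[OF lin(1)[OF b]] lin(2)[OF b] c(1) _ e(2) u])
    fix v assume "v \<in> M"
    have "c v - a (a (c v)) - c (v - b (b v)) = - (a (a (c v)) - c (b (b v)))"
      by (simp add: linear_diff[OF c(1)])
    then show "norm (c v - a (a (c v)) - c (v - b (b v))) \<le> e * norm v"
      using e(1)[OF \<open>v \<in> M\<close>] by (simp only: norm_minus_cancel)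
  qed
  have \<kappa>: "0 \<le> \<kappa> * norm u" using order_trans[OF norm_ge_zero c(2)] .
  have 2: "norm (poly_op (sqpoly N) ?A (c u) - a (c u)) \<le> sqd N * (\<kappa> * norm u)"
    using order_trans[OF root[OF a] mult_left_mono[OF c(2)]] sqd_pos[of N] by simp
  have k0: "norm (c v) \<le> \<bar>\<kappa>\<bar> * norm v" for v
    by (rule order_trans[OF c(2)]) (simp add: mult_right_mono)
  have 3: "norm (c (poly_op (sqpoly N) ?B u) - c (b u)) \<le> sqd N * (\<kappa> * norm u)"
  proof (cases "u = 0")
    case False
    then have "0 \<le> \<kappa>" using \<kappa> by (simp add: zero_le_mult_iff)
    have "norm (c (poly_op (sqpoly N) ?B u - b u)) \<le> \<kappa> * (sqd N * norm u)"
      by (rule order_trans[OF c(2) mult_left_mono[OF root[OF b] \<open>0 \<le> \<kappa>\<close>]])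
    then show ?thesis by (simp add: linear_diff[OF c(1)] mult_ac)
  next
    case True
    then show ?thesis
      by (simp add: linear_0[OF poly_op_linear[OF sa_linear[OF lin(1)[OF b]]]] linear_0[OF c(1)]
          linear_0[OF pcontr_linear[OF b]])
  qed
  have "a (c u) - c (b u) = - (poly_op (sqpoly N) ?A (c u) - a (c u))
      + (poly_op (sqpoly N) ?A (c u) - c (poly_op (sqpoly N) ?B u))
      + (c (poly_op (sqpoly N) ?B u) - c (b u))" by simp
  also have "norm \<dots> \<le> sqd N * (\<kappa> * norm u) + real N * e * norm u + sqd N * (\<kappa> * norm u)"
    by (intro norm_triangle_mono) (use 1 2 3 in \<open>simp_all only: norm_minus_cancel\<close>)
  finally show ?thesis by (simp add: algebra_simps)
qed

text \<open>
  If \<open>a\<^sup>2 c - c b\<^sup>2\<close> is of size \<open>\<theta>\<^sup>j\<close> with \<open>\<theta> = \<eta>\<^sup>4\<close>, then \<open>N\<close> of size \<open>\<eta>\<^sup>-\<^sup>2\<^sup>j\<close> turns the two errors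
  \<open>N\<^sup>-\<^sup>1\<^sup>/\<^sup>2\<close> and \<open>N \<theta>\<^sup>j\<close> into \<open>\<eta>\<^sup>j\<close> and \<open>\<eta>\<^sup>2\<^sup>j\<close>.
\<close>

theorem eqv_sqrt:
  assumes a: "bnd a" "\<And>j. spos (a j)" and b: "bnd b" "\<And>j. spos (b j)" and c: "bnd c"
    and eq: "a \<star> a \<star> c \<simeq> c \<star> (b \<star> b)"
  shows "a \<star> c \<simeq> c \<star> b"
proof -
  obtain Ka where Ka: "0 < Ka" "\<And>j u. norm (a j u) \<le> Ka * norm u" using bndE[OF a(1)] by metis
  obtain Kb where Kb: "0 < Kb" "\<And>j u. norm (b j u) \<le> Kb * norm u" using bndE[OF b(1)] by metis
  obtain \<kappa> where \<kappa>: "0 < \<kappa>" "\<And>j u. norm (c j u) \<le> \<kappa> * norm u" using bndE[OF c] by metis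
  define K where "K = max Ka Kb"
  have K: "0 < K" "norm (a j u) \<le> K * norm u" "norm (b j u) \<le> K * norm u" for j u
    using Ka Kb order_trans[OF Ka(2) mult_right_mono[of Ka K "norm u"]]
      order_trans[OF Kb(2) mult_right_mono[of Kb K "norm u"]] by (auto simp: K_def)
  have pc: "pcontr (\<lambda>u. (1 / K) *\<^sub>R h j u)" if "\<And>j. spos (h j)" "\<And>j u. norm (h j u) \<le> K * norm u" for h :: "'e opseq" and j
    by (rule pcontrI[OF spos_scaleR[OF that(1)]]) (use K(1) that(2)[of j] in \<open>auto simp: divide_le_eq mult.commute\<close>)
  obtain C \<theta> where C: "0 \<le> C" "0 < \<theta>" "\<theta> < 1"
    "\<And>j u. u \<in> M \<Longrightarrow> norm ((a \<star> a \<star> c \<boxminus> c \<star> (b \<star> b)) j u) \<le> C * \<theta> ^ j * norm u"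
    using nulE[OF eq[unfolded eqv_def]] by metis
  define \<eta> where "\<eta> = sqrt (sqrt \<theta>)"
  have \<eta>: "0 < \<eta>" "\<eta> < 1" "\<eta> ^ 4 = \<theta>" proof -
    have "\<eta> ^ 4 = (\<eta>\<^sup>2)\<^sup>2" by simp
    then show "\<eta> ^ 4 = \<theta>" using C by (simp add: \<eta>_def)
  qed (use C in \<open>auto simp: \<eta>_def\<close>)
  have "nul (a \<star> c \<boxminus> c \<star> b)"
  proof (rule nulI[of "K * (2 * \<kappa> + 2 * (C / K\<^sup>2))" \<eta>])
    fix j u assume u: "u \<in> M"
    let ?a = "\<lambda>u. (1 / K) *\<^sub>R a j u" and ?b = "\<lambda>u. (1 / K) *\<^sub>R b j u"
    define x where "x = (1 / \<eta>) ^ (2 * j)"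
    have x: "1 \<le> x" unfolding x_def using \<eta> by (intro one_le_power) simp
    define N where "N = nat \<lceil>x\<rceil>"
    have N: "x \<le> real N" "real N \<le> 2 * x" "1 \<le> N"
    proof -
      show "x \<le> real N" using x by (simp add: N_def)
      have "real N \<le> x + 1" using x by (simp add: N_def)
      then show "real N \<le> 2 * x" using x by simp
      show "1 \<le> N" using x \<open>x \<le> real N\<close> by linarith
    qed
    let ?e = "C / K\<^sup>2 * \<theta> ^ j"
    have "norm (?a (c j u) - c j (?b u)) \<le> (2 * \<kappa> * sqd N + real N * ?e) * norm u"
    proof (rule norm_sqrt_intertwine[OF pc[of a] pc[of b] bnd_linear[OF c] \<kappa>(2) _ _ u N(3)])
      fix v assume v: "v \<in> M"
      have "?a (?a (c j v)) - c j (?b (?b v)) = (1 / K\<^sup>2) *\<^sub>R ((a \<star> a \<star> c \<boxminus> c \<star> (b \<star> b)) j v)"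
        by (simp add: opmul_def opsub_def linear_scale[OF bnd_linear[OF a(1)]] linear_scale[OF bnd_linear[OF b(1)]]
            linear_scale[OF bnd_linear[OF c]] scaleR_diff_right power2_eq_square)
      then show "norm (?a (?a (c j v)) - c j (?b (?b v))) \<le> ?e * norm v"
        using C(4)[OF v, of j] K(1) by (simp add: field_simps)
    qed (use K a b C in auto)
    also have "\<dots> \<le> (2 * \<kappa> * \<eta> ^ j + 2 * (C / K\<^sup>2) * \<eta> ^ j) * norm u"
    proof (intro mult_right_mono add_mono)
      have "sqd N \<le> 1 / sqrt (2 * real N + 1)" by (rule sqd_le)
      also have "\<dots> \<le> 1 / sqrt x" using x N by (intro divide_left_mono real_sqrt_le_mono) auto
      also have "sqrt x = (1 / \<eta>) ^ j"
        using \<eta> by (simp add: x_def power_mult power2_eq_square[symmetric] real_sqrt_power[symmetric] mult.commute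
            power_even_eq)
      also have "1 / (1 / \<eta>) ^ j = \<eta> ^ j" by (simp add: power_one_over)
      finally show "2 * \<kappa> * sqd N \<le> 2 * \<kappa> * \<eta> ^ j" using \<kappa>(1) by simp
      have "real N * ?e \<le> 2 * x * ?e" using N C K by (intro mult_right_mono) auto
      also have "2 * x * ?e = 2 * (C / K\<^sup>2) * (x * \<theta> ^ j)" by simp
      also have "x * \<theta> ^ j = \<eta> ^ (2 * j)"
      proof -
        have "\<theta> ^ j = \<eta> ^ (2 * j) * \<eta> ^ (2 * j)"
          by (simp add: \<eta>(3)[symmetric] power_mult[symmetric] power_add[symmetric])
        then show ?thesis using \<eta>(1) by (simp add: x_def power_one_over)
      qed
      also have "2 * (C / K\<^sup>2) * \<eta> ^ (2 * j) \<le> 2 * (C / K\<^sup>2) * \<eta> ^ j"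
        using \<eta> C by (intro mult_left_mono power_decreasing) auto
      finally show "real N * ?e \<le> 2 * (C / K\<^sup>2) * \<eta> ^ j" .
    qed auto
    finally have *: "norm (?a (c j u) - c j (?b u)) \<le> (2 * \<kappa> * \<eta> ^ j + 2 * (C / K\<^sup>2) * \<eta> ^ j) * norm u" .
    have "(a \<star> c \<boxminus> c \<star> b) j u = K *\<^sub>R (?a (c j u) - c j (?b u))"
      using K(1) by (simp add: opmul_def opsub_def linear_scale[OF bnd_linear[OF c]] scaleR_diff_right)
    then have "norm ((a \<star> c \<boxminus> c \<star> b) j u) = K * norm (?a (c j u) - c j (?b u))"
      using K(1) by simp
    also have "\<dots> \<le> K * ((2 * \<kappa> * \<eta> ^ j + 2 * (C / K\<^sup>2) * \<eta> ^ j) * norm u)"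
      using * K(1) by (intro mult_left_mono) auto
    finally show "norm ((a \<star> c \<boxminus> c \<star> b) j u) \<le> K * (2 * \<kappa> + 2 * (C / K\<^sup>2)) * \<eta> ^ j * norm u"
      by (simp add: distrib_left distrib_right mult_ac)
  qed (use K \<kappa> C \<eta> in auto)
  then show ?thesis by (simp add: eqv_def)
qed

end

section \<open>Bounded transforms at geometric scales\<close>

text \<open>
  For \<open>r = 2\<^sup>j\<close> the functions below express \<open>Y = (1 + D\<^sup>2 / r\<^sup>2)\<^sup>-\<^sup>1\<close> as \<open>yf(R)\<close> and
  \<open>Z = (D / r) (1 + D\<^sup>2 / r\<^sup>2)\<^sup>-\<^sup>1\<close> as \<open>F zf(R)\<close>, where \<open>R = (1 + D\<^sup>2)\<^sup>-\<^sup>1\<close> and \<open>F\<close> is the bounded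
  transform of \<open>D\<close>.  The positive operator \<open>W = F Z\<close> agrees with the absolute value of \<open>Z\<close> up to
  decay.  So \<open>W\<close> is determined by \<open>Z\<^sup>2\<close>, and comparing \<open>W\<close> with \<open>Z\<close> recovers \<open>F\<close>.
\<close>

definition den :: "nat \<Rightarrow> real \<Rightarrow> real" where "den j x = 1 + (4 ^ j - 1) * x"
definition yf :: "nat \<Rightarrow> real \<Rightarrow> real" where "yf j x = 4 ^ j * x / den j x"
definition zf :: "nat \<Rightarrow> real \<Rightarrow> real" where "zf j x = 2 ^ j * sqrt x / den j x"

lemma den_pos: "0 \<le> x \<Longrightarrow> 0 < den j x"
  by (simp add: den_def add_pos_nonneg)

lemma den_nz: "0 \<le> x \<Longrightarrow> den j x \<noteq> 0"
  using den_pos[of x j] by simp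

lemma den_cont: "cont01 (den j)"
  unfolding den_def by (intro continuous_intros)

lemma yf_cont: "cont01 (yf j)"
  unfolding yf_def by (intro continuous_intros den_cont) (simp add: den_nz)

lemma zf_cont: "cont01 (zf j)"
  unfolding zf_def by (intro continuous_intros den_cont) (simp add: den_nz)

lemma four_power: "(4::real) ^ j = 2 ^ j * 2 ^ j"
  by (simp add: power_mult_distrib[symmetric])

lemma den_ge:
  assumes "0 \<le> x" "x \<le> 1"
  shows "4 ^ j * x \<le> den j x" "2 ^ j * sqrt x \<le> den j x"
proof -
  show 1: "4 ^ j * x \<le> den j x" using assms by (simp add: den_def algebra_simps)
  define t where "t = 2 ^ j * sqrt x"
  have t: "0 \<le> t" "t * t = 4 ^ j * x" using assms by (auto simp: t_def four_power algebra_simps)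
  have "x \<le> t * t" using mult_right_mono[of 1 "4 ^ j" x] assms by (simp add: t(2))
  have "t \<le> den j x"
  proof (cases "t \<le> 1")
    case True
    have "den j x = 1 + (t * t - x)" by (simp add: den_def t(2) algebra_simps)
    then show ?thesis using True \<open>x \<le> t * t\<close> by simp
  next
    case False
    then have "t * 1 \<le> t * t" by (intro mult_left_mono t(1)) simp
    then show ?thesis using 1 unfolding t(2) by linarith
  qed
  then show "2 ^ j * sqrt x \<le> den j x" by (simp add: t_def)
qed

lemma one_minus_yf: "0 \<le> x \<Longrightarrow> 1 - yf j x = (1 - x) / den j x"
  using den_pos[of x j] by (simp add: yf_def field_simps) (simp add: den_def algebra_simps)

lemma yf_bounds:
  assumes "0 \<le> x" "x \<le> 1"
  shows "0 \<le> yf j x" "yf j x \<le> 1" "2 ^ j * sqrt x * (1 - yf j x) \<le> 1"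
proof -
  show "0 \<le> yf j x" "yf j x \<le> 1"
    using den_pos[OF assms(1), of j] den_ge[OF assms, of j] assms by (auto simp: yf_def divide_le_eq)
  have "2 ^ j * sqrt x * (1 - yf j x) \<le> 2 ^ j * sqrt x * (1 / den j x)"
    unfolding one_minus_yf[OF assms(1)] using assms den_pos[OF assms(1), of j]
    by (intro mult_left_mono divide_right_mono) auto
  also have "\<dots> \<le> 1" using den_pos[OF assms(1), of j] den_ge[OF assms, of j] by (simp add: divide_le_eq)
  finally show "2 ^ j * sqrt x * (1 - yf j x) \<le> 1" .
qed

lemma zf_bounds:
  assumes "0 \<le> x" "x \<le> 1"
  shows "0 \<le> zf j x" "zf j x \<le> 1" "2 ^ j * sqrt x * zf j x \<le> 1"
proof -
  show "0 \<le> zf j x" "zf j x \<le> 1"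
    using den_pos[OF assms(1), of j] den_ge[OF assms, of j] assms by (auto simp: zf_def divide_le_eq)
  have "2 ^ j * sqrt x * zf j x = yf j x" using assms by (simp add: zf_def yf_def four_power)
  then show "2 ^ j * sqrt x * zf j x \<le> 1" using yf_bounds[OF assms] by simp
qed

text \<open>
  With \<open>s = sqrt x\<close> and \<open>r = 2\<^sup>j\<close> the left side is at most \<open>s\<^sup>1\<^sup>-\<^sup>\<alpha>\<close> and at most \<open>s\<^sup>-\<^sup>\<alpha> / r\<close>.  The
  first bound increases in \<open>s\<close>, the second does not, and they meet at \<open>s = 1 / r\<close>.
\<close>

lemma powr_decay:
  assumes "0 \<le> \<alpha>" "\<alpha> < 1" "0 \<le> x" "0 \<le> h" "h \<le> 1" "2 ^ j * sqrt x * h \<le> 1"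
  shows "x powr ((1 - \<alpha>) / 2) * h \<le> (2 powr (\<alpha> - 1)) ^ j"
proof (cases "x = 0")
  case False
  define s where "s = sqrt x"
  define r where "r = (2::real) ^ j"
  have s: "0 < s" using assms False by (simp add: s_def)
  have r: "0 < r" by (simp add: r_def)
  have ps: "x powr ((1 - \<alpha>) / 2) = s powr (1 - \<alpha>)"
    using assms by (simp add: s_def powr_half_sqrt[symmetric] powr_powr)
  have pr: "(2 powr (\<alpha> - 1)) ^ j = (1 / r) powr (1 - \<alpha>)"
  proof -
    have "(2 powr (\<alpha> - 1)) ^ j = (2 powr real j) powr (\<alpha> - 1)"
      by (simp add: powr_powr powr_realpow[symmetric] mult.commute)
    also have "\<dots> = (1 / r) powr (1 - \<alpha>)"
      using powr_minus_divide[of r "1 - \<alpha>"] r by (simp add: r_def powr_realpow powr_divide)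
    finally show ?thesis .
  qed
  show ?thesis
  proof (cases "s \<le> 1 / r")
    case True
    have "s powr (1 - \<alpha>) * h \<le> (1 / r) powr (1 - \<alpha>) * 1"
      using assms s True by (intro mult_mono powr_mono2) auto
    then show ?thesis by (simp add: ps pr)
  next
    case False
    have h: "h \<le> (1 / r) / s" using assms(6) s r by (simp add: field_simps s_def r_def)
    have "s powr (1 - \<alpha>) * h \<le> s powr (1 - \<alpha>) * ((1 / r) / s)"
      using h by (intro mult_left_mono) auto
    also have "\<dots> = s powr (- \<alpha>) * (1 / r)"
      using s by (simp add: powr_diff powr_minus_divide)
    also have "\<dots> \<le> (1 / r) powr (- \<alpha>) * (1 / r)"
      using False s r assms by (intro mult_right_mono powr_mono2') auto
    also have "\<dots> = (1 / r) powr (1 - \<alpha>)"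
      using r by (simp add: powr_diff powr_minus_divide)
    finally show ?thesis by (simp add: ps pr)
  qed
qed (use assms in auto)

text \<open>\<open>\<psi> \<alpha>\<close> of \<open>(1 + D\<^sup>2)\<^sup>-\<^sup>1\<close> is \<open>\<langle>D\<rangle>\<close> to the power \<open>\<alpha> - 1\<close>.\<close>

definition \<psi> :: "real \<Rightarrow> real \<Rightarrow> real" where "\<psi> \<alpha> x = x powr ((1 - \<alpha>) / 2)"

lemma psi_cont: "\<alpha> < 1 \<Longrightarrow> cont01 (\<psi> \<alpha>)"
  unfolding \<psi>_def by (intro continuous_on_powr' continuous_intros) auto

context hmod
begin

lemma fc_mult_eq:
  assumes A: "pcontr A" and f: "cont01 f" and g: "cont01 g"
    and eq: "\<And>x. 0 \<le> x \<Longrightarrow> x \<le> 1 \<Longrightarrow> f x * g x = h x"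
  shows "fc f A (fc g A u) = fc h A u"
  unfolding fc_mult[OF A f g, symmetric]
  by (rule fc_cong[OF A]) (use eq in \<open>auto intro: cont01_cong[OF continuous_on_mult[OF f g]]\<close>)

context
  fixes R F
  assumes tp: "tp R F"
begin

lemma tp_R: "pcontr R" and tp_F: "sa F" and tp_FF: "F (F u) = u - R u" and tp_FR: "F (R u) = R (F u)"
  using tp by (auto simp: tp_def)

lemma tp_comm: "cont01 f \<Longrightarrow> F (fc f R u) = fc f R (F u)"
  by (rule fc_commute[OF tp_R _ sa_bounded[OF tp_F] tp_FR])

lemma tp_FF_fc: "F (F u) = fc (\<lambda>x. 1 - x) R u"
  using fc_diff[OF tp_R, of "\<lambda>x. 1" "\<lambda>x. x" u] tp_R
  by (simp add: tp_FF fc_one fc_id continuous_on_id)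

lemma tp_linear: "linear F" by (rule sa_linear[OF tp_F])

lemma bgraph_iff: "(u, v) \<in> bgraph R F \<longleftrightarrow> fc sqrt R v = F u"
proof
  assume "(u, v) \<in> bgraph R F"
  then show "fc sqrt R v = F u" by (auto simp: bgraph_def tp_comm[OF cont01_sqrt])
next
  assume *: "fc sqrt R v = F u"
  note lG = sa_linear[OF sa_fc[OF tp_R cont01_sqrt]]
  let ?\<eta> = "F v + fc sqrt R u"
  have "fc sqrt R ?\<eta> = u"
    by (simp add: linear_add[OF lG] fc_sqrt_sqrt[OF tp_R] tp_comm[OF cont01_sqrt, symmetric] * tp_FF)
  moreover have "F ?\<eta> = v"
    by (simp add: linear_add[OF tp_linear] tp_comm[OF cont01_sqrt] *[symmetric] fc_sqrt_sqrt[OF tp_R] tp_FF)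
  ultimately show "(u, v) \<in> bgraph R F" unfolding bgraph_def by (metis (mono_tags, lifting) mem_Collect_eq)
qed

lemma tp_F_norm: "norm (F u) \<le> norm u"
proof -
  have "(norm (F u))\<^sup>2 \<le> norm u * norm (F (F u))"
    using norm_square_le[OF sa_adm[OF tp_F], of u] by (simp add: sa_ad[OF tp_F])
  also have "norm (F (F u)) \<le> 1 * norm u"
    unfolding tp_FF_fc by (rule norm_fc_le[OF tp_R]) (auto intro: continuous_intros)
  finally show ?thesis by (simp add: mult_left_mono power2_eq_square[symmetric])
qed

end

end

context isub
begin

lemma eq_eqv_trans [trans]: "S = T \<Longrightarrow> T \<simeq> U \<Longrightarrow> S \<simeq> U"
  and eqv_eq_trans [trans]: "S \<simeq> T \<Longrightarrow> T = U \<Longrightarrow> S \<simeq> U"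
  by simp_all

definition Ys :: "('e \<Rightarrow> 'e) \<Rightarrow> 'e opseq" where "Ys R j = fc (yf j) R"
definition Zs :: "('e \<Rightarrow> 'e) \<Rightarrow> ('e \<Rightarrow> 'e) \<Rightarrow> 'e opseq" where "Zs R F j u = F (fc (zf j) R u)"
definition Ws :: "('e \<Rightarrow> 'e) \<Rightarrow> 'e opseq" where "Ws R j = fc (\<lambda>x. (1 - x) * zf j x) R"
definition Vs :: "('e \<Rightarrow> 'e) \<Rightarrow> 'e opseq" where "Vs R j = fc (\<lambda>x. sqrt ((1 - x) * zf j x)) R"

lemma nul_fc:
  assumes R: "pcontr R" and f: "\<And>j. cont01 (f j)" and \<theta>: "0 < \<theta>" "\<theta> < 1"
    and le: "\<And>j x. 0 \<le> x \<Longrightarrow> x \<le> 1 \<Longrightarrow> \<bar>f j x\<bar> \<le> \<theta> ^ j"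
  shows "nul (\<lambda>j. fc (f j) R)"
  by (rule nulI[of 1 \<theta>]) (use \<theta> norm_fc_le[OF R f le] in auto)

lemma bnd_fc:
  assumes "pcontr R" "\<And>j. cont01 (f j)" "\<And>j x. 0 \<le> x \<Longrightarrow> x \<le> 1 \<Longrightarrow> \<bar>f j x\<bar> \<le> 1"
  shows "bnd (\<lambda>j. fc (f j) R)"
proof (rule bndI)
  show "adm (fc (f j) R)" for j by (rule adm_fc[OF assms(1,2)])
  show "norm (fc (f j) R u) \<le> 1 * norm u" for j u by (rule norm_fc_le[OF assms(1,2,3)])
qed

context
  fixes R F
  assumes tp: "tp R F"
begin

private lemma wz: "0 \<le> x \<Longrightarrow> x \<le> 1 \<Longrightarrow> 0 \<le> (1 - x) * zf j x \<and> (1 - x) * zf j x \<le> 1"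
  using zf_bounds[of x j] by (auto intro: mult_le_one)

lemma W_cont: "cont01 (\<lambda>x. (1 - x) * zf j x)" and V_cont: "cont01 (\<lambda>x. sqrt ((1 - x) * zf j x))"
  by (intro continuous_intros zf_cont)+

lemma bnd_Y: "bnd (Ys R)"
  unfolding Ys_def by (rule bnd_fc[OF tp_R[OF tp] yf_cont]) (use yf_bounds in auto)

lemma bnd_F: "bnd (cst F)" and bnd_R: "bnd (cst R)"
  by (intro bnd_cst sa_adm tp_F[OF tp] pcontr_sa tp_R[OF tp])+

lemma bnd_Z: "bnd (Zs R F)"
proof -
  have "bnd (cst F \<star> (\<lambda>j. fc (zf j) R))"
    by (intro bnd_mul bnd_F bnd_fc[OF tp_R[OF tp] zf_cont]) (use zf_bounds in auto)
  then show ?thesis by (simp add: opmul_def Zs_def[abs_def])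
qed

lemma bnd_W: "bnd (Ws R)" and spos_W: "spos (Ws R j)"
proof -
  show "bnd (Ws R)" unfolding Ws_def by (rule bnd_fc[OF tp_R[OF tp] W_cont]) (use wz in auto)
  show "spos (Ws R j)" unfolding Ws_def
    by (rule spos_pcontr[OF pcontr_fc[OF tp_R[OF tp] W_cont wz]])
qed

lemma bnd_V: "bnd (Vs R)" and spos_V: "spos (Vs R j)"
proof -
  show "bnd (Vs R)" unfolding Vs_def by (rule bnd_fc[OF tp_R[OF tp] V_cont]) (use wz in auto)
  show "spos (Vs R j)" unfolding Vs_def
    by (rule spos_pcontr[OF pcontr_fc[OF tp_R[OF tp] V_cont]]) (use wz in auto)
qed

lemma VV: "Vs R \<star> Vs R = Ws R"
proof (intro ext)
  fix j u
  show "(Vs R \<star> Vs R) j u = Ws R j u" unfolding opmul_def Vs_def Ws_def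
    by (rule fc_mult_eq[OF tp_R[OF tp] V_cont V_cont]) (use wz in auto)
qed

lemma FZ: "cst F \<star> Zs R F = Ws R"
proof (intro ext)
  fix j u
  show "(cst F \<star> Zs R F) j u = Ws R j u"
    unfolding opmul_def Zs_def Ws_def tp_FF_fc[OF tp]
    by (rule fc_mult_eq[OF tp_R[OF tp] _ zf_cont]) (auto intro: continuous_intros)
qed

lemma ZF: "Zs R F \<star> cst F = Ws R"
  unfolding FZ[symmetric] by (simp add: opmul_def Zs_def tp_comm[OF tp zf_cont])

lemma nul_xzf: "nul (\<lambda>j. fc (\<lambda>x. x * zf j x) R)"
proof (rule nul_fc[OF tp_R[OF tp], of _ "1/2"])
  show "cont01 (\<lambda>x. x * zf j x)" for j by (intro continuous_intros zf_cont)
  fix j and x :: real assume x: "0 \<le> x" "x \<le> 1"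
  have "2 ^ j * (x * zf j x) = sqrt x * (2 ^ j * sqrt x * zf j x)" using x by simp
  also have "\<dots> \<le> 1 * 1" using zf_bounds[OF x, of j] x by (intro mult_mono) auto
  finally show "\<bar>x * zf j x\<bar> \<le> (1/2) ^ j"
    using zf_bounds[OF x, of j] x by (simp add: power_one_over field_simps)
qed auto

lemma nul_RZ: "nul (cst R \<star> Zs R F)"
proof (rule nul_cong[OF nul_mul_left[OF bnd_F nul_xzf]])
  fix j u
  have "R (F (fc (zf j) R u)) = F (R (fc (zf j) R u))" by (simp add: tp_FR[OF tp])
  also have "R (fc (zf j) R u) = fc (\<lambda>x. x * zf j x) R u"
    using fc_mult[OF tp_R[OF tp] continuous_on_id zf_cont, of j u] by (simp add: fc_id[OF tp_R[OF tp]])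
  finally show "(cst R \<star> Zs R F) j u = (cst F \<star> (\<lambda>j. fc (\<lambda>x. x * zf j x) R)) j u"
    by (simp add: opmul_def Zs_def)
qed

lemma FW: "cst F \<star> Ws R \<simeq> Zs R F"
  unfolding eqv_def FZ[symmetric]
  by (rule nul_cong[OF nul_minus[OF nul_RZ]]) (simp add: opmul_def opsub_def tp_FF[OF tp])

lemma WW: "Ws R \<star> Ws R \<simeq> Zs R F \<star> Zs R F"
proof -
  have "Ws R \<star> Ws R = Zs R F \<star> (cst F \<star> Ws R)"
    by (simp only: opmul_assoc[symmetric] ZF)
  also have "\<dots> \<simeq> Zs R F \<star> Zs R F" by (rule eqv_left[OF bnd_Z FW])
  finally show ?thesis .
qed

lemma sa_Y: "sa (Ys R j)" and sa_Z: "sa (Zs R F j)" and sa_W: "sa (Ws R j)"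
proof -
  show "sa (Ys R j)" "sa (Ws R j)"
    unfolding Ys_def Ws_def by (rule sa_fc[OF tp_R[OF tp]], rule yf_cont W_cont)+
  have "ip E (Zs R F j x) y = ip E x (Zs R F j y)" for x y
    unfolding Zs_def sa_ip[OF tp_F[OF tp]] sa_ip[OF sa_fc[OF tp_R[OF tp] zf_cont]]
    by (simp only: tp_comm[OF tp zf_cont])
  then show "sa (Zs R F j)" unfolding sa_def by blast
qed

lemma pcontr_Y: "pcontr (Ys R j)"
  unfolding Ys_def by (rule pcontr_fc[OF tp_R[OF tp] yf_cont]) (use yf_bounds in auto)

lemma pcontr_1Y: "pcontr (\<lambda>u. u - Ys R j u)"
proof -
  have "(\<lambda>u. u - Ys R j u) = fc (\<lambda>x. 1 - yf j x) R"
    using fc_diff[OF tp_R[OF tp] _ yf_cont, of "\<lambda>x. 1" j] fc_one[OF tp_R[OF tp]]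
    by (auto simp: Ys_def)
  moreover have "pcontr (fc (\<lambda>x. 1 - yf j x) R)"
    by (rule pcontr_fc[OF tp_R[OF tp]], intro continuous_intros yf_cont) (use yf_bounds in auto)
  ultimately show ?thesis by simp
qed

text \<open>
  The graph of \<open>D / 2\<^sup>j\<close> is the range of the projection with rows \<open>(Y, Z)\<close> and \<open>(Z, 1 - Y)\<close>.  It
  fixes the vectors of the graph, and by \<open>scale_YZ\<close> and \<open>scale_Z1Y\<close> its columns lie in the graph.
\<close>

lemma scale_graph:
  assumes "fc sqrt R (2 ^ j *\<^sub>R v) = F u"
  shows "Ys R j v = Zs R F j u" "Zs R F j v = u - Ys R j u"
proof -
  note lG = sa_linear[OF sa_fc[OF tp_R[OF tp] cont01_sqrt]]
  have "(u, 2 ^ j *\<^sub>R v) \<in> bgraph R F" using assms by (simp add: bgraph_iff[OF tp])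
  then obtain \<eta> where \<eta>: "u = fc sqrt R \<eta>" "2 ^ j *\<^sub>R v = F \<eta>" by (auto simp: bgraph_def)
  have v: "v = (1 / 2 ^ j) *\<^sub>R F \<eta>" unfolding \<eta>(2)[symmetric] by simp
  let ?h = "\<lambda>x. sqrt x * zf j x"
  have c: "cont01 ?h" by (intro continuous_intros zf_cont)
  have c1: "cont01 (\<lambda>x. 1 - x)" "cont01 (\<lambda>x. 1 - yf j x)" by (intro continuous_intros yf_cont)+
  have "Ys R j v = (1 / 2 ^ j) *\<^sub>R F (fc (yf j) R \<eta>)"
    unfolding v Ys_def by (simp add: linear_scale[OF sa_linear[OF sa_fc[OF tp_R[OF tp] yf_cont]]] tp_comm[OF tp yf_cont])
  also have "\<dots> = F (fc ?h R \<eta>)"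
  proof -
    have "fc (yf j) R \<eta> = 2 ^ j *\<^sub>R fc ?h R \<eta>"
      unfolding fc_scaleR[OF tp_R[OF tp] c, symmetric]
      by (rule fc_cong[OF tp_R[OF tp] continuous_on_mult[OF continuous_on_const c]])
        (auto simp: yf_def zf_def four_power)
    then show ?thesis by (simp add: linear_scale[OF tp_linear[OF tp]])
  qed
  also have "\<dots> = Zs R F j u"
    unfolding Zs_def \<eta>(1) by (rule arg_cong[of _ _ F], rule sym, rule fc_mult_eq[OF tp_R[OF tp] zf_cont cont01_sqrt]) auto
  finally show "Ys R j v = Zs R F j u" .
  have "Zs R F j v = (1 / 2 ^ j) *\<^sub>R fc (\<lambda>x. (1 - x) * zf j x) R \<eta>"
  proof -
    have "Zs R F j v = (1 / 2 ^ j) *\<^sub>R (Zs R F \<star> cst F) j \<eta>"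
      unfolding v by (simp add: linear_scale[OF bnd_linear[OF bnd_Z]] opmul_def)
    then show ?thesis by (simp only: ZF Ws_def)
  qed
  also have "\<dots> = fc (\<lambda>x. (1 / 2 ^ j) * ((1 - x) * zf j x)) R \<eta>"
    by (rule fc_scaleR[OF tp_R[OF tp] W_cont, symmetric])
  also have "\<dots> = fc (\<lambda>x. (1 - yf j x)) R (fc sqrt R \<eta>)"
    by (rule sym, rule fc_mult_eq[OF tp_R[OF tp] c1(2) cont01_sqrt]) (simp add: one_minus_yf zf_def)
  also have "\<dots> = u - Ys R j u"
    using fc_diff[OF tp_R[OF tp] _ yf_cont, of "\<lambda>x. 1" j] fc_one[OF tp_R[OF tp]]
    by (simp add: Ys_def \<eta>(1))
  finally show "Zs R F j v = u - Ys R j u" .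
qed

lemma scale_YZ: "fc sqrt R (2 ^ j *\<^sub>R Zs R F j u) = F (Ys R j u)"
proof -
  note lG = sa_linear[OF sa_fc[OF tp_R[OF tp] cont01_sqrt]]
  let ?h = "\<lambda>x. sqrt x * zf j x"
  have c: "cont01 ?h" by (intro continuous_intros zf_cont)
  have "fc sqrt R (2 ^ j *\<^sub>R Zs R F j u) = F (2 ^ j *\<^sub>R fc sqrt R (fc (zf j) R u))"
    unfolding Zs_def by (simp add: linear_scale[OF lG] linear_scale[OF tp_linear[OF tp]] tp_comm[OF tp cont01_sqrt])
  also have "fc sqrt R (fc (zf j) R u) = fc ?h R u"
    by (rule fc_mult_eq[OF tp_R[OF tp] cont01_sqrt zf_cont]) simp
  also have "2 ^ j *\<^sub>R fc ?h R u = Ys R j u"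
    unfolding fc_scaleR[OF tp_R[OF tp] c, symmetric] Ys_def
    by (rule fc_cong[OF tp_R[OF tp] yf_cont]) (auto simp: yf_def zf_def four_power)
  finally show ?thesis .
qed

lemma scale_Z1Y: "fc sqrt R (2 ^ j *\<^sub>R (u - Ys R j u)) = F (Zs R F j u)"
proof -
  note lG = sa_linear[OF sa_fc[OF tp_R[OF tp] cont01_sqrt]]
  have c1: "cont01 (\<lambda>x. 1 - yf j x)" by (intro continuous_intros yf_cont)+
  have c2: "cont01 (\<lambda>x. (1 - x) * zf j x)" by (rule W_cont)
  have "u - Ys R j u = fc (\<lambda>x. 1 - yf j x) R u"
    using fc_diff[OF tp_R[OF tp] _ yf_cont, of "\<lambda>x. 1" j] fc_one[OF tp_R[OF tp]] by (simp add: Ys_def)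
  then have "fc sqrt R (2 ^ j *\<^sub>R (u - Ys R j u)) = 2 ^ j *\<^sub>R fc sqrt R (fc (\<lambda>x. 1 - yf j x) R u)"
    by (simp add: linear_scale[OF lG])
  also have "fc sqrt R (fc (\<lambda>x. 1 - yf j x) R u) = fc (\<lambda>x. (1 / 2 ^ j) * ((1 - x) * zf j x)) R u"
    by (rule fc_mult_eq[OF tp_R[OF tp] cont01_sqrt c1]) (simp add: one_minus_yf zf_def)
  also have "2 ^ j *\<^sub>R \<dots> = Ws R j u"
    unfolding fc_scaleR[OF tp_R[OF tp] c2] Ws_def by simp
  also have "\<dots> = F (Zs R F j u)" by (simp add: FZ[symmetric] opmul_def)
  finally show ?thesis .
qed

context
  fixes \<alpha> :: real
  assumes \<alpha>: "0 \<le> \<alpha>" "\<alpha> < 1"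
begin

private lemma th: "0 < (2::real) powr (\<alpha> - 1)" "(2::real) powr (\<alpha> - 1) < 1"
  using \<alpha> powr_less_mono[of "\<alpha> - 1" 0 2] by auto

private lemma nul_psi_mult:
  assumes f: "\<And>j. cont01 (f j)" "\<And>j x. 0 \<le> x \<Longrightarrow> x \<le> 1 \<Longrightarrow> 0 \<le> f j x \<and> f j x \<le> 1 \<and> 2 ^ j * sqrt x * f j x \<le> 1"
  shows "nul (cst (fc (\<psi> \<alpha>) R) \<star> (\<lambda>j. fc (f j) R))"
proof -
  have "nul (\<lambda>j. fc (\<lambda>x. \<psi> \<alpha> x * f j x) R)"
  proof (rule nul_fc[OF tp_R[OF tp] _ th])
    show "cont01 (\<lambda>x. \<psi> \<alpha> x * f j x)" for j by (intro continuous_on_mult psi_cont \<alpha> f)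
    fix j and x :: real assume x: "0 \<le> x" "x \<le> 1"
    have "0 \<le> \<psi> \<alpha> x" by (simp add: \<psi>_def)
    then show "\<bar>\<psi> \<alpha> x * f j x\<bar> \<le> (2 powr (\<alpha> - 1)) ^ j"
      using powr_decay[OF \<alpha> x(1), of "f j x" j] f(2)[OF x, of j] by (simp add: \<psi>_def abs_mult)
  qed
  then show ?thesis
    by (rule nul_cong) (simp add: opmul_def fc_mult[OF tp_R[OF tp] psi_cont[OF \<alpha>(2)] f(1)])
qed

text \<open>
  The entries \<open>Z\<close> and \<open>1 - Y\<close> are small where \<open>D\<close> is small compared to \<open>2\<^sup>j\<close>, and powers of \<open>\<langle>D\<rangle>\<close> of
  negative order are small elsewhere.
\<close>

lemma nul_psi_Z: "nul (cst (fc (\<psi> \<alpha>) R) \<star> Zs R F)"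
proof (rule nul_cong)
  show "nul (cst F \<star> (cst (fc (\<psi> \<alpha>) R) \<star> (\<lambda>j. fc (zf j) R)))"
    by (rule nul_mul_left[OF bnd_F nul_psi_mult[OF zf_cont]]) (use zf_bounds in auto)
qed (simp add: opmul_def Zs_def tp_comm[OF tp psi_cont[OF \<alpha>(2)]])

lemma nul_psi_1Y: "nul (cst (fc (\<psi> \<alpha>) R) \<star> (one \<boxminus> Ys R))"
proof -
  have "(one \<boxminus> Ys R) = (\<lambda>j. fc (\<lambda>x. 1 - yf j x) R)"
    using fc_diff[OF tp_R[OF tp] _ yf_cont, of "\<lambda>x. 1"] fc_one[OF tp_R[OF tp]]
    by (intro ext) (simp add: Ys_def opsub_def)
  moreover have "nul (cst (fc (\<psi> \<alpha>) R) \<star> (\<lambda>j. fc (\<lambda>x. 1 - yf j x) R))"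
    by (rule nul_psi_mult, intro continuous_intros yf_cont) (use yf_bounds in auto)
  ultimately show ?thesis by simp
qed

end

text \<open>
  Operators that are small on \<open>Z\<close> are small on \<open>1 - Y\<close>: the difference of consecutive \<open>Y\<close> is \<open>Z\<close>
  times a bounded operator, and \<open>Y\<close> tends strongly to \<open>1\<close>, so that \<open>T (1 - Y)\<close> is the tail of a
  geometric series.
\<close>

lemma nul_telescope:
  assumes dense: "closure (range (fc sqrt R)) = UNIV" and T: "adm T" and nul: "nul (cst T \<star> Zs R F)"
  shows "nul (cst T \<star> (one \<boxminus> Ys R))"
proof -
  obtain C \<theta> where C: "0 \<le> C" "0 < \<theta>" "\<theta> < 1" "\<And>j u. u \<in> M \<Longrightarrow> norm (T (Zs R F j u)) \<le> C * \<theta> ^ j * norm u"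
    using nulE[OF nul] unfolding opmul_def by metis
  have lT: "linear T" by (simp add: T adm_clinear clinear_linear)
  have bT: "bounded_linear T" by (rule adm_bounded[OF T])
  \<comment> \<open>The increment of \<open>yf\<close> from \<open>j\<close> to \<open>j + 1\<close> is \<open>(1 - x) zf j x\<close> times this function.\<close>
  let ?h = "\<lambda>j x. 3/2 * zf (Suc j) x"
  have ch: "cont01 (?h j)" for j by (intro continuous_intros zf_cont)
  have step: "Ys R (Suc j) u - Ys R j u = Zs R F j (F (fc (?h j) R u))" for j u
  proof -
    have "Zs R F j (F (fc (?h j) R u)) = (Zs R F \<star> cst F) j (fc (?h j) R u)" by (simp add: opmul_def)
    also have "\<dots> = fc (\<lambda>x. (1 - x) * zf j x) R (fc (?h j) R u)" by (simp only: ZF Ws_def)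
    also have "\<dots> = fc (\<lambda>x. yf (Suc j) x - yf j x) R u"
    proof (rule fc_mult_eq[OF tp_R[OF tp] W_cont ch])
      fix x :: real assume x: "0 \<le> x" "x \<le> 1"
      define p where "p = (4::real) ^ j"
      define d where "d = den j x"
      define d' where "d' = den (Suc j) x"
      have pos: "0 < d" "0 < d'" using den_pos[OF x(1)] by (auto simp: d_def d'_def)
      have dd: "d = 1 + (p - 1) * x" "d' = 1 + (4 * p - 1) * x" by (auto simp: d_def d'_def den_def p_def)
      have "zf j x * zf (Suc j) x = 2 * p * x / (d * d')"
        using x by (simp add: zf_def d_def d'_def p_def four_power)
      moreover have "(1 - x) * zf j x * (3/2 * zf (Suc j) x) = 3/2 * (1 - x) * (zf j x * zf (Suc j) x)"
        by (simp only: mult_ac)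
      ultimately have "(1 - x) * zf j x * (3/2 * zf (Suc j) x) = 3 * p * x * (1 - x) / (d * d')"
        by simp
      also have "\<dots> = 4 * p * x / d' - p * x / d"
      proof -
        have "4 * p * x / d' - p * x / d = (4 * p * x * d - p * x * d') / (d * d')"
          using pos by (simp add: diff_divide_distrib)
        also have "4 * p * x * d - p * x * d' = 3 * p * x * (1 - x)"
          unfolding dd by (simp add: algebra_simps)
        finally show ?thesis by simp
      qed
      also have "\<dots> = yf (Suc j) x - yf j x" by (simp add: yf_def d_def d'_def p_def)
      finally show "(1 - x) * zf j x * ?h j x = yf (Suc j) x - yf j x" .
    qed
    also have "\<dots> = Ys R (Suc j) u - Ys R j u"
      unfolding Ys_def by (rule fc_diff[OF tp_R[OF tp] yf_cont yf_cont])
    finally show ?thesis by simp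
  qed
  have d: "norm (T (Ys R (Suc j) u) - T (Ys R j u)) \<le> C * \<theta> ^ j * (3/2 * norm u)" if u: "u \<in> M" for j u
  proof -
    have "F (fc (?h j) R u) \<in> M"
      by (intro M_inv[OF sa_adm[OF tp_F[OF tp]]] M_inv[OF adm_fc[OF tp_R[OF tp] ch]] u)
    from C(4)[OF this, of j]
    have "norm (T (Ys R (Suc j) u) - T (Ys R j u)) \<le> C * \<theta> ^ j * norm (F (fc (?h j) R u))"
      unfolding step[symmetric] linear_diff[OF lT, symmetric] .
    also have "norm (F (fc (?h j) R u)) \<le> 3/2 * norm u"
      by (rule order_trans[OF tp_F_norm[OF tp] norm_fc_le[OF tp_R[OF tp] ch]]) (use zf_bounds in auto)
    finally show ?thesis using C by (simp add: mult_left_mono)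
  qed
  have d': "norm (T (Ys R (j + n) u) - T (Ys R j u)) \<le> C * \<theta> ^ j * (3/2 * norm u) / (1 - \<theta>)"
    if u: "u \<in> M" for j n u
  proof -
    have "norm (T (Ys R (j + n) u) - T (Ys R j u)) \<le> (\<Sum>i<n. C * \<theta> ^ (j + i) * (3/2 * norm u))"
    proof (induction n)
      case (Suc n)
      have "norm (T (Ys R (j + Suc n) u) - T (Ys R j u))
          \<le> norm (T (Ys R (Suc (j + n)) u) - T (Ys R (j + n) u)) + norm (T (Ys R (j + n) u) - T (Ys R j u))"
        by (rule order_trans[OF _ norm_triangle_ineq]) simp
      then show ?case using Suc d[OF u, of "j + n"] by simp
    qed simp
    also have "\<dots> = C * \<theta> ^ j * (3/2 * norm u) * (\<Sum>i<n. \<theta> ^ i)"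
      by (simp add: sum_distrib_left power_add mult_ac)
    also have "\<dots> \<le> C * \<theta> ^ j * (3/2 * norm u) * (1 / (1 - \<theta>))"
    proof (rule mult_left_mono)
      show "(\<Sum>i<n. \<theta> ^ i) \<le> 1 / (1 - \<theta>)"
        using sum_le_suminf[OF summable_geometric, of \<theta> "{..<n}"] suminf_geometric[of \<theta>] C by auto
    qed (use C in auto)
    finally show ?thesis by simp
  qed
  have strong: "(\<lambda>n. Ys R n u) \<longlonglongrightarrow> u" for u
  proof (rule LIMSEQ_I)
    fix e :: real assume e: "0 < e"
    have "u \<in> closure (range (fc sqrt R))" using dense by simp
    then obtain w where w: "dist (fc sqrt R w) u < e / 3"
      using e closure_approachable[of u "range (fc sqrt R)"] by (metis divide_pos_pos rangeE zero_less_numeral)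
    obtain m where m: "norm w / (e / 3) < 2 ^ m" using real_arch_pow[of 2] by auto
    show "\<exists>m. \<forall>n\<ge>m. norm (Ys R n u - u) < e"
    proof (intro exI[of _ m] allI impI)
      fix n assume n: "m \<le> n"
      let ?g = "fc sqrt R w"
      have mn: "(2::real) ^ m \<le> 2 ^ n" using n by (intro power_increasing) auto
      have c1: "cont01 (\<lambda>x. 1 - yf n x)" by (intro continuous_intros yf_cont)
      have "?g - Ys R n ?g = fc (\<lambda>x. 1 - yf n x) R ?g"
        using fc_diff[OF tp_R[OF tp] _ yf_cont, of "\<lambda>x. 1" n] fc_one[OF tp_R[OF tp]] by (simp add: Ys_def)
      also have "\<dots> = fc (\<lambda>x. (1 - yf n x) * sqrt x) R w"
        by (rule fc_mult[OF tp_R[OF tp] c1 cont01_sqrt, symmetric])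
      finally have "norm (?g - Ys R n ?g) \<le> 1 / 2 ^ n * norm w"
      proof (simp only:, intro norm_fc_le[OF tp_R[OF tp]] continuous_on_mult c1 cont01_sqrt)
        fix x :: real assume x: "0 \<le> x" "x \<le> 1"
        have "0 \<le> (1 - yf n x) * sqrt x" using yf_bounds[OF x, of n] x by simp
        then show "\<bar>(1 - yf n x) * sqrt x\<bar> \<le> 1 / 2 ^ n"
          using yf_bounds(3)[OF x, of n] by (simp add: le_divide_eq mult_ac)
      qed
      also have "\<dots> < e / 3"
      proof -
        have "norm w / (e / 3) < 2 ^ n" using m mn by linarith
        then show ?thesis using e by (simp add: field_simps)
      qed
      finally have 1: "norm (?g - Ys R n ?g) < e / 3" .
      have 2: "norm (Ys R n (?g - u)) < e / 3"
        using pcontr_norm_le[OF pcontr_Y, of n "?g - u"] w by (simp add: dist_norm)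
      have 3: "norm (?g - u) < e / 3" using w by (simp add: dist_norm)
      have "Ys R n u - u = - (?g - Ys R n ?g) - Ys R n (?g - u) + (?g - u)"
        by (simp add: linear_diff[OF bnd_linear[OF bnd_Y]])
      also have "norm \<dots> \<le> norm (?g - Ys R n ?g) + norm (Ys R n (?g - u)) + norm (?g - u)"
        using norm_triangle_ineq[of "- (?g - Ys R n ?g) - Ys R n (?g - u)" "?g - u"]
          norm_triangle_ineq4[of "- (?g - Ys R n ?g)" "Ys R n (?g - u)"] norm_minus_cancel[of "?g - Ys R n ?g"]
        by linarith
      finally show "norm (Ys R n u - u) < e" using 1 2 3 by linarith
    qed
  qed
  show ?thesis
  proof (rule nulI[of "C * (3/2) / (1 - \<theta>)" \<theta>])
    fix j u assume u: "u \<in> M"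
    have "(\<lambda>n. T (Ys R (j + n) u) - T (Ys R j u)) \<longlonglongrightarrow> T u - T (Ys R j u)"
      using bounded_linear.tendsto[OF bT LIMSEQ_ignore_initial_segment[OF strong[of u], of j]]
      by (intro tendsto_diff tendsto_const) (simp add: add.commute)
    from LIMSEQ_le_const2[OF tendsto_norm[OF this]] d'[OF u, of j]
    have "norm (T u - T (Ys R j u)) \<le> C * \<theta> ^ j * (3/2 * norm u) / (1 - \<theta>)" by blast
    then show "norm ((cst T \<star> (one \<boxminus> Ys R)) j u) \<le> C * (3/2) / (1 - \<theta>) * \<theta> ^ j * norm u"
      by (simp add: opmul_def opsub_def linear_diff[OF lT] mult_ac)
  qed (use C in auto)
qed

end

end

section \<open>Intertwining the bounded transforms\<close>

context hmod
begin

lemma spos_sandwich: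
  assumes A: "adm A" and P: "spos P"
  shows "spos (\<lambda>u. A (P (ad A u)))"
proof -
  obtain V where V: "sa V" "\<And>u. V (V u) = P u" using spos_sqrt[OF P] by metis
  have aV: "adm V" and aA: "adm (ad A)" by (rule sa_adm[OF V(1)], rule adm_ad(1)[OF A])
  have "spos (\<lambda>u. ad (\<lambda>u. V (ad A u)) (V (ad A u)))"
    by (rule spos_adjoint_square[OF adm_comp[OF aV aA]])
  then show ?thesis
    by (simp add: ad_comp[OF aV aA] adm_ad(2)[OF A] sa_ad[OF V(1)] V(2))
qed

end

context isub
begin

lemma eqv_mul: "bnd S \<Longrightarrow> bnd T' \<Longrightarrow> S \<simeq> S' \<Longrightarrow> T \<simeq> T' \<Longrightarrow> S \<star> T \<simeq> S' \<star> T'"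
  by (rule eqv_trans[OF eqv_left eqv_right])

text \<open>Commutation up to decay.\<close>

definition cm :: "'e opseq \<Rightarrow> 'e opseq \<Rightarrow> bool" where
  "cm A B \<longleftrightarrow> A \<star> B \<simeq> B \<star> A"

lemma cm_ad:
  assumes "bnd A" "bnd B" "cm A B"
  shows "cm (\<lambda>j. ad (A j)) (\<lambda>j. ad (B j))"
proof -
  have "(\<lambda>j. ad ((A \<star> B) j)) \<simeq> (\<lambda>j. ad ((B \<star> A) j))"
    by (rule eqv_ad[OF bnd_mul bnd_mul]) (use assms in \<open>auto simp: cm_def\<close>)
  moreover have "(\<lambda>j. ad ((A \<star> B) j)) = (\<lambda>j. ad (B j)) \<star> (\<lambda>j. ad (A j))"
    "(\<lambda>j. ad ((B \<star> A) j)) = (\<lambda>j. ad (A j)) \<star> (\<lambda>j. ad (B j))"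
    using ad_comp[OF bnd_adm[OF assms(1)] bnd_adm[OF assms(2)]]
      ad_comp[OF bnd_adm[OF assms(2)] bnd_adm[OF assms(1)]]
    by (simp_all add: opmul_def)
  ultimately show ?thesis unfolding cm_def by (metis eqv_sym)
qed

lemma cm_sqrt:
  assumes "bnd a" "\<And>j. spos (a j)" "bnd c" "cm (a \<star> a) c"
  shows "cm a c"
  unfolding cm_def by (rule eqv_sqrt) (use assms in \<open>auto simp: cm_def\<close>)

lemma cm_square:
  assumes "bnd A" "bnd B" "cm A B"
  shows "cm (A \<star> A) B"
proof -
  have "A \<star> A \<star> B = A \<star> (A \<star> B)" by (rule opmul_assoc)
  also have "\<dots> \<simeq> A \<star> (B \<star> A)" by (rule eqv_left) (use assms in \<open>auto simp: cm_def\<close>)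
  also have "\<dots> = (A \<star> B) \<star> A" by (rule opmul_assoc[symmetric])
  also have "\<dots> \<simeq> (B \<star> A) \<star> A" by (rule eqv_right) (use assms in \<open>auto simp: cm_def\<close>)
  also have "\<dots> = B \<star> (A \<star> A)" by (rule opmul_assoc)
  finally show ?thesis by (simp add: cm_def)
qed

lemma cm_cong:
  assumes "bnd B" "A \<simeq> A'" "cm A B"
  shows "cm A' B"
  unfolding cm_def
  by (rule eqv_trans[OF eqv_right[OF assms(1) eqv_sym[OF assms(2)]]
        eqv_trans[OF assms(3)[unfolded cm_def] eqv_left[OF assms(1,2)]]])

text \<open>If \<open>W\<^sup>2 = Z\<^sup>2\<close>, then \<open>(W N)\<^sup>2 = (Z N)\<^sup>2\<close> for \<open>N\<close> commuting with both.\<close>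

lemma eqv_square_mul:
  assumes b: "bnd W" "bnd Z" "bnd N" and c: "cm W N" "cm Z N" and eq: "W \<star> W \<simeq> Z \<star> Z"
  shows "(W \<star> N) \<star> (W \<star> N) \<simeq> (Z \<star> N) \<star> (Z \<star> N)"
proof -
  have expand: "(W \<star> N) \<star> (W \<star> N) \<simeq> (W \<star> W) \<star> (N \<star> N)" if "bnd W" "bnd N" "cm W N" for W
  proof -
    have "(W \<star> N) \<star> (W \<star> N) = W \<star> ((N \<star> W) \<star> N)" by (simp only: opmul_assoc)
    also have "\<dots> \<simeq> W \<star> ((W \<star> N) \<star> N)"
      by (intro eqv_left eqv_right that eqv_sym[OF that(3)[unfolded cm_def]])
    also have "\<dots> = (W \<star> W) \<star> (N \<star> N)" by (simp only: opmul_assoc)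
    finally show ?thesis .
  qed
  have "(W \<star> N) \<star> (W \<star> N) \<simeq> (W \<star> W) \<star> (N \<star> N)" by (rule expand) fact+
  also have "\<dots> \<simeq> (Z \<star> Z) \<star> (N \<star> N)" by (intro eqv_right bnd_mul b eq)
  also have "\<dots> \<simeq> (Z \<star> N) \<star> (Z \<star> N)" by (rule eqv_sym[OF expand]) fact+
  finally show ?thesis .
qed

lemma nul_scaled:
  assumes "bnd A"
  shows "nul (\<lambda>j u. (1 / 2 ^ j) *\<^sub>R A j u)"
proof -
  obtain C where C: "0 < C" "\<And>j u. norm (A j u) \<le> C * norm u" using bndE[OF assms] by metis
  show ?thesis
    by (rule nulI[of C "1/2"]) (use C in \<open>auto simp: power_one_over divide_right_mono\<close>)
qed

text \<open>
  \<open>tmap\<close> says that the graph of the second operator, scaled by \<open>2\<^sup>j\<close>, contains \<open>(S, T)\<close> up to decay.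
  \<open>inter\<close> is the bounded form of the identity \<open>D\<^sub>2 X = Y D\<^sub>1 + K \<langle>D\<^sub>1\<rangle>\<^sup>\<alpha>\<close>, multiplied by
  \<open>\<langle>D\<^sub>1\<rangle>\<^sup>-\<^sup>1\<close> from the right and \<open>\<langle>D\<^sub>2\<rangle>\<^sup>-\<^sup>1\<close> from the left.
\<close>

definition tmap :: "('e \<Rightarrow> 'e) \<Rightarrow> ('e \<Rightarrow> 'e) \<Rightarrow> 'e opseq \<Rightarrow> 'e opseq \<Rightarrow> bool" where
  "tmap R F S T \<longleftrightarrow> (\<exists>N. nul N \<and> (\<forall>j. \<forall>u\<in>M. fc sqrt R (2 ^ j *\<^sub>R (T j u + N j u)) = F (S j u)))"

definition inter :: "real \<Rightarrow> ('e \<Rightarrow> 'e) \<Rightarrow> ('e \<Rightarrow> 'e) \<Rightarrow> ('e \<Rightarrow> 'e) \<Rightarrow> ('e \<Rightarrow> 'e) \<Rightarrow>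
    ('e \<Rightarrow> 'e) \<Rightarrow> ('e \<Rightarrow> 'e) \<Rightarrow> bool" where
  "inter \<alpha> R1 F1 R2 F2 X Y \<longleftrightarrow> (\<exists>K. adm K \<and>
     (\<forall>u\<in>M. F2 (X (fc sqrt R1 u)) = fc sqrt R2 (Y (F1 u) + K (fc (\<psi> \<alpha>) R1 u))))"

lemma tmap_eqv:
  assumes tp: "tp R F" and tm: "tmap R F S T"
  shows "Ys R \<star> T \<simeq> Zs R F \<star> S" "Zs R F \<star> T \<simeq> S \<boxminus> Ys R \<star> S"
proof -
  obtain N where N: "nul N" "\<And>j u. u \<in> M \<Longrightarrow> fc sqrt R (2 ^ j *\<^sub>R (T j u + N j u)) = F (S j u)"
    using tm unfolding tmap_def by blast
  have e: "Ys R j (T j u) + Ys R j (N j u) = Zs R F j (S j u)"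
    "Zs R F j (T j u) + Zs R F j (N j u) = S j u - Ys R j (S j u)" if "u \<in> M" for j u
    using scale_graph[OF tp N(2)[OF that], of j]
    by (simp_all add: linear_add[OF bnd_linear[OF bnd_Y[OF tp]]] linear_add[OF bnd_linear[OF bnd_Z[OF tp]]])
  show "Ys R \<star> T \<simeq> Zs R F \<star> S" unfolding eqv_def
    by (rule nul_cong[OF nul_minus[OF nul_mul_left[OF bnd_Y[OF tp] N(1)]]])
      (simp add: opmul_def opsub_def e(1)[symmetric])
  show "Zs R F \<star> T \<simeq> S \<boxminus> Ys R \<star> S" unfolding eqv_def
    by (rule nul_cong[OF nul_minus[OF nul_mul_left[OF bnd_Z[OF tp] N(1)]]])
      (simp add: opmul_def opsub_def e(2)[symmetric])
qed

text \<open>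
  The columns of the projection onto the graph of \<open>D\<^sub>1 / 2\<^sup>j\<close> are of the form \<open>(S, T)\<close>; writing a
  vector of the graph as \<open>(R\<^sub>1\<^sup>1\<^sup>/\<^sup>2 \<eta>, F\<^sub>1 \<eta>)\<close>, the term \<open>K \<langle>D\<^sub>1\<rangle>\<^sup>\<alpha>\<^sup>-\<^sup>1 \<eta>\<close> decays after division by \<open>2\<^sup>j\<close>.
\<close>

lemma inter_tmap:
  assumes tp1: "tp R1 F1" and \<alpha>: "\<alpha> < 1"
    and int: "inter \<alpha> R1 F1 R2 F2 X Y" and X: "adm X" and Y: "adm Y"
    and S: "bnd S" and T: "bnd T" and small: "nul (cst (fc (\<psi> \<alpha>) R1) \<star> T)"
    and ST: "\<And>j u. fc sqrt R1 (2 ^ j *\<^sub>R T j u) = F1 (S j u)"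
  shows "tmap R2 F2 (cst X \<star> S) (cst Y \<star> T)"
proof -
  obtain K where K: "adm K" "\<And>u. u \<in> M \<Longrightarrow> F2 (X (fc sqrt R1 u)) = fc sqrt R2 (Y (F1 u) + K (fc (\<psi> \<alpha>) R1 u))"
    using int unfolding inter_def by blast
  note R1 = tp_R[OF tp1]
  let ?G = "fc sqrt R1" and ?P = "fc (\<psi> \<alpha>) R1"
  have bP: "bnd (cst ?P)" and bG: "bnd (cst ?G)"
    by (intro bnd_cst adm_fc[OF R1] psi_cont \<alpha> cont01_sqrt)+
  have lP: "linear ?P" and lG: "linear ?G" and lK: "linear K" and lY: "linear Y" and lF: "linear F1"
    by (rule bnd_linear[OF bP] bnd_linear[OF bG] bnd_linear[OF bnd_cst[OF K(1)]] bnd_linear[OF bnd_cst[OF Y]]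
        tp_linear[OF tp1])+
  define N where "N = cst K \<star> (cst F1 \<star> (cst ?P \<star> T)) \<boxplus> (\<lambda>j u. (1 / 2 ^ j) *\<^sub>R (cst K \<star> (cst ?P \<star> (cst ?G \<star> S))) j u)"
  have "nul N" unfolding N_def
    by (intro nul_add nul_mul_left[OF bnd_cst[OF K(1)]] nul_mul_left[OF bnd_F[OF tp1]] small nul_scaled
        bnd_mul bnd_cst[OF K(1)] bP bG S)
  moreover have "fc sqrt R2 (2 ^ j *\<^sub>R ((cst Y \<star> T) j u + N j u)) = F2 ((cst X \<star> S) j u)" if u: "u \<in> M" for j u
  proof -
    obtain \<eta> where \<eta>: "S j u = ?G \<eta>" "2 ^ j *\<^sub>R T j u = F1 \<eta>"
      using bgraph_iff[OF tp1, of "S j u" "2 ^ j *\<^sub>R T j u"] ST[of j u] by (auto simp: bgraph_def)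
    have eta: "\<eta> = F1 (2 ^ j *\<^sub>R T j u) + ?G (S j u)"
      by (simp add: \<eta> tp_FF[OF tp1] fc_sqrt_sqrt[OF R1])
    have "subspace M" by (rule M_subspace)
    then have "\<eta> \<in> M" unfolding eta
      by (intro subspace_add M_inv[OF bnd_adm[OF bnd_F[OF tp1]]] subspace_scale bnd_M[OF T u]
          M_inv[OF bnd_adm[OF bG]] bnd_M[OF S u])
    from K(2)[OF this] have "F2 (X (S j u)) = fc sqrt R2 (Y (2 ^ j *\<^sub>R T j u) + K (?P \<eta>))"
      by (simp add: \<eta>)
    also have "K (?P \<eta>) = 2 ^ j *\<^sub>R N j u"
      by (simp add: eta N_def opadd_def opmul_def linear_add[OF lP] linear_add[OF lK] linear_scale[OF lP] linear_scale[OF lK]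
          linear_scale[OF lF] tp_comm[OF tp1 psi_cont[OF \<alpha>]] scaleR_add_right)
    finally show ?thesis by (simp add: opmul_def linear_scale[OF lY] scaleR_add_right)
  qed
  ultimately show ?thesis unfolding tmap_def by blast
qed

context
  fixes \<alpha> :: real and R1 F1 R2 F2 X Y
  assumes \<alpha>: "0 \<le> \<alpha>" "\<alpha> < 1" and tp1: "tp R1 F1" and tp2: "tp R2 F2"
    and int: "inter \<alpha> R1 F1 R2 F2 X Y" and X: "adm X" and Y: "adm Y"
begin

text \<open>
  The projection onto the graph of \<open>D\<^sub>2 / 2\<^sup>j\<close> fixes, up to decay, the images of the two columns of the
  projection for \<open>D\<^sub>1\<close>.
\<close>

lemma inter_eqv:
  "Ys R2 \<star> (cst Y \<star> Zs R1 F1) \<simeq> Zs R2 F2 \<star> (cst X \<star> Ys R1)"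
  "Zs R2 F2 \<star> (cst Y \<star> Zs R1 F1) \<simeq> cst X \<star> Ys R1 \<boxminus> Ys R2 \<star> (cst X \<star> Ys R1)"
  "Ys R2 \<star> (cst Y \<star> (one \<boxminus> Ys R1)) \<simeq> Zs R2 F2 \<star> (cst X \<star> Zs R1 F1)"
  "Zs R2 F2 \<star> (cst Y \<star> (one \<boxminus> Ys R1)) \<simeq> cst X \<star> Zs R1 F1 \<boxminus> Ys R2 \<star> (cst X \<star> Zs R1 F1)"
proof -
  have 1: "tmap R2 F2 (cst X \<star> Ys R1) (cst Y \<star> Zs R1 F1)"
    by (rule inter_tmap[OF tp1 \<alpha>(2) int X Y bnd_Y[OF tp1] bnd_Z[OF tp1] nul_psi_Z[OF tp1 \<alpha>] scale_YZ[OF tp1]])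
  have 2: "tmap R2 F2 (cst X \<star> Zs R1 F1) (cst Y \<star> (one \<boxminus> Ys R1))"
    by (rule inter_tmap[OF tp1 \<alpha>(2) int X Y bnd_Z[OF tp1] bnd_sub[OF bnd_one bnd_Y[OF tp1]] nul_psi_1Y[OF tp1 \<alpha>]])
      (simp add: opsub_def scale_Z1Y[OF tp1])
  show "Ys R2 \<star> (cst Y \<star> Zs R1 F1) \<simeq> Zs R2 F2 \<star> (cst X \<star> Ys R1)"
    "Zs R2 F2 \<star> (cst Y \<star> Zs R1 F1) \<simeq> cst X \<star> Ys R1 \<boxminus> Ys R2 \<star> (cst X \<star> Ys R1)"
    by (rule tmap_eqv[OF tp2 1])+
  show "Ys R2 \<star> (cst Y \<star> (one \<boxminus> Ys R1)) \<simeq> Zs R2 F2 \<star> (cst X \<star> Zs R1 F1)"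
    "Zs R2 F2 \<star> (cst Y \<star> (one \<boxminus> Ys R1)) \<simeq> cst X \<star> Zs R1 F1 \<boxminus> Ys R2 \<star> (cst X \<star> Zs R1 F1)"
    by (rule tmap_eqv[OF tp2 2])+
qed

end

text \<open>The first of the relations \<open>inter_eqv\<close> cancels the two terms of the fourth that involve \<open>Y\<close>.\<close>

lemma cm_Z:
  assumes \<alpha>: "0 \<le> \<alpha>" "\<alpha> < 1" and tp: "tp R F" and int: "inter \<alpha> R F R F b b" and b: "adm b"
  shows "cm (Zs R F) (cst b)"
proof -
  let ?Y = "Ys R" and ?Z = "Zs R F" and ?b = "cst b"
  note e = inter_eqv[OF \<alpha> tp tp int b b]
  have bb: "bnd ?b" by (rule bnd_cst[OF b])
  have bY: "bnd ?Y" by (rule bnd_Y[OF tp])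
  have dist: "A \<star> (?b \<star> (one \<boxminus> ?Y)) = A \<star> ?b \<boxminus> A \<star> (?b \<star> ?Y)" if "bnd A" for A
    by (simp add: mul_sub[OF bb] mul_sub[OF that])
  have "?Z \<star> ?b \<boxminus> ?Z \<star> (?b \<star> ?Y) \<simeq> ?b \<star> ?Z \<boxminus> ?Y \<star> (?b \<star> ?Z)"
    using e(4) unfolding dist[OF bnd_Z[OF tp]] .
  then have "?Z \<star> ?b \<simeq> ?b \<star> ?Z"
    by (rule eqv_cancel') (rule eqv_sym[OF e(1)])
  then show ?thesis by (simp add: cm_def)
qed

lemma cm_W:
  assumes tp: "tp R F" and c: "bnd c" "cm (Zs R F) c"
  shows "cm (Ws R) c" "cm (Vs R) c"
proof -
  show *: "cm (Ws R) c"
    by (rule cm_sqrt[OF bnd_W[OF tp] spos_W[OF tp] c(1)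
          cm_cong[OF c(1) eqv_sym[OF WW[OF tp]] cm_square[OF bnd_Z[OF tp] c]]])
  show "cm (Vs R) c"
    by (rule cm_sqrt[OF bnd_V[OF tp] spos_V[OF tp] c(1)]) (simp add: VV[OF tp] *)
qed

text \<open>A bounded operator with bounded commutator of lower order commutes with the bounded transform up to decay.\<close>

theorem nul_commutator:
  assumes \<alpha>: "0 \<le> \<alpha>" "\<alpha> < 1" and tp: "tp R F" and int: "inter \<alpha> R F R F b b" and b: "adm b"
  shows "nul (cst (\<lambda>u. F (b u) - b (F u)) \<star> Zs R F)"
proof -
  have bb: "bnd (cst b)" by (rule bnd_cst[OF b])
  have c: "cm (Zs R F) (cst b)" by (rule cm_Z[OF \<alpha> tp int b])
  have "cst F \<star> (cst b \<star> Zs R F) \<simeq> cst F \<star> (Zs R F \<star> cst b)"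
    by (rule eqv_left[OF bnd_F[OF tp] eqv_sym[OF c[unfolded cm_def]]])
  also have "\<dots> = Ws R \<star> cst b" by (simp only: opmul_assoc[symmetric] FZ[OF tp])
  also have "\<dots> \<simeq> cst b \<star> Ws R" using cm_W(1)[OF tp bb c] by (simp add: cm_def)
  also have "\<dots> = cst b \<star> (cst F \<star> Zs R F)" by (simp only: FZ[OF tp])
  finally show ?thesis unfolding eqv_def by (rule nul_cong) (simp add: opmul_def opsub_def)
qed

text \<open>
  The comparison of two bounded transforms.  Let \<open>q = x x\<^sup>*\<close>.  By \<open>inter_eqv\<close> the positive operator
  \<open>N = X Y\<^sub>1 X\<^sup>* + Y (1 - Y\<^sub>1) Y\<^sup>*\<close> satisfies \<open>Z\<^sub>2 N \<simeq> q Z\<^sub>1\<close>, where \<open>Y\<^sub>1\<close> and \<open>Z\<^sub>1\<close> belong to the scales of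
  \<open>D\<^sub>1\<close> and \<open>Z\<^sub>2\<close> to those of \<open>D\<^sub>2\<close>.  As \<open>q\<close> commutes with \<open>Z\<^sub>1\<close>, taking adjoints shows that \<open>N\<close> commutes
  with \<open>Z\<^sub>2\<close>.  Hence \<open>(W\<^sub>2 N)\<^sup>2 \<simeq> (Z\<^sub>2 N)\<^sup>2 \<simeq> (q Z\<^sub>1)\<^sup>2 \<simeq> (q W\<^sub>1)\<^sup>2\<close>, and the uniqueness of positive roots
  gives \<open>W\<^sub>2 N \<simeq> q W\<^sub>1\<close>.  Since \<open>F Z = W\<close>, this says \<open>F\<^sub>2 q Z\<^sub>1 \<simeq> F\<^sub>2 Z\<^sub>2 N = W\<^sub>2 N \<simeq> q W\<^sub>1 \<simeq> F\<^sub>1 q Z\<^sub>1\<close>.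
\<close>

theorem nul_intertwiner:
  assumes \<alpha>: "0 \<le> \<alpha>" "\<alpha> < 1" and tp1: "tp R1 F1" and tp2: "tp R2 F2"
    and X: "adm X" and Y: "adm Y" and x: "adm x"
    and int: "inter \<alpha> R1 F1 R2 F2 X Y"
    and intX: "inter \<alpha> R1 F1 R1 F1 (ad X) (ad X)" and intY: "inter \<alpha> R1 F1 R1 F1 (ad Y) (ad Y)"
    and xx: "\<And>u. u \<in> M \<Longrightarrow> X (ad Y u) = x (ad x u)" "\<And>u. u \<in> M \<Longrightarrow> Y (ad X u) = x (ad x u)"
  shows "nul (cst (\<lambda>u. F2 (x (ad x u)) - F1 (x (ad x u))) \<star> Zs R1 F1)"
proof -
  let ?X = "cst X" and ?X' = "cst (ad X)" and ?Y = "cst Y" and ?Y' = "cst (ad Y)"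
  let ?q = "cst (\<lambda>u. x (ad x u))"
  let ?y1 = "Ys R1" and ?z1 = "Zs R1 F1" and ?w1 = "Ws R1" and ?v1 = "Vs R1"
  let ?y2 = "Ys R2" and ?z2 = "Zs R2 F2" and ?w2 = "Ws R2" and ?v2 = "Vs R2"
  have aq: "adm (\<lambda>u. x (ad x u))" by (rule adm_comp[OF x adm_ad(1)[OF x]])
  have sq: "ad (\<lambda>u. x (ad x u)) = (\<lambda>u. x (ad x u))" by (simp add: ad_comp[OF x adm_ad(1)[OF x]] adm_ad(2)[OF x])
  note bs = bnd_cst[OF X] bnd_cst[OF Y] bnd_cst[OF adm_ad(1)[OF X]] bnd_cst[OF adm_ad(1)[OF Y]] bnd_cst[OF aq]
    bnd_Y[OF tp1] bnd_Z[OF tp1] bnd_W[OF tp1] bnd_V[OF tp1] bnd_Y[OF tp2] bnd_Z[OF tp2] bnd_W[OF tp2] bnd_V[OF tp2]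
    bnd_one
  note e = inter_eqv[OF \<alpha> tp1 tp2 int X Y]
  have cX: "cm ?z1 ?X'" by (rule cm_Z[OF \<alpha> tp1 intX adm_ad(1)[OF X]])
  have cY: "cm ?z1 ?Y'" by (rule cm_Z[OF \<alpha> tp1 intY adm_ad(1)[OF Y]])
  have XY: "?X \<star> ?Y' \<simeq> ?q" and YX: "?Y \<star> ?X' \<simeq> ?q" by (rule eqv_M, simp add: opmul_def xx)+
  have sz: "(\<lambda>j. ad (?z1 j)) = ?z1" "(\<lambda>j. ad (?z2 j)) = ?z2"
    using sa_ad[OF sa_Z[OF tp1]] sa_ad[OF sa_Z[OF tp2]] by simp_all
  have cX': "cm ?z1 ?X"
    using cm_ad[OF bs(7,3) cX] by (simp add: sz adm_ad(2)[OF X])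
  have cq: "cm ?z1 ?q"
  proof -
    have "?z1 \<star> ?q \<simeq> ?z1 \<star> (?X \<star> ?Y')" by (intro eqv_left bs eqv_sym[OF XY])
    also have "\<dots> = (?z1 \<star> ?X) \<star> ?Y'" by (rule opmul_assoc[symmetric])
    also have "\<dots> \<simeq> (?X \<star> ?z1) \<star> ?Y'" by (intro eqv_right bs cX'[unfolded cm_def])
    also have "\<dots> = ?X \<star> (?z1 \<star> ?Y')" by (rule opmul_assoc)
    also have "\<dots> \<simeq> ?X \<star> (?Y' \<star> ?z1)" by (intro eqv_left bs cY[unfolded cm_def])
    also have "\<dots> = (?X \<star> ?Y') \<star> ?z1" by (rule opmul_assoc[symmetric])
    also have "\<dots> \<simeq> ?q \<star> ?z1" by (intro eqv_right bs XY)
    finally show ?thesis by (simp add: cm_def)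
  qed
  define N where "N = ?X \<star> (?y1 \<star> ?X') \<boxplus> ?Y \<star> ((one \<boxminus> ?y1) \<star> ?Y')"
  have bN: "bnd N" unfolding N_def by (intro bnd_add bnd_mul bnd_sub bs)
  have z2N: "?z2 \<star> N \<simeq> ?q \<star> ?z1"
  proof -
    have "?z2 \<star> (?X \<star> (?y1 \<star> ?X')) \<simeq> ?y2 \<star> (?q \<star> ?z1)"
    proof -
      have "?z2 \<star> (?X \<star> (?y1 \<star> ?X')) = (?z2 \<star> (?X \<star> ?y1)) \<star> ?X'" by (simp only: opmul_assoc)
      also have "\<dots> \<simeq> (?y2 \<star> (?Y \<star> ?z1)) \<star> ?X'" by (intro eqv_right bs eqv_sym[OF e(1)])
      also have "\<dots> = ?y2 \<star> (?Y \<star> (?z1 \<star> ?X'))" by (simp only: opmul_assoc)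
      also have "\<dots> \<simeq> ?y2 \<star> (?Y \<star> (?X' \<star> ?z1))" by (intro eqv_left bs cX[unfolded cm_def])
      also have "\<dots> = ?y2 \<star> ((?Y \<star> ?X') \<star> ?z1)" by (simp only: opmul_assoc)
      also have "\<dots> \<simeq> ?y2 \<star> (?q \<star> ?z1)" by (intro eqv_left eqv_right bs YX)
      finally show ?thesis .
    qed
    moreover have "?z2 \<star> (?Y \<star> ((one \<boxminus> ?y1) \<star> ?Y')) \<simeq> ?q \<star> ?z1 \<boxminus> ?y2 \<star> (?q \<star> ?z1)"
    proof -
      have Xq: "?X \<star> (?z1 \<star> ?Y') \<simeq> ?q \<star> ?z1"
      proof -
        have "?X \<star> (?z1 \<star> ?Y') \<simeq> ?X \<star> (?Y' \<star> ?z1)" by (intro eqv_left bs cY[unfolded cm_def])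
        also have "\<dots> = (?X \<star> ?Y') \<star> ?z1" by (simp only: opmul_assoc)
        also have "\<dots> \<simeq> ?q \<star> ?z1" by (intro eqv_right bs XY)
        finally show ?thesis .
      qed
      have "?z2 \<star> (?Y \<star> ((one \<boxminus> ?y1) \<star> ?Y')) = (?z2 \<star> (?Y \<star> (one \<boxminus> ?y1))) \<star> ?Y'" by (simp only: opmul_assoc)
      also have "\<dots> \<simeq> (?X \<star> ?z1 \<boxminus> ?y2 \<star> (?X \<star> ?z1)) \<star> ?Y'" by (intro eqv_right bs e(4))
      also have "\<dots> = ?X \<star> (?z1 \<star> ?Y') \<boxminus> ?y2 \<star> (?X \<star> (?z1 \<star> ?Y'))" by (simp only: opmul_assoc opsub_mul)
      also have "\<dots> \<simeq> ?q \<star> ?z1 \<boxminus> ?y2 \<star> (?q \<star> ?z1)" by (intro eqv_sub eqv_left bs Xq)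
      finally show ?thesis .
    qed
    ultimately have "?z2 \<star> N \<simeq> ?y2 \<star> (?q \<star> ?z1) \<boxplus> (?q \<star> ?z1 \<boxminus> ?y2 \<star> (?q \<star> ?z1))"
      unfolding N_def mul_add[OF bs(11)] by (rule eqv_add)
    also have "\<dots> = ?q \<star> ?z1" by (simp add: opadd_def opsub_def)
    finally show ?thesis .
  qed
  have saN: "ad (N j) = N j" for j
  proof -
    have 1: "sa (\<lambda>u. X (?y1 j (ad X u)))" by (rule sa_sandwich[OF X sa_Y[OF tp1]])
    have 2: "sa (\<lambda>u. Y (ad Y u - ?y1 j (ad Y u)))"
      using sa_sandwich[OF Y pcontr_sa[OF pcontr_1Y[OF tp1, of j]]] .
    have "sa (N j)" using sa_add[OF 1 2] by (simp add: N_def opadd_def opmul_def opsub_def)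
    then show ?thesis by (rule sa_ad)
  qed
  have cN: "cm ?z2 N"
  proof -
    have "(\<lambda>j. ad ((?z2 \<star> N) j)) \<simeq> (\<lambda>j. ad ((?q \<star> ?z1) j))"
      by (intro eqv_ad bnd_mul bs bN z2N)
    moreover have "(\<lambda>j. ad ((?z2 \<star> N) j)) = N \<star> ?z2"
      using ad_comp[OF bnd_adm[OF bs(11)] bnd_adm[OF bN]] sa_ad[OF sa_Z[OF tp2]]
      by (simp add: opmul_def saN)
    moreover have "(\<lambda>j. ad ((?q \<star> ?z1) j)) = ?z1 \<star> ?q"
      using ad_comp[OF aq bnd_adm[OF bs(7)]] sa_ad[OF sa_Z[OF tp1]]
      by (simp add: opmul_def sq)
    ultimately have "N \<star> ?z2 \<simeq> ?z1 \<star> ?q" by simp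
    also have "\<dots> \<simeq> ?q \<star> ?z1" using cq by (simp add: cm_def)
    also have "\<dots> \<simeq> ?z2 \<star> N" by (rule eqv_sym[OF z2N])
    finally show ?thesis unfolding cm_def by (rule eqv_sym)
  qed
  note c2 = cm_W[OF tp2 bN cN] and c1 = cm_W[OF tp1 bs(5) cq]
  \<comment> \<open>Positive representatives of \<open>W\<^sub>2 N\<close> and \<open>q W\<^sub>1\<close>, which are themselves positive only up to decay.\<close>
  let ?A = "?v2 \<star> (N \<star> ?v2)" and ?B = "?v1 \<star> (?q \<star> ?v1)"
  have A: "?A \<simeq> ?w2 \<star> N"
  proof -
    have "?A \<simeq> ?v2 \<star> (?v2 \<star> N)" by (intro eqv_left bs eqv_sym[OF c2(2)[unfolded cm_def]])
    also have "\<dots> = ?w2 \<star> N" by (simp only: opmul_assoc[symmetric] VV[OF tp2])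
    finally show ?thesis .
  qed
  have B: "?B \<simeq> ?q \<star> ?w1"
  proof -
    have "?B = (?v1 \<star> ?q) \<star> ?v1" by (simp only: opmul_assoc)
    also have "\<dots> \<simeq> (?q \<star> ?v1) \<star> ?v1" by (intro eqv_right bs c1(2)[unfolded cm_def])
    also have "\<dots> = ?q \<star> ?w1" by (simp only: opmul_assoc VV[OF tp1])
    finally show ?thesis .
  qed
  have bA: "bnd ?A" "bnd ?B" by (intro bnd_mul bs bN)+
  have AB: "?A \<star> ?A \<simeq> ?B \<star> ?B"
  proof -
    have "?A \<star> ?A \<simeq> (?w2 \<star> N) \<star> (?w2 \<star> N)" by (rule eqv_mul[OF bA(1) _ A A]) (intro bnd_mul bs bN)
    also have "\<dots> \<simeq> (?z2 \<star> N) \<star> (?z2 \<star> N)"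
      by (rule eqv_square_mul[OF bs(12,11) bN c2(1) cN WW[OF tp2]])
    also have "\<dots> \<simeq> (?q \<star> ?z1) \<star> (?q \<star> ?z1)" by (rule eqv_mul[OF _ _ z2N z2N]) (intro bnd_mul bs bN)+
    also have "\<dots> \<simeq> (?z1 \<star> ?q) \<star> (?z1 \<star> ?q)"
      by (rule eqv_mul[OF _ _ eqv_sym eqv_sym]) (use cq in \<open>auto simp: cm_def intro!: bnd_mul bs\<close>)
    also have "\<dots> \<simeq> (?w1 \<star> ?q) \<star> (?w1 \<star> ?q)"
      by (rule eqv_sym[OF eqv_square_mul[OF bs(8,7,5) c1(1) cq WW[OF tp1]]])
    also have "\<dots> \<simeq> (?q \<star> ?w1) \<star> (?q \<star> ?w1)"
      by (rule eqv_mul) (use c1(1) in \<open>auto simp: cm_def intro!: bnd_mul bs\<close>)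
    also have "\<dots> \<simeq> ?B \<star> ?B"
      by (rule eqv_sym, rule eqv_mul[OF bA(2) _ B B]) (intro bnd_mul bs)
    finally show ?thesis .
  qed
  have sA: "spos (?A j)" for j
  proof -
    have 1: "spos (\<lambda>u. X (?y1 j (ad X u)))"
      by (rule spos_sandwich[OF X spos_pcontr[OF pcontr_Y[OF tp1]]])
    have 2: "spos (\<lambda>u. Y (ad Y u - ?y1 j (ad Y u)))"
      using spos_sandwich[OF Y spos_pcontr[OF pcontr_1Y[OF tp1, of j]]] .
    have "spos (N j)" using spos_add[OF 1 2] by (simp add: N_def opadd_def opmul_def opsub_def)
    from spos_sandwich[OF sa_adm[OF spos_sa[OF spos_V[OF tp2]]] this, of j] show ?thesis
      by (simp add: opmul_def sa_ad[OF spos_sa[OF spos_V[OF tp2]]])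
  qed
  have sB: "spos (?B j)" for j
  proof -
    have 1: "spos (\<lambda>u. x (ad x u))" by (rule spos_sandwich[OF x spos_square[OF sa_id]])
    from spos_sandwich[OF sa_adm[OF spos_sa[OF spos_V[OF tp1]]] this, of j] show ?thesis
      by (simp add: opmul_def sa_ad[OF spos_sa[OF spos_V[OF tp1]]])
  qed
  have "?A \<star> one \<simeq> one \<star> ?B"
    by (rule eqv_sqrt[OF bA(1) sA bA(2) sB bnd_one]) (use AB in simp)
  then have AeqB: "?A \<simeq> ?B" by simp
  have "cst F2 \<star> (?q \<star> ?z1) \<simeq> cst F2 \<star> (?z2 \<star> N)"
    by (rule eqv_left[OF bnd_F[OF tp2] eqv_sym[OF z2N]])
  also have "\<dots> = ?w2 \<star> N" by (simp only: opmul_assoc[symmetric] FZ[OF tp2])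
  also have "\<dots> \<simeq> ?A" by (rule eqv_sym[OF A])
  also have "\<dots> \<simeq> ?B" by (rule AeqB)
  also have "\<dots> \<simeq> ?q \<star> ?w1" by (rule B)
  also have "\<dots> \<simeq> ?w1 \<star> ?q" using c1(1) unfolding cm_def by (rule eqv_sym)
  also have "\<dots> = cst F1 \<star> (?z1 \<star> ?q)" by (simp only: opmul_assoc[symmetric] FZ[OF tp1])
  also have "\<dots> \<simeq> cst F1 \<star> (?q \<star> ?z1)"
    by (rule eqv_left[OF bnd_F[OF tp1]]) (use cq in \<open>simp add: cm_def\<close>)
  finally show ?thesis unfolding eqv_def by (rule nul_cong) (simp add: opmul_def opsub_def)
qed

end

section \<open>Bounded pictures of unbounded operators\<close>

text \<open>\<open>bneg \<beta>\<close> of \<open>(1 + D\<^sup>2)\<^sup>-\<^sup>1\<close> is \<open>\<langle>D\<rangle>\<close> to the power \<open>- \<beta>\<close>, with the value \<open>1\<close> at \<open>0\<close> for \<open>\<beta> = 0\<close>.\<close>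

definition bneg :: "real \<Rightarrow> real \<Rightarrow> real" where
  "bneg \<beta> x = (if \<beta> = 0 then 1 else x powr (\<beta> / 2))"

lemma bneg_cont: "0 \<le> \<beta> \<Longrightarrow> cont01 (bneg \<beta>)"
proof (cases "\<beta> = 0")
  case False
  assume "0 \<le> \<beta>"
  then have "cont01 (\<lambda>x. x powr (\<beta> / 2))" using False
    by (intro continuous_on_powr' continuous_intros) auto
  then show ?thesis using False by (simp add: bneg_def[abs_def])
qed (simp add: bneg_def[abs_def] continuous_on_const)

lemma bneg_psi: "0 \<le> \<beta> \<Longrightarrow> 0 \<le> x \<Longrightarrow> bneg \<beta> x * \<psi> \<beta> x = sqrt x"
  by (auto simp: bneg_def \<psi>_def powr_add[symmetric] powr_half_sqrt add_divide_distrib[symmetric])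

lemma psi_bneg: "0 \<le> \<beta> \<Longrightarrow> 0 \<le> x \<Longrightarrow> \<psi> \<beta> x * bneg \<beta> x = sqrt x"
  by (subst mult.commute) (rule bneg_psi)

context hmod
begin

context
  fixes R F
  assumes tp: "tp R F"
begin

lemma resolvent_sq_bgraph: "resolvent_sq (bgraph R F) = R"
proof
  fix w
  note R = tp_R[OF tp]
  note lG = sa_linear[OF sa_fc[OF R cont01_sqrt]]
  have "(THE u. (w, u) \<in> (Id \<oplus> bgraph R F \<odot> bgraph R F)\<inverse>) = R w"
  proof (rule the_equality)
    have "(R w, F (fc sqrt R w)) \<in> bgraph R F" "(F (fc sqrt R w), F (F w)) \<in> bgraph R F"
      by (simp_all add: bgraph_iff[OF tp] tp_comm[OF tp cont01_sqrt] fc_sqrt_sqrt[OF R]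
          tp_FR[OF tp])
    then have "(R w, R w + F (F w)) \<in> Id \<oplus> bgraph R F \<odot> bgraph R F"
      by (intro op_addI) auto
    then show "(w, R w) \<in> (Id \<oplus> bgraph R F \<odot> bgraph R F)\<inverse>" by (simp add: tp_FF[OF tp])
    fix u assume "(w, u) \<in> (Id \<oplus> bgraph R F \<odot> bgraph R F)\<inverse>"
    then obtain u' u'' where u: "(u, u') \<in> bgraph R F" "(u', u'') \<in> bgraph R F" "w = u + u''"
      by (auto simp: op_add_def)
    have "R w = R u + fc sqrt R (fc sqrt R u'')"
      by (simp add: u(3) fc_sqrt_sqrt[OF R] linear_add[OF pcontr_linear[OF R]])
    also have "fc sqrt R u'' = F u'" using u(2) by (simp add: bgraph_iff[OF tp])
    also have "fc sqrt R (F u') = F (F u)"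
      using u(1) by (simp add: bgraph_iff[OF tp] tp_comm[OF tp cont01_sqrt, symmetric])
    finally show "u = R w" by (simp add: tp_FF[OF tp])
  qed
  then show "resolvent_sq (bgraph R F) w = R w" by (simp add: resolvent_sq_def op_apply_def)
qed

lemma bracket_neg_bgraph: "0 \<le> \<beta> \<Longrightarrow> bracket_neg \<beta> (bgraph R F) = fc (bneg \<beta>) R"
proof (cases "\<beta> = 0")
  case True
  then show ?thesis by (simp add: bracket_neg_def bneg_def[abs_def] fc_one[OF tp_R[OF tp]] id_def fun_eq_iff)
next
  case False
  assume b: "0 \<le> \<beta>"
  have "bneg \<beta> = (\<lambda>x. x powr (\<beta> / 2))" using False by (simp add: bneg_def fun_eq_iff)
  then show ?thesis
    using fun_calc_eq_fc[OF tp_R[OF tp] bneg_cont[OF b]] False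
    by (simp add: bracket_neg_def resolvent_sq_bgraph)
qed

lemma bounded_transform_bgraph:
  assumes "single_valued (bgraph R F)"
  shows "bounded_transform (bgraph R F) = F"
proof
  fix u
  have c: "cont01 (\<lambda>x. x powr (1/2))" by (intro continuous_on_powr' continuous_intros) auto
  have "fc (bneg 1) R u = fc sqrt R u"
    by (rule fc_cong[OF tp_R[OF tp] cont01_sqrt]) (simp add: bneg_def powr_half_sqrt)
  moreover have "op_apply (bgraph R F) (fc sqrt R u) = F u"
    unfolding op_apply_def
    by (rule the_equality) (use assms in \<open>auto simp: bgraph_def dest: single_valuedD\<close>)
  ultimately show "bounded_transform (bgraph R F) u = F u"
    by (simp add: bounded_transform_def bracket_neg_bgraph)
qed

end

end

section \<open>Operators on one leg of a tensor product\<close>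

lemma bilinear_add: "bilinear f \<Longrightarrow> bilinear g \<Longrightarrow> bilinear (\<lambda>a b. f a b + g a b)"
  by (simp add: bilinear_def linear_compose_add)

lemma (in hmod) bilinear_ip: "linear f \<Longrightarrow> linear g \<Longrightarrow> bilinear (\<lambda>a b. ip E (f a) (g b))"
  unfolding bilinear_def
  by (auto intro!: linearI simp: linear_add linear_scale ip_add_left ip_add_right ip_scaleR_left ip_scaleR_right)

text \<open>
  \<open>T \<otimes> 1\<close> exists as soon as the inner products of elementary tensors depend additively on the
  inner product of the first legs: with \<open>d\<^sup>2 = 1 - T\<^sup>*T\<close> for a contraction \<open>T\<close>, the squares of
  \<open>(T \<otimes> 1) u\<close> and \<open>(d \<otimes> 1) u\<close> add up to that of \<open>u\<close>.
\<close>

locale ltens0 = E: hmod E + G: hmod G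
  for E :: "('e::complex_banach, 'b::cstar_algebra) hmodule"
    and G :: "('g::complex_banach, 'c::cstar_algebra) hmodule" +
  fixes t :: "'e \<Rightarrow> 'f \<Rightarrow> 'g" and \<Phi> :: "'f \<Rightarrow> 'f \<Rightarrow> 'b \<Rightarrow> 'c"
  assumes t_clinear: "\<And>x. clinear (\<lambda>\<xi>. t \<xi> x)"
    and t_total: "total_set {t \<xi> x | \<xi> x. True}"
    and ip_t: "\<And>\<xi> \<eta> x y. ip G (t \<xi> x) (t \<eta> y) = \<Phi> x y (ip E \<xi> \<eta>)"
    and \<Phi>_add: "\<And>x y b c. \<Phi> x y (b + c) = \<Phi> x y b + \<Phi> x y c"
begin

lemma adm_ext:
  assumes "G.adm S" "G.adm T" "\<And>\<xi> x. S (t \<xi> x) = T (t \<xi> x)"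
  shows "S = T"
  by (rule ext, rule total_ext[OF G.adm_bounded[OF assms(1)] G.adm_bounded[OF assms(2)] t_total])
    (use assms(3) in auto)

lemma lt_exists:
  assumes X: "E.adm X" and c: "0 < c" "\<And>\<xi>. norm (X \<xi>) \<le> c * norm \<xi>"
  shows "\<exists>Z. bounded_linear Z \<and> (\<forall>\<xi> x. Z (t \<xi> x) = t (X \<xi>) x) \<and> (\<forall>u. norm (Z u) \<le> c * norm u)"
proof -
  define X1 where "X1 = (\<lambda>\<xi>. (1 / c) *\<^sub>R X \<xi>)"
  have a1: "E.adm X1" unfolding X1_def by (rule E.adm_scaleR(1)[OF X])
  have n1: "norm (X1 \<xi>) \<le> norm \<xi>" for \<xi> using c by (simp add: X1_def divide_le_eq mult.commute)
  have n2: "norm (E.ad X1 \<xi>) \<le> norm \<xi>" for \<xi> using E.norm_ad_le[OF a1, of 1] n1 by simp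
  have pc: "E.pcontr (\<lambda>\<xi>. E.ad X1 (X1 \<xi>))"
    using E.pcontr_adjoint_square[OF E.adm_ad(1)[OF a1] n2] by (simp add: E.adm_ad(2)[OF a1])
  define d where "d = fc (\<lambda>x. sqrt (1 - x)) (\<lambda>\<xi>. E.ad X1 (X1 \<xi>))"
  have cd: "cont01 (\<lambda>x. sqrt (1 - x))" by (intro continuous_intros)
  have sd: "E.sa d" unfolding d_def by (rule E.sa_fc[OF pc cd])
  have dd: "d (d \<xi>) = \<xi> - E.ad X1 (X1 \<xi>)" for \<xi>
    using E.fc_mult_eq[OF pc cd cd, of "\<lambda>x. 1 - x" \<xi>] E.fc_diff[OF pc, of "\<lambda>x. 1" "\<lambda>x. x" \<xi>]
    by (simp add: d_def E.fc_one[OF pc] E.fc_id[OF pc] continuous_on_id)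
  let ?S = "{(t \<xi> x, t (X1 \<xi>) x, t (d \<xi>) x) | \<xi> x. True}"
  have sq: "ip G u u = ip G v v + ip G w w" if uvw: "(u, v, w) \<in> span ?S" for u v w
  proof -
    have l: "linear (fst :: 'g \<times> 'g \<times> 'g \<Rightarrow> _)" "linear (\<lambda>a :: 'g \<times> 'g \<times> 'g. fst (snd a))"
      "linear (\<lambda>a :: 'g \<times> 'g \<times> 'g. snd (snd a))" by (auto intro: linearI)
    have "ip G (fst a) (fst b) = ip G (fst (snd a)) (fst (snd b)) + ip G (snd (snd a)) (snd (snd b))"
      if ab: "a \<in> ?S" "b \<in> ?S" for a b
    proof -
      obtain \<xi> x \<eta> y where e: "a = (t \<xi> x, t (X1 \<xi>) x, t (d \<xi>) x)" "b = (t \<eta> y, t (X1 \<eta>) y, t (d \<eta>) y)"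
        using ab by auto
      have "ip E \<xi> \<eta> = ip E (X1 \<xi>) (X1 \<eta>) + ip E (d \<xi>) (d \<eta>)"
        by (simp add: E.ip_ad[OF a1] E.sa_ip[OF sd] dd E.ip_diff_right)
      then show ?thesis by (simp add: e ip_t \<Phi>_add)
    qed
    from bilinear_eq[OF G.bilinear_ip[OF l(1,1)] bilinear_add[OF G.bilinear_ip[OF l(2,2)] G.bilinear_ip[OF l(3,3)]]
        order_refl order_refl uvw uvw this] show ?thesis by simp
  qed
  let ?T = "{(t \<xi> x, t (X1 \<xi>) x) | \<xi> x. True}"
  have "\<exists>Z. bounded_linear Z \<and> (\<forall>(u, v)\<in>?T. Z u = v) \<and> (\<forall>u. norm (Z u) \<le> 1 * norm u)"
  proof (rule dense_extension)
    fix u v assume uv: "(u, v) \<in> span ?T"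
    let ?pr = "\<lambda>p :: 'g \<times> 'g \<times> 'g. (fst p, fst (snd p))"
    have lin: "linear ?pr" by (rule linearI) auto
    have T: "?T = ?pr ` ?S" by force
    have "span ?T = ?pr ` span ?S" unfolding T by (rule linear_span_image[OF lin])
    then obtain w where "(u, v, w) \<in> span ?S" using uv by force
    from sq[OF this] show "norm v \<le> 1 * norm u"
      using G.norm_ip_self_mono[of v w] G.norm_ip_self[of u] by simp
  next
    have "fst ` ?T = {t \<xi> x | \<xi> x. True}" by force
    then show "closure (span (fst ` ?T)) = UNIV" using t_total by (simp add: total_set_def)
  qed
  then obtain Z where Z: "bounded_linear Z" "\<And>\<xi> x. Z (t \<xi> x) = t (X1 \<xi>) x" "\<And>u. norm (Z u) \<le> norm u"
    by fastforce
  have "c *\<^sub>R t (X1 \<xi>) x = t (X \<xi>) x" for \<xi> x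
    using clinear_scaleR[OF t_clinear, of c "X1 \<xi>" x] c(1) by (simp add: X1_def)
  then show ?thesis
    using Z c by (intro exI[of _ "\<lambda>u. c *\<^sub>R Z u"]) (auto intro: bounded_linear_scaleR_right[THEN bounded_linear_compose])
qed

definition lt :: "('e \<Rightarrow> 'e) \<Rightarrow> 'g \<Rightarrow> 'g" where
  "lt X = (THE Z. G.adm Z \<and> (\<forall>\<xi> x. Z (t \<xi> x) = t (X \<xi>) x))"

lemma lt_eqI:
  assumes "G.adm Z" "\<And>\<xi> x. Z (t \<xi> x) = t (X \<xi>) x"
  shows "lt X = Z"
  unfolding lt_def by (rule the_equality) (use assms adm_ext in auto)

lemma lt:
  assumes X: "E.adm X"
  shows "G.adm (lt X)" "lt X (t \<xi> x) = t (X \<xi>) x"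
    "0 \<le> c \<Longrightarrow> (\<And>\<xi>. norm (X \<xi>) \<le> c * norm \<xi>) \<Longrightarrow> norm (lt X u) \<le> c * norm u"
    "G.ad (lt X) = lt (E.ad X)"
proof -
  have aX: "E.adm (E.ad X)" by (rule E.adm_ad(1)[OF X])
  obtain c1 where c1: "0 < c1" "\<And>u. norm (X u) \<le> c1 * norm u" by (rule E.adm_bound[OF X]) blast
  obtain c2 where c2: "0 < c2" "\<And>u. norm (E.ad X u) \<le> c2 * norm u" by (rule E.adm_bound[OF aX]) blast
  obtain Z where Z: "bounded_linear Z" "\<And>\<xi> x. Z (t \<xi> x) = t (X \<xi>) x" using lt_exists[OF X c1] by blast
  obtain Z' where Z': "bounded_linear Z'" "\<And>\<xi> x. Z' (t \<xi> x) = t (E.ad X \<xi>) x" using lt_exists[OF aX c2] by blast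
  have adj: "ip G (Z u) v = ip G u (Z' v)" for u v
    by (rule ip_total_ext[OF G.hmod_axioms G.hmod_axioms Z(1) Z'(1) t_total t_total])
      (auto simp: Z Z' ip_t E.ip_ad[OF X])
  then have adj': "ip G (Z' u) v = ip G u (Z v)" for u v by (metis G.star_ip)
  have aZ: "G.adm Z" by (rule adjointableI) (rule adj)
  have aZ': "G.adm Z'" by (rule adjointableI) (rule adj')
  have lX: "lt X = Z" by (rule lt_eqI[OF aZ Z(2)])
  have lX': "lt (E.ad X) = Z'" by (rule lt_eqI[OF aZ' Z'(2)])
  show "G.adm (lt X)" "lt X (t \<xi> x) = t (X \<xi>) x" using lX aZ Z by auto
  show "G.ad (lt X) = lt (E.ad X)" unfolding lX lX' by (rule G.adj_eqI) (rule adj)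
  assume c: "0 \<le> c" "\<And>\<xi>. norm (X \<xi>) \<le> c * norm \<xi>"
  \<comment> \<open>The extension was constructed for positive bounds only, whereas \<open>c\<close> may be \<open>0\<close>.\<close>
  have "norm (Z u) \<le> (c + e) * norm u" if e: "0 < e" for e
  proof -
    have "norm (X \<xi>) \<le> (c + e) * norm \<xi>" for \<xi>
      by (rule order_trans[OF c(2)]) (use e in \<open>simp add: mult_right_mono\<close>)
    then obtain Y where Y: "bounded_linear Y" "\<And>\<xi> x. Y (t \<xi> x) = t (X \<xi>) x" "\<And>u. norm (Y u) \<le> (c + e) * norm u"
      using lt_exists[OF X, of "c + e"] c e by fastforce
    have "Z u = Y u" by (rule total_ext[OF Z(1) Y(1) t_total]) (use Z Y in auto)
    then show ?thesis using Y(3) by simp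
  qed
  then have "norm (Z u) \<le> c * norm u + e" if "0 < e" for e
  proof (cases "u = 0")
    case True
    then show ?thesis using Z(1) that by (simp add: linear_simps)
  next
    case False
    then show ?thesis using \<open>\<And>e. 0 < e \<Longrightarrow> norm (Z u) \<le> (c + e) * norm u\<close>[of "e / norm u"] that
      by (simp add: distrib_right)
  qed
  then show "norm (lt X u) \<le> c * norm u" unfolding lX by (rule field_le_epsilon)
qed

lemma tensor_op_lt: "E.adm X \<Longrightarrow> tensor_op G G t t X id = lt X"
  by (simp add: tensor_op_def lt_def)

lemma lt_comp: "E.adm X \<Longrightarrow> E.adm Y \<Longrightarrow> lt (\<lambda>\<xi>. X (Y \<xi>)) = (\<lambda>u. lt X (lt Y u))"
  by (rule lt_eqI) (simp_all add: lt G.adm_comp)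

lemma lt_diff: "E.adm X \<Longrightarrow> E.adm Y \<Longrightarrow> lt (\<lambda>\<xi>. X \<xi> - Y \<xi>) = (\<lambda>u. lt X u - lt Y u)"
  by (rule lt_eqI) (simp_all add: lt G.adm_diff clinear_diff[OF t_clinear])

lemma lt_scaleR: "E.adm X \<Longrightarrow> lt (\<lambda>\<xi>. r *\<^sub>R X \<xi>) = (\<lambda>u. r *\<^sub>R lt X u)"
  by (rule lt_eqI) (simp_all add: lt G.adm_scaleR clinear_scaleR[OF t_clinear])

lemma lt_id: "lt (\<lambda>\<xi>. \<xi>) = (\<lambda>u. u)"
  by (rule lt_eqI) (simp_all add: G.adm_id)

lemma sa_lt: "E.sa X \<Longrightarrow> G.sa (lt X)"
  by (rule G.saI) (simp_all add: lt E.sa_adm E.sa_ad)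

lemma pcontr_lt:
  assumes R: "E.pcontr R"
  shows "G.pcontr (lt R)"
proof -
  have a: "E.adm R" by (rule E.sa_adm[OF E.pcontr_sa[OF R]])
  have "norm (2 *\<^sub>R lt R u - u) \<le> norm u" for u
    using lt(3)[OF E.adm_diff(1)[OF E.adm_scaleR(1)[OF a, of 2] E.adm_id], of 1 u] R
    by (simp add: lt_diff[OF E.adm_scaleR(1)[OF a] E.adm_id] lt_scaleR[OF a] lt_id E.pcontr_def)
  then show ?thesis using sa_lt[OF E.pcontr_sa[OF R]] by (simp add: G.pcontr_def)
qed

lemma poly_op_lt: "E.adm R \<Longrightarrow> poly_op p (lt R) (t \<xi> x) = t (poly_op p R \<xi>) x"
proof -
  assume R: "E.adm R"
  have "(lt R ^^ i) (t \<xi> x) = t ((R ^^ i) \<xi>) x" for i by (induction i) (simp_all add: lt(2)[OF R])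
  then show ?thesis
    by (simp add: poly_op_def clinear_sum[OF t_clinear] clinear_scaleR[OF t_clinear])
qed

end

locale ltens = ltens0 +
  assumes t_bounded: "\<And>x. \<exists>C. \<forall>\<xi>. norm (t \<xi> x) \<le> C * norm \<xi>"
begin

lemma t_bounded_linear: "bounded_linear (\<lambda>\<xi>. t \<xi> x)"
proof -
  obtain C where "\<And>\<xi>. norm (t \<xi> x) \<le> C * norm \<xi>" using t_bounded by metis
  then show ?thesis
    by (intro bounded_linear_intro[where K=C])
      (auto simp: clinear_add[OF t_clinear] clinear_scaleR[OF t_clinear] mult.commute)
qed

lemma fc_lt:
  assumes R: "E.pcontr R" and f: "cont01 f"
  shows "fc f (lt R) = lt (fc f R)"
proof (rule lt_eqI[symmetric])
  show "G.adm (fc f (lt R))" by (rule G.adm_fc[OF pcontr_lt[OF R] f])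
  fix \<xi> x
  have a: "E.adm R" by (rule E.sa_adm[OF E.pcontr_sa[OF R]])
  have "(\<lambda>n. poly_op (approx_poly f n) (lt R) (t \<xi> x)) \<longlonglongrightarrow> fc f (lt R) (t \<xi> x)"
    by (rule G.fc_LIMSEQ[OF pcontr_lt[OF R] f])
  moreover have "(\<lambda>n. t (poly_op (approx_poly f n) R \<xi>) x) \<longlonglongrightarrow> t (fc f R \<xi>) x"
    by (rule bounded_linear.tendsto[OF t_bounded_linear E.fc_LIMSEQ[OF R f]])
  ultimately show "fc f (lt R) (t \<xi> x) = t (fc f R \<xi>) x"
    unfolding poly_op_lt[OF a] by (rule LIMSEQ_unique)
qed

lemma tp_lt:
  assumes tp: "E.tp R F"
  shows "G.tp (lt R) (lt F)"
proof -
  have R: "E.adm R" and F: "E.adm F" by (rule E.sa_adm[OF E.pcontr_sa[OF E.tp_R[OF tp]]] E.sa_adm[OF E.tp_F[OF tp]])+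
  have "(\<lambda>u. lt F (lt F u)) = (\<lambda>u. u - lt R u)"
    unfolding lt_comp[OF F F, symmetric] E.tp_FF[OF tp] lt_diff[OF E.adm_id R] lt_id ..
  moreover have "(\<lambda>u. lt F (lt R u)) = (\<lambda>u. lt R (lt F u))"
    unfolding lt_comp[OF F R, symmetric] lt_comp[OF R F, symmetric] E.tp_FR[OF tp] ..
  ultimately show ?thesis
    using pcontr_lt[OF E.tp_R[OF tp]] sa_lt[OF E.tp_F[OF tp]] by (simp add: G.tp_def fun_eq_iff)
qed

text \<open>
  Both graphs are parametrised by \<open>u \<mapsto> (R\<^sup>1\<^sup>/\<^sup>2 u, F u)\<close> on the tensor product, one of them for \<open>u\<close> in the
  algebraic tensor product before closure, and the parametrised graph over all \<open>u\<close> is closed.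
\<close>

lemma unb_tensor_one_bgraph:
  assumes tp: "E.tp R F"
  shows "unb_tensor_one t (E.bgraph R F) = G.bgraph (lt R) (lt F)"
proof -
  let ?G = "fc sqrt (lt R)" and ?F = "lt F"
  let ?S = "{(t \<xi> x, t \<eta> x) |\<xi> \<eta> x. (\<xi>, \<eta>) \<in> E.bgraph R F}"
  note tG = tp_lt[OF tp]
  have aF: "E.adm F" by (rule E.sa_adm[OF E.tp_F[OF tp]])
  have aG: "E.adm (fc sqrt R)" by (rule E.adm_fc[OF E.tp_R[OF tp] E.cont01_sqrt])
  have G: "?G (t \<xi> x) = t (fc sqrt R \<xi>) x" and F: "?F (t \<xi> x) = t (F \<xi>) x" for \<xi> x
    by (simp_all add: fc_lt[OF E.tp_R[OF tp] E.cont01_sqrt] lt(2)[OF aG] lt(2)[OF aF])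
  have bG: "bounded_linear ?G" by (rule G.sa_bounded[OF G.sa_fc[OF G.tp_R[OF tG] E.cont01_sqrt]])
  have bF: "bounded_linear ?F" by (rule G.sa_bounded[OF G.tp_F[OF tG]])
  have "?S = (\<lambda>u. (?G u, ?F u)) ` {t \<xi> x |\<xi> x. True}"
    by (auto simp: E.bgraph_def G F image_iff) (metis G F)+
  then have span: "span ?S = (\<lambda>u. (?G u, ?F u)) ` span {t \<xi> x |\<xi> x. True}"
    using linear_span_image[OF bounded_linear.linear[OF bounded_linear_Pair[OF bG bF]]] by simp
  have "closure (span ?S) \<subseteq> G.bgraph (lt R) (lt F)"
  proof (rule closure_minimal)
    show "span ?S \<subseteq> G.bgraph (lt R) (lt F)" unfolding span G.bgraph_def by auto
    have "G.bgraph (lt R) (lt F) = {p. ?G (snd p) = ?F (fst p)}"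
      using G.bgraph_iff[OF tG] by auto
    also have "closed \<dots>"
      by (intro closed_Collect_eq continuous_intros linear_continuous_on_compose[OF _ bounded_linear.linear]
         bounded_linear.continuous_on[OF bG] bounded_linear.continuous_on[OF bF])
    finally show "closed (G.bgraph (lt R) (lt F))" .
  qed
  moreover have "G.bgraph (lt R) (lt F) \<subseteq> closure (span ?S)"
  proof
    fix p assume "p \<in> G.bgraph (lt R) (lt F)"
    then obtain \<zeta> where p: "p = (?G \<zeta>, ?F \<zeta>)" by (auto simp: G.bgraph_def)
    have "\<zeta> \<in> closure (span {t \<xi> x |\<xi> x. True})" using t_total by (simp add: total_set_def)
    then obtain a where a: "\<And>n::nat. a n \<in> span {t \<xi> x |\<xi> x. True}" "a \<longlonglongrightarrow> \<zeta>"
      unfolding closure_sequential by blast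
    have "(\<lambda>n. (?G (a n), ?F (a n))) \<longlonglongrightarrow> p"
      unfolding p by (intro tendsto_Pair bounded_linear.tendsto[OF bG] bounded_linear.tendsto[OF bF] a)
    moreover have "(?G (a n), ?F (a n)) \<in> span ?S" for n unfolding span using a(1) by blast
    ultimately show "p \<in> closure (span ?S)" unfolding closure_sequential by (intro exI[of _ "\<lambda>n. (?G (a n), ?F (a n))"]) simp
  qed
  ultimately show ?thesis unfolding unb_tensor_one_def by blast
qed

end

section \<open>Local units and the Pedersen ideal\<close>

lemma lmul_eqI: "(\<And>t. x * t = y * t) \<Longrightarrow> x = (y::'s::cstar_algebra)"
  using norm_star_mult[of "star (x - y)"] by (simp add: star_star algebra_simps)

lemma norm_le_lmul:
  assumes "\<And>t. norm (x * t) \<le> K * norm t" "0 \<le> K"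
  shows "norm (x::'s::cstar_algebra) \<le> K"
proof (cases "x = 0")
  case False
  have "(norm x)\<^sup>2 = norm (x * star x)" using norm_star_mult[of "star x"] by (simp add: star_star)
  also have "\<dots> \<le> K * norm x" using assms(1)[of "star x"] by simp
  finally show ?thesis using False by (simp add: power2_eq_square)
qed (use assms in simp)

definition cutoff :: "nat \<Rightarrow> real \<Rightarrow> real" where
  "cutoff n x = min 1 (max 0 (real n * x - 1))"

lemma cutoff_absorb: "0 \<le> x \<Longrightarrow> cutoff n x * cutoff (2 * n) x = cutoff n x"
proof (cases "real n * x \<le> 1")
  case False
  assume "0 \<le> x"
  with False have "cutoff (2 * n) x = 1" by (simp add: cutoff_def)
  then show ?thesis by simp
qed (simp add: cutoff_def)

lemma cutoff_remainder:
  assumes "0 \<le> x" "0 < n"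
  shows "\<bar>x * ((1 - cutoff n x) * (1 - cutoff n x))\<bar> \<le> 2 / real n"
proof (cases "real n * x \<le> 2")
  case True
  have "0 \<le> 1 - cutoff n x" "1 - cutoff n x \<le> 1" by (auto simp: cutoff_def)
  then have "x * ((1 - cutoff n x) * (1 - cutoff n x)) \<le> x * 1"
    using assms by (intro mult_left_mono mult_le_one) auto
  also have "\<dots> \<le> 2 / real n" using True assms by (simp add: field_simps)
  finally show ?thesis using assms \<open>0 \<le> 1 - cutoff n x\<close> by simp
next
  case False
  then have "cutoff n x = 1" by (simp add: cutoff_def)
  then show ?thesis by simp
qed

text \<open>
  The local units are \<open>cutoff n\<close>, \<open>cutoff (2 n)\<close> and \<open>cutoff (4 n)\<close> of \<open>h\<close>, each of which is \<open>1\<close> on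
  the support of the preceding one.  As \<open>cutoff n\<close> vanishes near \<open>0\<close>, it is \<open>x\<close> times a continuous
  function \<open>g\<close>, and \<open>g(h) h\<close> is an element of the algebra, although the algebra may have no unit.
\<close>

lemma local_unit:
  fixes h :: "'s::cstar_algebra"
  assumes h: "cpos h" and e: "0 < e"
  obtains c c' c'' where "star c = c" "star c' = c'" "star c'' = c''" "c * c' = c" "c' * c'' = c'"
    "norm (h - c * h - h * c + c * h * c) < e"
proof -
  interpret S: hmod "self_module :: ('s, 's) hmodule" by (rule hmod_self_module)
  define \<tau> where "\<tau> = norm h + 1"
  have \<tau>: "0 < \<tau>" by (simp add: \<tau>_def add_nonneg_pos)
  define h' where "h' = (1 / \<tau>) *\<^sub>R h"
  have hh: "h = \<tau> *\<^sub>R h'" using \<tau> by (simp add: h'_def)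
  let ?A = "lmul h'"
  have pc: "S.pcontr ?A"
  proof (rule S.pcontrI)
    have "S.spos (\<lambda>u. (1 / \<tau>) *\<^sub>R (h * u))"
      using h \<tau> by (intro S.spos_scaleR) (auto simp: cpos_def)
    then show "S.spos ?A" by (simp add: h'_def)
    fix u
    have "norm (h * u) \<le> \<tau> * norm u"
      by (rule order_trans[OF norm_mult_ineq]) (simp add: \<tau>_def mult_right_mono)
    then show "norm (?A u) \<le> norm u" using \<tau> by (simp add: h'_def divide_le_eq mult.commute)
  qed
  define g where "g = (\<lambda>n x. cutoff n x / max x (1 / real n))"
  have cf: "cont01 (cutoff n)" for n unfolding cutoff_def by (intro continuous_intros)
  have cg: "cont01 (g n)" if "0 < n" for n unfolding g_def
    by (intro continuous_intros cf) (use that in \<open>auto simp: max_def\<close>)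
  have gx: "g n x * x = cutoff n x" if "0 < n" "0 \<le> x" for n x
  proof (cases "1 / real n \<le> x")
    case True
    then have "0 < x" using that by (meson less_le_trans of_nat_0_less_iff zero_less_divide_1_iff)
    then show ?thesis using True by (simp add: g_def max_def)
  next
    case False
    then have "real n * x \<le> 1" using that by (simp add: field_simps)
    then show ?thesis by (simp add: g_def cutoff_def)
  qed
  define c where "c = (\<lambda>n. fc (g n) ?A h')"
  have cl: "c n * t = fc (cutoff n) ?A t" if n: "0 < n" for n t
  proof -
    have "c n * t = fc (g n) ?A (h' * t)"
      using S.adm_act[OF S.adm_fc[OF pc cg[OF n]], of h' t] by (simp add: c_def)
    also have "h' * t = fc (\<lambda>x. x) ?A t" by (simp add: S.fc_id[OF pc])
    also have "fc (g n) ?A \<dots> = fc (cutoff n) ?A t"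
      by (rule S.fc_mult_eq[OF pc cg[OF n] continuous_on_id gx[OF n]])
    finally show ?thesis .
  qed
  have cs: "star (c n) = c n" if n: "0 < n" for n
  proof (rule lmul_eqI)
    fix t
    have "S.sa (lmul (c n))" using S.sa_fc[OF pc cf[of n]] by (simp add: cl[OF n, abs_def])
    from S.sa_ad[OF this] show "star (c n) * t = c n * t" by (simp add: lmul_adjoint(2) fun_eq_iff)
  qed
  have cc: "c n * c (2 * n) = c n" if n: "0 < n" for n
  proof (rule lmul_eqI)
    fix t
    have "c n * c (2 * n) * t = fc (cutoff n) ?A (fc (cutoff (2 * n)) ?A t)"
      using cl[OF n, of "c (2 * n) * t"] cl[of "2 * n" t] n by (simp only: mult.assoc)
    also have "\<dots> = fc (cutoff n) ?A t" by (rule S.fc_mult_eq[OF pc cf cf cutoff_absorb])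
    finally show "c n * c (2 * n) * t = c n * t" by (simp add: cl[OF n])
  qed
  have rem: "norm (h - c n * h - h * c n + c n * h * c n) \<le> \<tau> * (2 / real n)" if n: "0 < n" for n
  proof (rule norm_le_lmul)
    fix t
    let ?r = "\<lambda>x. x * ((1 - cutoff n x) * (1 - cutoff n x))"
    have c1: "cont01 (\<lambda>x. 1 - cutoff n x)" by (intro continuous_intros cf)
    have one: "fc (\<lambda>x. 1 - cutoff n x) ?A u = u - c n * u" for u
      using S.fc_diff[OF pc _ cf, of "\<lambda>x. 1" n u] by (simp add: S.fc_one[OF pc] cl[OF n])
    have "fc ?r ?A t = h' * (fc (\<lambda>x. (1 - cutoff n x) * (1 - cutoff n x)) ?A t)"
      using S.fc_mult[OF pc continuous_on_id continuous_on_mult[OF c1 c1], of t] by (simp add: S.fc_id[OF pc])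
    also have "\<dots> = (\<lambda>u. h' * u) (fc (\<lambda>x. 1 - cutoff n x) ?A (fc (\<lambda>x. 1 - cutoff n x) ?A t))"
      by (simp add: S.fc_mult[OF pc c1 c1])
    also have "\<dots> = fc (\<lambda>x. 1 - cutoff n x) ?A (h' * fc (\<lambda>x. 1 - cutoff n x) ?A t)"
      using S.fc_swap[OF pc continuous_on_id c1] by (simp add: S.fc_id[OF pc])
    also have "\<dots> = h' * (t - c n * t) - c n * (h' * (t - c n * t))" by (simp add: one)
    finally have r: "fc ?r ?A t = h' * (t - c n * t) - c n * (h' * (t - c n * t))" .
    have "(h - c n * h - h * c n + c n * h * c n) * t = \<tau> *\<^sub>R fc ?r ?A t"
      unfolding r by (simp add: hh algebra_simps)
    moreover have "norm (fc ?r ?A t) \<le> 2 / real n * norm t"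
      by (rule S.norm_fc_le[OF pc])
        (use cutoff_remainder[OF _ n] in \<open>auto intro!: continuous_on_mult continuous_on_id c1\<close>)
    ultimately show "norm ((h - c n * h - h * c n + c n * h * c n) * t) \<le> \<tau> * (2 / real n) * norm t"
      using \<tau> by (simp only: norm_scaleR mult.assoc abs_of_pos mult_left_mono less_imp_le)
  qed (use \<tau> in simp)
  obtain n where n: "2 * \<tau> / e < real n" using reals_Archimedean2 by blast
  then have n0: "0 < n" using \<tau> e by (metis divide_pos_pos less_trans mult_pos_pos of_nat_0_less_iff zero_less_numeral)
  show thesis
  proof (rule that[of "c n" "c (2 * n)" "c (2 * (2 * n))"])
    have "\<tau> * (2 / real n) < e" using n n0 e by (simp add: field_simps)
    then show "norm (h - c n * h - h * c n + c n * h * c n) < e" using rem[OF n0] by simp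
  qed (use n0 cs cc[of n] cc[of "2 * n"] in auto)
qed

text \<open>
  An element with a left unit lies in every dense ideal: if \<open>y\<close> in the ideal is at distance less than \<open>1\<close>
  from the unit, then \<open>k = y k + w k\<close> with \<open>\<parallel>w\<parallel> < 1\<close>, and a Neumann series expresses \<open>k\<close> by \<open>y k\<close>.
\<close>

lemma pedersen_local_unit:
  assumes unit: "k' * k = (k::'s::cstar_algebra)"
  shows "k \<in> pedersen_ideal"
  unfolding pedersen_ideal_def
proof (intro InterI, clarify)
  fix I :: "'s set"
  assume I: "\<forall>x\<in>I. \<forall>y\<in>I. x + y \<in> I" "\<forall>x\<in>I. \<forall>s. s * x \<in> I \<and> x * s \<in> I" "closure I = UNIV"
  have "k' \<in> closure I" using I(3) by simp
  then obtain y where y: "y \<in> I" "dist y k' < 1" unfolding closure_approachable by (meson zero_less_one)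
  define w where "w = k' - y"
  have w: "norm w < 1" using y by (simp add: w_def dist_norm norm_minus_commute)
  define z where "z = y * k"
  have zI: "z \<in> I" using I(2) y(1) by (simp add: z_def)
  have kz: "k = z + w * k" by (simp add: z_def w_def left_diff_distrib unit)
  define f where "f = (\<lambda>n. ((*) w ^^ n) w)"
  have nf: "norm (f n) \<le> norm w * norm w ^ n" for n
  proof (induction n)
    case (Suc n)
    have "norm (f (Suc n)) \<le> norm w * norm (f n)" by (simp add: f_def norm_mult_ineq)
    also have "\<dots> \<le> norm w * (norm w * norm w ^ n)" by (rule mult_left_mono[OF Suc]) simp
    finally show ?case by simp
  qed (simp add: f_def)
  have sf: "summable f"
    by (rule summable_comparison_test'[OF summable_mult[OF summable_geometric[of "norm w"]], of 0 f "norm w"])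
      (use w nf in auto)
  define v where "v = suminf f"
  have vw: "v = w + w * v"
  proof -
    have "v = f 0 + (\<Sum>n. f (Suc n))" using suminf_split_head[OF sf] by (simp add: v_def)
    also have "(\<lambda>n. f (Suc n)) = (\<lambda>n. w * f n)" by (simp add: f_def)
    also have "(\<Sum>n. w * f n) = w * v"
      unfolding v_def by (rule bounded_linear.suminf[OF bounded_linear_mult_right sf, symmetric])
    finally show ?thesis by (simp add: f_def)
  qed
  have "k = z + v * z"
  proof -
    let ?d = "k - (z + v * z)"
    have "w * (z + v * z) = v * z"
    proof -
      have "v * z = (w + w * v) * z" using vw by simp
      then show ?thesis by (simp add: algebra_simps)
    qed
    then have "?d = w * ?d" using kz by (simp add: algebra_simps)
    then have "norm ?d \<le> norm w * norm ?d" using norm_mult_ineq[of w ?d] by simp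
    then have "norm ?d = 0" using w mult_le_cancel_right1[of "norm ?d" "norm w"] by (smt (verit) norm_ge_zero)
    then show ?thesis by simp
  qed
  then show "k \<in> I" using I(1,2) zI by metis
qed

lemma pedersen_mult: "k \<in> pedersen_ideal \<Longrightarrow> k * u \<in> pedersen_ideal" "k \<in> pedersen_ideal \<Longrightarrow> u * k \<in> pedersen_ideal"
  unfolding pedersen_ideal_def by auto

section \<open>Exterior tensor products\<close>

locale xtens = E: hmod E + ES: hmod ES
  for E :: "('e::complex_banach, 'b::cstar_algebra) hmodule"
    and ES :: "('es::complex_banach, 'bs::cstar_algebra) hmodule" +
  fixes tBS :: "'b \<Rightarrow> 's::cstar_algebra \<Rightarrow> 'bs" and tES :: "'e \<Rightarrow> 's \<Rightarrow> 'es"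
  assumes min: "min_tensor tBS" and ext: "exterior_tensor E tBS ES tES"
begin

lemma tBS_clinear: "clinear (tBS b)" "clinear (\<lambda>b. tBS b s)"
  and tBS_mult: "tBS b s * tBS b' s' = tBS (b * b') (s * s')"
  and tBS_star: "star (tBS b s) = tBS (star b) (star s)"
  and tBS_total: "total_set {tBS b s | b s. True}"
  using min unfolding min_tensor_def by (auto simp: cbilinear_def)

lemma tES_clinear: "clinear (tES \<xi>)" "clinear (\<lambda>\<xi>. tES \<xi> s)"
  and ip_tES: "ip ES (tES \<xi> s) (tES \<eta> u) = tBS (ip E \<xi> \<eta>) (star s * u)"
  and act_tES: "act ES (tES \<xi> s) (tBS b u) = tES (act E \<xi> b) (s * u)"
  and tES_total: "total_set {tES \<xi> s | \<xi> s. True}"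
  using ext unfolding exterior_tensor_def by (auto simp: cbilinear_def)

sublocale S: hmod "self_module :: ('s, 's) hmodule" by (rule hmod_self_module)
sublocale B: hmod "self_module :: ('b, 'b) hmodule" by (rule hmod_self_module)
sublocale BS: hmod "self_module :: ('bs, 'bs) hmodule" by (rule hmod_self_module)

lemma swap_set: "{t x y | y x. True} = {t x y | x y. True}"
  by blast

sublocale BSl: ltens0 "self_module :: ('b, 'b) hmodule" "self_module :: ('bs, 'bs) hmodule" tBS
    "\<lambda>x y c. tBS c (star x * y)"
  by unfold_locales (use tBS_total in \<open>simp_all add: tBS_clinear tBS_star tBS_mult clinear_add[OF tBS_clinear(2)]\<close>)

sublocale BSr: ltens0 "self_module :: ('s, 's) hmodule" "self_module :: ('bs, 'bs) hmodule" "\<lambda>s b. tBS b s"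
    "\<lambda>x y c. tBS (star x * y) c"
  by unfold_locales (use tBS_total[unfolded swap_set[symmetric, of tBS]] in
      \<open>simp_all add: tBS_clinear tBS_star tBS_mult clinear_add[OF tBS_clinear(1)]\<close>)

text \<open>
  The C*-identity gives \<open>\<parallel>x\<parallel>\<^sup>2 = \<parallel>(b\<^sup>* \<otimes> 1) (1 \<otimes> s\<^sup>*) x\<parallel>\<close> for \<open>x = b \<otimes> s\<close>, and an operator on one leg
  has at most the norm of its factor.
\<close>

lemma norm_tBS: "norm (tBS b s) \<le> norm b * norm s"
proof -
  let ?x = "tBS b s"
  have "star ?x * ?x = BSl.lt (lmul (star b)) (BSr.lt (lmul (star s)) ?x)"
    by (simp add: tBS_star tBS_mult BSl.lt BSr.lt lmul_adjoint)
  also have "norm \<dots> \<le> norm b * (norm s * norm ?x)"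
    using BSl.lt(3)[OF lmul_adjoint(1), of "norm b" "star b" "BSr.lt (lmul (star s)) ?x"]
      BSr.lt(3)[OF lmul_adjoint(1), of "norm s" "star s" ?x]
      norm_mult_ineq[of "star b"] norm_mult_ineq[of "star s"]
    by simp (meson mult_left_mono norm_ge_zero order_trans)
  finally have "norm ?x * norm ?x \<le> norm b * norm s * norm ?x"
    by (simp add: norm_star_mult power2_eq_square)
  then show ?thesis by (cases "?x = 0") auto
qed

lemma norm_tES: "norm (tES \<xi> s) \<le> norm \<xi> * norm s"
proof -
  have "(norm (tES \<xi> s))\<^sup>2 \<le> norm (ip E \<xi> \<xi>) * norm (star s * s)"
    using norm_tBS by (simp add: ES.norm_ip_self[symmetric] ip_tES)
  then have "(norm (tES \<xi> s))\<^sup>2 \<le> (norm \<xi> * norm s)\<^sup>2"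
    by (simp add: E.norm_ip_self norm_star_mult power_mult_distrib)
  then show ?thesis by (rule power2_le_imp_le) simp
qed

sublocale L: ltens E ES tES "\<lambda>x y c. tBS c (star x * y)"
proof unfold_locales
  show "\<exists>C. \<forall>\<xi>. norm (tES \<xi> x) \<le> C * norm \<xi>" for x
    using norm_tES by (intro exI[of _ "norm x"]) (simp add: mult.commute)
qed (use tES_total in \<open>simp_all add: tES_clinear ip_tES clinear_add[OF tBS_clinear(2)]\<close>)

sublocale R: ltens "self_module :: ('s, 's) hmodule" ES "\<lambda>s \<xi>. tES \<xi> s" "\<lambda>\<xi> \<eta> c. tBS (ip E \<xi> \<eta>) c"
proof unfold_locales
  show "\<exists>C. \<forall>s. norm (tES \<xi> s) \<le> C * norm s" for \<xi>
    using norm_tES by (intro exI[of _ "norm \<xi>"]) simp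
qed (use tES_total[unfolded swap_set[symmetric, of tES]] in
    \<open>simp_all add: tES_clinear ip_tES clinear_add[OF tBS_clinear(1)]\<close>)

lemma adm_tES_ext:
  assumes "ES.adm S" "ES.adm T" "\<And>\<xi> s. S (tES \<xi> s) = T (tES \<xi> s)"
  shows "S = T"
  by (rule L.adm_ext) (use assms in auto)

lemma tensor_op_eqI:
  assumes "ES.adm Z" "\<And>\<xi> s. Z (tES \<xi> s) = tES (X \<xi>) (m s)"
  shows "tensor_op ES ES tES tES X m = Z"
  unfolding tensor_op_def by (rule the_equality) (use assms adm_tES_ext in auto)

lemma tensor_op:
  assumes X: "E.adm X" and m: "S.adm m"
  shows "tensor_op ES ES tES tES X m = (\<lambda>u. L.lt X (R.lt m u))"
    and "L.lt X (R.lt m u) = R.lt m (L.lt X u)"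
proof -
  show "tensor_op ES ES tES tES X m = (\<lambda>u. L.lt X (R.lt m u))"
    by (rule tensor_op_eqI) (simp_all add: ES.adm_comp L.lt R.lt X m)
  have "(\<lambda>u. L.lt X (R.lt m u)) = (\<lambda>u. R.lt m (L.lt X u))"
    by (rule adm_tES_ext) (simp_all add: ES.adm_comp L.lt R.lt X m)
  then show "L.lt X (R.lt m u) = R.lt m (L.lt X u)" by metis
qed

subsection \<open>Right multiplication by the second leg\<close>

text \<open>\<open>x (1 \<otimes> s)\<close>, obtained by the involution from left multiplication by \<open>1 \<otimes> s\<^sup>*\<close>.\<close>

definition BSmul :: "'s \<Rightarrow> 'bs \<Rightarrow> 'bs" where
  "BSmul s x = star (BSr.lt (lmul (star s)) (star x))"

lemma BSmul_tBS: "BSmul s (tBS b u) = tBS b (u * s)"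
  by (simp add: BSmul_def tBS_star BSr.lt lmul_adjoint star_mult star_star)

lemma norm_BSmul: "norm (BSmul s x) \<le> norm s * norm x"
  using BSr.lt(3)[OF lmul_adjoint(1), of "norm s" "star s" "star x"] norm_mult_ineq[of "star s"]
  by (simp add: BSmul_def)

lemma bounded_linear_BSmul: "bounded_linear (BSmul s)"
proof (rule bounded_linear_intro[where K="norm s"])
  have l: "linear (BSr.lt (lmul (star s)))"
    by (rule clinear_linear[OF BS.adm_clinear[OF BSr.lt(1)[OF lmul_adjoint(1)]]])
  show "BSmul s (x + y) = BSmul s x + BSmul s y" for x y
    by (simp add: BSmul_def star_add linear_add[OF l])
  show "BSmul s (r *\<^sub>R x) = r *\<^sub>R BSmul s x" for r x
    by (simp add: BSmul_def star_scaleR linear_scale[OF l])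
  show "norm (BSmul s x) \<le> norm x * norm s" for x using norm_BSmul by (simp add: mult.commute)
qed

text \<open>The square of \<open>u (1 \<otimes> s)\<close> is \<open>(1 \<otimes> s)\<^sup>* \<langle>u | u\<rangle> (1 \<otimes> s)\<close>.\<close>

lemma rho_exists:
  "\<exists>\<rho>. bounded_linear \<rho> \<and> (\<forall>\<xi> u. \<rho> (tES \<xi> u) = tES \<xi> (u * s)) \<and> (\<forall>u. norm (\<rho> u) \<le> norm s * norm u)"
proof -
  let ?S = "{(tES \<xi> u, tES \<xi> (u * s)) | \<xi> u. True}"
  let ?b = "\<lambda>x. star (BSmul s (star (BSmul s x)))"
  have bb: "bounded_linear ?b"
    by (intro bounded_linear_compose[OF bounded_linear_star] bounded_linear_compose[OF bounded_linear_BSmul]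
        bounded_linear_star bounded_linear_BSmul)
  have lb: "linear ?b" by (rule bounded_linear.linear[OF bb])
  have bil: "bilinear (\<lambda>(a :: 'es \<times> 'es) (b :: 'es \<times> 'es). ?b (ip ES (fst a) (fst b)))"
    unfolding bilinear_def
    by (auto intro!: linearI simp: ES.ip_add_left ES.ip_add_right ES.ip_scaleR_left ES.ip_scaleR_right
        linear_add[OF lb] linear_scale[OF lb])
  from bilinear_eq[OF ES.bilinear_ip[OF linear_snd linear_snd] bil order_refl order_refl, of _ ?S _ ?S]
  have both: "ip ES v v = ?b (ip ES u u)" if "(u, v) \<in> span ?S" for u v
    using that by (fastforce simp: ip_tES BSmul_tBS tBS_star star_mult star_star mult.assoc)
  have "\<exists>R. bounded_linear R \<and> (\<forall>(u, v)\<in>?S. R u = v) \<and> (\<forall>u. norm (R u) \<le> norm s * norm u)"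
  proof (rule dense_extension)
    fix u v assume uv: "(u, v) \<in> span ?S"
    have "norm (star (BSmul s (star (BSmul s (ip ES u u))))) \<le> norm s * (norm s * norm (ip ES u u))"
      using order_trans[OF norm_BSmul[of s "star (BSmul s (ip ES u u))"]
          mult_left_mono[OF norm_BSmul[of s "ip ES u u", folded norm_star[of "BSmul s (ip ES u u)"]], of "norm s"]]
      by simp
    then have "(norm v)\<^sup>2 \<le> (norm s * norm u)\<^sup>2"
      using both[OF uv] by (simp add: ES.norm_ip_self[symmetric] power_mult_distrib power2_eq_square[of "norm s"] mult.assoc)
    then show "norm v \<le> norm s * norm u" by (rule power2_le_imp_le) simp
  next
    have "fst ` ?S = {tES \<xi> x | \<xi> x. True}" by force
    then show "closure (span (fst ` ?S)) = UNIV" using tES_total by (simp add: total_set_def)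
  qed
  then obtain P where "bounded_linear P" "\<forall>(u, v)\<in>?S. P u = v" "\<forall>u. norm (P u) \<le> norm s * norm u"
    by blast
  then show ?thesis by (intro exI[of _ P]) auto
qed

abbreviation \<rho> :: "'s \<Rightarrow> 'es \<Rightarrow> 'es" where "\<rho> \<equiv> rmul_one_tensor tES"

lemma rho: "bounded_linear (\<rho> s)" "\<rho> s (tES \<xi> u) = tES \<xi> (u * s)" "norm (\<rho> s \<zeta>) \<le> norm s * norm \<zeta>"
proof -
  obtain P where P: "bounded_linear P" "\<And>\<xi> u. P (tES \<xi> u) = tES \<xi> (u * s)" "\<And>u. norm (P u) \<le> norm s * norm u"
    using rho_exists by metis
  have "\<rho> s = P" unfolding rmul_one_tensor_def
  proof (rule the_equality)
    show "bounded_linear P \<and> (\<forall>\<xi> u. P (tES \<xi> u) = tES \<xi> (u * s))" using P by blast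
    fix Q assume Q: "bounded_linear Q \<and> (\<forall>\<xi> u. Q (tES \<xi> u) = tES \<xi> (u * s))"
    show "Q = P"
    proof
      fix u show "Q u = P u" by (rule total_ext[OF _ P(1) tES_total]) (use Q P(2) in auto)
    qed
  qed
  then show "bounded_linear (\<rho> s)" "\<rho> s (tES \<xi> u) = tES \<xi> (u * s)" "norm (\<rho> s \<zeta>) \<le> norm s * norm \<zeta>"
    using P by auto
qed

lemma rho_linear: "linear (\<rho> s)"
  by (rule bounded_linear.linear[OF rho(1)])

lemma rho_rho: "\<rho> s (\<rho> u \<zeta>) = \<rho> (u * s) \<zeta>"
  by (rule total_ext[where f="\<lambda>\<zeta>. \<rho> s (\<rho> u \<zeta>)" and g="\<rho> (u * s)", OF bounded_linear_compose[OF rho(1) rho(1)] rho(1) tES_total])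
    (auto simp: rho mult.assoc)

lemma ip_rho: "ip ES \<eta> (\<rho> s \<zeta>) = BSmul s (ip ES \<eta> \<zeta>)"
proof -
  have "ip ES (tES \<xi> u) (\<rho> s \<zeta>) = BSmul s (ip ES (tES \<xi> u) \<zeta>)" for \<xi> u \<zeta>
    by (rule total_ext[where f="\<lambda>\<zeta>. ip ES (tES \<xi> u) (\<rho> s \<zeta>)" and g="\<lambda>\<zeta>. BSmul s (ip ES (tES \<xi> u) \<zeta>)",
          OF bounded_linear_compose[OF ES.bounded_linear_ip_right rho(1)]
          bounded_linear_compose[OF bounded_linear_BSmul ES.bounded_linear_ip_right] tES_total])
      (auto simp: rho ip_tES BSmul_tBS mult.assoc)
  then show ?thesis
    using total_ext[where f="\<lambda>\<eta>. ip ES \<eta> (\<rho> s \<zeta>)" and g="\<lambda>\<eta>. BSmul s (ip ES \<eta> \<zeta>)" and u=\<eta>,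
          OF ES.bounded_linear_ip_left bounded_linear_compose[OF bounded_linear_BSmul ES.bounded_linear_ip_left] tES_total]
    by blast
qed

lemma rho_adm:
  assumes T: "ES.adm T"
  shows "T (\<rho> s \<zeta>) = \<rho> s (T \<zeta>)"
proof (rule ES.ip_ext)
  fix \<eta>
  have "ip ES \<eta> (T (\<rho> s \<zeta>)) = ip ES (ES.ad T \<eta>) (\<rho> s \<zeta>)" by (simp add: ES.ip_ad_left[OF T])
  also have "\<dots> = ip ES \<eta> (\<rho> s (T \<zeta>))" by (simp add: ip_rho ES.ip_ad_left[OF T])
  finally show "ip ES \<eta> (T (\<rho> s \<zeta>)) = ip ES \<eta> (\<rho> s (T \<zeta>))" .
qed

lemma act_BSmul: "act ES \<zeta> (BSmul s x) = \<rho> s (act ES \<zeta> x)"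
proof (rule ES.ip_ext)
  fix \<eta>
  have "y * BSmul s x = BSmul s (y * x)" for y
    using BS.adm_act[OF BSr.lt(1)[OF lmul_adjoint(1)], of "star s" "star x" "star y"]
    by (simp add: BSmul_def star_mult star_star)
  then show "ip ES \<eta> (act ES \<zeta> (BSmul s x)) = ip ES \<eta> (\<rho> s (act ES \<zeta> x))"
    by (simp add: ip_rho ES.ip_act_right)
qed

end

section \<open>Localisation of matched operators\<close>

lemma closed_subspace_total:
  assumes "subspace V" "closed V" "X \<subseteq> V" "total_set X"
  shows "u \<in> V"
proof -
  have "closure (span X) \<subseteq> V"
    by (intro closure_minimal span_minimal assms)
  then show ?thesis using assms(4) by (auto simp: total_set_def)
qed

lemma closure_span_induct:
  assumes "u \<in> closure (span X)" "subspace V" "closed V" "\<And>x. x \<in> X \<Longrightarrow> x \<in> V"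
  shows "u \<in> V"
  using closure_minimal[OF span_minimal[of X V]] assms by blast

lemma bounded_linear_vimage:
  assumes "bounded_linear f" "subspace V" "closed V"
  shows "subspace {x. f x \<in> V}" "closed {x. f x \<in> V}"
proof -
  note l = bounded_linear.linear[OF assms(1)]
  show "subspace {x. f x \<in> V}"
    using assms(2) by (auto simp: subspace_def linear_0[OF l] linear_add[OF l] linear_scale[OF l])
  show "closed {x. f x \<in> V}"
    using continuous_closed_vimage[OF assms(3), of f] linear_continuous_at[OF assms(1)] by (simp add: vimage_def)
qed

context hmod
begin

text \<open>A local unit for \<open>\<langle>u | u\<rangle> + \<langle>v | v\<rangle>\<close> works for both vectors.\<close>

lemma approximate_unit2:
  assumes "0 < e"
  obtains c where "norm (u - act E u c) < e" "norm (v - act E v c) < e"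
proof -
  let ?h = "ip E u u + ip E v v"
  have "cpos ?h" by (intro cpos_add cpos_ip)
  moreover have "0 < e\<^sup>2" using assms by simp
  ultimately obtain c c' c'' where c: "star c = c" "norm (?h - c * ?h - ?h * c + c * ?h * c) < e\<^sup>2"
    by (rule local_unit) blast
  have "ip E (u - act E u c) (u - act E u c) + ip E (v - act E v c) (v - act E v c)
      = ?h - c * ?h - ?h * c + c * ?h * c"
    by (simp add: ip_diff_left ip_diff_right ip_act_left ip_act_right c(1) algebra_simps)
  then have lt: "norm (ip E (u - act E u c) (u - act E u c) + ip E (v - act E v c) (v - act E v c)) < e\<^sup>2"
    using c(2) by simp
  show thesis
  proof (rule that)
    have "norm (u - act E u c) \<le> sqrt (norm (ip E (u - act E u c) (u - act E u c) + ip E (v - act E v c) (v - act E v c)))"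
      by (rule norm_ip_self_mono)
    also have "\<dots> < e" using lt assms by (simp add: real_less_lsqrt)
    finally show "norm (u - act E u c) < e" .
    have "norm (v - act E v c) \<le> sqrt (norm (ip E (v - act E v c) (v - act E v c) + ip E (u - act E u c) (u - act E u c)))"
      by (rule norm_ip_self_mono)
    also have "\<dots> < e" using lt assms by (simp add: real_less_lsqrt add.commute)
    finally show "norm (v - act E v c) < e" .
  qed
qed

end

context xtens
begin

lemma rho_add: "\<rho> (s + u) \<zeta> = \<rho> s \<zeta> + \<rho> u \<zeta>"
  by (rule total_ext[where f="\<rho> (s + u)" and g="\<lambda>\<zeta>. \<rho> s \<zeta> + \<rho> u \<zeta>", OF rho(1) bounded_linear_add[OF rho(1) rho(1)] tES_total])
    (auto simp: rho distrib_left clinear_add[OF tES_clinear(1)])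

lemma rho_scaleC: "\<rho> (c *\<^sub>C s) \<zeta> = \<rho> s (c *\<^sub>C \<zeta>)"
proof -
  have "bounded_linear (\<lambda>\<zeta>::'es. c *\<^sub>C \<zeta>)"
    by (rule bounded_linear_intro[where K="cmod c"])
      (auto simp: scaleC_add_right scaleR_scaleC_commute norm_scaleC)
  from bounded_linear_compose[OF rho(1) this] show ?thesis
    by (rule total_ext[where f="\<rho> (c *\<^sub>C s)" and g="\<lambda>\<zeta>. \<rho> s (c *\<^sub>C \<zeta>)", OF rho(1) _ tES_total])
      (auto simp: rho clinear_scaleC[OF tES_clinear(1), symmetric] mult_scaleC_left mult_scaleC_right)
qed

lemma rho_zero: "\<rho> 0 \<zeta> = 0"
  using rho(3)[of 0 \<zeta>] by simp

text \<open>
  The graph of \<open>T\<close> is invariant under the action of \<open>B \<otimes> S\<close>, hence under \<open>c (1 \<otimes> s)\<close> for \<open>c\<close> in an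
  approximate unit, and it is closed.
\<close>

lemma graph_rho:
  assumes T: "regular ES T" and uv: "(u, v) \<in> T"
  shows "(\<rho> s u, \<rho> s v) \<in> T"
proof -
  define d where "d = (\<lambda>n. 1 / real (Suc n))"
  have "\<exists>c. norm (u - act ES u c) < d n \<and> norm (v - act ES v c) < d n" for n
    by (rule ES.approximate_unit2[of "d n" u v]) (auto simp: d_def)
  then obtain c where c: "\<And>n. norm (u - act ES u (c n)) < d n" "\<And>n. norm (v - act ES v (c n)) < d n" by metis
  have d0: "d \<longlonglongrightarrow> 0" unfolding d_def by (rule LIMSEQ_Suc[OF lim_1_over_n])
  have "(\<lambda>n. u - act ES u (c n)) \<longlonglongrightarrow> 0" "(\<lambda>n. v - act ES v (c n)) \<longlonglongrightarrow> 0"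
    by (rule Lim_null_comparison[OF _ d0]; use c in \<open>auto intro!: always_eventually less_imp_le\<close>)+
  then have lim: "(\<lambda>n. act ES u (c n)) \<longlonglongrightarrow> u" "(\<lambda>n. act ES v (c n)) \<longlonglongrightarrow> v"
    using tendsto_diff[OF tendsto_const[of u]] tendsto_diff[OF tendsto_const[of v]] by fastforce+
  have mem: "(\<rho> s (act ES u (c n)), \<rho> s (act ES v (c n))) \<in> T" for n
    using regularD(5)[OF T uv, of "BSmul s (c n)"] by (simp add: act_BSmul)
  have "(\<lambda>n. (\<rho> s (act ES u (c n)), \<rho> s (act ES v (c n)))) \<longlonglongrightarrow> (\<rho> s u, \<rho> s v)"
    by (intro tendsto_Pair bounded_linear.tendsto[OF rho(1)] lim)
  then show ?thesis by (rule closed_sequentially[OF regularD(6)[OF T] mem])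
qed

text \<open>By \<open>graph_rho\<close> the elements that map everything into the domain form a dense two-sided ideal.\<close>

lemma pedersen_dom:
  assumes T: "matched ES tES T" and k: "k \<in> pedersen_ideal"
  shows "\<rho> k \<zeta> \<in> Domain T"
proof -
  have reg: "regular ES T" and dense: "closure {s. range (\<rho> s) \<subseteq> Domain T} = UNIV"
    using T by (auto simp: matched_def)
  let ?I = "{s. range (\<rho> s) \<subseteq> Domain T}"
  have add: "x + y \<in> Domain T" if "x \<in> Domain T" "y \<in> Domain T" for x y
    using that regularD(3)[OF reg] by (meson DomainE DomainI)
  have "?I \<in> {I. 0 \<in> I \<and> (\<forall>x\<in>I. \<forall>y\<in>I. x + y \<in> I) \<and> (\<forall>c. \<forall>x\<in>I. c *\<^sub>C x \<in> I)
      \<and> (\<forall>x\<in>I. \<forall>s. s * x \<in> I \<and> x * s \<in> I) \<and> closure I = UNIV}"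
  proof (intro CollectI conjI ballI allI dense)
    show "range (\<rho> 0) \<subseteq> Domain T" using regularD(2)[OF reg] by (auto simp: rho_zero)
    show "range (\<rho> (x + y)) \<subseteq> Domain T" if "x \<in> ?I" "y \<in> ?I" for x y
      using that by (auto simp: rho_add intro!: add)
    show "range (\<rho> (c *\<^sub>C x)) \<subseteq> Domain T" if "x \<in> ?I" for c x
      using that by (auto simp: rho_scaleC)
    show "range (\<rho> (s * x)) \<subseteq> Domain T" if "x \<in> ?I" for x s
      using that by (auto simp: rho_rho[symmetric])
    show "range (\<rho> (x * s)) \<subseteq> Domain T" if x: "x \<in> ?I" for x s
    proof
      fix y assume "y \<in> range (\<rho> (x * s))"
      then obtain \<zeta> where y: "y = \<rho> s (\<rho> x \<zeta>)" by (auto simp: rho_rho)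
      have "\<rho> x \<zeta> \<in> Domain T" using x by auto
      then obtain v where "(\<rho> x \<zeta>, v) \<in> T" by auto
      from graph_rho[OF reg this] show "y \<in> Domain T" unfolding y by auto
    qed
  qed
  then have "pedersen_ideal \<subseteq> ?I" unfolding pedersen_ideal_def by (rule Inter_lower)
  then show ?thesis using k by blast
qed

text \<open>
  For \<open>(y, z)\<close> in the graph of \<open>T\<^sup>*\<close> the functionals \<open>\<zeta> \<mapsto> \<langle>z | \<zeta> (1 \<otimes> k)\<rangle> / \<parallel>y\<parallel>\<close> are bounded at \<open>\<zeta>\<close> by
  the norm of \<open>T (\<zeta> (1 \<otimes> k))\<close>, hence uniformly, and the domain of \<open>T\<^sup>*\<close> is dense.
\<close>

lemma pedersen_bounded:
  assumes T: "matched ES tES T" and k: "k \<in> pedersen_ideal"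
  obtains C where "0 \<le> C" "\<And>\<zeta> w. (\<rho> k \<zeta>, w) \<in> T \<Longrightarrow> norm w \<le> C * norm \<zeta>"
proof -
  have reg: "regular ES T" using T by (simp add: matched_def)
  let ?f = "\<lambda>(y, z) \<zeta>. (1 / norm y) *\<^sub>R ip ES z (\<rho> k \<zeta>)"
  have yw: "ip ES y w = ip ES z x" if "(y, z) \<in> op_adjoint ES T" "(x, w) \<in> T" for x y z w
    using op_adjointD[OF that] by (metis ES.star_ip)
  have "\<exists>C\<ge>0. \<forall>p\<in>op_adjoint ES T. \<forall>x. norm (?f p x) \<le> C * norm x"
  proof (rule uniform_boundedness)
    fix p assume "p \<in> op_adjoint ES T"
    show "bounded_linear (?f p)"
      by (cases p) (auto intro!: bounded_linear_compose[OF bounded_linear_scaleR_right]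
          bounded_linear_compose[OF ES.bounded_linear_ip_right rho(1)])
  next
    fix \<zeta>
    obtain w where w: "(\<rho> k \<zeta>, w) \<in> T" using pedersen_dom[OF T k, of \<zeta>] by auto
    show "\<exists>C. \<forall>p\<in>op_adjoint ES T. norm (?f p \<zeta>) \<le> C"
    proof (intro exI[of _ "norm w"] ballI, clarify)
      fix y z assume yz: "(y, z) \<in> op_adjoint ES T"
      have "norm (ip ES y w) \<le> norm y * norm w" by (rule ES.cauchy_schwarz)
      then show "norm ((1 / norm y) *\<^sub>R ip ES z (\<rho> k \<zeta>)) \<le> norm w"
        by (cases "y = 0") (auto simp: yw[OF yz w, symmetric] divide_le_eq mult.commute)
    qed
  qed
  then obtain C where C: "0 \<le> C" "\<And>y z x. (y, z) \<in> op_adjoint ES T \<Longrightarrow> norm (?f (y, z) x) \<le> C * norm x" by blast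
  show thesis
  proof (rule that[OF C(1)])
    fix \<zeta> w assume w: "(\<rho> k \<zeta>, w) \<in> T"
    show "norm w \<le> C * norm \<zeta>"
    proof (rule ES.norm_le_ip)
      fix y
      have "y \<in> closure (Domain (op_adjoint ES T))" using regularD(8)[OF reg] by simp
      then obtain a where a: "\<And>n::nat. a n \<in> Domain (op_adjoint ES T)" "a \<longlonglongrightarrow> y"
        unfolding closure_sequential by blast
      have "norm (ip ES (a n) w) \<le> C * norm \<zeta> * norm (a n)" for n
      proof -
        obtain z where z: "(a n, z) \<in> op_adjoint ES T" using a(1)[of n] by auto
        show ?thesis
        proof (cases "a n = 0")
          case False
          then show ?thesis using C(2)[OF z, of \<zeta>]
            by (simp add: yw[OF z w, symmetric] divide_le_eq)
        qed simp
      qed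
      moreover have "(\<lambda>n. norm (ip ES (a n) w)) \<longlonglongrightarrow> norm (ip ES y w)"
        by (intro tendsto_norm bounded_linear.tendsto[OF ES.bounded_linear_ip_left] a)
      moreover have "(\<lambda>n. C * norm \<zeta> * norm (a n)) \<longlonglongrightarrow> C * norm \<zeta> * norm y"
        by (intro tendsto_intros a)
      ultimately show "norm (ip ES y w) \<le> C * norm \<zeta> * norm y" using LIMSEQ_le by blast
    qed (use C in simp)
  qed
qed

text \<open>
  Right multiplication by \<open>k\<close> takes values in a spectral subspace of \<open>T\<^sup>*T\<close> for a bounded interval.
  For a vector \<open>v\<close> of the complementary subspace, \<open>Q v\<close> and \<open>H v\<close> are much smaller than \<open>v\<close>.  If \<open>v\<close>
  is also invariant under \<open>k'\<close>, then \<open>w = T v\<close> is at most \<open>C\<close> times as large as \<open>v\<close>, which contradicts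
  \<open>\<langle>v | v\<rangle> = \<langle>w | H v\<rangle> + \<langle>v | Q v\<rangle>\<close> unless \<open>v = 0\<close>.
\<close>

lemma matched_cutoff:
  assumes T: "matched ES tES T" and k: "k * k' = k" "k' \<in> pedersen_ideal"
    and Q: "ES.pcontr Q" and H: "ES.adm H" and QH: "\<And>w. (Q w, H w) \<in> T" "\<And>w. (H w, w - Q w) \<in> op_adjoint ES T"
  obtains \<epsilon> where "0 < \<epsilon>" "\<And>\<zeta>. fc (\<lambda>x. max 0 (\<epsilon> - x)) Q (\<rho> k \<zeta>) = 0"
proof -
  obtain C where C: "0 \<le> C" "\<And>\<zeta> w. (\<rho> k' \<zeta>, w) \<in> T \<Longrightarrow> norm w \<le> C * norm \<zeta>"
    by (rule pedersen_bounded[OF T k(2)]) blast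
  \<comment> \<open>Chosen such that \<open>C \<delta> + \<delta>\<^sup>2 < 1\<close>.\<close>
  define \<delta> where "\<delta> = 1 / (2 * C + 2)"
  define \<epsilon> where "\<epsilon> = \<delta>\<^sup>2"
  have \<delta>: "0 < \<delta>" "\<delta> \<le> 1/2" "C * \<delta> < 1/2" using C(1) by (auto simp: \<delta>_def field_simps)
  have \<epsilon>: "0 < \<epsilon>" "\<epsilon> \<le> 1/4" "sqrt \<epsilon> = \<delta>"
    using \<delta> power_mono[of \<delta> "1/2" 2] by (auto simp: \<epsilon>_def power2_eq_square)
  let ?s = "\<lambda>x. max 0 (\<epsilon> - x)"
  have cs: "cont01 ?s" by (intro continuous_intros)
  have aS: "ES.adm (fc ?s Q)" by (rule ES.adm_fc[OF Q cs])
  have "fc ?s Q (\<rho> k \<zeta>) = 0" for \<zeta>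
  proof (rule ccontr)
    let ?v = "fc ?s Q (\<rho> k \<zeta>)"
    assume v0: "?v \<noteq> 0"
    have v: "\<rho> k' ?v = ?v" by (simp add: rho_adm[OF aS] rho_rho k(1))
    obtain w where w: "(?v, w) \<in> T" using pedersen_dom[OF T k(2), of ?v] unfolding v by auto
    have nw: "norm w \<le> C * norm ?v" using C(2)[of ?v w] w unfolding v by simp
    have bd: "norm (fc f Q ?v) \<le> \<epsilon> * norm ?v"
      if f: "cont01 f" "\<And>x. 0 \<le> x \<Longrightarrow> x \<le> 1 \<Longrightarrow> \<bar>f x\<bar> \<le> x" for f
    proof -
      have "norm (fc (\<lambda>x. f x * ?s x) Q (\<rho> k \<zeta>)) \<le> norm (fc (\<lambda>x. \<epsilon> * ?s x) Q (\<rho> k \<zeta>))"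
      proof (rule ES.norm_fc_mono[OF Q continuous_on_mult[OF f(1) cs] continuous_on_mult[OF continuous_on_const cs]])
        fix x :: real assume x: "0 \<le> x" "x \<le> 1"
        show "\<bar>f x * ?s x\<bar> \<le> \<bar>\<epsilon> * ?s x\<bar>"
        proof (cases "x \<le> \<epsilon>")
          case True
          then show ?thesis using f(2)[OF x] x \<epsilon> by (auto simp: abs_mult intro!: mult_right_mono)
        qed simp
      qed
      then show ?thesis
        using \<epsilon> by (simp add: ES.fc_mult[OF Q f(1) cs] ES.fc_scaleR[OF Q cs])
    qed
    have Qv: "norm (Q ?v) \<le> \<epsilon> * norm ?v"
      using bd[of "\<lambda>x. x"] by (simp add: ES.fc_id[OF Q] continuous_on_id)
    have QQv: "norm (Q ?v - Q (Q ?v)) \<le> \<epsilon> * norm ?v"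
    proof -
      have c: "cont01 (\<lambda>x. x * x)" by (intro continuous_intros)
      have "fc (\<lambda>x. x - x * x) Q ?v = Q ?v - Q (Q ?v)"
        by (simp add: ES.fc_diff[OF Q continuous_on_id c] ES.fc_id[OF Q] ES.fc_mult[OF Q continuous_on_id continuous_on_id])
      moreover have "norm (fc (\<lambda>x. x - x * x) Q ?v) \<le> \<epsilon> * norm ?v"
      proof (rule bd)
        fix x :: real assume x: "0 \<le> x" "x \<le> 1"
        then have "x * x \<le> x * 1" "0 \<le> x * x" by (intro mult_left_mono) auto
        then show "\<bar>x - x * x\<bar> \<le> x" by simp
      qed (intro continuous_intros)
      ultimately show ?thesis by simp
    qed
    have HH: "norm (H ?v) \<le> \<delta> * norm ?v"
    proof -
      have "ip ES (H ?v) (H ?v) = ip ES (Q ?v) (?v - Q ?v)" by (rule op_adjointD[OF QH(2) QH(1)])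
      also have "\<dots> = ip ES ?v (Q ?v - Q (Q ?v))"
        by (simp add: ES.sa_ip[OF ES.pcontr_sa[OF Q]] linear_diff[OF ES.pcontr_linear[OF Q]])
      finally have "(norm (H ?v))\<^sup>2 \<le> norm ?v * norm (Q ?v - Q (Q ?v))"
        by (metis ES.cauchy_schwarz ES.norm_ip_self)
      from ES.norm_le_of_square[where T=H, OF this QQv] \<epsilon> show ?thesis by simp
    qed
    have "ip ES w (H ?v) = ip ES ?v (?v - Q ?v)" by (rule op_adjointD[OF QH(2) w])
    then have "ip ES ?v ?v = ip ES w (H ?v) + ip ES ?v (Q ?v)" by (simp add: ES.ip_diff_right)
    then have "(norm ?v)\<^sup>2 \<le> norm w * norm (H ?v) + norm ?v * norm (Q ?v)"
      by (metis ES.norm_ip_self norm_triangle_mono ES.cauchy_schwarz)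
    also have "\<dots> \<le> (C * norm ?v) * (\<delta> * norm ?v) + norm ?v * (\<epsilon> * norm ?v)"
      by (intro add_mono mult_mono nw HH Qv mult_left_mono) (use C in auto)
    also have "\<dots> = (C * \<delta> + \<epsilon>) * (norm ?v)\<^sup>2" by (simp add: power2_eq_square algebra_simps)
    also have "\<dots> < 1 * (norm ?v)\<^sup>2"
      by (rule mult_strict_right_mono) (use \<delta> \<epsilon> v0 in auto)
    finally show False by simp
  qed
  then show thesis using that \<epsilon>(1) by blast
qed

text \<open>
  \<open>E \<otimes> I\<close> and \<open>B \<otimes> I\<close> for the closed ideal \<open>I\<close> generated by \<open>k\<close>.  For a local unit \<open>k\<close> these are the
  places where matched operators become bounded.
\<close>

definition Msub :: "'s \<Rightarrow> 'es set" where
  "Msub k = closure (span {tES \<xi> (t * k * u) | \<xi> t u. True})"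

definition Jsub :: "'s \<Rightarrow> 'bs set" where
  "Jsub k = closure (span {tBS b (t * k * u) | b t u. True})"

lemma Msub_subspace: "subspace (Msub k)" "closed (Msub k)"
  and Jsub_subspace: "subspace (Jsub k)" "closed (Jsub k)"
  by (simp_all add: Msub_def Jsub_def subspace_closure)

lemma Msub_base: "tES \<xi> (t * k * u) \<in> Msub k"
  unfolding Msub_def by (rule subsetD[OF closure_subset], rule span_base) auto

lemma Jsub_base: "tBS b (t * k * u) \<in> Jsub k"
  unfolding Jsub_def by (rule subsetD[OF closure_subset], rule span_base) auto

lemma Msub_induct:
  assumes "\<zeta> \<in> Msub k" "subspace V" "closed V" "\<And>\<xi> t u. tES \<xi> (t * k * u) \<in> V"
  shows "\<zeta> \<in> V"
  by (rule closure_span_induct[OF assms(1)[unfolded Msub_def] assms(2,3)]) (use assms(4) in auto)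

lemma rho_Msub: "\<rho> (k * u) \<zeta> \<in> Msub k"
proof -
  have "\<zeta> \<in> {\<zeta>. \<rho> (k * u) \<zeta> \<in> Msub k}"
    by (rule closed_subspace_total[OF bounded_linear_vimage[OF rho(1) Msub_subspace] _ tES_total])
      (auto simp: rho mult.assoc[symmetric] intro: Msub_base)
  then show ?thesis by simp
qed

lemma Msub_adm:
  assumes T: "ES.adm T" and \<zeta>: "\<zeta> \<in> Msub k"
  shows "T \<zeta> \<in> Msub k"
proof -
  have "\<zeta> \<in> {\<zeta>. T \<zeta> \<in> Msub k}"
  proof (rule Msub_induct[OF \<zeta> bounded_linear_vimage[OF ES.adm_bounded[OF T] Msub_subspace]])
    fix \<xi> t u
    have "tES \<xi> (t * k * u) = \<rho> (k * u) (tES \<xi> t)" by (simp add: rho mult.assoc)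
    then show "tES \<xi> (t * k * u) \<in> {\<zeta>. T \<zeta> \<in> Msub k}"
      by (simp add: rho_adm[OF T] rho_Msub)
  qed
  then show ?thesis by simp
qed

lemma isub_Msub: "isub ES (Msub k)"
  by unfold_locales (simp_all add: Msub_subspace Msub_adm)

lemma act_Jsub:
  assumes j: "j \<in> Jsub k"
  shows "act ES x j \<in> Msub k"
proof -
  have gen: "act ES x (tBS b (t * k * u)) \<in> Msub k" for x b t u
  proof -
    have "x \<in> {x. act ES x (tBS b (t * k * u)) \<in> Msub k}"
      by (rule closed_subspace_total[OF bounded_linear_vimage[OF ES.bounded_linear_act_left Msub_subspace] _ tES_total])
        (auto simp: act_tES mult.assoc[symmetric] intro: Msub_base)
    then show ?thesis by simp
  qed
  have "j \<in> {j. act ES x j \<in> Msub k}"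
    by (rule closure_span_induct[OF j[unfolded Jsub_def] bounded_linear_vimage[OF ES.bounded_linear_act_right Msub_subspace]])
      (auto intro: gen)
  then show ?thesis by simp
qed

lemma ip_Msub:
  assumes \<zeta>: "\<zeta> \<in> Msub k"
  shows "ip ES y \<zeta> \<in> Jsub k"
proof -
  have gen: "ip ES y (tES \<xi> (t * k * u)) \<in> Jsub k" for y \<xi> t u
  proof -
    have "y \<in> {y. ip ES y (tES \<xi> (t * k * u)) \<in> Jsub k}"
      by (rule closed_subspace_total[OF bounded_linear_vimage[OF ES.bounded_linear_ip_left Jsub_subspace] _ tES_total])
        (auto simp: ip_tES mult.assoc[symmetric] intro: Jsub_base)
    then show ?thesis by simp
  qed
  have "\<zeta> \<in> {\<zeta>. ip ES y \<zeta> \<in> Jsub k}"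
    by (rule Msub_induct[OF \<zeta> bounded_linear_vimage[OF ES.bounded_linear_ip_right Jsub_subspace]]) (simp add: gen)
  then show ?thesis by simp
qed

text \<open>
  On \<open>Msub k\<close> the resolvent \<open>Q = (1 + T\<^sup>*T)\<^sup>-\<^sup>1\<close> is inverted by \<open>g(Q)\<close> with \<open>g(x) = 1 / max x \<epsilon>\<close>, so that
  \<open>T\<close> agrees with \<open>H g(Q)\<close>, where \<open>H = T Q\<close>.  For the adjoint, let \<open>(x, w)\<close> be in the graph of \<open>T\<close> and
  \<open>c = \<langle>w - T' x | \<zeta>\<rangle>\<close>.  Then \<open>x c\<close> is in \<open>Msub k\<close>, so \<open>(w - T' x) c = 0\<close> and \<open>c\<^sup>*c = 0\<close>.
\<close>

theorem matched_local:
  assumes T: "matched ES tES T" and k: "k * k' = k" "k' \<in> pedersen_ideal"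
  obtains T' where "ES.adm T'" "\<And>\<zeta>. \<zeta> \<in> Msub k \<Longrightarrow> (\<zeta>, T' \<zeta>) \<in> T"
    "\<And>\<zeta>. \<zeta> \<in> Msub k \<Longrightarrow> (\<zeta>, ES.ad T' \<zeta>) \<in> op_adjoint ES T"
proof -
  have reg: "regular ES T" using T by (simp add: matched_def)
  obtain Q H where Q: "ES.pcontr Q" and H: "ES.adm H" and QH: "\<And>w. (Q w, H w) \<in> T"
    "\<And>w. (H w, w - Q w) \<in> op_adjoint ES T" by (rule ES.regular_resolvent[OF reg]) blast
  obtain \<epsilon> where \<epsilon>: "0 < \<epsilon>" "\<And>\<zeta>. fc (\<lambda>x. max 0 (\<epsilon> - x)) Q (\<rho> k \<zeta>) = 0"
    by (rule matched_cutoff[OF T k Q H QH]) blast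
  let ?s = "\<lambda>x. max 0 (\<epsilon> - x)" and ?g = "\<lambda>x. 1 / max x \<epsilon>"
  have cs: "cont01 ?s" by (intro continuous_intros)
  have cg: "cont01 ?g" by (intro continuous_intros) (use \<epsilon>(1) in \<open>auto simp: max_def\<close>)
  have bs: "bounded_linear (fc ?s Q)" by (rule ES.adm_bounded[OF ES.adm_fc[OF Q cs]])
  have zero: "fc ?s Q \<zeta> = 0" if \<zeta>: "\<zeta> \<in> Msub k" for \<zeta>
  proof -
    have "\<zeta> \<in> {\<zeta>. fc ?s Q \<zeta> \<in> {0}}"
    proof (rule Msub_induct[OF \<zeta> bounded_linear_vimage[OF bs]])
      fix \<xi> t u
      have "tES \<xi> (t * k * u) = \<rho> u (\<rho> k (tES \<xi> t))" by (simp add: rho)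
      then show "tES \<xi> (t * k * u) \<in> {\<zeta>. fc ?s Q \<zeta> \<in> {0}}"
        using rho_adm[OF ES.adm_fc[OF Q cs], of u "\<rho> k (tES \<xi> t)"]
        by (simp add: \<epsilon>(2) linear_0[OF rho_linear])
    qed auto
    then show ?thesis by simp
  qed
  define T' where "T' = (\<lambda>u. H (fc ?g Q u))"
  have aT: "ES.adm T'" unfolding T'_def by (rule ES.adm_comp[OF H ES.adm_fc[OF Q cg]])
  have TT: "(\<zeta>, T' \<zeta>) \<in> T" if \<zeta>: "\<zeta> \<in> Msub k" for \<zeta>
  proof -
    have cd: "cont01 (\<lambda>x. (1 / \<epsilon>) * ?s x)" by (intro continuous_intros)
    have "Q (fc ?g Q \<zeta>) = fc (\<lambda>x. 1 - (1 / \<epsilon>) * ?s x) Q \<zeta>"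
      using ES.fc_mult_eq[OF Q continuous_on_id cg, of "\<lambda>x. 1 - (1 / \<epsilon>) * ?s x" \<zeta>] \<epsilon>(1)
      by (simp add: ES.fc_id[OF Q] max_def field_simps)
    also have "\<dots> = \<zeta> - (1 / \<epsilon>) *\<^sub>R fc ?s Q \<zeta>"
      by (simp only: ES.fc_diff[OF Q continuous_on_const cd] ES.fc_one[OF Q] ES.fc_scaleR[OF Q cs])
    also have "\<dots> = \<zeta>" by (simp add: zero[OF \<zeta>])
    finally show ?thesis using QH(1)[of "fc ?g Q \<zeta>"] by (simp add: T'_def)
  qed
  show thesis
  proof (rule that[OF aT TT])
    fix \<zeta> assume \<zeta>: "\<zeta> \<in> Msub k"
    show "(\<zeta>, ES.ad T' \<zeta>) \<in> op_adjoint ES T"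
    proof (rule op_adjointI)
      fix x w assume xw: "(x, w) \<in> T"
      let ?y = "w - T' x" and ?c = "ip ES (w - T' x) \<zeta>"
      have cJ: "?c \<in> Jsub k" by (rule ip_Msub[OF \<zeta>])
      have "act ES w ?c = T' (act ES x ?c)"
        using regularD(5)[OF reg xw, of ?c] TT[OF act_Jsub[OF cJ]] regularD(1)[OF reg] by (metis single_valuedD)
      then have "act ES ?y ?c = 0" by (simp add: ES.act_diff_left ES.adm_act[OF aT])
      then have "star ?c * ?c = 0" by (metis ES.ip_act_left ES.ip_zero_left)
      then have "?c = 0" by (rule star_mult_self_zero)
      then show "ip ES w \<zeta> = ip ES x (ES.ad T' \<zeta>)" by (simp add: ES.ip_diff_left ES.ip_ad[OF aT])
    qed
  qed
qed

end

section \<open>Compact operators\<close>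

lemma op_span_base: "T \<in> X \<Longrightarrow> T \<in> op_span X"
proof -
  assume "T \<in> X"
  then have "(\<forall>i<1. (\<lambda>i::nat. T) i \<in> X) \<and> T = (\<lambda>x. \<Sum>i<1. (\<lambda>i::nat. 1) i *\<^sub>C (\<lambda>i::nat. T) i x)"
    by simp
  then show ?thesis unfolding op_span_def by (intro CollectI exI)
qed

lemma op_span_induct [consumes 1, case_names zero step]:
  assumes T: "T \<in> op_span X" and "P (\<lambda>x. 0)"
    and "\<And>c G S. G \<in> X \<Longrightarrow> P S \<Longrightarrow> P (\<lambda>x. S x + c *\<^sub>C G x)"
  shows "P T"
proof -
  obtain n c G where G: "\<forall>i<(n::nat). G i \<in> X" "T = (\<lambda>x. \<Sum>i<n. c i *\<^sub>C G i x)"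
    using T unfolding op_span_def by blast
  have "P (\<lambda>x. \<Sum>i<m. c i *\<^sub>C G i x)" if "m \<le> n" for m
    using that by (induction m) (auto intro: assms(2) assms(3)[OF G(1)[rule_format]])
  then show ?thesis unfolding G(2) by simp
qed

lemma op_span_step: "S \<in> op_span X \<Longrightarrow> G \<in> X \<Longrightarrow> (\<lambda>x. S x + c *\<^sub>C G x) \<in> op_span X"
proof -
  assume S: "S \<in> op_span X" and G: "G \<in> X"
  obtain n d H where H: "\<forall>i<(n::nat). H i \<in> X" "S = (\<lambda>x. \<Sum>i<n. d i *\<^sub>C H i x)"
    using S unfolding op_span_def by blast
  have "(\<forall>i<Suc n. (H(n := G)) i \<in> X) \<and>
      (\<lambda>x. S x + c *\<^sub>C G x) = (\<lambda>x. \<Sum>i<Suc n. (d(n := c)) i *\<^sub>C (H(n := G)) i x)"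
    using H G by (auto simp: less_Suc_eq fun_eq_iff)
  then show ?thesis unfolding op_span_def by (intro CollectI exI)
qed

lemma op_span_zero: "(\<lambda>x. 0) \<in> op_span X"
proof -
  have "(\<forall>i<0. (\<lambda>i::nat. undefined) i \<in> X) \<and> (\<lambda>x. 0) = (\<lambda>x. \<Sum>i<0. (\<lambda>i::nat. 0) i *\<^sub>C (\<lambda>i::nat. undefined) i x)"
    by simp
  then show ?thesis unfolding op_span_def by (intro CollectI exI)
qed

lemma op_span_add: "S \<in> op_span X \<Longrightarrow> T \<in> op_span X \<Longrightarrow> (\<lambda>x. S x + T x) \<in> op_span X"
proof -
  assume S: "S \<in> op_span X" and "T \<in> op_span X"
  from this(2) show ?thesis
  proof (induction rule: op_span_induct)
    case zero then show ?case using S by simp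
  next
    case (step c G R)
    then show ?case using op_span_step[OF step(2) step(1), of c] by (simp add: add.assoc)
  qed
qed

lemma op_closureI:
  assumes "bounded_linear T" "\<And>e. 0 < e \<Longrightarrow> \<exists>G\<in>X. \<forall>x. norm (T x - G x) \<le> e * norm x"
  shows "T \<in> op_closure X"
  unfolding op_closure_def
proof (intro CollectI conjI assms(1) allI impI)
  fix e :: real assume e: "0 < e"
  then obtain G where G: "G \<in> X" "\<And>x. norm (T x - G x) \<le> e / 2 * norm x" using assms(2)[of "e / 2"] by auto
  have "onorm (\<lambda>x. T x - G x) \<le> e / 2" by (rule onorm_bound) (use e G in auto)
  then show "\<exists>G\<in>X. onorm (\<lambda>x. T x - G x) < e" using G(1) e by (intro bexI[of _ G]) auto
qed

lemma op_closureD: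
  assumes "T \<in> op_closure X" "\<And>G. G \<in> X \<Longrightarrow> bounded_linear G"
  shows "bounded_linear T" "0 < e \<Longrightarrow> \<exists>G\<in>X. \<forall>x. norm (T x - G x) \<le> e * norm x"
proof -
  show T: "bounded_linear T" using assms(1) by (simp add: op_closure_def)
  assume "0 < e"
  then obtain G where G: "G \<in> X" "onorm (\<lambda>x. T x - G x) < e"
    using assms(1) unfolding op_closure_def by blast
  have "norm (T x - G x) \<le> e * norm x" for x
  proof -
    have "norm (T x - G x) \<le> onorm (\<lambda>x. T x - G x) * norm x"
      by (rule onorm[OF bounded_linear_sub[OF T assms(2)[OF G(1)]]])
    also have "\<dots> \<le> e * norm x" using G(2) by (intro mult_right_mono) auto
    finally show ?thesis .
  qed
  then show "\<exists>G\<in>X. \<forall>x. norm (T x - G x) \<le> e * norm x" using G(1) by blast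
qed

context hmod
begin

definition rank1 :: "'e \<Rightarrow> 'e \<Rightarrow> 'e \<Rightarrow> 'e" where "rank1 \<xi> \<eta> \<zeta> = act E \<xi> (ip E \<eta> \<zeta>)"

definition frank :: "('e \<Rightarrow> 'e) set" where "frank = op_span {rank1 \<xi> \<eta> | \<xi> \<eta>. True}"

lemma compact_ops_frank: "compact_ops E = op_closure frank"
proof -
  have "{T. \<exists>\<xi> \<eta>. T = (\<lambda>\<zeta>. act E \<xi> (ip E \<eta> \<zeta>))} = {rank1 \<xi> \<eta> | \<xi> \<eta>. True}"
    by (auto simp: rank1_def fun_eq_iff)
  then show ?thesis by (simp add: compact_ops_def frank_def)
qed

lemma rank1_adm: "adm (rank1 \<xi> \<eta>)" "ad (rank1 \<xi> \<eta>) = rank1 \<eta> \<xi>"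
proof -
  have *: "ip E (rank1 \<xi> \<eta> x) y = ip E x (rank1 \<eta> \<xi> y)" for x y
    by (simp add: rank1_def ip_act_left ip_act_right star_ip)
  show "adm (rank1 \<xi> \<eta>)" by (rule adjointableI) (rule *)
  show "ad (rank1 \<xi> \<eta>) = rank1 \<eta> \<xi>" by (rule adj_eqI) (rule *)
qed

lemma op_span_ad:
  assumes "T \<in> op_span X" and X: "\<And>G. G \<in> X \<Longrightarrow> adm G \<and> ad G \<in> Y"
  shows "adm T \<and> ad T \<in> op_span Y"
  using assms(1)
proof (induction rule: op_span_induct)
  case zero then show ?case by (simp add: adm_zero ad_zero op_span_zero)
next
  case (step c G S)
  have G: "adm G" "ad G \<in> Y" using X[OF step(1)] by auto
  show ?case
    using adm_add[of S "\<lambda>x. c *\<^sub>C G x"] adm_scaleC[OF G(1), of c] step(2) op_span_step[of "ad S" Y "ad G" "cnj c"] G(2)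
    by auto
qed

lemma op_closure_ad:
  assumes T: "T \<in> op_closure (op_span X)" "adm T" and X: "\<And>G. G \<in> X \<Longrightarrow> adm G \<and> ad G \<in> Y"
  shows "ad T \<in> op_closure (op_span Y)"
proof (rule op_closureI[OF adm_bounded[OF adm_ad(1)[OF T(2)]]])
  fix e :: real assume e: "0 < e"
  have bl: "bounded_linear G" if "G \<in> op_span X" for G using op_span_ad[OF that X] adm_bounded by blast
  obtain G where G: "G \<in> op_span X" "\<And>x. norm (T x - G x) \<le> e * norm x"
    using op_closureD(2)[OF T(1) bl e] by blast
  have aG: "adm G" "ad G \<in> op_span Y" using op_span_ad[OF G(1) X] by auto
  have "norm (ad (\<lambda>x. T x - G x) x) \<le> e * norm x" for x
    by (rule norm_ad_le[OF adm_diff(1)[OF T(2) aG(1)] G(2)]) (use e in simp)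
  then show "\<exists>G\<in>op_span Y. \<forall>x. norm (ad T x - G x) \<le> e * norm x"
    using aG(2) by (auto simp: adm_diff(2)[OF T(2) aG(1)])
qed

lemma frank_adm: "T \<in> frank \<Longrightarrow> adm T"
  unfolding frank_def using op_span_ad[of T _ UNIV] rank1_adm(1) by auto

lemma frank_comp:
  assumes S: "adm S" and T: "T \<in> frank"
  shows "(\<lambda>x. S (T x)) \<in> frank" "(\<lambda>x. T (S x)) \<in> frank"
proof -
  have 1: "(\<lambda>x. S (rank1 \<xi> \<eta> x)) = rank1 (S \<xi>) \<eta>" "(\<lambda>x. rank1 \<xi> \<eta> (S x)) = rank1 \<xi> (ad S \<eta>)" for \<xi> \<eta>
    by (auto simp: rank1_def adm_act[OF S] ip_ad_left[OF S])
  note c = adm_clinear[OF S]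
  show "(\<lambda>x. S (T x)) \<in> frank" using T unfolding frank_def
  proof (induction rule: op_span_induct)
    case zero then show ?case by (simp add: clinear_zero[OF c] op_span_zero)
  next
    case (step d G R)
    then obtain \<xi> \<eta> where "G = rank1 \<xi> \<eta>" by auto
    then show ?case using op_span_step[OF step(2), of "rank1 (S \<xi>) \<eta>" d] 1(1)[of \<xi> \<eta>]
      by (auto simp: clinear_add[OF c] clinear_scaleC[OF c] fun_eq_iff)
  qed
  show "(\<lambda>x. T (S x)) \<in> frank" using T unfolding frank_def
  proof (induction rule: op_span_induct)
    case zero then show ?case by (simp add: op_span_zero)
  next
    case (step d G R)
    then obtain \<xi> \<eta> where "G = rank1 \<xi> \<eta>" by auto
    then show ?case using op_span_step[OF step(2), of "rank1 \<xi> (ad S \<eta>)" d] 1(2)[of \<xi> \<eta>]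
      by (auto simp: fun_eq_iff)
  qed
qed

lemma frank_bounded: "T \<in> frank \<Longrightarrow> bounded_linear T"
  using frank_adm adm_bounded by blast

lemma compact_bounded: "T \<in> compact_ops E \<Longrightarrow> bounded_linear T"
  by (simp add: compact_ops_def op_closure_def)

lemma compactD: "T \<in> compact_ops E \<Longrightarrow> 0 < e \<Longrightarrow> \<exists>G\<in>frank. \<forall>x. norm (T x - G x) \<le> e * norm x"
  unfolding compact_ops_frank by (rule op_closureD(2)[OF _ frank_bounded])

lemma compact_closed:
  assumes "bounded_linear T" "\<And>e. 0 < e \<Longrightarrow> \<exists>K\<in>compact_ops E. \<forall>x. norm (T x - K x) \<le> e * norm x"
  shows "T \<in> compact_ops E"
  unfolding compact_ops_frank
proof (rule op_closureI[OF assms(1)])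
  fix e :: real assume e: "0 < e"
  obtain K where K: "K \<in> compact_ops E" "\<And>x. norm (T x - K x) \<le> e / 2 * norm x" using assms(2)[of "e / 2"] e by auto
  obtain G where G: "G \<in> frank" "\<And>x. norm (K x - G x) \<le> e / 2 * norm x" using compactD[OF K(1), of "e / 2"] e by auto
  have "norm (T x - G x) \<le> e * norm x" for x
    using norm_triangle_mono[OF K(2)[of x] G(2)[of x]] by (simp add: field_simps)
  then show "\<exists>G\<in>frank. \<forall>x. norm (T x - G x) \<le> e * norm x" using G(1) by blast
qed

lemma frank_compact: "T \<in> frank \<Longrightarrow> T \<in> compact_ops E"
  unfolding compact_ops_frank by (rule op_closureI[OF frank_bounded]) (auto intro!: bexI[of _ T])

lemma compact_zero: "(\<lambda>x. 0) \<in> compact_ops E"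
  by (rule frank_compact) (simp add: frank_def op_span_zero)

lemma compact_add:
  assumes "S \<in> compact_ops E" "T \<in> compact_ops E"
  shows "(\<lambda>x. S x + T x) \<in> compact_ops E"
proof (rule compact_closed)
  show "bounded_linear (\<lambda>x. S x + T x)" by (intro bounded_linear_add compact_bounded assms)
  fix e :: real assume e: "0 < e"
  obtain G where G: "G \<in> frank" "\<And>x. norm (S x - G x) \<le> e / 2 * norm x" using compactD[OF assms(1), of "e / 2"] e by auto
  obtain H where H: "H \<in> frank" "\<And>x. norm (T x - H x) \<le> e / 2 * norm x" using compactD[OF assms(2), of "e / 2"] e by auto
  have "norm (S x + T x - (G x + H x)) \<le> e * norm x" for x
    using norm_triangle_mono[OF G(2)[of x] H(2)[of x]] by (simp add: algebra_simps)
  moreover have "(\<lambda>x. G x + H x) \<in> frank" using G(1) H(1) unfolding frank_def by (rule op_span_add)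
  ultimately show "\<exists>K\<in>compact_ops E. \<forall>x. norm (S x + T x - K x) \<le> e * norm x"
    by (intro bexI[OF _ frank_compact]) auto
qed

lemma compact_left:
  assumes S: "adm S" and T: "T \<in> compact_ops E"
  shows "(\<lambda>x. S (T x)) \<in> compact_ops E"
proof (rule compact_closed)
  show "bounded_linear (\<lambda>x. S (T x))" by (rule bounded_linear_compose[OF adm_bounded[OF S] compact_bounded[OF T]])
  fix e :: real assume e: "0 < e"
  obtain C where C: "0 < C" "\<And>x. norm (S x) \<le> C * norm x" by (rule adm_bound[OF S]) blast
  obtain G where G: "G \<in> frank" "\<And>x. norm (T x - G x) \<le> e / C * norm x"
    using compactD[OF T, of "e / C"] e C(1) by auto
  have "norm (S (T x) - S (G x)) \<le> e * norm x" for x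
    using order_trans[OF C(2)[of "T x - G x"] mult_left_mono[OF G(2)[of x] less_imp_le[OF C(1)]]] C(1)
    by (simp add: clinear_diff[OF adm_clinear[OF S]])
  then show "\<exists>K\<in>compact_ops E. \<forall>x. norm (S (T x) - K x) \<le> e * norm x"
    by (intro bexI[OF _ frank_compact[OF frank_comp(1)[OF S G(1)]]]) simp
qed

lemma compact_scaleC: "T \<in> compact_ops E \<Longrightarrow> (\<lambda>x. c *\<^sub>C T x) \<in> compact_ops E"
  using compact_left[OF adm_scaleC(1)[OF adm_id]] by simp

lemma compact_ad:
  assumes T: "adm T" "T \<in> compact_ops E"
  shows "ad T \<in> compact_ops E"
  using T(2) unfolding compact_ops_frank frank_def
  by (rule op_closure_ad[OF _ T(1)]) (use rank1_adm in \<open>clarsimp, blast\<close>)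

end

context isub
begin

text \<open>
  By \<open>nul_telescope\<close> the operators \<open>T (1 - Y) c\<close> decay, while \<open>Y\<close> is a multiple of \<open>R\<close>, so that
  \<open>T Y c\<close> is compact.
\<close>

theorem nul_compact:
  assumes tp: "tp R F" and dense: "closure (range (fc sqrt R)) = UNIV" and T: "adm T"
    and nul: "nul (cst T \<star> Zs R F)"
    and c: "adm c" "\<And>u. c u \<in> M" and Rc: "(\<lambda>u. R (c u)) \<in> compact_ops E"
  shows "(\<lambda>u. T (c u)) \<in> compact_ops E"
proof (rule compact_closed)
  show "bounded_linear (\<lambda>u. T (c u))" by (rule adm_bounded[OF adm_comp[OF T c(1)]])
  obtain C \<theta> where C: "0 \<le> C" "0 < \<theta>" "\<theta> < 1"
    "\<And>j u. u \<in> M \<Longrightarrow> norm (T (u - Ys R j u)) \<le> C * \<theta> ^ j * norm u"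
    using nulE[OF nul_telescope[OF tp dense T nul]] unfolding opmul_def opsub_def by metis
  obtain B where B: "0 < B" "\<And>u. norm (c u) \<le> B * norm u" by (rule adm_bound[OF c(1)]) blast
  note R = tp_R[OF tp]
  have cp: "(\<lambda>u. T (Ys R j (c u))) \<in> compact_ops E" for j
  proof -
    let ?h = "\<lambda>x. 4 ^ j / den j x"
    have ch: "cont01 ?h" by (intro continuous_intros den_cont) (simp add: den_nz)
    have "Ys R j u = fc ?h R (R u)" for u
      using fc_mult_eq[OF R ch continuous_on_id, of "yf j" u] by (simp add: Ys_def yf_def fc_id[OF R])
    then show ?thesis using compact_left[OF T compact_left[OF adm_fc[OF R ch] Rc]] by simp
  qed
  fix e :: real assume e: "0 < e"
  have "(\<lambda>j. C * B * \<theta> ^ j) \<longlonglongrightarrow> C * B * 0"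
    by (intro tendsto_intros LIMSEQ_realpow_zero) (use C in auto)
  then have "\<forall>\<^sub>F j in sequentially. C * B * \<theta> ^ j < e" using e by (intro order_tendstoD(2)) auto
  then obtain j where j: "C * B * \<theta> ^ j < e" by (meson eventually_happens' trivial_limit_sequentially)
  have "norm (T (c u) - T (Ys R j (c u))) \<le> e * norm u" for u
  proof -
    have "norm (T (c u) - T (Ys R j (c u))) \<le> C * \<theta> ^ j * norm (c u)"
      using C(4)[OF c(2), of u j] by (simp add: clinear_diff[OF adm_clinear[OF T]])
    also have "\<dots> \<le> C * \<theta> ^ j * (B * norm u)" using C B by (intro mult_left_mono) auto
    also have "\<dots> = C * B * \<theta> ^ j * norm u" by simp
    also have "\<dots> \<le> e * norm u" using j by (intro mult_right_mono) auto
    finally show ?thesis .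
  qed
  then show "\<exists>K\<in>compact_ops E. \<forall>u. norm (T (c u) - K u) \<le> e * norm u"
    by (intro bexI[OF _ cp[of j]]) simp
qed

end

section \<open>Representations\<close>

context hmod
begin

context
  fixes \<pi> :: "'a::cstar_algebra \<Rightarrow> 'e \<Rightarrow> 'e"
  assumes rep: "representation E \<pi>"
begin

lemma rep_clinear: "clinear (\<lambda>a. \<pi> a x)" and rep_mult: "\<pi> (a * b) x = \<pi> a (\<pi> b x)"
  and rep_ip: "ip E (\<pi> a x) y = ip E x (\<pi> (star a) y)"
  using rep by (auto simp: representation_def)

lemma rep_adm: "adm (\<pi> a)" and rep_ad: "ad (\<pi> a) = \<pi> (star a)"
  by (rule adjointableI adj_eqI, rule rep_ip)+

text \<open>Representations are contractive: for \<open>\<parallel>a\<parallel> \<le> 1\<close> one has \<open>b\<^sup>*b - (a b)\<^sup>*(a b) = v\<^sup>*v\<close>.\<close>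

lemma rep_norm_le: "norm (\<pi> a x) \<le> norm a * norm x"
proof -
  have one: "norm (\<pi> (star a) x) \<le> norm x" if a: "norm a \<le> 1" for a x
  proof -
    have le: "norm (\<pi> a (\<pi> b y)) \<le> norm (\<pi> b y)" for b y
    proof -
      obtain v where v: "star b * b - star (a * b) * (a * b) = star v * v"
        using contraction_complement_square[OF a] by blast
      have "ip E (\<pi> b y) (\<pi> b y) = ip E y (\<pi> (star b * b) y)" by (simp add: rep_ip rep_mult)
      also have "star b * b = star (a * b) * (a * b) + star v * v" using v by (simp add: algebra_simps)
      also have "ip E y (\<pi> (star (a * b) * (a * b) + star v * v) y)
          = ip E (\<pi> (a * b) y) (\<pi> (a * b) y) + ip E (\<pi> v y) (\<pi> v y)"
        by (simp only: clinear_add[OF rep_clinear] ip_add_right rep_ip rep_mult[of "star (a * b)"] rep_mult[of "star v"])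
      finally have "norm (\<pi> (a * b) y) \<le> sqrt (norm (ip E (\<pi> b y) (\<pi> b y)))"
        using norm_ip_self_mono[of "\<pi> (a * b) y" "\<pi> v y"] by simp
      then show ?thesis by (simp add: rep_mult norm_ip_self)
    qed
    have "(norm (\<pi> (star a) x))\<^sup>2 \<le> norm x * norm (\<pi> a (\<pi> (star a) x))"
      using norm_square_le[OF rep_adm, of "star a" x] by (simp add: rep_ad star_star)
    also have "\<dots> \<le> norm x * norm (\<pi> (star a) x)" by (intro mult_left_mono le) simp
    finally show ?thesis by (cases "\<pi> (star a) x = 0") (auto simp: power2_eq_square)
  qed
  show ?thesis
  proof (cases "a = 0")
    case True
    then show ?thesis by (simp add: clinear_zero[OF rep_clinear])
  next
    case False
    let ?a = "(1 / norm a) *\<^sub>R a"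
    have "norm (\<pi> ?a x) \<le> norm x" using one[of "star ?a" x] False by (simp add: star_star)
    then show ?thesis using False
      by (simp add: clinear_scaleR[OF rep_clinear] divide_le_eq mult.commute)
  qed
qed

end

lemma hmod_frame: "isub E UNIV"
  by unfold_locales auto

section \<open>From cycles to bounded Kasparov modules\<close>

text \<open>
  The bounded operator that extends \<open>[D, b] \<langle>D\<rangle>\<^sup>-\<^sup>\<alpha>\<close> is evaluated at the vectors \<open>\<langle>D\<rangle>\<^sup>\<alpha>\<^sup>-\<^sup>1 u\<close>.
\<close>

lemma Lip_inter:
  assumes \<alpha>: "0 \<le> \<alpha>" "\<alpha> < 1" and tp: "tp R F" and b: "b \<in> Lip_star \<alpha> E (bgraph R F)"
  shows "isub.inter E UNIV \<alpha> R F R F b b"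
proof -
  let ?D = "bgraph R F"
  obtain T where T: "adm T" "commutator ?D (gr b) \<odot> gr (bracket_neg \<alpha> ?D) \<subseteq> gr T" and dom: "b ` Domain ?D \<subseteq> Domain ?D"
    using b unfolding Lip_star_def extends_adjointable_def by blast
  have "F (b (fc sqrt R u)) = fc sqrt R (b (F u) + T (fc (\<psi> \<alpha>) R u))" for u
  proof -
    let ?g = "fc sqrt R u"
    have g: "(?g, F u) \<in> ?D" by (auto simp: bgraph_def)
    then obtain v where v: "(b ?g, v) \<in> ?D" using dom by (metis DomainE DomainI imageI subsetD)
    have L: "bracket_neg \<alpha> ?D (fc (\<psi> \<alpha>) R u) = ?g"
      unfolding bracket_neg_bgraph[OF tp \<alpha>(1)]
      by (rule fc_mult_eq[OF tp_R[OF tp] bneg_cont[OF \<alpha>(1)] psi_cont[OF \<alpha>(2)] bneg_psi[OF \<alpha>(1)]])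
    have "(?g, v - b (F u)) \<in> commutator ?D (gr b)"
      unfolding commutator_def by (rule op_diffI) (use g v in \<open>auto simp: gr_def relcomp_unfold\<close>)
    then have "(fc (\<psi> \<alpha>) R u, v - b (F u)) \<in> commutator ?D (gr b) \<odot> gr (bracket_neg \<alpha> ?D)"
      using L by (auto simp: gr_iff relcomp_unfold)
    then have "v - b (F u) = T (fc (\<psi> \<alpha>) R u)" using T(2) by (auto simp: gr_iff)
    then have "v = b (F u) + T (fc (\<psi> \<alpha>) R u)" by (simp add: algebra_simps)
    then show ?thesis using v by (simp add: bgraph_iff[OF tp])
  qed
  then show ?thesis unfolding isub.inter_def[OF hmod_frame] using T(1) by blast
qed

lemma cycle_transform:
  assumes sr: "selfadjoint_regular E D"
  obtains R F where "tp R F" "D = bgraph R F" "resolvent_sq D = R" "bounded_transform D = F"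
    "closure (range (fc sqrt R)) = UNIV"
proof -
  obtain R F where tp: "tp R F" and D: "D = bgraph R F"
    using selfadjoint_btrans[OF sr] by blast
  have reg: "regular E D" using sr by (simp add: selfadjoint_regular_def)
  have "Domain D = range (fc sqrt R)" by (auto simp: D bgraph_def)
  then have "closure (range (fc sqrt R)) = UNIV" using regularD(7)[OF reg] by simp
  moreover have "bounded_transform D = F"
    using bounded_transform_bgraph[OF tp] regularD(1)[OF reg] by (simp add: D)
  moreover have "resolvent_sq D = R" by (simp add: D resolvent_sq_bgraph[OF tp])
  ultimately show thesis by (intro that[OF tp D])
qed

text \<open>
  The commutator of the bounded transform with a Lipschitz element \<open>b\<close> decays at the scales \<open>2\<^sup>j\<close>, so
  that \<open>[F, b] \<pi>(e)\<close> is compact, and by approximation so is \<open>[F, \<pi>(a)] \<pi>(e)\<close>.  The other half of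
  \<open>[F, \<pi>(a e)] = [F, \<pi>(a)] \<pi>(e) + \<pi>(a) [F, \<pi>(e)]\<close> follows by taking adjoints, and an approximate unit
  gives \<open>[F, \<pi>(a)]\<close> itself.
\<close>

lemma commutator_compact:
  assumes \<alpha>: "0 \<le> \<alpha>" "\<alpha> < 1" and rep: "representation E \<pi>" and tp: "tp R F"
    and dense: "closure (range (fc sqrt R)) = UNIV"
    and Rc: "\<And>a. R \<circ> \<pi> a \<in> compact_ops E"
    and Lip: "range \<pi> \<subseteq> op_closure (Lip_star \<alpha> E (bgraph R F))"
  shows "(\<lambda>x. F (\<pi> a x) - \<pi> a (F x)) \<in> compact_ops E"
proof -
  interpret U: isub E UNIV by (rule hmod_frame)
  note ra = rep_adm[OF rep] and nF = tp_F_norm[OF tp]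
  have aF: "adm F" by (rule sa_adm[OF tp_F[OF tp]])
  note lF = adm_clinear[OF aF]
  have Lb: "(\<lambda>x. F (b (\<pi> e x)) - b (F (\<pi> e x))) \<in> compact_ops E"
    if b: "b \<in> Lip_star \<alpha> E (bgraph R F)" for b e
  proof -
    have ab: "adm b" using b by (simp add: Lip_star_def)
    have aT: "adm (\<lambda>u. F (b u) - b (F u))" by (intro adm_diff(1) adm_comp[OF aF ab] adm_comp[OF ab aF])
    have Rce: "(\<lambda>u. R (\<pi> e u)) \<in> compact_ops E" using Rc[of e] by (simp add: o_def)
    from U.nul_compact[OF tp dense aT U.nul_commutator[OF \<alpha> tp Lip_inter[OF \<alpha> tp b] ab] ra _ Rce]
    show ?thesis by simp
  qed
  have 2: "(\<lambda>x. F (\<pi> a (\<pi> e x)) - \<pi> a (F (\<pi> e x))) \<in> compact_ops E" for a e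
  proof (rule compact_closed)
    show "bounded_linear (\<lambda>x. F (\<pi> a (\<pi> e x)) - \<pi> a (F (\<pi> e x)))"
      by (intro adm_bounded adm_diff(1) adm_comp[OF aF adm_comp[OF ra ra]] adm_comp[OF ra adm_comp[OF aF ra]])
    fix \<epsilon> :: real assume \<epsilon>: "0 < \<epsilon>"
    define d where "d = \<epsilon> / 2 / (norm e + 1)"
    have d: "0 < d" using \<epsilon> by (simp add: d_def add_nonneg_pos)
    have "\<pi> a \<in> op_closure (Lip_star \<alpha> E (bgraph R F))" using Lip by auto
    then obtain b where b: "b \<in> Lip_star \<alpha> E (bgraph R F)" "\<And>x. norm (\<pi> a x - b x) \<le> d * norm x"
      using op_closureD(2)[OF _ _ d, of "\<pi> a" "Lip_star \<alpha> E (bgraph R F)"]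
      by (auto simp: Lip_star_def adm_bounded)
    have "norm (F (\<pi> a (\<pi> e x)) - \<pi> a (F (\<pi> e x)) - (F (b (\<pi> e x)) - b (F (\<pi> e x)))) \<le> \<epsilon> * norm x" for x
    proof -
      let ?y = "\<pi> e x"
      have eq: "F (\<pi> a ?y) - \<pi> a (F ?y) - (F (b ?y) - b (F ?y)) = F (\<pi> a ?y - b ?y) - (\<pi> a (F ?y) - b (F ?y))"
        by (simp add: clinear_diff[OF lF])
      have "norm (F (\<pi> a ?y - b ?y)) \<le> d * norm ?y" by (rule order_trans[OF nF b(2)])
      moreover have "norm (\<pi> a (F ?y) - b (F ?y)) \<le> d * norm ?y"
        using order_trans[OF b(2) mult_left_mono[OF nF]] d by simp
      ultimately have "norm (F (\<pi> a ?y - b ?y) - (\<pi> a (F ?y) - b (F ?y))) \<le> d * norm ?y + d * norm ?y"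
        using norm_triangle_ineq4 by (meson add_mono order_trans)
      also have "\<dots> = 2 * d * norm ?y" by simp
      also have "\<dots> \<le> 2 * d * ((norm e + 1) * norm x)"
        using rep_norm_le[OF rep, of e x] d
        by (intro mult_left_mono) (auto simp: distrib_right intro: order_trans)
      also have "\<dots> = \<epsilon> * norm x"
      proof -
        have n: "norm e + 1 \<noteq> 0" using norm_ge_zero[of e] by linarith
        have "d * (norm e + 1) = \<epsilon> / 2" unfolding d_def
          by (metis n nonzero_mult_div_cancel_right times_divide_eq_left)
        then have "2 * d * (norm e + 1) = \<epsilon>" by linarith
        then show ?thesis by (metis mult.assoc)
      qed
      finally show ?thesis unfolding eq .
    qed
    then show "\<exists>K\<in>compact_ops E. \<forall>x. norm (F (\<pi> a (\<pi> e x)) - \<pi> a (F (\<pi> e x)) - K x) \<le> \<epsilon> * norm x"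
      by (intro bexI[OF _ Lb[OF b(1), of e]]) simp
  qed
  have 3: "(\<lambda>x. \<pi> a (F (\<pi> e x)) - \<pi> a (\<pi> e (F x))) \<in> compact_ops E" for a e
  proof -
    let ?T = "\<lambda>x. F (\<pi> (star e) (\<pi> (star a) x)) - \<pi> (star e) (F (\<pi> (star a) x))"
    have a1: "adm (\<lambda>x. F (\<pi> (star e) (\<pi> (star a) x)))" "adm (\<lambda>x. \<pi> (star e) (F (\<pi> (star a) x)))"
      by (intro adm_comp[OF aF adm_comp[OF ra ra]] adm_comp[OF ra adm_comp[OF aF ra]])+
    have "ad ?T = (\<lambda>x. \<pi> a (\<pi> e (F x)) - \<pi> a (F (\<pi> e x)))"
      using adm_diff(2)[OF a1]
      by (simp add: ad_comp[OF aF adm_comp[OF ra ra]] ad_comp[OF ra adm_comp[OF aF ra]] ad_comp[OF ra ra]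
          ad_comp[OF aF ra] rep_ad[OF rep] sa_ad[OF tp_F[OF tp]] star_star)
    then have "(\<lambda>x. \<pi> a (\<pi> e (F x)) - \<pi> a (F (\<pi> e x))) \<in> compact_ops E"
      using compact_ad[OF adm_diff(1)[OF a1] 2] by simp
    from compact_scaleC[OF this, of "-1"] show ?thesis by simp
  qed
  show ?thesis
  proof (rule compact_closed)
    show "bounded_linear (\<lambda>x. F (\<pi> a x) - \<pi> a (F x))"
      by (intro adm_bounded adm_diff(1) adm_comp[OF aF ra] adm_comp[OF ra aF])
    fix \<epsilon> :: real assume "0 < \<epsilon>"
    then obtain c where c: "norm (a - a * c) < \<epsilon> / 2"
      using hmod.approximate_unit2[OF hmod_self_module, of "\<epsilon> / 2" a a] by auto
    have "(\<lambda>x. F (\<pi> (a * c) x) - \<pi> (a * c) (F x)) \<in> compact_ops E"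
      using compact_add[OF 2[of a c] 3[of a c]] by (simp add: rep_mult[OF rep])
    moreover have "norm (F (\<pi> a x) - \<pi> a (F x) - (F (\<pi> (a * c) x) - \<pi> (a * c) (F x))) \<le> \<epsilon> * norm x" for x
    proof -
      have eq: "F (\<pi> a x) - \<pi> a (F x) - (F (\<pi> (a * c) x) - \<pi> (a * c) (F x))
          = F (\<pi> (a - a * c) x) - \<pi> (a - a * c) (F x)"
        by (simp add: clinear_diff[OF rep_clinear[OF rep]] clinear_diff[OF lF])
      have "norm (F (\<pi> (a - a * c) x)) \<le> norm (a - a * c) * norm x"
        by (rule order_trans[OF nF rep_norm_le[OF rep]])
      moreover have "norm (\<pi> (a - a * c) (F x)) \<le> norm (a - a * c) * norm x"
        by (rule order_trans[OF rep_norm_le[OF rep] mult_left_mono[OF nF]]) simp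
      ultimately have "norm (F (\<pi> (a - a * c) x) - \<pi> (a - a * c) (F x)) \<le> norm (a - a * c) * norm x + norm (a - a * c) * norm x"
        using norm_triangle_ineq4 by (meson add_mono order_trans)
      also have "\<dots> \<le> \<epsilon> / 2 * norm x + \<epsilon> / 2 * norm x"
        using c by (intro add_mono mult_right_mono) auto
      finally show ?thesis unfolding eq by (simp add: algebra_simps)
    qed
    ultimately show "\<exists>K\<in>compact_ops E. \<forall>x. norm (F (\<pi> a x) - \<pi> a (F x) - K x) \<le> \<epsilon> * norm x"
      by (intro bexI[of _ "\<lambda>x. F (\<pi> (a * c) x) - \<pi> (a * c) (F x)"]) simp_all
  qed
qed

lemma resolvent_eqI:
  assumes tp: "tp R F" and "(u, v) \<in> bgraph R F" "(v, w - u) \<in> bgraph R F"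
  shows "R w = u"
proof -
  note R = tp_R[OF tp]
  have "R (w - u) = fc sqrt R (F v)"
    using assms(3) by (simp add: bgraph_iff[OF tp] fc_sqrt_sqrt[OF R, symmetric])
  also have "\<dots> = F (F u)" using assms(2) by (simp add: bgraph_iff[OF tp] tp_comm[OF tp cont01_sqrt, symmetric])
  finally show ?thesis by (simp add: tp_FF[OF tp] linear_diff[OF pcontr_linear[OF R]])
qed

text \<open>An odd operator has an even resolvent, hence an odd bounded transform.\<close>

lemma odd_transform:
  assumes tp: "tp R F" and sv: "single_valued (bgraph R F)"
    and \<gamma>: "grading_operator E \<gamma>" and odd: "odd_operator \<gamma> (bgraph R F)"
  shows "odd_operator \<gamma> (gr F)"
proof -
  have s\<gamma>: "sa \<gamma>" using \<gamma> by (simp add: grading_operator_def sa_def)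
  note l\<gamma> = sa_linear[OF s\<gamma>] and R = tp_R[OF tp]
  have o: "(\<gamma> u, - \<gamma> v) \<in> bgraph R F" if "(u, v) \<in> bgraph R F" for u v
    using odd that by (auto simp: odd_operator_def)
  have \<gamma>R: "\<gamma> (R w) = R (\<gamma> w)" for w
  proof -
    have "(R w, F (fc sqrt R w)) \<in> bgraph R F" "(F (fc sqrt R w), F (F w)) \<in> bgraph R F"
      by (simp_all add: bgraph_iff[OF tp] tp_comm[OF tp cont01_sqrt] fc_sqrt_sqrt[OF R] tp_FR[OF tp])
    from o[OF this(1)] o[OF this(2)]
    have 1: "(\<gamma> (R w), - \<gamma> (F (fc sqrt R w))) \<in> bgraph R F" and
      2: "(\<gamma> (F (fc sqrt R w)), - \<gamma> (F (F w))) \<in> bgraph R F" .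
    have "(- \<gamma> (F (fc sqrt R w)), \<gamma> w - \<gamma> (R w)) \<in> bgraph R F"
      using 2 unfolding bgraph_iff[OF tp] tp_FF[OF tp]
      by (simp add: linear_neg[OF tp_linear[OF tp]] linear_diff[OF l\<gamma>] linear_neg[OF l\<gamma>]
          linear_diff[OF sa_linear[OF sa_fc[OF R cont01_sqrt]]] linear_neg[OF sa_linear[OF sa_fc[OF R cont01_sqrt]]])
        (metis minus_diff_eq)
    from resolvent_eqI[OF tp 1 this] show ?thesis by simp
  qed
  have G: "\<gamma> (fc sqrt R u) = fc sqrt R (\<gamma> u)" for u
    by (rule fc_commute[OF R cont01_sqrt sa_bounded[OF s\<gamma>] \<gamma>R])
  have "F (\<gamma> u) = - \<gamma> (F u)" for u
  proof -
    have "(fc sqrt R u, F u) \<in> bgraph R F" "(fc sqrt R (\<gamma> u), F (\<gamma> u)) \<in> bgraph R F"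
      by (auto simp: bgraph_def)
    from o[OF this(1)] this(2) show ?thesis using sv unfolding G by (metis single_valuedD)
  qed
  then show ?thesis by (auto simp: odd_operator_def gr_iff)
qed

theorem order_cycle_kasparov:
  assumes \<alpha>: "0 \<le> \<alpha>" "\<alpha> < 1" and cyc: "order_cycle \<alpha> E g \<pi> D"
  shows "kasparov_module E g \<pi> (bounded_transform D)"
proof -
  have rep: "representation E \<pi>" and sr: "selfadjoint_regular E D"
    and Rc: "\<And>a. resolvent_sq D \<circ> \<pi> a \<in> compact_ops E"
    and Lip: "range \<pi> \<subseteq> op_closure (Lip_star \<alpha> E D)" and par: "parity_compatible E g \<pi> D"
    using cyc by (auto simp: order_cycle_def)
  obtain R F where tp: "tp R F" and D: "D = bgraph R F" and RD: "resolvent_sq D = R"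
    and FD: "bounded_transform D = F" and dense: "closure (range (fc sqrt R)) = UNIV"
    by (rule cycle_transform[OF sr])
  have sF: "sa F" by (rule tp_F[OF tp])
  have sv: "single_valued (bgraph R F)" using sr regularD(1) by (auto simp: selfadjoint_regular_def D)
  have "parity_compatible E g \<pi> (gr F)"
    using par odd_transform[OF tp sv] by (auto simp: parity_compatible_def D split: option.splits)
  moreover have "(\<lambda>x. \<pi> a x - F (F (\<pi> a x))) \<in> compact_ops E" for a
    using Rc[of a] by (simp add: RD tp_FF[OF tp] o_def)
  moreover have "(\<lambda>x. F (\<pi> a x) - \<pi> a (F x)) \<in> compact_ops E" for a
    by (rule commutator_compact[OF \<alpha> rep tp dense]) (use Rc[unfolded RD] Lip[unfolded D] in simp_all)
  ultimately show ?thesis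
    unfolding kasparov_module_def FD using hilbert rep sa_adm[OF sF]
    by (simp add: sa_ad[OF sF] compact_zero)
qed

end

section \<open>Unitary equivalence\<close>

lemma isometric_extension:
  assumes "hmod G" "hmod H" and iso: "\<And>u v u' v'. (u, v) \<in> S \<Longrightarrow> (u', v') \<in> S \<Longrightarrow> ip G u u' = ip H v v'"
    and tot: "total_set (fst ` S)"
  shows "\<exists>V. bounded_linear V \<and> (\<forall>(u, v)\<in>S. V u = v) \<and> (\<forall>u. norm (V u) \<le> norm u)"
proof -
  interpret G: hmod G by fact
  interpret H: hmod H by fact
  have both: "ip G u u = ip H v v" if "(u, v) \<in> span S" for u v
    using bilinear_eq[OF G.bilinear_ip[OF linear_fst linear_fst] H.bilinear_ip[OF linear_snd linear_snd]
        order_refl order_refl that that] iso by fastforce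
  have "\<exists>V. bounded_linear V \<and> (\<forall>(u, v)\<in>S. V u = v) \<and> (\<forall>u. norm (V u) \<le> 1 * norm u)"
  proof (rule dense_extension)
    show "norm v \<le> 1 * norm u" if "(u, v) \<in> span S" for u v
      using both[OF that] G.norm_ip_self[of u] H.norm_ip_self[of v]
      by simp
    show "closure (span (fst ` S)) = UNIV" using tot by (simp add: total_set_def)
  qed
  then show ?thesis by simp
qed

locale unitary = G: hmod G + H: hmod H
  for G :: "('g::complex_banach, 'b::cstar_algebra) hmodule" and H :: "('h::complex_banach, 'b) hmodule" +
  fixes V :: "'g \<Rightarrow> 'h"
  assumes V_adj: "adjointable G H V" and VstarV: "adj G H V \<circ> V = id" and VVstar: "V \<circ> adj G H V = id"
begin

abbreviation V' :: "'h \<Rightarrow> 'g" where "V' \<equiv> adj G H V"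

lemma V'V [simp]: "V' (V u) = u" and VV' [simp]: "V (V' v) = v"
  using VstarV VVstar by (metis comp_apply id_apply)+

lemma ip_V: "ip H (V u) v = ip G u (V' v)" and ip_V': "ip G (V' v) u = ip H v (V u)"
  using G.ip_adj[OF V_adj] ip_adj_left[OF G.hmod_axioms H.hmod_axioms V_adj] by auto

lemma clinear_V: "clinear V" and clinear_V': "clinear V'"
  by (rule clinear_adjointable[OF G.hmod_axioms H.hmod_axioms V_adj]
      clinear_adjointable[OF H.hmod_axioms G.hmod_axioms adjointable_adj[OF G.hmod_axioms H.hmod_axioms V_adj]])+

lemma norm_V: "norm (V u) = norm u" and norm_V': "norm (V' v) = norm v"
proof -
  have "(norm (V u))\<^sup>2 = (norm u)\<^sup>2" for u
    by (simp add: G.norm_ip_self[symmetric] H.norm_ip_self[symmetric] ip_V)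
  then show *: "norm (V u) = norm u" for u by simp
  from *[of "V' v"] show "norm (V' v) = norm v" by simp
qed

lemma bounded_linear_V: "bounded_linear V" and bounded_linear_V': "bounded_linear V'"
  by (rule bounded_linear_intro[where K=1];
      simp add: clinear_add[OF clinear_V] clinear_scaleR[OF clinear_V] clinear_add[OF clinear_V']
        clinear_scaleR[OF clinear_V'] norm_V norm_V')+

definition cj :: "('g \<Rightarrow> 'g) \<Rightarrow> 'h \<Rightarrow> 'h" where "cj T v = V (T (V' v))"

lemma sa_cj: "G.sa T \<Longrightarrow> H.sa (cj T)"
  unfolding H.sa_def cj_def ip_V by (simp add: G.sa_ip ip_V'[symmetric])

lemma pcontr_cj:
  assumes R: "G.pcontr R"
  shows "H.pcontr (cj R)"
proof -
  have "norm (2 *\<^sub>R cj R v - v) \<le> norm v" for v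
  proof -
    have "2 *\<^sub>R cj R v - v = V (2 *\<^sub>R R (V' v) - V' v)"
      by (simp add: cj_def clinear_diff[OF clinear_V] clinear_scaleR[OF clinear_V])
    also have "norm \<dots> \<le> norm (V' v)" unfolding norm_V using R by (simp add: G.pcontr_def)
    finally show ?thesis by (simp add: norm_V')
  qed
  then show ?thesis using sa_cj[OF G.pcontr_sa[OF R]] by (simp add: H.pcontr_def)
qed

lemma fc_cj:
  assumes R: "G.pcontr R" and f: "cont01 f"
  shows "fc f (cj R) = cj (fc f R)"
proof
  fix v
  have "(cj R ^^ i) v = V ((R ^^ i) (V' v))" for i by (induction i) (simp_all add: cj_def)
  then have p: "poly_op p (cj R) v = V (poly_op p R (V' v))" for p
    by (simp add: poly_op_def clinear_sum[OF clinear_V] clinear_scaleR[OF clinear_V])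
  have "(\<lambda>n. poly_op (approx_poly f n) (cj R) v) \<longlonglongrightarrow> fc f (cj R) v"
    by (rule H.fc_LIMSEQ[OF pcontr_cj[OF R] f])
  moreover have "(\<lambda>n. V (poly_op (approx_poly f n) R (V' v))) \<longlonglongrightarrow> V (fc f R (V' v))"
    by (rule bounded_linear.tendsto[OF bounded_linear_V G.fc_LIMSEQ[OF R f]])
  ultimately have "fc f (cj R) v = V (fc f R (V' v))" unfolding p by (rule LIMSEQ_unique)
  then show "fc f (cj R) v = cj (fc f R) v" by (simp add: cj_def)
qed

lemma tp_cj:
  assumes tp: "G.tp R F"
  shows "H.tp (cj R) (cj F)"
  using pcontr_cj[OF G.tp_R[OF tp]] sa_cj[OF G.tp_F[OF tp]]
  by (simp add: H.tp_def cj_def G.tp_FF[OF tp] G.tp_FR[OF tp] clinear_diff[OF clinear_V])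

lemma op_conj_bgraph:
  assumes tp: "G.tp R F"
  shows "op_conj V (G.bgraph R F) = H.bgraph (cj R) (cj F)"
proof (intro equalityI subrelI)
  have *: "(V x, V y) \<in> H.bgraph (cj R) (cj F) \<longleftrightarrow> (x, y) \<in> G.bgraph R F" for x y
    unfolding H.bgraph_iff[OF tp_cj[OF tp]] G.bgraph_iff[OF tp] fc_cj[OF G.tp_R[OF tp] G.cont01_sqrt]
    by (simp add: cj_def) (metis V'V)
  show "(u, v) \<in> H.bgraph (cj R) (cj F)" if "(u, v) \<in> op_conj V (G.bgraph R F)" for u v
    using that * by (auto simp: op_conj_def)
  show "(u, v) \<in> op_conj V (G.bgraph R F)" if "(u, v) \<in> H.bgraph (cj R) (cj F)" for u v
    using that *[of "V' u" "V' v"] unfolding op_conj_def by (intro CollectI exI[of _ "V' u"] exI[of _ "V' v"]) simp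
qed

end

context ltens
begin

lemma dense_lt:
  assumes X: "E.adm X" and dense: "closure (range X) = UNIV"
  shows "closure (range (lt X)) = UNIV"
proof -
  have sub: "subspace (closure (range (lt X)))"
    by (intro subspace_closure linear_subspace_image subspace_UNIV clinear_linear G.adm_clinear lt(1)[OF X])
  have "t \<xi> x \<in> closure (range (lt X))" for \<xi> x
  proof -
    have "closure (range X) \<subseteq> {\<xi>. t \<xi> x \<in> closure (range (lt X))}"
    proof (rule closure_minimal)
      have "t (X \<eta>) x \<in> range (lt X)" for \<eta> using lt(2)[OF X, of \<eta> x] by (metis rangeI)
      then show "range X \<subseteq> {\<xi>. t \<xi> x \<in> closure (range (lt X))}" using closure_subset by blast
      show "closed {\<xi>. t \<xi> x \<in> closure (range (lt X))}"
        by (rule bounded_linear_vimage(2)[OF t_bounded_linear sub]) simp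
    qed
    then show ?thesis using dense by auto
  qed
  then have "u \<in> closure (range (lt X))" for u
    by (intro closed_subspace_total[OF sub _ _ t_total]) auto
  then show ?thesis by blast
qed

end

section \<open>The conformal conditions in the bounded picture\<close>

context isub
begin

text \<open>As \<open>M\<close> is invariant, the restriction of an operator to \<open>M\<close> determines that of its adjoint.\<close>

lemma ad_eq_M:
  assumes A: "adm A" and B: "adm B" and eq: "\<And>u. u \<in> M \<Longrightarrow> A u = B u" and u: "u \<in> M"
  shows "ad A u = ad B u"
proof -
  let ?z = "ad A u - ad B u"
  have z: "?z \<in> M"
    by (intro subspace_diff[OF M_subspace] M_inv[OF adm_ad(1)] A B u)
  have "ip E ?z ?z = ip E u (A ?z - B ?z)"
    by (simp only: ip_diff_left[of "ad A u" "ad B u"] ip_ad_left[OF A] ip_ad_left[OF B] ip_diff_right[of u])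
  also have "\<dots> = 0" by (simp only: eq[OF z]) simp
  finally have "?z = 0" by (rule ip_self_eq_zero)
  then show ?thesis by simp
qed

lemma inter_add:
  assumes "linear F2" "linear (fc sqrt R2)" "inter \<alpha> R1 F1 R2 F2 X Y" "inter \<alpha> R1 F1 R2 F2 X' Y'"
  shows "inter \<alpha> R1 F1 R2 F2 (\<lambda>u. X u + X' u) (\<lambda>u. Y u + Y' u)"
proof -
  obtain K where K: "adm K" "\<And>u. u \<in> M \<Longrightarrow> F2 (X (fc sqrt R1 u)) = fc sqrt R2 (Y (F1 u) + K (fc (\<psi> \<alpha>) R1 u))"
    using assms(3) unfolding inter_def by blast
  obtain K' where K': "adm K'" "\<And>u. u \<in> M \<Longrightarrow> F2 (X' (fc sqrt R1 u)) = fc sqrt R2 (Y' (F1 u) + K' (fc (\<psi> \<alpha>) R1 u))"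
    using assms(4) unfolding inter_def by blast
  show ?thesis unfolding inter_def
    by (rule exI[of _ "\<lambda>u. K u + K' u"])
      (simp add: adm_add K K' linear_add[OF assms(1)] linear_add[OF assms(2)])
qed

lemma inter_scaleC:
  assumes "clinear F2" "clinear (fc sqrt R2)" "inter \<alpha> R1 F1 R2 F2 X Y"
  shows "inter \<alpha> R1 F1 R2 F2 (\<lambda>u. c *\<^sub>C X u) (\<lambda>u. c *\<^sub>C Y u)"
proof -
  obtain K where K: "adm K" "\<And>u. u \<in> M \<Longrightarrow> F2 (X (fc sqrt R1 u)) = fc sqrt R2 (Y (F1 u) + K (fc (\<psi> \<alpha>) R1 u))"
    using assms(3) unfolding inter_def by blast
  show ?thesis unfolding inter_def
    by (rule exI[of _ "\<lambda>u. c *\<^sub>C K u"])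
      (simp add: adm_scaleC K clinear_scaleC[OF assms(1)] clinear_scaleC[OF assms(2)] scaleC_add_right[symmetric])
qed

end

text \<open>
  A localised picture of the conformal factor: bounded operators \<open>m\<close> and \<open>i\<close> that agree, together
  with their adjoints, with \<open>\<mu>\<close> and \<open>\<mu>\<^sup>-\<^sup>1\<close> on \<open>Msub k\<close>.  They exist by \<open>matched_local\<close>.
\<close>

locale conformal = xtens E ES tBS tES
  for E :: "('e::complex_banach, 'b::cstar_algebra) hmodule"
    and ES :: "('es::complex_banach, 'bs::cstar_algebra) hmodule"
    and tBS :: "'b \<Rightarrow> 's::cstar_algebra \<Rightarrow> 'bs" and tES :: "'e \<Rightarrow> 's \<Rightarrow> 'es" +
  fixes \<alpha> :: real and R1 F1 R2 F2 :: "'es \<Rightarrow> 'es" and \<mu> :: "'es op_graph" and k k' :: 's and m i :: "'es \<Rightarrow> 'es"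
  assumes \<alpha>: "0 \<le> \<alpha>" "\<alpha> < 1" and tp1: "ES.tp R1 F1" and tp2: "ES.tp R2 F2"
    and \<mu>: "matched ES tES \<mu>" "matched ES tES (\<mu>\<inverse>)"
    and k: "k * k' = k" "k' * k = k" "k' \<in> pedersen_ideal"
    and m: "ES.adm m" "\<And>\<zeta>. \<zeta> \<in> Msub k \<Longrightarrow> (\<zeta>, m \<zeta>) \<in> \<mu>" "\<And>\<zeta>. \<zeta> \<in> Msub k \<Longrightarrow> (\<zeta>, ES.ad m \<zeta>) \<in> op_adjoint ES \<mu>"
    and i: "ES.adm i" "\<And>\<zeta>. \<zeta> \<in> Msub k \<Longrightarrow> (\<zeta>, i \<zeta>) \<in> \<mu>\<inverse>" "\<And>\<zeta>. \<zeta> \<in> Msub k \<Longrightarrow> (\<zeta>, ES.ad i \<zeta>) \<in> op_adjoint ES (\<mu>\<inverse>)"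
begin

sublocale M: isub ES "Msub k" by (rule isub_Msub)

lemma k_pedersen: "k * u \<in> pedersen_ideal"
  by (rule pedersen_mult(1)[OF pedersen_local_unit[OF k(2)]])

lemma mi: "\<zeta> \<in> Msub k \<Longrightarrow> m (i \<zeta>) = \<zeta>" and im: "\<zeta> \<in> Msub k \<Longrightarrow> i (m \<zeta>) = \<zeta>"
proof -
  have sv: "single_valued \<mu>" "single_valued (\<mu>\<inverse>)" using \<mu> regularD(1) by (auto simp: matched_def)
  assume \<zeta>: "\<zeta> \<in> Msub k"
  have "(i \<zeta>, \<zeta>) \<in> \<mu>" "(i \<zeta>, m (i \<zeta>)) \<in> \<mu>" using i(2)[OF \<zeta>] m(2)[OF Msub_adm[OF i(1) \<zeta>]] by auto
  then show "m (i \<zeta>) = \<zeta>" using sv(1) by (metis single_valuedD)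
  have "(m \<zeta>, \<zeta>) \<in> \<mu>\<inverse>" "(m \<zeta>, i (m \<zeta>)) \<in> \<mu>\<inverse>" using m(2)[OF \<zeta>] i(2)[OF Msub_adm[OF m(1) \<zeta>]] by auto
  then show "i (m \<zeta>) = \<zeta>" using sv(2) by (metis single_valuedD)
qed

abbreviation n :: "'es \<Rightarrow> 'es" where "n \<equiv> ES.ad i"

lemma n: "ES.adm n" "ES.ad n = i"
  using ES.adm_ad[OF i(1)] .

lemma nm: "\<zeta> \<in> Msub k \<Longrightarrow> n (ES.ad m \<zeta>) = \<zeta>" and mn: "\<zeta> \<in> Msub k \<Longrightarrow> ES.ad m (n \<zeta>) = \<zeta>"
  using M.ad_eq_M[OF ES.adm_comp[OF m(1) i(1)] ES.adm_id mi] M.ad_eq_M[OF ES.adm_comp[OF i(1) m(1)] ES.adm_id im]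
  by (simp_all add: ES.ad_comp[OF m(1) i(1)] ES.ad_comp[OF i(1) m(1)] ES.ad_id)

lemma Msub_eqI:
  assumes "bounded_linear A" "bounded_linear B" "\<And>\<eta> u. A (\<rho> (k * u) \<eta>) = B (\<rho> (k * u) \<eta>)" "\<zeta> \<in> Msub k"
  shows "A \<zeta> = B \<zeta>"
proof -
  have "\<zeta> \<in> {\<zeta>. A \<zeta> - B \<zeta> \<in> {0}}"
  proof (rule Msub_induct[OF assms(4) bounded_linear_vimage[OF bounded_linear_sub[OF assms(1,2)]]])
    fix \<xi> t u
    have "tES \<xi> (t * k * u) = \<rho> (k * u) (tES \<xi> t)" by (simp add: rho mult.assoc)
    then show "tES \<xi> (t * k * u) \<in> {\<zeta>. A \<zeta> - B \<zeta> \<in> {0}}" using assms(3) by simp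
  qed auto
  then show ?thesis by simp
qed

abbreviation "G1 \<equiv> fc sqrt R1"
abbreviation "\<Psi> \<equiv> fc (\<psi> \<alpha>) R1"
abbreviation "\<Lambda> \<equiv> fc (bneg \<alpha>) R1"

lemma adms: "ES.adm F1" "ES.adm F2" "ES.adm G1" "ES.adm \<Psi>" "ES.adm (fc sqrt R2)"
  by (rule ES.sa_adm[OF ES.tp_F[OF tp1]] ES.sa_adm[OF ES.tp_F[OF tp2]] ES.adm_fc[OF ES.tp_R[OF tp1] ES.cont01_sqrt]
      ES.adm_fc[OF ES.tp_R[OF tp1] psi_cont[OF \<alpha>(2)]] ES.adm_fc[OF ES.tp_R[OF tp2] ES.cont01_sqrt])+

lemma Lpsi: "\<Lambda> (\<Psi> \<zeta>) = G1 \<zeta>" "\<Psi> (\<Lambda> \<zeta>) = G1 \<zeta>"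
  by (rule ES.fc_mult_eq[OF ES.tp_R[OF tp1] bneg_cont[OF \<alpha>(1)] psi_cont[OF \<alpha>(2)] bneg_psi[OF \<alpha>(1)]], simp)
    (rule ES.fc_mult_eq[OF ES.tp_R[OF tp1] psi_cont[OF \<alpha>(2)] bneg_cont[OF \<alpha>(1)] psi_bneg[OF \<alpha>(1)]], simp)

text \<open>
  For \<open>\<zeta>\<close> in \<open>Msub k\<close> the conformal condition is evaluated at \<open>\<langle>D\<^sub>1\<rangle>\<^sup>\<alpha>\<^sup>-\<^sup>1 \<zeta>\<close>, which \<open>\<Lambda>\<close> maps to
  \<open>R\<^sub>1\<^sup>1\<^sup>/\<^sup>2 \<zeta>\<close> and \<open>\<mu>\<^sup>-\<^sup>1\<^sup>*\<close> to \<open>n (R\<^sub>1\<^sup>1\<^sup>/\<^sup>2 \<zeta>)\<close>.  There \<open>\<mu>\<^sup>*\<close> is inverse to \<open>n\<close>, so that the subtracted term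
  becomes \<open>x m (F\<^sub>1 \<zeta>)\<close>.  The domain condition provides this for \<open>\<zeta>\<close> of the form \<open>\<eta> (1 \<otimes> k u)\<close>; as
  an identity between bounded operators it extends to \<open>Msub k\<close>.
\<close>

lemma inter_conformal:
  assumes x: "ES.adm x" and T: "matched ES tES T"
    and sub: "(ES.bgraph R2 F2 \<odot> gr x \<ominus> gr x \<odot> \<mu> \<odot> ES.bgraph R1 F1 \<odot> op_adjoint ES \<mu>)
        \<odot> op_adjoint ES (\<mu>\<inverse>) \<odot> gr \<Lambda> \<subseteq> T"
    and dom: "\<And>\<eta> u. x (n (\<rho> (k * u) (G1 \<eta>))) \<in> Domain (ES.bgraph R2 F2)"
  shows "M.inter \<alpha> R1 F1 R2 F2 (\<lambda>u. x (n u)) (\<lambda>u. x (m u))"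
proof -
  obtain K where K: "ES.adm K" "\<And>\<zeta>. \<zeta> \<in> Msub k \<Longrightarrow> (\<zeta>, K \<zeta>) \<in> T"
    by (rule matched_local[OF T k(1,3)]) blast
  have sv: "single_valued T" using T regularD(1) by (auto simp: matched_def)
  have "F2 (x (n (G1 \<zeta>))) = fc sqrt R2 (x (m (F1 \<zeta>)) + K (\<Psi> \<zeta>))" if "\<zeta> \<in> Msub k" for \<zeta>
  proof (rule Msub_eqI[where A="\<lambda>\<zeta>. F2 (x (n (G1 \<zeta>)))" and B="\<lambda>\<zeta>. fc sqrt R2 (x (m (F1 \<zeta>)) + K (\<Psi> \<zeta>))", OF _ _ _ that])
    show "bounded_linear (\<lambda>\<zeta>. F2 (x (n (G1 \<zeta>))))"
      by (rule ES.adm_bounded[OF ES.adm_comp[OF adms(2) ES.adm_comp[OF x ES.adm_comp[OF n(1) adms(3)]]]])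
    show "bounded_linear (\<lambda>\<zeta>. fc sqrt R2 (x (m (F1 \<zeta>)) + K (\<Psi> \<zeta>)))"
      by (rule ES.adm_bounded[OF ES.adm_comp[OF adms(5) ES.adm_add(1)[OF ES.adm_comp[OF x ES.adm_comp[OF m(1) adms(1)]]
            ES.adm_comp[OF K(1) adms(4)]]]])
    fix \<eta> u
    let ?\<zeta> = "\<rho> (k * u) \<eta>"
    have \<zeta>M: "?\<zeta> \<in> Msub k" by (rule rho_Msub)
    note GM = Msub_adm[OF adms(3) \<zeta>M] and FM = Msub_adm[OF adms(1) \<zeta>M] and PM = Msub_adm[OF adms(4) \<zeta>M]
    let ?p = "n (G1 ?\<zeta>)"
    have pM: "?p \<in> Msub k" by (rule Msub_adm[OF n(1) GM])
    have "x ?p \<in> Domain (ES.bgraph R2 F2)" using dom[of u \<eta>] by (simp add: rho_adm[OF adms(3)])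
    then obtain v where v: "(x ?p, v) \<in> ES.bgraph R2 F2" by auto
    have 1: "(?p, v) \<in> ES.bgraph R2 F2 \<odot> gr x" using v by (auto simp: gr_iff relcomp_unfold)
    have "(?p, G1 ?\<zeta>) \<in> op_adjoint ES \<mu>" using m(3)[OF pM] by (simp add: mn[OF GM])
    moreover have "(G1 ?\<zeta>, F1 ?\<zeta>) \<in> ES.bgraph R1 F1" by (auto simp: ES.bgraph_def)
    moreover have "(F1 ?\<zeta>, m (F1 ?\<zeta>)) \<in> \<mu>" by (rule m(2)[OF FM])
    ultimately have 2: "(?p, x (m (F1 ?\<zeta>))) \<in> gr x \<odot> \<mu> \<odot> ES.bgraph R1 F1 \<odot> op_adjoint ES \<mu>"
      by (intro relcompI) (auto simp: gr_iff)
    have "(\<Psi> ?\<zeta>, G1 ?\<zeta>) \<in> gr \<Lambda>" by (simp add: gr_iff Lpsi)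
    moreover have "(G1 ?\<zeta>, ?p) \<in> op_adjoint ES (\<mu>\<inverse>)" by (rule i(3)[OF GM])
    ultimately have "(\<Psi> ?\<zeta>, v - x (m (F1 ?\<zeta>))) \<in> T"
      using op_diffI[OF 1 2] sub by (meson relcompI subsetD)
    then have "v - x (m (F1 ?\<zeta>)) = K (\<Psi> ?\<zeta>)" using K(2)[OF PM] sv by (metis single_valuedD)
    then have "v = x (m (F1 ?\<zeta>)) + K (\<Psi> ?\<zeta>)" by (simp add: algebra_simps)
    then show "F2 (x ?p) = fc sqrt R2 (x (m (F1 ?\<zeta>)) + K (\<Psi> ?\<zeta>))"
      using v by (simp add: ES.bgraph_iff[OF tp2])
  qed
  then show ?thesis unfolding M.inter_def using K(1) by blast
qed

text \<open>
  The power of \<open>\<langle>D\<^sub>1\<rangle>\<close> stands on the left of the commutator, so the identity between bounded operators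
  that it provides on \<open>Msub k\<close> is the adjoint of one of the form required by \<open>inter\<close>.
\<close>

lemma inter_commutator:
  assumes x: "ES.adm x" and T: "matched ES tES T" and l: "ES.adm l"
    and N: "\<And>\<zeta>. \<zeta> \<in> Msub k \<Longrightarrow> (\<zeta>, l \<zeta>) \<in> N"
    and sub: "gr \<Lambda> \<odot> commutator (ES.bgraph R1 F1) (gr x \<odot> N) \<subseteq> T"
    and dom: "\<And>\<eta> u. x (l (\<rho> (k * u) (G1 \<eta>))) \<in> Domain (ES.bgraph R1 F1)"
  shows "M.inter \<alpha> R1 F1 R1 F1 (ES.ad (\<lambda>u. x (l u))) (ES.ad (\<lambda>u. x (l u)))"
proof -
  obtain K where K: "ES.adm K" "\<And>\<zeta>. \<zeta> \<in> Msub k \<Longrightarrow> (\<zeta>, K \<zeta>) \<in> T"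
    by (rule matched_local[OF T k(1,3)]) blast
  have sv: "single_valued T" using T regularD(1) by (auto simp: matched_def)
  let ?Y = "\<lambda>u. x (l u)"
  have aY: "ES.adm ?Y" by (rule ES.adm_comp[OF x l])
  let ?A = "\<lambda>\<zeta>. F1 (?Y (G1 \<zeta>))" and ?B1 = "\<lambda>\<zeta>. G1 (?Y (F1 \<zeta>))" and ?B2 = "\<lambda>\<zeta>. \<Psi> (K (G1 \<zeta>))"
  have aA: "ES.adm ?A" by (rule ES.adm_comp[OF adms(1) ES.adm_comp[OF aY adms(3)]])
  have aB1: "ES.adm ?B1" by (rule ES.adm_comp[OF adms(3) ES.adm_comp[OF aY adms(1)]])
  have aB2: "ES.adm ?B2" by (rule ES.adm_comp[OF adms(4) ES.adm_comp[OF K(1) adms(3)]])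
  have eq: "?A \<zeta> = ?B1 \<zeta> + ?B2 \<zeta>" if "\<zeta> \<in> Msub k" for \<zeta>
  proof (rule Msub_eqI[where A="?A" and B="\<lambda>\<zeta>. ?B1 \<zeta> + ?B2 \<zeta>", OF _ _ _ that])
    show "bounded_linear ?A" "bounded_linear (\<lambda>\<zeta>. ?B1 \<zeta> + ?B2 \<zeta>)"
      by (rule ES.adm_bounded[OF aA] ES.adm_bounded[OF ES.adm_add(1)[OF aB1 aB2]])+
    fix \<eta> u
    let ?\<zeta> = "\<rho> (k * u) \<eta>"
    have \<zeta>M: "?\<zeta> \<in> Msub k" by (rule rho_Msub)
    note GM = Msub_adm[OF adms(3) \<zeta>M] and FM = Msub_adm[OF adms(1) \<zeta>M]
    have "?Y (G1 ?\<zeta>) \<in> Domain (ES.bgraph R1 F1)" using dom[of u \<eta>] by (simp add: rho_adm[OF adms(3)])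
    then obtain v where v: "(?Y (G1 ?\<zeta>), v) \<in> ES.bgraph R1 F1" by auto
    have 1: "(G1 ?\<zeta>, v) \<in> ES.bgraph R1 F1 \<odot> (gr x \<odot> N)"
      by (rule relcompI[OF relcompI[OF N[OF GM]] v]) (simp add: gr_iff)
    have "(G1 ?\<zeta>, F1 ?\<zeta>) \<in> ES.bgraph R1 F1" by (auto simp: ES.bgraph_def)
    then have 2: "(G1 ?\<zeta>, ?Y (F1 ?\<zeta>)) \<in> (gr x \<odot> N) \<odot> ES.bgraph R1 F1"
      by (rule relcompI[OF _ relcompI[OF N[OF FM]]]) (simp add: gr_iff)
    have "(G1 ?\<zeta>, \<Lambda> (v - ?Y (F1 ?\<zeta>))) \<in> gr \<Lambda> \<odot> commutator (ES.bgraph R1 F1) (gr x \<odot> N)"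
      unfolding commutator_def by (rule relcompI[OF op_diffI[OF 1 2]]) (simp add: gr_iff)
    then have "(G1 ?\<zeta>, \<Lambda> (v - ?Y (F1 ?\<zeta>))) \<in> T" using sub by blast
    then have "\<Lambda> (v - ?Y (F1 ?\<zeta>)) = K (G1 ?\<zeta>)" using K(2)[OF GM] sv by (metis single_valuedD)
    then have "G1 (v - ?Y (F1 ?\<zeta>)) = ?B2 ?\<zeta>" by (simp add: Lpsi(2)[symmetric])
    then show "?A ?\<zeta> = ?B1 ?\<zeta> + ?B2 ?\<zeta>"
      using v by (simp add: ES.bgraph_iff[OF tp1] clinear_diff[OF ES.adm_clinear[OF adms(3)]] algebra_simps)
  qed
  have sa: "ES.ad F1 = F1" "ES.ad G1 = G1" "ES.ad \<Psi> = \<Psi>"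
    by (rule ES.sa_ad[OF ES.tp_F[OF tp1]] ES.sa_ad[OF ES.sa_fc[OF ES.tp_R[OF tp1] ES.cont01_sqrt]]
        ES.sa_ad[OF ES.sa_fc[OF ES.tp_R[OF tp1] psi_cont[OF \<alpha>(2)]]])+
  have adA: "ES.ad ?A = (\<lambda>u. G1 (ES.ad ?Y (F1 u)))"
    by (simp add: ES.ad_comp[OF adms(1) ES.adm_comp[OF aY adms(3)]] ES.ad_comp[OF aY adms(3)] sa)
  have adB: "ES.ad (\<lambda>u. ?B1 u + ?B2 u) = (\<lambda>u. F1 (ES.ad ?Y (G1 u)) + G1 (ES.ad K (\<Psi> u)))"
    by (simp add: ES.adm_add(2)[OF aB1 aB2] ES.ad_comp[OF adms(3) ES.adm_comp[OF aY adms(1)]] ES.ad_comp[OF aY adms(1)]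
        ES.ad_comp[OF adms(4) ES.adm_comp[OF K(1) adms(3)]] ES.ad_comp[OF K(1) adms(3)] sa)
  have "F1 (ES.ad ?Y (G1 u)) = G1 (ES.ad ?Y (F1 u) + - ES.ad K (\<Psi> u))" if u: "u \<in> Msub k" for u
    using M.ad_eq_M[OF aA ES.adm_add(1)[OF aB1 aB2] eq u] unfolding adA adB
    by (simp add: clinear_diff[OF ES.adm_clinear[OF adms(3)]])
  then show ?thesis unfolding M.inter_def
    using ES.adm_minus(1)[OF ES.adm_ad(1)[OF K(1)]] by (intro exI[of _ "\<lambda>u. - ES.ad K u"]) simp
qed

text \<open>
  With \<open>X = x n\<close> and \<open>Y = x m\<close>, the bounded versions of \<open>x \<mu>\<^sup>-\<^sup>1\<^sup>*\<close> and \<open>x \<mu>\<close>, these are the conditions of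
  \<open>nul_intertwiner\<close>.  They are linear in \<open>x\<close>.
\<close>

definition good :: "('es \<Rightarrow> 'es) \<Rightarrow> bool" where
  "good x \<longleftrightarrow> ES.adm x
   \<and> M.inter \<alpha> R1 F1 R2 F2 (\<lambda>u. x (n u)) (\<lambda>u. x (m u))
   \<and> M.inter \<alpha> R1 F1 R1 F1 (ES.ad (\<lambda>u. x (n u))) (ES.ad (\<lambda>u. x (n u)))
   \<and> M.inter \<alpha> R1 F1 R1 F1 (ES.ad (\<lambda>u. x (m u))) (ES.ad (\<lambda>u. x (m u)))"

lemma good_add:
  assumes x: "good x" and y: "good y"
  shows "good (\<lambda>u. x u + y u)"
proof -
  note l = clinear_linear[OF ES.adm_clinear]
  have ax: "ES.adm x" and ay: "ES.adm y" using x y by (simp_all add: good_def)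
  have "ES.ad (\<lambda>u. x (l u) + y (l u)) = (\<lambda>u. ES.ad (\<lambda>u. x (l u)) u + ES.ad (\<lambda>u. y (l u)) u)" if "ES.adm l" for l
    by (rule ES.adm_add(2)[OF ES.adm_comp[OF ax that] ES.adm_comp[OF ay that]])
  note ad = this[OF m(1)] this[OF n(1)]
  show ?thesis
    using x y unfolding good_def ad
    by (auto intro!: M.inter_add l[OF adms(1)] l[OF adms(2)] l[OF adms(3)] l[OF adms(5)] ES.adm_add(1)[OF ax ay])
qed

lemma good_scaleC:
  assumes x: "good x"
  shows "good (\<lambda>u. c *\<^sub>C x u)"
proof -
  note l = ES.adm_clinear
  have ax: "ES.adm x" using x by (simp add: good_def)
  have "ES.ad (\<lambda>u. c *\<^sub>C x (l u)) = (\<lambda>u. cnj c *\<^sub>C ES.ad (\<lambda>u. x (l u)) u)" if "ES.adm l" for l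
    by (rule ES.adm_scaleC(2)[OF ES.adm_comp[OF ax that]])
  note ad = this[OF m(1)] this[OF n(1)]
  show ?thesis
    using x unfolding good_def ad
    by (auto intro!: M.inter_scaleC l[OF adms(1)] l[OF adms(2)] l[OF adms(3)] l[OF adms(5)] ES.adm_scaleC(1)[OF ax])
qed

context
  fixes c
  assumes dense: "closure (range G1) = UNIV"
    and c: "ES.adm c" "\<And>u. c u \<in> Msub k" and Rc: "(\<lambda>u. R1 (c u)) \<in> compact_ops ES"
begin

text \<open>On \<open>Msub k\<close> the product \<open>X Y\<^sup>* = x n m\<^sup>* x\<^sup>*\<close> is \<open>x x\<^sup>*\<close>, because \<open>n\<close> and \<open>m\<^sup>*\<close> are inverse there.\<close>

lemma good_square_compact:
  assumes x: "good x"
  shows "(\<lambda>u. F2 (x (ES.ad x (c u))) - F1 (x (ES.ad x (c u)))) \<in> compact_ops ES"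
proof -
  have ax: "ES.adm x" using x by (simp add: good_def)
  note ax' = ES.adm_ad(1)[OF ax]
  have aq: "ES.adm (\<lambda>u. x (ES.ad x u))" by (rule ES.adm_comp[OF ax ax'])
  have an: "ES.ad (\<lambda>u. x (n u)) = (\<lambda>u. i (ES.ad x u))" and am: "ES.ad (\<lambda>u. x (m u)) = (\<lambda>u. ES.ad m (ES.ad x u))"
    by (simp_all add: ES.ad_comp[OF ax n(1)] ES.ad_comp[OF ax m(1)] n(2))
  have "M.nul (cst (\<lambda>u. F2 (x (ES.ad x u)) - F1 (x (ES.ad x u))) \<star> M.Zs R1 F1)"
  proof (rule M.nul_intertwiner[OF \<alpha> tp1 tp2 ES.adm_comp[OF ax n(1)] ES.adm_comp[OF ax m(1)] ax])
    show "x (n (ES.ad (\<lambda>u. x (m u)) u)) = x (ES.ad x u)" if "u \<in> Msub k" for u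
      unfolding am using nm[OF Msub_adm[OF ax' that]] by simp
    show "x (m (ES.ad (\<lambda>u. x (n u)) u)) = x (ES.ad x u)" if "u \<in> Msub k" for u
      unfolding an using mi[OF Msub_adm[OF ax' that]] by simp
  qed (use x in \<open>simp_all add: good_def\<close>)
  from M.nul_compact[OF tp1 dense ES.adm_diff(1)[OF ES.adm_comp[OF adms(2) aq] ES.adm_comp[OF adms(1) aq]] this c Rc]
  show ?thesis .
qed

text \<open>Polarisation: \<open>x y\<^sup>*\<close> is a quarter of the sum of \<open>d (x + d y) (x + d y)\<^sup>*\<close> over \<open>d\<^sup>4 = 1\<close>.\<close>

lemma good_compact:
  assumes x: "good x" and y: "good y"
  shows "(\<lambda>u. F2 (x (ES.ad y (c u))) - F1 (x (ES.ad y (c u)))) \<in> compact_ops ES"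
proof -
  have ax: "ES.adm x" and ay: "ES.adm y" using x y by (simp_all add: good_def)
  let ?\<Delta> = "\<lambda>u. F2 u - F1 u"
  let ?z = "\<lambda>d u. x u + d *\<^sub>C y u"
  have l: "clinear x" "clinear y" "clinear F1" "clinear F2"
    by (rule ES.adm_clinear[OF ax] ES.adm_clinear[OF ay] ES.adm_clinear[OF adms(1)] ES.adm_clinear[OF adms(2)])+
  have K: "(\<lambda>u. d *\<^sub>C ?\<Delta> (?z d (ES.ad (?z d) (c u)))) \<in> compact_ops ES" for d
    by (rule ES.compact_scaleC[OF good_square_compact[OF good_add[OF x good_scaleC[OF y]]]])
  have ad: "ES.ad (?z d) u = ES.ad x u + cnj d *\<^sub>C ES.ad y u" for d u
    by (simp add: ES.adm_add(2)[OF ax ES.adm_scaleC(1)[OF ay]] ES.adm_scaleC(2)[OF ay])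
  have pol: "d *\<^sub>C ?\<Delta> (?z d (ES.ad (?z d) v))
      = d *\<^sub>C ?\<Delta> (x (ES.ad x v)) + (d * cnj d) *\<^sub>C ?\<Delta> (x (ES.ad y v))
        + (d * d) *\<^sub>C ?\<Delta> (y (ES.ad x v)) + (d * d * cnj d) *\<^sub>C ?\<Delta> (y (ES.ad y v))" for d v
    unfolding ad by (simp add: l clinear_add clinear_scaleC scaleC_add_right scaleC_diff_right scaleC_scaleC mult.assoc)
  have "(\<lambda>u. (1/4) *\<^sub>C ((1 *\<^sub>C ?\<Delta> (?z 1 (ES.ad (?z 1) (c u))) + (-1) *\<^sub>C ?\<Delta> (?z (-1) (ES.ad (?z (-1)) (c u))))
      + (\<i> *\<^sub>C ?\<Delta> (?z \<i> (ES.ad (?z \<i>) (c u))) + (-\<i>) *\<^sub>C ?\<Delta> (?z (-\<i>) (ES.ad (?z (-\<i>)) (c u)))))) \<in> compact_ops ES"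
    by (intro ES.compact_scaleC[OF ES.compact_add[OF ES.compact_add[OF K K] ES.compact_add[OF K K]]])
  moreover have "(1/4) *\<^sub>C ((1 *\<^sub>C ?\<Delta> (?z 1 (ES.ad (?z 1) v)) + (-1) *\<^sub>C ?\<Delta> (?z (-1) (ES.ad (?z (-1)) v)))
      + (\<i> *\<^sub>C ?\<Delta> (?z \<i> (ES.ad (?z \<i>) v)) + (-\<i>) *\<^sub>C ?\<Delta> (?z (-\<i>) (ES.ad (?z (-\<i>)) v)))) = ?\<Delta> (x (ES.ad y v))" for v
  proof -
    have four: "w + w + (w + w) = 4 *\<^sub>C w" for w :: 'es
      using scaleC_add_left[of 2 2 w] scaleC_add_left[of 1 1 w] by (simp add: add.assoc)
    have quarter: "(1/4) *\<^sub>C (w + (w + (w + w))) = w" for w :: 'es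
      using four[of w] by (simp add: add.assoc scaleC_scaleC)
    show ?thesis unfolding pol by (simp add: scaleC_scaleC add_ac) (simp add: quarter)
  qed
  ultimately show ?thesis by simp
qed

end

end

section \<open>Density\<close>

context ltens0
begin

lemma lt_addC: "E.adm S \<Longrightarrow> E.adm T \<Longrightarrow> lt (\<lambda>x. S x + c *\<^sub>C T x) = (\<lambda>u. lt S u + c *\<^sub>C lt T u)"
  by (rule lt_eqI)
    (simp_all add: lt G.adm_add G.adm_scaleC clinear_add[OF t_clinear] clinear_scaleC[OF t_clinear])

lemma lt_zero: "lt (\<lambda>x. 0) = (\<lambda>u. 0)"
  by (rule lt_eqI) (simp_all add: G.adm_zero clinear_zero[OF t_clinear])

text \<open>Passing to norm limits and adjoints in \<open>X\<close> for compactness of \<open>P (X \<otimes> 1) N\<close>.\<close>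

lemma closure_compact_lt:
  assumes P: "G.adm P" and N: "G.adm N" and X: "X \<in> op_closure (op_span \<X>)" "E.adm X"
    and gen: "\<And>T. T \<in> \<X> \<Longrightarrow> E.adm T \<and> (\<lambda>\<zeta>. P (lt T (N \<zeta>))) \<in> compact_ops G"
  shows "(\<lambda>\<zeta>. P (lt X (N \<zeta>))) \<in> compact_ops G"
proof -
  obtain B where B: "0 < B" "\<And>u. norm (P u) \<le> B * norm u" by (rule G.adm_bound[OF P]) blast
  obtain B' where B': "0 < B'" "\<And>u. norm (N u) \<le> B' * norm u" by (rule G.adm_bound[OF N]) blast
  note l = G.adm_clinear[OF P]
  have span: "E.adm T \<and> (\<lambda>\<zeta>. P (lt T (N \<zeta>))) \<in> compact_ops G" if "T \<in> op_span \<X>" for T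
    using that
  proof (induction rule: op_span_induct)
    case zero then show ?case by (simp add: E.adm_zero lt_zero clinear_zero[OF l] G.compact_zero)
  next
    case (step c T S)
    have T: "E.adm T" "(\<lambda>\<zeta>. P (lt T (N \<zeta>))) \<in> compact_ops G" using gen[OF step(1)] by auto
    show ?case
      using step(2) T E.adm_add(1)[OF _ E.adm_scaleC(1)[OF T(1)]] G.compact_add[OF _ G.compact_scaleC[OF T(2)]]
      by (auto simp: lt_addC clinear_add[OF l] clinear_scaleC[OF l])
  qed
  show ?thesis
  proof (rule G.compact_closed)
    show "bounded_linear (\<lambda>\<zeta>. P (lt X (N \<zeta>)))"
      by (rule G.adm_bounded[OF G.adm_comp[OF P G.adm_comp[OF lt(1)[OF X(2)] N]]])
    fix e :: real assume e: "0 < e"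
    define d where "d = e / (B * B')"
    have d: "0 < d" using e B(1) B'(1) by (simp add: d_def)
    obtain T where T: "T \<in> op_span \<X>" "\<And>x. norm (X x - T x) \<le> d * norm x"
      using op_closureD(2)[OF X(1) _ d] span E.adm_bounded by blast
    have aT: "E.adm T" using span[OF T(1)] by simp
    have "norm (P (lt X (N \<zeta>)) - P (lt T (N \<zeta>))) \<le> e * norm \<zeta>" for \<zeta>
    proof -
      have "norm (lt (\<lambda>x. X x - T x) (N \<zeta>)) \<le> d * (B' * norm \<zeta>)"
        by (rule order_trans[OF lt(3)[OF E.adm_diff(1)[OF X(2) aT] _ T(2)] mult_left_mono[OF B'(2)]]) (use d in auto)
      then have "norm (P (lt (\<lambda>x. X x - T x) (N \<zeta>))) \<le> B * (d * (B' * norm \<zeta>))"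
        using order_trans[OF B(2) mult_left_mono] B(1) by (meson less_imp_le)
      also have "\<dots> = e * norm \<zeta>" using B(1) B'(1) by (simp add: d_def)
      finally show ?thesis by (simp add: lt_diff[OF X(2) aT] clinear_diff[OF l])
    qed
    then show "\<exists>K\<in>compact_ops G. \<forall>\<zeta>. norm (P (lt X (N \<zeta>)) - K \<zeta>) \<le> e * norm \<zeta>"
      using span[OF T(1)] by (intro bexI[of _ "\<lambda>\<zeta>. P (lt T (N \<zeta>))"]) auto
  qed
qed

lemma closure_compact_lt_ad:
  assumes P: "G.adm P" and N: "G.adm N" and X: "X \<in> op_closure (op_span \<X>)" "E.adm X"
    and gen: "\<And>T. T \<in> \<X> \<Longrightarrow> E.adm T \<and> (\<lambda>\<zeta>. P (lt (E.ad T) (N \<zeta>))) \<in> compact_ops G"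
  shows "(\<lambda>\<zeta>. P (lt (E.ad X) (N \<zeta>))) \<in> compact_ops G"
proof (rule closure_compact_lt[OF P N _ E.adm_ad(1)[OF X(2)]])
  show "E.ad X \<in> op_closure (op_span (E.ad ` \<X>))"
    by (rule E.op_closure_ad[OF X]) (use gen in auto)
qed (use gen E.adm_ad(1) in auto)

end

context xtens
begin

text \<open>For rank one operators, \<open>\<theta> \<otimes> s s'\<close> is again of rank one, with the vectors \<open>\<xi> \<otimes> s\<close> and \<open>\<eta> \<otimes> s'\<^sup>*\<close>.\<close>

lemma compact_tensor:
  assumes K: "K \<in> compact_ops E" "E.adm K"
  shows "(\<lambda>u. L.lt K (R.lt (lmul (s * s')) u)) \<in> compact_ops ES"
proof -
  have a: "ES.adm (R.lt (lmul (s * s')))" by (rule R.lt(1)[OF lmul_adjoint(1)])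
  have K': "K \<in> op_closure (op_span {E.rank1 \<xi> \<eta> | \<xi> \<eta>. True})"
    using K(1) by (simp add: E.compact_ops_frank E.frank_def)
  show ?thesis
  proof (rule L.closure_compact_lt[where P="\<lambda>u. u", OF ES.adm_id a K' K(2)])
    fix T assume "T \<in> {E.rank1 \<xi> \<eta> | \<xi> \<eta>. True}"
    then obtain \<xi> \<eta> where T: "T = E.rank1 \<xi> \<eta>" by auto
    have "(\<lambda>u. L.lt T (R.lt (lmul (s * s')) u)) = ES.rank1 (tES \<xi> s) (tES \<eta> (star s'))"
    proof (rule adm_tES_ext)
      show "ES.adm (\<lambda>u. L.lt T (R.lt (lmul (s * s')) u))"
        unfolding T by (rule ES.adm_comp[OF L.lt(1)[OF E.rank1_adm(1)] a])
      show "L.lt T (R.lt (lmul (s * s')) (tES e t)) = ES.rank1 (tES \<xi> s) (tES \<eta> (star s')) (tES e t)" for e t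
        unfolding T R.lt(2)[OF lmul_adjoint(1)] L.lt(2)[OF E.rank1_adm(1)]
        by (simp add: ES.rank1_def E.rank1_def ip_tES act_tES star_star mult.assoc)
    qed (rule ES.rank1_adm(1))
    moreover have "ES.rank1 (tES \<xi> s) (tES \<eta> (star s')) \<in> compact_ops ES"
      by (rule ES.frank_compact) (auto simp: ES.frank_def intro: op_span_base)
    ultimately show "E.adm T \<and> (\<lambda>u. L.lt T (R.lt (lmul (s * s')) u)) \<in> compact_ops ES"
      by (simp add: T E.rank1_adm(1))
  qed
qed

end

section \<open>Equivariance of the bounded transform\<close>

locale equivariant = xtens E ES tBS tES + I: ltens E EBS tEBS \<Phi>I + W: unitary EBS ES V
  for E :: "('e::complex_banach, 'b::cstar_algebra) hmodule"
    and ES :: "('es::complex_banach, 'bs::cstar_algebra) hmodule"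
    and tBS :: "'b \<Rightarrow> 's::cstar_algebra \<Rightarrow> 'bs" and tES :: "'e \<Rightarrow> 's \<Rightarrow> 'es"
    and EBS :: "('g::complex_banach, 'bs) hmodule" and tEBS :: "'e \<Rightarrow> 'bs \<Rightarrow> 'g"
    and \<Phi>I :: "'bs \<Rightarrow> 'bs \<Rightarrow> 'b \<Rightarrow> 'bs" and V :: "'g \<Rightarrow> 'es" +
  fixes \<alpha> :: real and R F :: "'e \<Rightarrow> 'e" and \<mu> :: "'es op_graph" and \<delta>E :: "'e \<Rightarrow> 'bs \<Rightarrow> 'es"
    and \<pi> :: "'a::cstar_algebra \<Rightarrow> 'e \<Rightarrow> 'e"
  assumes \<alpha>: "0 \<le> \<alpha>" "\<alpha> < 1" and tp: "E.tp R F" and dense: "closure (range (fc sqrt R)) = UNIV"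
    and \<mu>: "matched ES tES \<mu>" "matched ES tES (\<mu>\<inverse>)"
    and V: "V = admissible_unitary EBS tEBS ES \<delta>E"
    and rep: "representation E \<pi>" and R\<pi>: "\<And>a. R \<circ> \<pi> a \<in> compact_ops E"
begin

abbreviation "R1 \<equiv> L.lt R"
abbreviation "F1 \<equiv> L.lt F"
abbreviation "R2 \<equiv> W.cj (I.lt R)"
abbreviation "F2 \<equiv> W.cj (I.lt F)"

lemma tp1: "ES.tp R1 F1" and tp2: "ES.tp R2 F2"
  by (rule L.tp_lt[OF tp] W.tp_cj[OF I.tp_lt[OF tp]])+

lemma D1: "unb_tensor_one tES (E.bgraph R F) = ES.bgraph R1 F1"
  and D2: "op_conj V (unb_tensor_one tEBS (E.bgraph R F)) = ES.bgraph R2 F2"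
  by (simp_all add: L.unb_tensor_one_bgraph[OF tp] I.unb_tensor_one_bgraph[OF tp] W.op_conj_bgraph[OF I.tp_lt[OF tp]])

lemma adm12: "ES.adm F1" "ES.adm F2"
  by (rule ES.sa_adm[OF ES.tp_F[OF tp1]] ES.sa_adm[OF ES.tp_F[OF tp2]])+

abbreviation "mults \<equiv> conformal_multipliers \<alpha> ES tES EBS tEBS \<delta>E (E.bgraph R F) \<mu>"

text \<open>
  Written in the bounded pictures of \<open>D \<otimes> 1\<close> and \<open>V (D \<otimes> 1) V\<^sup>*\<close>, the conformal conditions are those of
  \<open>inter_conformal\<close> and \<open>inter_commutator\<close>.
\<close>

lemma good_multiplier:
  assumes "conformal E ES tBS tES \<alpha> R1 F1 R2 F2 \<mu> k k' m i"
    and a: "E.adm a" and s: "s \<in> mults a"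
  shows "conformal.good ES tES \<alpha> R1 F1 R2 F2 k m i (tensor_op ES ES tES tES a s)"
proof -
  interpret C: conformal E ES tBS tES \<alpha> R1 F1 R2 F2 \<mu> k k' m i by fact
  define x where "x = tensor_op ES ES tES tES a s"
  let ?D1 = "ES.bgraph R1 F1" and ?D2 = "ES.bgraph R2 F2"
  let ?\<mu>s = "op_adjoint ES \<mu>" and ?\<mu>is = "op_adjoint ES (\<mu>\<inverse>)"
  let ?W = "{\<rho> k x | k x. x \<in> Domain ?D1 \<and> k \<in> pedersen_ideal}"
  have L: "bracket_neg \<alpha> ?D1 = C.\<Lambda>" by (rule ES.bracket_neg_bgraph[OF tp1 \<alpha>(1)])
  have VD: "V ` Domain (unb_tensor_one tEBS (E.bgraph R F)) = Domain ?D2"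
    unfolding D2[symmetric] op_conj_def by (auto simp: image_iff)
  have ms: "multiplier s" and
    W: "(gr x \<odot> \<mu>) `` ?W \<union> (gr x \<odot> ?\<mu>is) `` ?W \<subseteq> Domain ?D1 \<inter> Domain ?D2" and
    T1: "extends_matched ES tES ((?D2 \<odot> gr x \<ominus> gr x \<odot> \<mu> \<odot> ?D1 \<odot> ?\<mu>s) \<odot> ?\<mu>is \<odot> gr C.\<Lambda>)" and
    T4: "extends_matched ES tES (gr C.\<Lambda> \<odot> commutator ?D1 (gr x \<odot> \<mu>))" and
    T6: "extends_matched ES tES (gr C.\<Lambda> \<odot> commutator ?D1 (gr x \<odot> ?\<mu>is))"
    using s unfolding conformal_multipliers_def Let_def D1 V[symmetric] L VD D2 x_def by simp_all
  have ax: "ES.adm x" unfolding x_def tensor_op(1)[OF a ms]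
    by (rule ES.adm_comp[OF L.lt(1)[OF a] R.lt(1)[OF ms]])
  have Gdom: "\<rho> (k * u) (C.G1 \<eta>) \<in> ?W" for u \<eta>
    using C.k_pedersen by (auto simp: ES.bgraph_def)
  have GM: "\<rho> (k * u) (C.G1 \<eta>) \<in> Msub k" for u \<eta> by (rule rho_Msub)
  have Wm: "x (m (\<rho> (k * u) (C.G1 \<eta>))) \<in> Domain ?D1" for u \<eta>
  proof -
    have "(\<rho> (k * u) (C.G1 \<eta>), x (m (\<rho> (k * u) (C.G1 \<eta>)))) \<in> gr x \<odot> \<mu>"
      by (rule relcompI[OF C.m(2)[OF GM]]) (simp add: gr_iff)
    from subsetD[OF W UnI1[OF ImageI[OF this Gdom]]] show ?thesis by simp
  qed
  have Wn: "x (C.n (\<rho> (k * u) (C.G1 \<eta>))) \<in> Domain ?D1 \<inter> Domain ?D2" for u \<eta>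
  proof -
    have "(\<rho> (k * u) (C.G1 \<eta>), x (C.n (\<rho> (k * u) (C.G1 \<eta>)))) \<in> gr x \<odot> ?\<mu>is"
      by (rule relcompI[OF C.i(3)[OF GM]]) (simp add: gr_iff)
    from subsetD[OF W UnI2[OF ImageI[OF this Gdom]]] show ?thesis .
  qed
  obtain S1 where S1: "matched ES tES S1" "(?D2 \<odot> gr x \<ominus> gr x \<odot> \<mu> \<odot> ?D1 \<odot> ?\<mu>s) \<odot> ?\<mu>is \<odot> gr C.\<Lambda> \<subseteq> S1"
    using T1 unfolding extends_matched_def by blast
  obtain S4 where S4: "matched ES tES S4" "gr C.\<Lambda> \<odot> commutator ?D1 (gr x \<odot> \<mu>) \<subseteq> S4"
    using T4 unfolding extends_matched_def by blast
  obtain S6 where S6: "matched ES tES S6" "gr C.\<Lambda> \<odot> commutator ?D1 (gr x \<odot> ?\<mu>is) \<subseteq> S6"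
    using T6 unfolding extends_matched_def by blast
  show ?thesis
    unfolding C.good_def x_def[symmetric]
  proof (intro conjI ax)
    show "C.M.inter \<alpha> R1 F1 R2 F2 (\<lambda>u. x (C.n u)) (\<lambda>u. x (m u))"
      by (rule C.inter_conformal[OF ax S1 IntD2[OF Wn]])
    show "C.M.inter \<alpha> R1 F1 R1 F1 (ES.ad (\<lambda>u. x (C.n u))) (ES.ad (\<lambda>u. x (C.n u)))"
      by (rule C.inter_commutator[OF ax S6(1) C.n(1) C.i(3) S6(2) IntD1[OF Wn]])
    show "C.M.inter \<alpha> R1 F1 R1 F1 (ES.ad (\<lambda>u. x (m u))) (ES.ad (\<lambda>u. x (m u)))"
      by (rule C.inter_commutator[OF ax S4(1) C.m(1) C.m(2) S4(2) Wm])
  qed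
qed

abbreviation tn :: "('e \<Rightarrow> 'e) \<Rightarrow> ('s \<Rightarrow> 's) \<Rightarrow> 'es \<Rightarrow> 'es" where
  "tn X m \<equiv> (\<lambda>\<zeta>. L.lt X (R.lt m \<zeta>))"

abbreviation \<Delta> :: "'es \<Rightarrow> 'es" where "\<Delta> \<equiv> (\<lambda>\<zeta>. F2 \<zeta> - F1 \<zeta>)"

lemma adm_tn: "E.adm X \<Longrightarrow> S.adm m \<Longrightarrow> ES.adm (tn X m)"
  by (rule ES.adm_comp[OF L.lt(1) R.lt(1)])

lemma adm_Delta: "ES.adm \<Delta>"
  by (rule ES.adm_diff(1)[OF adm12(2,1)])

lemma mults_multiplier: "s \<in> mults a \<Longrightarrow> S.adm s"
  by (simp add: conformal_multipliers_def)

text \<open>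
  There are local units \<open>k\<close> with \<open>k u\<close> close to \<open>u\<close>, and \<open>\<pi>(b) \<otimes> k u\<close> takes values in \<open>Msub k\<close>, where
  \<open>good_compact\<close> applies.
\<close>

lemma compact_products:
  assumes a: "E.adm a" "E.adm a'" and s: "s \<in> mults a" "s' \<in> mults a'"
  shows "(\<lambda>\<zeta>. \<Delta> (tn a s (ES.ad (tn a' s') (tn (\<pi> b) (lmul u) \<zeta>)))) \<in> compact_ops ES"
proof -
  note ms = s[THEN mults_multiplier] and rb = E.rep_adm[OF rep, of b]
  define P where "P = (\<lambda>\<zeta>. \<Delta> (tn a s (ES.ad (tn a' s') \<zeta>)))"
  have aP: "ES.adm P" unfolding P_def
    by (rule ES.adm_comp[OF adm_Delta ES.adm_comp[OF adm_tn[OF a(1) ms(1)] ES.adm_ad(1)[OF adm_tn[OF a(2) ms(2)]]]])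
  have au: "ES.adm (tn (\<pi> b) (lmul u))" for u by (rule adm_tn[OF rb lmul_adjoint(1)])
  obtain B where B: "0 < B" "\<And>u. norm (P u) \<le> B * norm u" by (rule ES.adm_bound[OF aP]) blast
  have "(\<lambda>\<zeta>. P (tn (\<pi> b) (lmul u) \<zeta>)) \<in> compact_ops ES"
  proof (rule ES.compact_closed)
    show "bounded_linear (\<lambda>\<zeta>. P (tn (\<pi> b) (lmul u) \<zeta>))"
      by (rule ES.adm_bounded[OF ES.adm_comp[OF aP au]])
    fix e :: real assume e: "0 < e"
    define d where "d = e / (B * (norm b + 1))"
    have Bb: "0 < B * (norm b + 1)" using B(1) by (simp add: add_nonneg_pos)
    have d: "0 < d" using e Bb by (simp add: d_def)
    have "cpos (u * star u)" using cpos_star_mult[of "star u"] by (simp add: star_star)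
    moreover have "0 < d\<^sup>2" using d by simp
    ultimately obtain k k' k'' where k: "star k = k" "star k' = k'" "star k'' = k''" "k * k' = k" "k' * k'' = k'"
      "norm (u * star u - k * (u * star u) - u * star u * k + k * (u * star u) * k) < d\<^sup>2"
      by (rule local_unit)
    have k'k: "k' * k = k" using k(1,2,4) by (metis star_mult)
    have "k'' * k' = k'" using k(2,3,5) by (metis star_mult)
    then have kP: "k' \<in> pedersen_ideal" by (rule pedersen_local_unit)
    have ku: "norm (u - k * u) \<le> d"
    proof -
      have "(norm (u - k * u))\<^sup>2 = norm ((u - k * u) * star (u - k * u))"
        using norm_star_mult[of "star (u - k * u)"] by (simp add: star_star)
      also have "(u - k * u) * star (u - k * u) = u * star u - k * (u * star u) - u * star u * k + k * (u * star u) * k"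
        by (simp add: star_diff star_mult k(1) algebra_simps)
      finally have "(norm (u - k * u))\<^sup>2 < d\<^sup>2" using k(6) by (simp only:)
      from power2_le_imp_le[OF less_imp_le[OF this] less_imp_le[OF d]] show ?thesis .
    qed
    obtain m where m: "ES.adm m" "\<And>\<zeta>. \<zeta> \<in> Msub k \<Longrightarrow> (\<zeta>, m \<zeta>) \<in> \<mu>" "\<And>\<zeta>. \<zeta> \<in> Msub k \<Longrightarrow> (\<zeta>, ES.ad m \<zeta>) \<in> op_adjoint ES \<mu>"
      by (rule matched_local[OF \<mu>(1) k(4) kP]) blast
    obtain i where i: "ES.adm i" "\<And>\<zeta>. \<zeta> \<in> Msub k \<Longrightarrow> (\<zeta>, i \<zeta>) \<in> \<mu>\<inverse>" "\<And>\<zeta>. \<zeta> \<in> Msub k \<Longrightarrow> (\<zeta>, ES.ad i \<zeta>) \<in> op_adjoint ES (\<mu>\<inverse>)"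
      by (rule matched_local[OF \<mu>(2) k(4) kP]) blast
    interpret C: conformal E ES tBS tES \<alpha> R1 F1 R2 F2 \<mu> k k' m i
      by unfold_locales (use \<alpha> tp1 tp2 \<mu> k(4) k'k kP m i in simp_all)
    have good: "C.good (tn a s)" "C.good (tn a' s')"
      using good_multiplier[OF C.conformal_axioms a(1) s(1)] good_multiplier[OF C.conformal_axioms a(2) s(2)]
      by (simp_all add: tensor_op(1) a ms)
    have dense1: "closure (range C.G1) = UNIV"
      using L.dense_lt[OF E.adm_fc[OF E.tp_R[OF tp] E.cont01_sqrt] dense]
      by (simp add: L.fc_lt[OF E.tp_R[OF tp] E.cont01_sqrt])
    let ?c = "tn (\<pi> b) (lmul (k * u))"
    have cM: "?c \<zeta> \<in> Msub k" for \<zeta>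
    proof -
      have "\<zeta> \<in> {\<zeta>. ?c \<zeta> \<in> Msub k}"
      proof (rule closed_subspace_total[OF bounded_linear_vimage[OF ES.adm_bounded[OF au] Msub_subspace] _ tES_total], clarify)
        fix \<xi> t
        have "?c (tES \<xi> t) = tES (\<pi> b \<xi>) (k' * k * (u * t))"
          unfolding R.lt(2)[OF lmul_adjoint(1)] L.lt(2)[OF rb] by (simp add: k'k mult.assoc)
        then show "?c (tES \<xi> t) \<in> Msub k" by (simp only: Msub_base)
      qed
      then show ?thesis by simp
    qed
    have aR: "E.adm R" by (rule E.sa_adm[OF E.pcontr_sa[OF E.tp_R[OF tp]]])
    have Rc: "(\<lambda>\<zeta>. R1 (?c \<zeta>)) \<in> compact_ops ES"
      using compact_tensor[OF R\<pi>[of b], of k u] E.adm_comp[OF aR rb] L.lt_comp[OF aR rb] by (simp add: o_def)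
    have K: "(\<lambda>\<zeta>. P (?c \<zeta>)) \<in> compact_ops ES"
      unfolding P_def by (rule C.good_compact[OF dense1 au cM Rc good])
    have "norm (P (tn (\<pi> b) (lmul u) \<zeta>) - P (?c \<zeta>)) \<le> e * norm \<zeta>" for \<zeta>
    proof -
      have "(\<lambda>\<zeta>. R.lt (lmul u) \<zeta> - R.lt (lmul (k * u)) \<zeta>) = R.lt (lmul (u - k * u))"
        using R.lt_diff[OF lmul_adjoint(1) lmul_adjoint(1), of u "k * u"] by (simp add: left_diff_distrib)
      then have "P (tn (\<pi> b) (lmul u) \<zeta>) - P (?c \<zeta>) = P (tn (\<pi> b) (lmul (u - k * u)) \<zeta>)"
        by (simp add: clinear_diff[OF ES.adm_clinear[OF aP], symmetric]
            clinear_diff[OF ES.adm_clinear[OF L.lt(1)[OF rb]], symmetric] fun_eq_iff)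
      also have "norm \<dots> \<le> B * (norm b * (d * norm \<zeta>))"
      proof (rule order_trans[OF B(2)], rule mult_left_mono)
        have "norm (L.lt (\<pi> b) (R.lt (lmul (u - k * u)) \<zeta>)) \<le> norm b * norm (R.lt (lmul (u - k * u)) \<zeta>)"
          by (rule L.lt(3)[OF rb norm_ge_zero E.rep_norm_le[OF rep]])
        also have "norm (R.lt (lmul (u - k * u)) \<zeta>) \<le> d * norm \<zeta>"
        proof (rule R.lt(3)[OF lmul_adjoint(1)])
          show "norm ((u - k * u) * t) \<le> d * norm t" for t
            by (rule order_trans[OF norm_mult_ineq mult_right_mono[OF ku]]) simp
        qed (use d in simp)
        finally show "norm (tn (\<pi> b) (lmul (u - k * u)) \<zeta>) \<le> norm b * (d * norm \<zeta>)"
          by (simp add: mult_left_mono)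
      qed (use B in simp)
      also have "\<dots> \<le> (B * (norm b + 1)) * d * norm \<zeta>"
        using B d by (simp add: algebra_simps)
      also have "B * (norm b + 1) * d = e" using less_imp_neq[OF Bb] by (simp only: d_def nonzero_mult_div_cancel_left times_divide_eq_right)
      finally show ?thesis .
    qed
    then show "\<exists>K\<in>compact_ops ES. \<forall>\<zeta>. norm (P (tn (\<pi> b) (lmul u) \<zeta>) - K \<zeta>) \<le> e * norm \<zeta>"
      by (intro bexI[OF _ K]) simp
  qed
  then show ?thesis by (simp only: P_def)
qed

text \<open>
  Two rounds of approximation.  The element \<open>\<pi>(a) \<otimes> u\<close> is a limit of sums of
  \<open>(q' \<otimes> m')\<^sup>* (\<pi>(b) \<otimes> v)\<close>, by the adjoint of the density condition for left multiples; this turns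
  \<open>compact_products\<close> into compactness of \<open>\<Delta> (q \<otimes> m) (\<pi>(a) \<otimes> u)\<close>.  By the density condition for
  right multiples, sums of \<open>(q \<otimes> m) (\<pi>(a) \<otimes> u)\<close> approximate \<open>\<pi>(a) \<otimes> s\<close>.
\<close>

theorem compact_difference:
  assumes \<Q>: "\<And>q. q \<in> \<Q> \<Longrightarrow> E.adm q"
    "\<And>q s. q \<in> \<Q> \<Longrightarrow> lmul s \<in> op_closure (op_span {lmul u \<circ> m | u m. m \<in> mults q})"
    "\<And>q s. q \<in> \<Q> \<Longrightarrow> lmul s \<in> op_closure (op_span {m \<circ> lmul u | u m. m \<in> mults q})"
    and \<pi>Q: "\<And>a. \<pi> a \<in> op_closure (op_span {\<pi> a \<circ> q | a q. q \<in> \<Q>})"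
      "\<And>a. \<pi> a \<in> op_closure (op_span {q \<circ> \<pi> a | a q. q \<in> \<Q>})"
  shows "(\<lambda>\<zeta>. \<Delta> (tn (\<pi> a) (lmul s) \<zeta>)) \<in> compact_ops ES"
proof -
  note ra = E.rep_adm[OF rep] and al = lmul_adjoint(1)
  have 2: "(\<lambda>\<zeta>. \<Delta> (tn q m (tn (\<pi> a) (lmul u) \<zeta>))) \<in> compact_ops ES" if q: "q \<in> \<Q>" and m: "m \<in> mults q" for q m a u
  proof -
    note aq = \<Q>(1)[OF q] and am = mults_multiplier[OF m]
    let ?P = "\<lambda>\<zeta>. \<Delta> (tn q m \<zeta>)"
    have aP: "ES.adm ?P" by (rule ES.adm_comp[OF adm_Delta adm_tn[OF aq am]])
    have "(\<lambda>\<zeta>. ?P (L.lt (E.ad (\<pi> (star a))) (R.lt (lmul u) \<zeta>))) \<in> compact_ops ES"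
    proof (rule L.closure_compact_lt_ad[OF aP R.lt(1)[OF al] \<pi>Q(1) ra])
      fix T assume "T \<in> {\<pi> a \<circ> q | a q. q \<in> \<Q>}"
      then obtain b q' where T: "T = (\<lambda>x. \<pi> b (q' x))" and q': "q' \<in> \<Q>" by (auto simp: o_def)
      note aq' = \<Q>(1)[OF q']
      have aT: "E.adm T" unfolding T by (rule E.adm_comp[OF ra aq'])
      have adT: "E.ad T = (\<lambda>x. E.ad q' (\<pi> (star b) x))"
        by (simp add: T E.ad_comp[OF ra aq'] E.rep_ad[OF rep])
      have aT': "E.adm (E.ad T)" by (rule E.adm_ad(1)[OF aT])
      have "(\<lambda>\<zeta>. ?P (L.lt (E.ad T) (R.lt (S.ad (lmul (star u))) \<zeta>))) \<in> compact_ops ES"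
      proof (rule R.closure_compact_lt_ad[where N="\<lambda>\<zeta>. \<zeta>", OF ES.adm_comp[OF aP L.lt(1)[OF aT']] ES.adm_id \<Q>(2)[OF q'] al])
        fix U assume "U \<in> {lmul u \<circ> m | u m. m \<in> mults q'}"
        then obtain v m' where U: "U = (\<lambda>t. v * m' t)" and m': "m' \<in> mults q'" by (auto simp: o_def)
        note am' = mults_multiplier[OF m']
        have aU: "S.adm U" unfolding U by (rule S.adm_comp[OF al am'])
        have adU: "S.ad U = (\<lambda>t. S.ad m' (star v * t))"
          using S.ad_comp[OF al am', of v] by (simp add: U lmul_adjoint(2))
        have lt1: "L.lt (E.ad T) \<zeta> = L.lt (E.ad q') (L.lt (\<pi> (star b)) \<zeta>)" for \<zeta>
          unfolding adT using L.lt_comp[OF E.adm_ad(1)[OF aq'] ra, of "star b"] by simp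
        have lt2: "R.lt (S.ad U) \<zeta> = R.lt (S.ad m') (R.lt (lmul (star v)) \<zeta>)" for \<zeta>
          unfolding adU using R.lt_comp[OF S.adm_ad(1)[OF am'] al, of "star v"] by simp
        have ady: "ES.ad (tn q' m') \<zeta> = L.lt (E.ad q') (R.lt (S.ad m') \<zeta>)" for \<zeta>
          using ES.ad_comp[OF L.lt(1)[OF aq'] R.lt(1)[OF am']]
          by (simp add: L.lt(4)[OF aq'] R.lt(4)[OF am'] tensor_op(2)[OF E.adm_ad(1)[OF aq'] S.adm_ad(1)[OF am']])
        have "L.lt (E.ad T) (R.lt (S.ad U) \<zeta>) = ES.ad (tn q' m') (tn (\<pi> (star b)) (lmul (star v)) \<zeta>)" for \<zeta>
          unfolding lt1 lt2 ady by (simp add: tensor_op(2)[OF ra S.adm_ad(1)[OF am']])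
        then show "S.adm U \<and> (\<lambda>\<zeta>. ?P (L.lt (E.ad T) (R.lt (S.ad U) \<zeta>))) \<in> compact_ops ES"
          using compact_products[OF aq aq' m m', of "star b" "star v"] aU by simp
      qed
      then show "E.adm T \<and> (\<lambda>\<zeta>. ?P (L.lt (E.ad T) (R.lt (lmul u) \<zeta>))) \<in> compact_ops ES"
        using aT by (simp add: lmul_adjoint(2) star_star)
    qed
    then show ?thesis by (simp add: E.rep_ad[OF rep] star_star)
  qed
  show ?thesis
  proof (rule L.closure_compact_lt[OF adm_Delta R.lt(1)[OF al] \<pi>Q(2) ra])
    fix T assume "T \<in> {q \<circ> \<pi> a | a q. q \<in> \<Q>}"
    then obtain b q where T: "T = (\<lambda>x. q (\<pi> b x))" and q: "q \<in> \<Q>" by (auto simp: o_def)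
    note aq = \<Q>(1)[OF q]
    have aT: "E.adm T" unfolding T by (rule E.adm_comp[OF aq ra])
    have "(\<lambda>\<zeta>. \<Delta> (L.lt T (R.lt (lmul s) \<zeta>))) \<in> compact_ops ES"
    proof (rule R.closure_compact_lt[where N="\<lambda>\<zeta>. \<zeta>", OF ES.adm_comp[OF adm_Delta L.lt(1)[OF aT]] ES.adm_id \<Q>(3)[OF q] al])
      fix U assume "U \<in> {m \<circ> lmul u | u m. m \<in> mults q}"
      then obtain v m where U: "U = (\<lambda>t. m (v * t))" and m: "m \<in> mults q" by (auto simp: o_def)
      note am = mults_multiplier[OF m]
      have aU: "S.adm U" unfolding U by (rule S.adm_comp[OF am al])
      have "L.lt T (R.lt U \<zeta>) = tn q m (tn (\<pi> b) (lmul v) \<zeta>)" for \<zeta>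
        unfolding T U using L.lt_comp[OF aq ra, of b] R.lt_comp[OF am al, of v]
        by (simp add: tensor_op(2)[OF ra am])
      then show "S.adm U \<and> (\<lambda>\<zeta>. \<Delta> (L.lt T (R.lt U \<zeta>))) \<in> compact_ops ES"
        using 2[OF q m, of b v] aU by simp
    qed
    then show "E.adm T \<and> (\<lambda>\<zeta>. \<Delta> (L.lt T (R.lt (lmul s) \<zeta>))) \<in> compact_ops ES" using aT by simp
  qed
qed

end

section \<open>The admissible unitary\<close>

lemma interior_ltens:
  fixes \<delta> :: "'b::cstar_algebra \<Rightarrow> 'c::cstar_algebra \<Rightarrow> 'c"
  assumes E: "hmod E" and rep: "representation self_module \<delta>"
    and int: "interior_tensor E self_module \<delta> EBS t"
  shows "ltens E EBS t (\<lambda>x y b. star x * \<delta> b y)"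
proof -
  interpret E: hmod E by fact
  interpret B: hmod "self_module :: ('c, 'c) hmodule" by (rule hmod_self_module)
  interpret G: hmod EBS using int by (simp add: interior_tensor_def hmod_def)
  have t: "clinear (\<lambda>\<xi>. t \<xi> x)" and tot: "total_set {t \<xi> x | \<xi> x. True}"
    and ip: "ip EBS (t \<xi> x) (t \<eta> y) = star x * \<delta> (ip E \<xi> \<eta>) y" for \<xi> \<eta> x y
    using int by (auto simp: interior_tensor_def cbilinear_def)
  show ?thesis
  proof unfold_locales
    show "\<exists>C. \<forall>\<xi>. norm (t \<xi> x) \<le> C * norm \<xi>" for x
    proof (intro exI[of _ "norm x"] allI)
      fix \<xi>
      have "(norm (t \<xi> x))\<^sup>2 = norm (star x * \<delta> (ip E \<xi> \<xi>) x)" by (simp add: G.norm_ip_self[symmetric] ip)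
      also have "\<dots> \<le> norm x * (norm (ip E \<xi> \<xi>) * norm x)"
        by (rule order_trans[OF norm_mult_ineq]) (simp add: mult_left_mono B.rep_norm_le[OF rep])
      also have "\<dots> = (norm x * norm \<xi>)\<^sup>2" by (simp add: E.norm_ip_self power_mult_distrib power2_eq_square)
      finally show "norm (t \<xi> x) \<le> norm x * norm \<xi>" by (rule power2_le_imp_le) simp
    qed
  qed (use tot in \<open>simp_all add: t ip clinear_add[OF B.rep_clinear[OF rep]] distrib_left\<close>)
qed

text \<open>Vectors \<open>\<xi> \<otimes> x\<close> and \<open>\<delta>(\<xi>) x\<close> have the same inner products, and both families are total.\<close>

lemma admissible_unitary:
  fixes \<delta>\<^sub>B :: "'b::cstar_algebra \<Rightarrow> 'c::cstar_algebra \<Rightarrow> 'c"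
  assumes E: "hmod E" and ES: "hmod ES" and rep: "representation self_module \<delta>\<^sub>B"
    and int: "interior_tensor E self_module \<delta>\<^sub>B EBS t"
    and \<delta>adj: "\<And>\<xi>. adjointable self_module ES (\<delta> \<xi>)"
    and \<delta>ip: "\<And>\<xi> \<eta>. adj self_module ES (\<delta> \<xi>) \<circ> \<delta> \<eta> = \<delta>\<^sub>B (ip E \<xi> \<eta>)"
    and tot: "total_set {\<delta> \<xi> x | \<xi> x. True}"
  shows "unitary EBS ES (admissible_unitary EBS t ES \<delta>)"
proof -
  interpret I: ltens E EBS t "\<lambda>x y b. star x * \<delta>\<^sub>B b y" by (rule interior_ltens[OF E rep int])
  interpret ES: hmod ES by fact
  interpret B: hmod "self_module :: ('c, 'c) hmodule" by (rule hmod_self_module)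
  have ip: "ip ES (\<delta> \<xi> x) (\<delta> \<eta> y) = ip EBS (t \<xi> x) (t \<eta> y)" for \<xi> \<eta> x y
    using B.ip_adj[OF \<delta>adj, of \<xi> x "\<delta> \<eta> y"] \<delta>ip[of \<xi> \<eta>] by (simp add: I.ip_t fun_eq_iff)
  let ?S = "{(t \<xi> x, \<delta> \<xi> x) | \<xi> x. True}" and ?S' = "{(\<delta> \<xi> x, t \<xi> x) | \<xi> x. True}"
  have im: "fst ` ?S = {t \<xi> x | \<xi> x. True}" "fst ` ?S' = {\<delta> \<xi> x | \<xi> x. True}" by force+
  have "\<exists>V. bounded_linear V \<and> (\<forall>(u, v)\<in>?S. V u = v) \<and> (\<forall>u. norm (V u) \<le> norm u)"
    by (rule isometric_extension[OF I.G.hmod_axioms ES]) (unfold im, auto simp: ip intro: I.t_total[simplified])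
  then obtain V where V: "bounded_linear V" "\<forall>(u, v)\<in>?S. V u = v" by blast
  have "\<exists>V. bounded_linear V \<and> (\<forall>(u, v)\<in>?S'. V u = v) \<and> (\<forall>u. norm (V u) \<le> norm u)"
    by (rule isometric_extension[OF ES I.G.hmod_axioms]) (unfold im, auto simp: ip intro: tot[simplified])
  then obtain V' where V': "bounded_linear V'" "\<forall>(u, v)\<in>?S'. V' u = v" by blast
  have Vt: "V (t \<xi> x) = \<delta> \<xi> x" and V't: "V' (\<delta> \<xi> x) = t \<xi> x" for \<xi> x
    using bspec[OF V(2), of "(t \<xi> x, \<delta> \<xi> x)"] bspec[OF V'(2), of "(\<delta> \<xi> x, t \<xi> x)"] by auto
  have adj: "ip ES (V u) v = ip EBS u (V' v)" for u v
    by (rule ip_total_ext[OF I.G.hmod_axioms ES V(1) V'(1) I.t_total tot]) (auto simp: Vt V't ip)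
  have aV: "adjointable EBS ES V" by (rule adjointableI) (rule adj)
  have adV: "adj EBS ES V = V'" by (rule I.G.adj_eqI) (rule adj)
  have "V' (V u) = u" for u
    by (rule total_ext[where f="\<lambda>u. V' (V u)" and g="\<lambda>u. u", OF bounded_linear_compose[OF V'(1) V(1)] bounded_linear_ident I.t_total])
      (auto simp: Vt V't)
  moreover have "V (V' v) = v" for v
    by (rule total_ext[where f="\<lambda>u. V (V' u)" and g="\<lambda>u. u", OF bounded_linear_compose[OF V(1) V'(1)] bounded_linear_ident tot])
      (auto simp: Vt V't)
  ultimately have un: "adj EBS ES V \<circ> V = id" "V \<circ> adj EBS ES V = id" by (auto simp: adV)
  have "admissible_unitary EBS t ES \<delta> = V"
    unfolding admissible_unitary_def
  proof (rule the_equality)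
    show "adjointable EBS ES V \<and> adj EBS ES V \<circ> V = id \<and> V \<circ> adj EBS ES V = id \<and> (\<forall>\<xi>. V \<circ> t \<xi> = \<delta> \<xi>)"
      using aV un Vt by auto
    fix U assume U: "adjointable EBS ES U \<and> adj EBS ES U \<circ> U = id \<and> U \<circ> adj EBS ES U = id \<and> (\<forall>\<xi>. U \<circ> t \<xi> = \<delta> \<xi>)"
    then interpret U: unitary EBS ES U by unfold_locales auto
    have Ut: "U (t \<xi> x) = \<delta> \<xi> x" for \<xi> x using U by (metis comp_apply)
    show "U = V"
      by (rule ext, rule total_ext[OF U.bounded_linear_V V(1) I.t_total]) (auto simp: Ut Vt)
  qed
  then show ?thesis using aV un by unfold_locales auto
qed

section \<open>Conformally equivariant cycles define equivariant Kasparov modules\<close>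

theorem theorem4p24:
  fixes tSS :: "'s::cstar_algebra \<Rightarrow> 's \<Rightarrow> 'ss::cstar_algebra"
    and tSSS :: "'ss \<Rightarrow> 's \<Rightarrow> 'sss::cstar_algebra"
    and tAS :: "'a::cstar_algebra \<Rightarrow> 's \<Rightarrow> 'as::cstar_algebra"
    and tASS :: "'as \<Rightarrow> 's \<Rightarrow> 'ass::cstar_algebra"
    and tBS :: "'b::cstar_algebra \<Rightarrow> 's \<Rightarrow> 'bs::cstar_algebra"
    and tBSS :: "'bs \<Rightarrow> 's \<Rightarrow> 'bss::cstar_algebra"
    and \<Delta> :: "'s \<Rightarrow> 'ss \<Rightarrow> 'ss"
    and \<delta>\<^sub>A :: "'a \<Rightarrow> 'as \<Rightarrow> 'as"
    and \<delta>\<^sub>B :: "'b \<Rightarrow> 'bs \<Rightarrow> 'bs"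
    and E :: "('e::complex_banach, 'b) hmodule"
    and ES :: "('es::complex_banach, 'bs) hmodule"
    and tES :: "'e \<Rightarrow> 's \<Rightarrow> 'es"
    and ESS :: "('ess::complex_banach, 'bss) hmodule"
    and tESS :: "'es \<Rightarrow> 's \<Rightarrow> 'ess"
    and EBS :: "('g::complex_banach, 'bs) hmodule"
    and tEBS :: "'e \<Rightarrow> 'bs \<Rightarrow> 'g"
    and \<pi> :: "'a \<Rightarrow> 'e \<Rightarrow> 'e"
    and \<delta>\<^sub>E :: "'e \<Rightarrow> 'bs \<Rightarrow> 'es"
    and g :: "('e \<Rightarrow> 'e) option"
    and D :: "'e op_graph"
    and \<mu> :: "'es op_graph"
    and \<alpha> :: real
  assumes "min_tensor tSS" and "min_tensor tSSS"
    and "min_tensor tAS" and "min_tensor tASS"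
    and "min_tensor tBS" and "min_tensor tBSS"
    and "cstar_bialgebra tSS tSSS \<Delta>"
    and "algebra_coaction tSS \<Delta> tAS tASS \<delta>\<^sub>A"
    and "algebra_coaction tSS \<Delta> tBS tBSS \<delta>\<^sub>B"
    and "exterior_tensor E tBS ES tES"
    and "exterior_tensor ES tBSS ESS tESS"
    and "interior_tensor E self_module \<delta>\<^sub>B EBS tEBS"
    and "0 \<le> \<alpha>" and "\<alpha> < 1"
    and "conformally_equivariant_cycle \<alpha> tSS \<Delta> tAS \<delta>\<^sub>A tBS tBSS \<delta>\<^sub>B
           E ES tES ESS tESS EBS tEBS g \<pi> \<delta>\<^sub>E D \<mu>"
  shows "equivariant_kasparov_module tSS \<Delta> tAS \<delta>\<^sub>A tBS tBSS \<delta>\<^sub>B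
           E ES tES ESS tESS EBS tEBS g \<pi> \<delta>\<^sub>E (bounded_transform D)"
proof -
  note \<alpha> = \<open>0 \<le> \<alpha>\<close> \<open>\<alpha> < 1\<close>
  let ?V = "admissible_unitary EBS tEBS ES \<delta>\<^sub>E"
  let ?\<S> = "conformal_multipliers \<alpha> ES tES EBS tEBS \<delta>\<^sub>E D \<mu>"
  define \<Q> where "\<Q> = {a \<in> Lip_star \<alpha> E D. \<forall>s.
                 lmul s \<in> op_closure (op_span {lmul u \<circ> m | u m. m \<in> ?\<S> a})
               \<and> lmul s \<in> op_closure (op_span {m \<circ> lmul u | u m. m \<in> ?\<S> a})}"
  have cyc: "order_cycle \<alpha> E g \<pi> D"
    and cor: "equivariant_correspondence tSS \<Delta> tAS \<delta>\<^sub>A tBS tBSS \<delta>\<^sub>B E ES tES ESS tESS \<pi> \<delta>\<^sub>E"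
    and \<mu>: "matched ES tES \<mu>" "matched ES tES (\<mu>\<inverse>)"
    and \<pi>Q: "range \<pi> \<subseteq> op_closure (op_span {\<pi> a \<circ> q | a q. q \<in> \<Q>})"
      "range \<pi> \<subseteq> op_closure (op_span {q \<circ> \<pi> a | a q. q \<in> \<Q>})"
    using assms(15) unfolding conformally_equivariant_cycle_def Let_def \<Q>_def by auto
  have hE: "hmod E" and rep: "representation E \<pi>" and sr: "selfadjoint_regular E D"
    and R\<pi>: "\<And>a. resolvent_sq D \<circ> \<pi> a \<in> compact_ops E"
    using cyc by (auto simp: order_cycle_def hmod_def)
  have hES: "hmod ES" using assms(10) by (simp add: exterior_tensor_def hmod_def)
  have repB: "representation self_module \<delta>\<^sub>B" using assms(9) by (simp add: algebra_coaction_def)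
  have mc: "module_coaction tSS \<Delta> tBS tBSS \<delta>\<^sub>B E ES tES ESS tESS \<delta>\<^sub>E"
    using cor by (simp add: equivariant_correspondence_def)
  interpret E: hmod E by (rule hE)
  interpret X: xtens E ES tBS tES
    using hE hES assms(5,10) by (simp add: xtens_def xtens_axioms_def)
  interpret I: ltens E EBS tEBS "\<lambda>x y b. star x * \<delta>\<^sub>B b y"
    by (rule interior_ltens[OF hE repB assms(12)])
  interpret W: unitary EBS ES ?V
    by (rule admissible_unitary[OF hE hES repB assms(12)])
      (use mc in \<open>auto simp: module_coaction_def S_multiplier_def\<close>)
  obtain R F where tp: "E.tp R F" and D: "D = E.bgraph R F" and RD: "resolvent_sq D = R"
    and FD: "bounded_transform D = F" and dense: "closure (range (fc sqrt R)) = UNIV"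
    by (rule E.cycle_transform[OF sr])
  interpret equivariant E ES tBS tES EBS tEBS "\<lambda>x y b. star x * \<delta>\<^sub>B b y" ?V \<alpha> R F \<mu> \<delta>\<^sub>E \<pi>
    by unfold_locales (use \<alpha> tp dense \<mu> rep R\<pi> RD in simp_all)
  have aF: "E.adm F" by (rule E.sa_adm[OF E.tp_F[OF tp]])
  have F\<delta>: "tensor_op EBS EBS tEBS tEBS F id = I.lt F" by (rule I.tensor_op_lt[OF aF])
  have F1: "tensor_op ES ES tES tES F id = X.L.lt F" by (rule X.L.tensor_op_lt[OF aF])
  have as: "tensor_op ES ES tES tES (\<pi> a) (lmul s) = (\<lambda>\<zeta>. X.L.lt (\<pi> a) (X.R.lt (lmul s) \<zeta>))" for a s
    by (rule X.tensor_op(1)[OF E.rep_adm[OF rep] lmul_adjoint(1)])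
  have main: "(\<lambda>\<zeta>. W.cj (I.lt F) (X.L.lt (\<pi> a) (X.R.lt (lmul s) \<zeta>)) - X.L.lt F (X.L.lt (\<pi> a) (X.R.lt (lmul s) \<zeta>)))
      \<in> compact_ops ES" for a s
  proof (rule compact_difference[of \<Q>])
    show "E.adm q" if "q \<in> \<Q>" for q using that by (simp add: \<Q>_def Lip_star_def)
    show "\<pi> a \<in> op_closure (op_span {\<pi> a \<circ> q | a q. q \<in> \<Q>})"
      "\<pi> a \<in> op_closure (op_span {q \<circ> \<pi> a | a q. q \<in> \<Q>})" for a using \<pi>Q by blast+
  qed (auto simp: \<Q>_def D)
  show ?thesis
    unfolding equivariant_kasparov_module_def Let_def F\<delta> F1 as FD
  proof (intro conjI allI cor)
    show "kasparov_module E g \<pi> F" using E.order_cycle_kasparov[OF \<alpha> cyc] by (simp add: FD)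
    show "(\<lambda>\<zeta>. ?V (I.lt F (adj EBS ES ?V (X.L.lt (\<pi> a) (X.R.lt (lmul s) \<zeta>))))
        - X.L.lt F (X.L.lt (\<pi> a) (X.R.lt (lmul s) \<zeta>))) \<in> compact_ops ES" for a s
      using main[of a s] by (simp add: W.cj_def)
  qed
qed

end
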